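(* Let the dimension be $n=2$, let $k\ge 1$ be an integer and let $\alpha>0$. (i) The function $F:(-\infty,\pi)\to\mathbb{R}$ given by $$F(\Theta)=\begin{cases}\lambda_k(\Theta,\alpha/\sinh|\Theta|)\,4\tanh^2(\Theta/2), & \Theta\in(-\infty,0),\\ \lambda_k(\mathbb{D},\alpha), & \Theta=0,\\ \lambda_k(\Theta,\alpha/\sin\Theta)\,4\tan^2(\Theta/2), & \Theta\in(0,\pi),\end{cases}$$ is continuous and strictly increasing, with $F(\Theta)\to 0$ as $\Theta\to-\infty$ and $F(\Theta)\to\infty$ as $\Theta\to\pi$. (ii) The function $G:(-\infty,\pi)\to\mathbb{R}$ given by $$G(\Theta)=\begin{cases}\lambda_k(\Theta,\alpha/\sinh|\Theta|)\,\sinh^2(\Theta), & \Theta\in(-\infty,0),\\ \lambda_k(\mathbb{D},\alpha), & \Theta=0,\\ \lambda_k(\Theta,\alpha/\sin\Theta)\,\sin^2(\Theta), & \Theta\in(0,\pi),\end{cases}$$ is continuous and strictly decreasing, with $G(\Theta)\to\infty$ as $\Theta\to-\infty$ and $G(\Theta)\to 0$ as $\Theta\to\pi$.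
   Context: For $0<\Theta<\pi$, $C(\Theta)$ denotes the spherical cap of aperture $\Theta$ in the unit sphere $\mathbb{S}^2$ (curvature $1$), i.e. the open geodesic disk of radius $\Theta$ about the north pole. For $\Theta<0$, $C(\Theta)$ denotes an open geodesic disk of radius $|\Theta|$ in the hyperbolic plane $\mathbb{H}^2$ (curvature $-1$). For $\beta\in\mathbb{R}$, $\lambda_1(\Theta,\beta)<\lambda_2(\Theta,\beta)\le\lambda_3(\Theta,\beta)\le\cdots\to\infty$ are the eigenvalues, counted with multiplicity, of the Robin problem $-\Delta u=\lambda u$ in $C(\Theta)$, $\partial u/\partial n+\beta u=0$ on $\partial C(\Theta)$, where $\Delta$ is the Laplace--Beltrami operator of $\mathbb{S}^2$ (if $\Theta>0$) or $\mathbb{H}^2$ (if $\Theta<0$) and $\partial/\partial n$ is the outer unit normal derivative. Equivalently, $$\lambda_k(\Theta,\beta)=\min_{\mathcal{L}}\max_{0\ne u\in\mathcal{L}}\frac{\int_{C(\Theta)}|\nabla u|^2\,dA+\beta\int_{\partial C(\Theta)}|u|^2\,dS}{\int_{C(\Theta)}|u|^2\,dA},$$ where $\mathcal{L}$ ranges over $k$-dimensional subspaces of $H^1(C(\Theta))$ and gradient, area and length are those of the corresponding space. $\mathbb{D}\subset\mathbb{R}^2$ is the Euclidean unit disk and $\lambda_k(\mathbb{D},\alpha)$ is its $k$-th Robin eigenvalue (Euclidean Laplacian, same boundary condition with parameter $\alpha$). *)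

theory Defs
  imports "HOL-Analysis.Analysis"
begin

text \<open>
  A Riemannian metric in a single planar chart is given by its Gram matrix
  \<open>g :: real^2 \<Rightarrow> real^2^2\<close>. The disks \<open>C(\<Theta>)\<close> all lie in one chart: \<open>\<S>\<^sup>2\<close> without the
  south pole, or all of \<open>\<H>\<^sup>2\<close>.
\<close>

definition area_measure :: "(real^2 \<Rightarrow> real^2^2) \<Rightarrow> (real^2) set \<Rightarrow> (real^2) measure" where
  "area_measure g \<Omega> = density (lebesgue_on \<Omega>) (\<lambda>x. ennreal (sqrt (det (g x))))"

text \<open>Arc length along a closed curve parametrised by \<open>[0, 2\<pi>]\<close>.\<close>

definition length_measure :: "(real^2 \<Rightarrow> real^2^2) \<Rightarrow> (real \<Rightarrow> real^2) \<Rightarrow> real measure" where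
  "length_measure g \<gamma> =
     density (lebesgue_on {0..2*pi})
       (\<lambda>t. ennreal (sqrt (vector_derivative \<gamma> (at t) \<bullet> (g (\<gamma> t) *v vector_derivative \<gamma> (at t)))))"

text \<open>
  Squared length of the covector with coordinates \<open>p\<close>, i.e. the sum of \<open>g\<^sup>i\<^sup>j p\<^sub>i p\<^sub>j\<close>;
  for \<open>p = (\<partial>\<^sub>1 u, \<partial>\<^sub>2 u)\<close> this is the squared length of the Riemannian gradient of \<open>u\<close>.
\<close>

definition conorm2 :: "(real^2 \<Rightarrow> real^2^2) \<Rightarrow> real^2 \<Rightarrow> real^2 \<Rightarrow> real" where
  "conorm2 g x p = p \<bullet> (matrix_inv (g x) *v p)"

definition partials :: "(real^2 \<Rightarrow> real) \<Rightarrow> real^2 \<Rightarrow> real^2" where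
  "partials \<phi> x = (\<chi> i. frechet_derivative \<phi> (at x) (axis i 1))"

definition C1 :: "(real^2 \<Rightarrow> real) \<Rightarrow> bool" where
  "C1 \<phi> \<longleftrightarrow> (\<forall>x. \<phi> differentiable (at x)) \<and> continuous_on UNIV (partials \<phi>)"

definition C1_test :: "(real^2) set \<Rightarrow> (real^2 \<Rightarrow> real) \<Rightarrow> bool" where
  "C1_test \<Omega> \<phi> \<longleftrightarrow> C1 \<phi> \<and> (\<exists>K. compact K \<and> K \<subseteq> \<Omega> \<and> (\<forall>x. x \<notin> K \<longrightarrow> \<phi> x = 0))"

text \<open>
  \<open>p\<close> is the weak differential of \<open>u\<close> on \<open>\<Omega>\<close>. The differential does not depend on a metric, so
  the integrals are with respect to coordinate Lebesgue measure.
\<close>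

definition weak_diff :: "(real^2) set \<Rightarrow> (real^2 \<Rightarrow> real) \<Rightarrow> (real^2 \<Rightarrow> real^2) \<Rightarrow> bool" where
  "weak_diff \<Omega> u p \<longleftrightarrow>
     (\<forall>\<phi> i. C1_test \<Omega> \<phi> \<longrightarrow>
        integral\<^sup>L (lebesgue_on \<Omega>) (\<lambda>x. u x * partials \<phi> x $ i) =
        - integral\<^sup>L (lebesgue_on \<Omega>) (\<lambda>x. p x $ i * \<phi> x))"

definition H1_pair ::
  "(real^2 \<Rightarrow> real^2^2) \<Rightarrow> (real^2) set \<Rightarrow> (real^2 \<Rightarrow> real) \<Rightarrow> (real^2 \<Rightarrow> real^2) \<Rightarrow> bool" where
  "H1_pair g \<Omega> u p \<longleftrightarrow>
     u \<in> borel_measurable (area_measure g \<Omega>) \<and>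
     p \<in> borel_measurable (area_measure g \<Omega>) \<and>
     integrable (area_measure g \<Omega>) (\<lambda>x. (u x)\<^sup>2) \<and>
     integrable (area_measure g \<Omega>) (\<lambda>x. conorm2 g x (p x)) \<and>
     weak_diff \<Omega> u p"

definition H1 :: "(real^2 \<Rightarrow> real^2^2) \<Rightarrow> (real^2) set \<Rightarrow> (real^2 \<Rightarrow> real) set" where
  "H1 g \<Omega> = {u. \<exists>p. H1_pair g \<Omega> u p}"

text \<open>Determined up to null sets, which is all that matters below.\<close>

definition wdiff :: "(real^2 \<Rightarrow> real^2^2) \<Rightarrow> (real^2) set \<Rightarrow> (real^2 \<Rightarrow> real) \<Rightarrow> real^2 \<Rightarrow> real^2" where
  "wdiff g \<Omega> u = (SOME p. H1_pair g \<Omega> u p)"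

text \<open>
  \<open>w\<close>, a function of the parameter of the boundary curve \<open>\<gamma>\<close>, is the trace of \<open>u \<in> H\<^sup>1(\<Omega>)\<close>:
  the continuous extension to \<open>H\<^sup>1\<close> of the restriction to the boundary of functions
  that are \<open>C\<^sup>1\<close> up to the boundary.
\<close>

definition is_trace ::
  "(real^2 \<Rightarrow> real^2^2) \<Rightarrow> (real^2) set \<Rightarrow> (real \<Rightarrow> real^2) \<Rightarrow> (real^2 \<Rightarrow> real) \<Rightarrow> (real \<Rightarrow> real) \<Rightarrow> bool"
  where
  "is_trace g \<Omega> \<gamma> u w \<longleftrightarrow>
     w \<in> borel_measurable (length_measure g \<gamma>) \<and>
     integrable (length_measure g \<gamma>) (\<lambda>t. (w t)\<^sup>2) \<and>
     (\<exists>\<phi> :: nat \<Rightarrow> real^2 \<Rightarrow> real. (\<forall>m. C1 (\<phi> m)) \<and>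
        (\<lambda>m. integral\<^sup>L (area_measure g \<Omega>)
               (\<lambda>x. (\<phi> m x - u x)\<^sup>2 + conorm2 g x (partials (\<phi> m) x - wdiff g \<Omega> u x))) \<longlonglongrightarrow> 0 \<and>
        (\<lambda>m. integral\<^sup>L (length_measure g \<gamma>) (\<lambda>t. (\<phi> m (\<gamma> t) - w t)\<^sup>2)) \<longlonglongrightarrow> 0)"

definition trace_of ::
  "(real^2 \<Rightarrow> real^2^2) \<Rightarrow> (real^2) set \<Rightarrow> (real \<Rightarrow> real^2) \<Rightarrow> (real^2 \<Rightarrow> real) \<Rightarrow> real \<Rightarrow> real" where
  "trace_of g \<Omega> \<gamma> u = (SOME w. is_trace g \<Omega> \<gamma> u w)"

definition robin_rayleigh ::
  "(real^2 \<Rightarrow> real^2^2) \<Rightarrow> (real^2) set \<Rightarrow> (real \<Rightarrow> real^2) \<Rightarrow> real \<Rightarrow> (real^2 \<Rightarrow> real) \<Rightarrow> real" where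
  "robin_rayleigh g \<Omega> \<gamma> \<beta> u =
     (integral\<^sup>L (area_measure g \<Omega>) (\<lambda>x. conorm2 g x (wdiff g \<Omega> u x))
       + \<beta> * integral\<^sup>L (length_measure g \<gamma>) (\<lambda>t. (trace_of g \<Omega> \<gamma> u t)\<^sup>2))
     / integral\<^sup>L (area_measure g \<Omega>) (\<lambda>x. (u x)\<^sup>2)"

text \<open>
  \<open>k\<close>-dimensional subspaces of \<open>H\<^sup>1(\<Omega>)\<close>, whose elements are functions modulo null sets: a
  subspace is represented by the set of all representatives of its elements.
\<close>

definition H1_subspace ::
  "(real^2 \<Rightarrow> real^2^2) \<Rightarrow> (real^2) set \<Rightarrow> nat \<Rightarrow> (real^2 \<Rightarrow> real) set \<Rightarrow> bool" where
  "H1_subspace g \<Omega> k L \<longleftrightarrow>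
     (\<exists>u :: nat \<Rightarrow> real^2 \<Rightarrow> real.
        (\<forall>i<k. u i \<in> H1 g \<Omega>) \<and>
        (\<forall>c :: nat \<Rightarrow> real. (AE x in area_measure g \<Omega>. (\<Sum>i<k. c i * u i x) = 0)
             \<longrightarrow> (\<forall>i<k. c i = 0)) \<and>
        L = {v \<in> H1 g \<Omega>. \<exists>c :: nat \<Rightarrow> real. AE x in area_measure g \<Omega>. v x = (\<Sum>i<k. c i * u i x)})"

definition robin_eigenvalue ::
  "(real^2 \<Rightarrow> real^2^2) \<Rightarrow> (real^2) set \<Rightarrow> (real \<Rightarrow> real^2) \<Rightarrow> nat \<Rightarrow> real \<Rightarrow> real" where
  "robin_eigenvalue g \<Omega> \<gamma> k \<beta> =
     (INF L \<in> {L. H1_subspace g \<Omega> k L}.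
        SUP u \<in> {u \<in> L. \<not> (AE x in area_measure g \<Omega>. u x = 0)}. robin_rayleigh g \<Omega> \<gamma> \<beta> u)"


text \<open>
  The metric induced on the chart domain by a parametrised surface \<open>\<sigma>\<close> and a bilinear form \<open>B\<close>
  on the ambient space \<open>\<real>\<^sup>3\<close>.
\<close>

definition induced_metric ::
  "(real^3 \<Rightarrow> real^3 \<Rightarrow> real) \<Rightarrow> (real^2 \<Rightarrow> real^3) \<Rightarrow> real^2 \<Rightarrow> real^2^2" where
  "induced_metric B \<sigma> x =
     (\<chi> i j. B (frechet_derivative \<sigma> (at x) (axis i 1)) (frechet_derivative \<sigma> (at x) (axis j 1)))"

definition pole :: "real^3" where
  "pole = vector [0, 0, 1]"

text \<open>Inverse stereographic projection from the south pole, onto \<open>\<S>\<^sup>2\<close> minus the south pole.\<close>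

definition sphere_param :: "real^2 \<Rightarrow> real^3" where
  "sphere_param z = (1 / (1 + z \<bullet> z)) *\<^sub>R vector [2 * z$1, 2 * z$2, 1 - z \<bullet> z]"

definition sphere_metric :: "real^2 \<Rightarrow> real^2^2" where
  "sphere_metric = induced_metric (\<bullet>) sphere_param"

text \<open>The great-circle distance between \<open>x, y \<in> \<S>\<^sup>2\<close> is \<open>arccos (x \<bullet> y)\<close>.\<close>

definition sphere_cap :: "real \<Rightarrow> (real^2) set" where
  "sphere_cap \<Theta> = {z. arccos (sphere_param z \<bullet> pole) < \<Theta>}"

text \<open>
  \<open>\<H>\<^sup>2\<close> is the hyperboloid \<open>\<langle>x,x\<rangle> = -1, x\<^sub>3 > 0\<close> in Minkowski space, parametrised by the unit
  disk; the geodesic distance between its points \<open>x\<close> and \<open>y\<close> is \<open>arcosh (-\<langle>x,y\<rangle>)\<close>.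
\<close>

definition minkowski :: "real^3 \<Rightarrow> real^3 \<Rightarrow> real" where
  "minkowski x y = x$1 * y$1 + x$2 * y$2 - x$3 * y$3"

definition hyperboloid_param :: "real^2 \<Rightarrow> real^3" where
  "hyperboloid_param z = (1 / (1 - z \<bullet> z)) *\<^sub>R vector [2 * z$1, 2 * z$2, 1 + z \<bullet> z]"

definition hyperbolic_metric :: "real^2 \<Rightarrow> real^2^2" where
  "hyperbolic_metric = induced_metric minkowski hyperboloid_param"

definition hyperbolic_disk :: "real \<Rightarrow> (real^2) set" where
  "hyperbolic_disk r = {z. norm z < 1 \<and> arcosh (- minkowski (hyperboloid_param z) pole) < r}"

definition circle_curve :: "real \<Rightarrow> real \<Rightarrow> real^2" where
  "circle_curve r t = r *\<^sub>R vector [cos t, sin t]"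

definition cap_eigenvalue :: "nat \<Rightarrow> real \<Rightarrow> real \<Rightarrow> real" where
  "cap_eigenvalue k \<Theta> \<beta> =
     (if \<Theta> > 0
      then robin_eigenvalue sphere_metric (sphere_cap \<Theta>) (circle_curve (tan (\<Theta> / 2))) k \<beta>
      else robin_eigenvalue hyperbolic_metric (hyperbolic_disk \<bar>\<Theta>\<bar>)
             (circle_curve (tanh (\<bar>\<Theta>\<bar> / 2))) k \<beta>)"

definition disk_eigenvalue :: "nat \<Rightarrow> real \<Rightarrow> real" where
  "disk_eigenvalue k \<alpha> = robin_eigenvalue (\<lambda>_. mat 1) (ball 0 1) (circle_curve 1) k \<alpha>"

definition F_fun :: "nat \<Rightarrow> real \<Rightarrow> real \<Rightarrow> real" where
  "F_fun k \<alpha> \<Theta> =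
     (if \<Theta> < 0 then cap_eigenvalue k \<Theta> (\<alpha> / sinh \<bar>\<Theta>\<bar>) * (4 * (tanh (\<Theta> / 2))\<^sup>2)
      else if \<Theta> = 0 then disk_eigenvalue k \<alpha>
      else cap_eigenvalue k \<Theta> (\<alpha> / sin \<Theta>) * (4 * (tan (\<Theta> / 2))\<^sup>2))"

definition G_fun :: "nat \<Rightarrow> real \<Rightarrow> real \<Rightarrow> real" where
  "G_fun k \<alpha> \<Theta> =
     (if \<Theta> < 0 then cap_eigenvalue k \<Theta> (\<alpha> / sinh \<bar>\<Theta>\<bar>) * (sinh \<Theta>)\<^sup>2
      else if \<Theta> = 0 then disk_eigenvalue k \<alpha>
      else cap_eigenvalue k \<Theta> (\<alpha> / sin \<Theta>) * (sin \<Theta>)\<^sup>2)"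


text \<open>
  Consistency of the charts: the parametrisations are bijections onto the two model surfaces,
  the geodesic disks are Euclidean disks in the chart (so that \<open>circle_curve\<close> with the radii used
  above parametrises their boundaries), and the induced metrics are the usual conformal ones.
\<close>

lemma param_derivative:
  fixes z :: "real^2" and e :: real and p :: "real^2 \<Rightarrow> real^3"
  assumes p: "p = (\<lambda>z. (1 / (1 + e * (z \<bullet> z))) *\<^sub>R vector [2 * z$1, 2 * z$2, 1 - e * (z \<bullet> z)])"
    and z: "1 + e * (z \<bullet> z) \<noteq> 0"
  shows "frechet_derivative p (at z) =
     (\<lambda>h. (2 / (1 + e * (z \<bullet> z))\<^sup>2) *\<^sub>R vector
        [(1 + e * (z \<bullet> z)) * h$1 - 2 * e * (z \<bullet> h) * z$1,
         (1 + e * (z \<bullet> z)) * h$2 - 2 * e * (z \<bullet> h) * z$2, - 2 * e * (z \<bullet> h)])"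
proof -
  have v: "vector [a, b, c] = a *\<^sub>R axis 1 1 + b *\<^sub>R axis 2 1 + c *\<^sub>R (axis 3 1 :: real^3)" for a b c :: real
    by (simp add: vec_eq_iff forall_3 axis_def)
  have d: "((\<lambda>x. x $ i) has_derivative (\<lambda>x. x $ i)) (at z)" for i
    by (rule bounded_linear_imp_has_derivative) (rule bounded_linear_vec_nth)
  have "(p has_derivative (\<lambda>h. (2 / (1 + e * (z \<bullet> z))\<^sup>2) *\<^sub>R vector
        [(1 + e * (z \<bullet> z)) * h$1 - 2 * e * (z \<bullet> h) * z$1,
         (1 + e * (z \<bullet> z)) * h$2 - 2 * e * (z \<bullet> h) * z$2, - 2 * e * (z \<bullet> h)])) (at z)"
    unfolding p v
    apply (rule has_derivative_eq_rhs)
     apply (rule derivative_eq_intros refl z d | simp add: z)+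
    apply (rule ext)
    using z apply (simp add: vec_eq_iff forall_3 axis_def inner_commute)
    apply (simp add: divide_simps power2_eq_square)
    apply (simp add: algebra_simps)
    done
  then show ?thesis by (rule frechet_derivative_at[symmetric])
qed

lemma circle_curve_image: "r \<ge> 0 \<Longrightarrow> circle_curve r ` {0..2*pi} = sphere 0 r"
proof (intro set_eqI iffI)
  fix x assume "r \<ge> 0" "x \<in> circle_curve r ` {0..2*pi}"
  moreover have "sqrt ((r * cos t)\<^sup>2 + (r * sin t)\<^sup>2) = r" for t
    using \<open>r \<ge> 0\<close> by (simp add: power_mult_distrib flip: distrib_left)
  ultimately show "x \<in> sphere 0 r"
    by (auto simp: circle_curve_def norm_eq_sqrt_inner inner_vec_def sum_2
        simp flip: power2_eq_square)
next
  fix x :: "real^2" assume r: "r \<ge> 0" and x: "x \<in> sphere 0 r"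
  show "x \<in> circle_curve r ` {0..2*pi}"
  proof (cases "r = 0")
    case True
    then show ?thesis using x by (auto simp: circle_curve_def image_iff intro!: bexI[of _ 0])
  next
    case False
    with r x have "(x$1/r)\<^sup>2 + (x$2/r)\<^sup>2 = 1"
      by (auto simp: norm_eq_sqrt_inner inner_vec_def sum_2 power2_eq_square field_simps real_sqrt_eq_iff)
    then obtain t where "0 \<le> t" "t \<le> 2*pi" "x$1/r = cos t" "x$2/r = sin t"
      by (metis sincos_total_2pi less_imp_le)
    with False have "x = circle_curve r t"
      by (simp add: circle_curve_def vec_eq_iff forall_2 field_simps)
    with \<open>0 \<le> t\<close> \<open>t \<le> 2*pi\<close> show ?thesis by auto
  qed
qed

lemma sphere_param_bij: "bij_betw sphere_param UNIV (sphere 0 1 - {- pole})"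
  unfolding bij_betw_def
proof (intro conjI set_eqI iffI)
  have pos: "1 + z \<bullet> z > 0" for z :: "real^2" by (smt (verit) inner_ge_zero)
  show "inj sphere_param"
  proof (rule injI)
    fix z w assume "sphere_param z = sphere_param w"
    then have e: "2 * z$1 / (1 + z \<bullet> z) = 2 * w$1 / (1 + w \<bullet> w)"
      "2 * z$2 / (1 + z \<bullet> z) = 2 * w$2 / (1 + w \<bullet> w)"
      "(1 - z \<bullet> z) / (1 + z \<bullet> z) = (1 - w \<bullet> w) / (1 + w \<bullet> w)"
      by (simp_all add: sphere_param_def vec_eq_iff forall_3)
    from e(3) have "z \<bullet> z = w \<bullet> w"
      using pos[of z] pos[of w] by (simp add: frac_eq_eq algebra_simps)
    with e(1,2) pos[of w] show "z = w" by (simp add: vec_eq_iff forall_2)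
  qed
  fix x :: "real^3"
  {
    assume "x \<in> range sphere_param"
    then obtain z where x: "x = sphere_param z" by blast
    define s where "s = z \<bullet> z"
    have s: "s = z$1 * z$1 + z$2 * z$2" by (simp add: s_def inner_vec_def sum_2)
    have p: "1 + s > 0" using pos[of z] by (simp add: s_def)
    have "x \<bullet> x = (4 * s + (1 - s)\<^sup>2) / (1 + s)\<^sup>2"
      unfolding x sphere_param_def s_def[symmetric]
      by (simp add: inner_vec_def sum_3 power2_eq_square add_divide_distrib s)
    also have "4 * s + (1 - s)\<^sup>2 = (1 + s)\<^sup>2" by (simp add: power2_eq_square algebra_simps)
    finally have "x \<bullet> x = 1" using p by simp
    moreover have "x $ 3 \<noteq> - 1" using p
      unfolding x sphere_param_def s_def[symmetric] by (simp add: field_simps)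
    ultimately show "x \<in> sphere 0 1 - {- pole}"
      by (auto simp: pole_def norm_eq_sqrt_inner)
  }
  assume "x \<in> sphere 0 1 - {- pole}"
  then have n: "x \<bullet> x = 1" and ne: "x \<noteq> - pole" by (auto simp: norm_eq_sqrt_inner)
  have q: "(x$1)\<^sup>2 + (x$2)\<^sup>2 = (1 - x$3) * (1 + x$3)"
    using n by (simp add: inner_vec_def sum_3 power2_eq_square algebra_simps)
  have x3: "x$3 \<noteq> - 1"
  proof
    assume a: "x$3 = - 1"
    with q have "x$1 = 0" "x$2 = 0" by (simp_all add: sum_power2_eq_zero_iff)
    with a ne show False by (simp add: pole_def vec_eq_iff forall_3)
  qed
  then have x3': "1 + x$3 \<noteq> 0" by linarith
  define z :: "real^2" where "z = vector [x$1 / (1 + x$3), x$2 / (1 + x$3)]"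
  have "z \<bullet> z = ((x$1)\<^sup>2 + (x$2)\<^sup>2) / (1 + x$3)\<^sup>2"
    by (simp add: z_def inner_vec_def sum_2 power2_eq_square add_divide_distrib)
  also have "\<dots> = (1 - x$3) / (1 + x$3)"
    unfolding q power2_eq_square[of "1 + x$3"] by (rule nonzero_mult_divide_mult_cancel_right[OF x3'])
  finally have zz: "z \<bullet> z = (1 - x$3) / (1 + x$3)" .
  have f: "1 / (1 + z \<bullet> z) = (1 + x$3) / 2" "1 - z \<bullet> z = 2 * x$3 / (1 + x$3)"
    using x3 unfolding zz by (simp_all add: field_simps)
  have "sphere_param z = x"
    unfolding sphere_param_def f using x3' by (simp add: vec_eq_iff forall_3 z_def)
  then show "x \<in> range sphere_param" by blast
qed

lemma sphere_cap_eq_ball: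
  assumes "0 < \<Theta>" "\<Theta> < pi"
  shows "sphere_cap \<Theta> = ball 0 (tan (\<Theta> / 2))"
proof -
  have c: "cos (\<Theta> / 2) > 0" using assms by (intro cos_gt_zero_pi) auto
  have t: "tan (\<Theta> / 2) > 0" using assms by (intro tan_gt_zero) auto
  define T where "T = (tan (\<Theta> / 2))\<^sup>2"
  have T: "T \<ge> 0" by (simp add: T_def)
  have cT: "cos \<Theta> = (1 - T) / (1 + T)"
  proof -
    have e: "(cos (\<Theta>/2))\<^sup>2 * T = (sin (\<Theta>/2))\<^sup>2"
      unfolding T_def tan_def using c by (simp add: power_divide)
    have e1: "(cos (\<Theta>/2))\<^sup>2 * (1 + T) = 1"
      using e sin_cos_squared_add[of "\<Theta>/2"] by (simp only: distrib_left mult_1_right)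
    have "cos \<Theta> = (cos (\<Theta>/2))\<^sup>2 * (1 - T)"
      using e cos_double[of "\<Theta>/2"] by (simp add: right_diff_distrib)
    then have "cos \<Theta> * (1 + T) = ((cos (\<Theta>/2))\<^sup>2 * (1 + T)) * (1 - T)"
      by (simp only: mult_ac)
    then have "cos \<Theta> * (1 + T) = 1 - T" unfolding e1 by simp
    then show ?thesis using T by (simp add: eq_divide_eq)
  qed
  have "arccos (sphere_param z \<bullet> pole) < \<Theta> \<longleftrightarrow> norm z < tan (\<Theta> / 2)" for z
  proof -
    define s where "s = z \<bullet> z"
    have s: "s \<ge> 0" by (simp add: s_def)
    have h: "sphere_param z \<bullet> pole = (1 - s) / (1 + s)"
      by (simp add: sphere_param_def pole_def s_def inner_vec_def sum_3)
    have b: "\<bar>(1 - s) / (1 + s)\<bar> \<le> 1" using s by (simp add: abs_le_iff field_simps)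
    have "arccos (sphere_param z \<bullet> pole) < \<Theta> \<longleftrightarrow> arccos ((1 - s) / (1 + s)) < arccos (cos \<Theta>)"
      using assms by (simp add: h arccos_cos)
    also have "\<dots> \<longleftrightarrow> cos \<Theta> < (1 - s) / (1 + s)" using b by (intro arccos_less_mono) auto
    also have "\<dots> \<longleftrightarrow> s < T" using s T by (simp add: cT field_simps)
    also have "\<dots> \<longleftrightarrow> norm z < tan (\<Theta> / 2)"
      using t unfolding s_def T_def by (simp add: norm_lt_square)
    finally show ?thesis .
  qed
  then have "z \<in> sphere_cap \<Theta> \<longleftrightarrow> z \<in> ball 0 (tan (\<Theta> / 2))" for z
    unfolding sphere_cap_def mem_Collect_eq mem_ball_0 .
  then show ?thesis by blast
qed

lemma sphere_metric_conformal: "sphere_metric z = mat ((2 / (1 + z \<bullet> z))\<^sup>2)"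
proof -
  have pos: "1 + z \<bullet> z > 0" by (smt (verit) inner_ge_zero)
  define s where "s = z \<bullet> z"
  have s: "s = z$1 * z$1 + z$2 * z$2" by (simp add: s_def inner_vec_def sum_2)
  have p: "1 + s \<noteq> 0" using pos by (simp add: s_def)
  have D: "frechet_derivative sphere_param (at z) = (\<lambda>h. (2 / (1 + s)\<^sup>2) *\<^sub>R vector
        [(1 + s) * h$1 - 2 * (z \<bullet> h) * z$1, (1 + s) * h$2 - 2 * (z \<bullet> h) * z$2, - 2 * (z \<bullet> h)])"
    using param_derivative[of sphere_param 1 z] p by (simp add: sphere_param_def s_def fun_eq_iff)
  show ?thesis
    unfolding sphere_metric_def induced_metric_def D s_def[symmetric]
    using p
    by (simp add: vec_eq_iff forall_2 mat_def inner_vec_def sum_2 sum_3 axis_def)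
       (simp add: divide_simps power2_eq_square power4_eq_xxxx, simp add: s algebra_simps power4_eq_xxxx)
qed

lemma hyperboloid_param_bij:
  "bij_betw hyperboloid_param (ball 0 1) {x. minkowski x x = - 1 \<and> x $ 3 > 0}"
  unfolding bij_betw_def
proof (intro conjI set_eqI iffI)
  have pos: "1 - z \<bullet> z > 0" if "z \<in> ball 0 1" for z :: "real^2"
    using that by (simp add: dot_square_norm power_less_one_iff)
  show "inj_on hyperboloid_param (ball 0 1)"
  proof (rule inj_onI)
    fix z w :: "real^2" assume zw: "z \<in> ball 0 1" "w \<in> ball 0 1"
      and "hyperboloid_param z = hyperboloid_param w"
    then have e: "2 * z$1 / (1 - z \<bullet> z) = 2 * w$1 / (1 - w \<bullet> w)"
      "2 * z$2 / (1 - z \<bullet> z) = 2 * w$2 / (1 - w \<bullet> w)"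
      "(1 + z \<bullet> z) / (1 - z \<bullet> z) = (1 + w \<bullet> w) / (1 - w \<bullet> w)"
      by (simp_all add: hyperboloid_param_def vec_eq_iff forall_3)
    from e(3) have "z \<bullet> z = w \<bullet> w"
      using pos[OF zw(1)] pos[OF zw(2)] by (simp add: frac_eq_eq algebra_simps)
    with e(1,2) pos[OF zw(2)] show "z = w" by (simp add: vec_eq_iff forall_2)
  qed
  fix x :: "real^3"
  {
    assume "x \<in> hyperboloid_param ` ball 0 1"
    then obtain z where z: "z \<in> ball 0 1" and x: "x = hyperboloid_param z" by blast
    define s where "s = z \<bullet> z"
    have s: "s = z$1 * z$1 + z$2 * z$2" by (simp add: s_def inner_vec_def sum_2)
    have p: "1 - s > 0" and s0: "s \<ge> 0" using pos[OF z] by (simp_all add: s_def)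
    have "minkowski x x = (4 * s - (1 + s)\<^sup>2) / (1 - s)\<^sup>2"
      unfolding x hyperboloid_param_def s_def[symmetric]
      by (simp add: minkowski_def power2_eq_square algebra_simps
            flip: add_divide_distrib diff_divide_distrib)
        (simp add: s algebra_simps)
    also have "4 * s - (1 + s)\<^sup>2 = - ((1 - s)\<^sup>2)" by (simp add: power2_eq_square algebra_simps)
    finally have "minkowski x x = - 1" using p by simp
    moreover have "x $ 3 > 0" using p s0
      unfolding x hyperboloid_param_def s_def[symmetric] by simp
    ultimately show "x \<in> {x. minkowski x x = - 1 \<and> x $ 3 > 0}" by simp
  }
  assume "x \<in> {x. minkowski x x = - 1 \<and> x $ 3 > 0}"
  then have q: "(x$1)\<^sup>2 + (x$2)\<^sup>2 = (x$3 - 1) * (x$3 + 1)" and x3: "x$3 > 0"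
    by (simp_all add: minkowski_def power2_eq_square algebra_simps)
  from x3 have x3': "x$3 + 1 \<noteq> 0" by linarith
  define z :: "real^2" where "z = vector [x$1 / (x$3 + 1), x$2 / (x$3 + 1)]"
  have "z \<bullet> z = ((x$1)\<^sup>2 + (x$2)\<^sup>2) / (x$3 + 1)\<^sup>2"
    by (simp add: z_def inner_vec_def sum_2 power2_eq_square add_divide_distrib)
  also have "\<dots> = (x$3 - 1) / (x$3 + 1)"
    unfolding q power2_eq_square[of "x$3 + 1"] by (rule nonzero_mult_divide_mult_cancel_right[OF x3'])
  finally have zz: "z \<bullet> z = (x$3 - 1) / (x$3 + 1)" .
  have f: "1 / (1 - z \<bullet> z) = (x$3 + 1) / 2" "1 + z \<bullet> z = 2 * x$3 / (x$3 + 1)"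
    using x3 unfolding zz by (simp_all add: field_simps)
  have "hyperboloid_param z = x"
    unfolding hyperboloid_param_def f using x3' by (simp add: vec_eq_iff forall_3 z_def)
  moreover have "z \<bullet> z < 1" using x3 unfolding zz by simp
  then have "z \<in> ball 0 1" by (simp add: norm_eq_sqrt_inner)
  ultimately show "x \<in> hyperboloid_param ` ball 0 1" by blast
qed

lemma hyperbolic_disk_eq_ball:
  assumes "0 < r"
  shows "hyperbolic_disk r = ball 0 (tanh (r / 2))"
proof -
  define T where "T = (tanh (r / 2))\<^sup>2"
  have t: "0 < tanh (r / 2)" "tanh (r / 2) < 1" using assms tanh_real_lt_1 by auto
  then have T: "0 < T" "T < 1" by (simp_all add: T_def power_less_one_iff)
  have cT: "cosh r = (1 + T) / (1 - T)"
  proof -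
    have c: "cosh (r/2) \<noteq> 0" by simp
    have "(cosh (r/2))\<^sup>2 * T = (sinh (r/2))\<^sup>2"
      unfolding T_def tanh_def using c by (simp add: power_divide)
    then have e: "(cosh (r/2))\<^sup>2 * (1 - T) = 1"
      using cosh_square_eq[of "r/2"] by (simp add: algebra_simps)
    have "cosh r = cosh (2 * (r/2))" by simp
    also have "\<dots> = (cosh (r/2))\<^sup>2 * (1 + T)"
      unfolding cosh_double T_def tanh_def using c by (simp add: field_simps)
    also have "(cosh (r/2))\<^sup>2 = 1 / (1 - T)"
      using e T by (simp add: field_simps)
    finally show ?thesis by simp
  qed
  have "arcosh (- minkowski (hyperboloid_param z) pole) < r \<longleftrightarrow> norm z < tanh (r / 2)"
    if "norm z < 1" for z :: "real^2"
  proof -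
    define s where "s = z \<bullet> z"
    have s: "s \<ge> 0" "s < 1"
      using that by (simp_all add: s_def dot_square_norm power_less_one_iff)
    have h: "- minkowski (hyperboloid_param z) pole = (1 + s) / (1 - s)"
      by (simp add: hyperboloid_param_def pole_def s_def minkowski_def)
    have b: "(1 + s) / (1 - s) \<ge> 1" using s by (simp add: field_simps)
    have "arcosh ((1 + s) / (1 - s)) < r \<longleftrightarrow> cosh (arcosh ((1 + s) / (1 - s))) < cosh r"
      using assms b by (subst cosh_real_nonneg_less_iff) auto
    also have "\<dots> \<longleftrightarrow> (1 + s) / (1 - s) < cosh r" using b by simp
    also have "\<dots> \<longleftrightarrow> s < T" using s T by (simp add: cT field_simps)
    also have "\<dots> \<longleftrightarrow> norm z < tanh (r / 2)"
      using t unfolding s_def T_def by (simp add: norm_lt_square)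
    finally show ?thesis by (simp add: h)
  qed
  then show ?thesis using t(2) by (fastforce simp: hyperbolic_disk_def)
qed

lemma hyperbolic_metric_conformal:
  assumes "norm z < 1"
  shows "hyperbolic_metric z = mat ((2 / (1 - z \<bullet> z))\<^sup>2)"
proof -
  define s where "s = z \<bullet> z"
  have s: "s = z$1 * z$1 + z$2 * z$2" by (simp add: s_def inner_vec_def sum_2)
  have p: "1 - s \<noteq> 0" using assms power_less_one_iff[of "norm z" 2] by (simp add: s_def dot_square_norm)
  have D: "frechet_derivative hyperboloid_param (at z) = (\<lambda>h. (2 / (1 - s)\<^sup>2) *\<^sub>R vector
        [(1 - s) * h$1 + 2 * (z \<bullet> h) * z$1, (1 - s) * h$2 + 2 * (z \<bullet> h) * z$2, 2 * (z \<bullet> h)])"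
    using param_derivative[of hyperboloid_param "-1" z] p
    by (simp add: hyperboloid_param_def s_def fun_eq_iff)
  show ?thesis
    unfolding hyperbolic_metric_def induced_metric_def D s_def[symmetric]
    using p
    by (simp add: vec_eq_iff forall_2 mat_def minkowski_def sum_2 sum_3 inner_vec_def axis_def)
       (simp add: divide_simps power2_eq_square power4_eq_xxxx, simp add: s algebra_simps power4_eq_xxxx)
qed

end

theory Submission
  imports Defs
begin

text \<open>
  In a conformal chart the Dirichlet integral does not see the metric, and with the parameter
  \<open>\<alpha> / sin \<Theta>\<close> (or \<open>\<alpha> / sinh \<bar>\<Theta>\<bar>\<close>) the boundary term becomes \<open>\<alpha> \<integral> u\<^sup>2 d\<theta>\<close>. After rescaling the chart
  disk to the unit disk, only the denominator of the Rayleigh quotient depends on \<open>\<Theta>\<close>: with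
  \<open>t = tan\<^sup>2 (\<Theta> / 2)\<close> or \<open>t = - tanh\<^sup>2 (\<Theta> / 2)\<close> it is the integral of \<open>u\<^sup>2\<close> against the weight
  \<open>(1 + t \<bar>x\<bar>\<^sup>2)\<^sup>-\<^sup>2\<close> for \<open>F\<close> and against \<open>(1 + t)\<^sup>2 (1 + t \<bar>x\<bar>\<^sup>2)\<^sup>-\<^sup>2\<close> for \<open>G\<close>. The first weight decreases and the
  second increases in \<open>t\<close>, strictly away from the origin and from the boundary; these two places carry
  little mass because \<open>r u(r)\<^sup>2 \<le> 2 u(1)\<^sup>2 + 2 \<integral> (\<partial>\<^sub>r u)\<^sup>2 s ds\<close> on every radius, and the same inequality
  gives the divergence to infinity. Since \<open>C\<^sup>1\<close> functions are dense in \<open>H\<^sup>1\<close> of a disk, with convergent traces, the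
  min-max value may be computed on spaces of \<open>C\<^sup>1\<close> functions, where all of this is elementary.
\<close>

section \<open>Square-integrable functions\<close>

text \<open>Nothing in the argument is attained: eigenfunctions never appear, each eigenvalue is
  only an infimum of levels, and a pointwise strict inequality between weights would give no more
  than a weak inequality between infima. Strictness has to come from a factor that is uniform over
  all functions of bounded Rayleigh quotient. The weights to be compared agree at the origin (for
  \<open>F\<close>) or on the unit circle (for \<open>G\<close>), so no pointwise factor exists, and
  the mass near these places must be bounded first. A second obstacle is that \<open>wdiff\<close>
  and \<open>trace_of\<close> are chosen by \<open>SOME\<close>, separately for each function. Both
  must be shown unique up to null sets and linear before a Rayleigh quotient becomes a quotient of
  quadratic forms in the coefficients. Moreover \<open>Inf\<close> of an empty set and
  \<open>Sup\<close> of an unbounded set of reals are unspecified values, so nonemptiness and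
  boundedness are tracked throughout. The two limits 0 rest on explicit test spaces: for
  \<open>F\<close> polynomials, whose mass blows up along the circle as \<open>t\<close> tends to
  -1, and for \<open>G\<close> bumps shrunk to radius \<open>1 / sqrt t\<close>.\<close>

definition L2 :: "'a measure \<Rightarrow> ('a \<Rightarrow> real) \<Rightarrow> bool" where
  "L2 M f \<longleftrightarrow> f \<in> borel_measurable M \<and> integrable M (\<lambda>x. (f x)\<^sup>2)"

lemma L2_measurable [measurable_dest]: "L2 M f \<Longrightarrow> f \<in> borel_measurable M"
  by (simp add: L2_def)

lemma L2_integrable: "L2 M f \<Longrightarrow> integrable M (\<lambda>x. (f x)\<^sup>2)"
  by (simp add: L2_def)

lemma L2_mult_integrable:
  assumes "L2 M f" "L2 M g"
  shows "integrable M (\<lambda>x. f x * g x)"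
proof (rule Bochner_Integration.integrable_bound)
  show "integrable M (\<lambda>x. (f x)\<^sup>2 + (g x)\<^sup>2)"
    using assms by (simp add: L2_def)
  show "(\<lambda>x. f x * g x) \<in> borel_measurable M"
    using assms by (auto simp: L2_def)
  have "\<bar>f x * g x\<bar> \<le> (f x)\<^sup>2 + (g x)\<^sup>2" for x
    using sum_squares_bound[of "\<bar>f x\<bar>" "\<bar>g x\<bar>"] mult_nonneg_nonneg[of "\<bar>f x\<bar>" "\<bar>g x\<bar>"]
    by (simp add: abs_mult del: mult_nonneg_nonneg)
  then show "AE x in M. norm (f x * g x) \<le> norm ((f x)\<^sup>2 + (g x)\<^sup>2)"
    by simp
qed

lemma L2_add:
  assumes "L2 M f" "L2 M g"
  shows "L2 M (\<lambda>x. f x + g x)"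
proof -
  have "integrable M (\<lambda>x. (f x)\<^sup>2 + (g x)\<^sup>2 + 2 * (f x * g x))"
    using assms L2_mult_integrable[OF assms] by (simp add: L2_def)
  then show ?thesis
    using assms by (auto simp: L2_def power2_sum mult.assoc)
qed

lemma L2_scale: "L2 M f \<Longrightarrow> L2 M (\<lambda>x. c * f x)"
  by (auto simp: L2_def power_mult_distrib)

lemma L2_minus: "L2 M f \<Longrightarrow> L2 M (\<lambda>x. - f x)"
  by (auto simp: L2_def)

lemma L2_diff: "L2 M f \<Longrightarrow> L2 M g \<Longrightarrow> L2 M (\<lambda>x. f x - g x)"
  using L2_add[OF _ L2_minus, of M f g] by simp

lemma L2_zero: "L2 M (\<lambda>x. 0)"
  by (simp add: L2_def)

lemma L2_sum:
  assumes "\<And>i. i \<in> I \<Longrightarrow> L2 M (f i)"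
  shows "L2 M (\<lambda>x. \<Sum>i\<in>I. f i x)"
  using assms by (induction I rule: infinite_finite_induct) (auto simp: L2_zero L2_add)

lemma L2_cong_AE:
  assumes "L2 M f" "g \<in> borel_measurable M" "AE x in M. g x = f x"
  shows "L2 M g"
proof -
  have "integrable M (\<lambda>x. (g x)\<^sup>2) \<longleftrightarrow> integrable M (\<lambda>x. (f x)\<^sup>2)"
    by (rule integrable_cong_AE) (use assms in \<open>auto simp: L2_def\<close>)
  then show ?thesis
    using assms by (simp add: L2_def)
qed

lemma (in finite_measure) L2_bounded:
  assumes "f \<in> borel_measurable M" "\<And>x. x \<in> space M \<Longrightarrow> \<bar>f x\<bar> \<le> B"
  shows "L2 M f"
  unfolding L2_def
proof
  show "integrable M (\<lambda>x. (f x)\<^sup>2)"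
    by (rule integrable_const_bound[where B="B\<^sup>2"])
      (use assms in \<open>auto simp: abs_le_square_iff[symmetric] intro!: AE_I2 order_trans[OF assms(2)]\<close>)
qed fact

lemma (in finite_measure) L2_imp_integrable: "L2 M f \<Longrightarrow> integrable M f"
  using L2_mult_integrable[OF _ L2_bounded[of "\<lambda>x. 1" 1], of f] by simp

lemma L2_mult_bounded:
  assumes f: "L2 M f" and g: "g \<in> borel_measurable M" "\<And>x. x \<in> space M \<Longrightarrow> \<bar>g x\<bar> \<le> B"
  shows "L2 M (\<lambda>x. g x * f x)"
  unfolding L2_def
proof
  show "integrable M (\<lambda>x. (g x * f x)\<^sup>2)"
  proof (rule Bochner_Integration.integrable_bound)
    show "integrable M (\<lambda>x. B\<^sup>2 * (f x)\<^sup>2)"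
      using f by (simp add: L2_def)
    have "(g x)\<^sup>2 \<le> B\<^sup>2" if "x \<in> space M" for x
      using power_mono[OF g(2)[OF that] abs_ge_zero, of 2] by simp
    then show "AE x in M. norm ((g x * f x)\<^sup>2) \<le> norm (B\<^sup>2 * (f x)\<^sup>2)"
      by (auto simp: power_mult_distrib abs_mult intro!: AE_I2 mult_right_mono)
  qed (use f g in \<open>auto simp: L2_def\<close>)
qed (use f g in \<open>auto simp: L2_def\<close>)

text \<open>Expand \<open>(e * a - b)\<^sup>2 / e \<ge> 0\<close>. The factor of
  \<open>a\<^sup>2\<close> can be taken arbitrarily close to 1. The transfer of Rayleigh quotients
  from \<open>H1\<close> functions to \<open>C1\<close> approximations depends on this: a fixed
  constant there would spoil the min-max value.\<close>

lemma square_sum_le_young: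
  fixes a b e :: real
  assumes "e > 0"
  shows "(a + b)\<^sup>2 \<le> (1 + e) * a\<^sup>2 + (1 + 1 / e) * b\<^sup>2"
proof -
  have "0 \<le> (e * a - b)\<^sup>2 / e"
    using assms by simp
  also have "\<dots> = (1 + e) * a\<^sup>2 + (1 + 1 / e) * b\<^sup>2 - (a + b)\<^sup>2"
    using assms by (simp add: field_simps power2_eq_square)
  finally show ?thesis
    by simp
qed

lemma L2_young:
  assumes "L2 M f" "L2 M g" "e > 0"
  shows "(\<integral>x. (f x + g x)\<^sup>2 \<partial>M) \<le> (1 + e) * (\<integral>x. (f x)\<^sup>2 \<partial>M) + (1 + 1 / e) * (\<integral>x. (g x)\<^sup>2 \<partial>M)"
proof -
  have "(\<integral>x. (f x + g x)\<^sup>2 \<partial>M) \<le> (\<integral>x. (1 + e) * (f x)\<^sup>2 + (1 + 1 / e) * (g x)\<^sup>2 \<partial>M)"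
    using assms L2_add[OF assms(1,2)]
    by (intro integral_mono) (auto simp: L2_def square_sum_le_young)
  also have "\<dots> = (1 + e) * (\<integral>x. (f x)\<^sup>2 \<partial>M) + (1 + 1 / e) * (\<integral>x. (g x)\<^sup>2 \<partial>M)"
    using assms by (simp add: L2_def)
  finally show ?thesis .
qed

lemma L2_add_bound:
  assumes "L2 M f" "L2 M g"
  shows "(\<integral>x. (f x + g x)\<^sup>2 \<partial>M) \<le> 2 * (\<integral>x. (f x)\<^sup>2 \<partial>M) + 2 * (\<integral>x. (g x)\<^sup>2 \<partial>M)"
  using L2_young[OF assms, of 1] by simp

lemma L2_diff_triangle:
  assumes "L2 M f" "L2 M g" "L2 M h"
  shows "(\<integral>x. (f x - h x)\<^sup>2 \<partial>M) \<le> 2 * (\<integral>x. (f x - g x)\<^sup>2 \<partial>M) + 2 * (\<integral>x. (g x - h x)\<^sup>2 \<partial>M)"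
  using L2_add_bound[OF L2_diff[OF assms(1,2)] L2_diff[OF assms(2,3)]] by simp

section \<open>Finite linear combinations: bounds uniform in the coefficients\<close>

lemma L2_lincomb_bound:
  fixes f :: "nat \<Rightarrow> 'a \<Rightarrow> real"
  assumes "\<And>i. i < k \<Longrightarrow> L2 M (f i)"
  shows "(\<integral>x. (\<Sum>i<k. c i * f i x)\<^sup>2 \<partial>M) \<le> (\<Sum>i<k. (c i)\<^sup>2) * (\<Sum>i<k. \<integral>x. (f i x)\<^sup>2 \<partial>M)"
proof -
  have "(\<integral>x. (\<Sum>i<k. c i * f i x)\<^sup>2 \<partial>M) \<le> (\<integral>x. (\<Sum>i<k. (c i)\<^sup>2) * (\<Sum>i<k. (f i x)\<^sup>2) \<partial>M)"
    using L2_sum[of "{..<k}" M "\<lambda>i x. c i * f i x"] assms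
    by (intro integral_mono)
      (auto simp: L2_scale L2_integrable intro!: Cauchy_Schwarz_ineq_sum integrable_mult_right integrable_sum)
  also have "\<dots> = (\<Sum>i<k. (c i)\<^sup>2) * (\<Sum>i<k. \<integral>x. (f i x)\<^sup>2 \<partial>M)"
    using assms by (simp add: Bochner_Integration.integral_sum L2_integrable)
  finally show ?thesis .
qed

lemma L2_lincomb_expand:
  fixes f :: "nat \<Rightarrow> 'a \<Rightarrow> real"
  assumes "\<And>i. i < k \<Longrightarrow> L2 M (f i)"
  shows "(\<integral>x. (\<Sum>i<k. c i * f i x)\<^sup>2 \<partial>M) = (\<Sum>i<k. \<Sum>j<k. c i * c j * (\<integral>x. f i x * f j x \<partial>M))"
proof -
  have "(\<integral>x. (\<Sum>i<k. c i * f i x)\<^sup>2 \<partial>M) = (\<integral>x. (\<Sum>i<k. \<Sum>j<k. c i * c j * (f i x * f j x)) \<partial>M)"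
    by (intro Bochner_Integration.integral_cong)
      (simp_all add: power2_eq_square sum_product mult_ac)
  also have "\<dots> = (\<Sum>i<k. \<integral>x. (\<Sum>j<k. c i * c j * (f i x * f j x)) \<partial>M)"
    by (intro Bochner_Integration.integral_sum Bochner_Integration.integrable_sum integrable_mult_right L2_mult_integrable assms) auto
  also have "\<dots> = (\<Sum>i<k. \<Sum>j<k. \<integral>x. c i * c j * (f i x * f j x) \<partial>M)"
    by (intro sum.cong refl Bochner_Integration.integral_sum integrable_mult_right L2_mult_integrable assms) auto
  also have "\<dots> = (\<Sum>i<k. \<Sum>j<k. c i * c j * (\<integral>x. f i x * f j x \<partial>M))"
    by simp
  finally show ?thesis .
qed

text \<open>The dimension \<open>k\<close> is a variable, so coefficient vectors are functions on
  all of \<open>nat\<close>. Freezing them to 0 beyond \<open>k\<close> puts the unit sphere inside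
  a product of compact sets, and Tychonoff's theorem takes the place of Heine-Borel.\<close>

lemma compact_coefficient_sphere:
  "compact {c :: nat \<Rightarrow> real. (\<forall>i\<ge>k. c i = 0) \<and> (\<Sum>i<k. (c i)\<^sup>2) = 1}" (is "compact ?S")
proof -
  define K :: "nat \<Rightarrow> real set" where "K i = (if i < k then {-1..1} else {0})" for i
  have "compactin (product_topology (\<lambda>i. euclidean) UNIV) (PiE UNIV K)"
    by (subst compactin_PiE) (auto simp: K_def)
  then have K: "compact (PiE UNIV K)"
    by (simp add: euclidean_product_topology)
  have cont: "continuous_on UNIV (\<lambda>c::nat \<Rightarrow> real. \<Sum>i<k. (c i)\<^sup>2)"
    by (intro continuous_intros) auto
  have "closed ((\<lambda>c::nat \<Rightarrow> real. \<Sum>i<k. (c i)\<^sup>2) -` {1})"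
    using continuous_closed_vimage[of "{1::real}" "\<lambda>c::nat \<Rightarrow> real. \<Sum>i<k. (c i)\<^sup>2"] cont
    by (simp add: continuous_on_eq_continuous_at)
  then have "compact (PiE UNIV K \<inter> (\<lambda>c::nat \<Rightarrow> real. \<Sum>i<k. (c i)\<^sup>2) -` {1})"
    by (rule compact_Int_closed[OF K])
  moreover have "PiE UNIV K \<inter> (\<lambda>c::nat \<Rightarrow> real. \<Sum>i<k. (c i)\<^sup>2) -` {1} = ?S"
  proof (intro set_eqI iffI)
    fix c assume "c \<in> PiE UNIV K \<inter> (\<lambda>c::nat \<Rightarrow> real. \<Sum>i<k. (c i)\<^sup>2) -` {1}"
    then have c: "\<And>i. c i \<in> K i" "(\<Sum>i<k. (c i)\<^sup>2) = 1"
      by auto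
    have "c i = 0" if "i \<ge> k" for i
      using c(1)[of i] that by (simp add: K_def)
    with c(2) show "c \<in> ?S"
      by simp
  next
    fix c assume c: "c \<in> ?S"
    have "\<bar>c i\<bar> \<le> 1" if "i < k" for i
    proof -
      have "(c i)\<^sup>2 \<le> (\<Sum>i<k. (c i)\<^sup>2)"
        using that by (intro member_le_sum) auto
      then show ?thesis
        using c by (simp add: abs_square_le_1)
    qed
    then have "c i \<in> K i" for i
      using c by (cases "i < k") (simp_all add: K_def abs_le_iff minus_le_iff)
    then show "c \<in> PiE UNIV K \<inter> (\<lambda>c::nat \<Rightarrow> real. \<Sum>i<k. (c i)\<^sup>2) -` {1}"
      using c by (auto intro!: PiE_I)
  qed
  ultimately show ?thesis
    by simp
qed

text \<open>Equivalence of norms in finite dimension: the quadratic form is continuous, independence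
  makes it positive on the compact unit sphere, hence it has a positive minimum there, and
  homogeneity extends the bound to all \<open>c\<close>. The lower mass bounds of all test spaces
  below come from here.\<close>

lemma L2_indep_lower:
  fixes f :: "nat \<Rightarrow> 'a \<Rightarrow> real"
  assumes L2: "\<And>i. i < k \<Longrightarrow> L2 M (f i)"
    and indep: "\<And>c. AE x in M. (\<Sum>i<k. c i * f i x) = 0 \<Longrightarrow> \<forall>i<k. c i = 0"
  obtains \<kappa> where "\<kappa> > 0" "\<And>c. \<kappa> * (\<Sum>i<k. (c i)\<^sup>2) \<le> (\<integral>x. (\<Sum>i<k. c i * f i x)\<^sup>2 \<partial>M)"
proof -
  define q where "q c = (\<integral>x. (\<Sum>i<k. c i * f i x)\<^sup>2 \<partial>M)" for c :: "nat \<Rightarrow> real"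
  define S where "S = {c :: nat \<Rightarrow> real. (\<forall>i\<ge>k. c i = 0) \<and> (\<Sum>i<k. (c i)\<^sup>2) = 1}"
  have S: "compact S"
    unfolding S_def by (rule compact_coefficient_sphere)
  have hom: "q (\<lambda>i. a * c i) = a\<^sup>2 * q c" for a c
    unfolding q_def by (simp add: mult.assoc power_mult_distrib flip: sum_distrib_left)
  have q0: "q c = q (\<lambda>i. if i < k then c i else 0)" for c
    unfolding q_def by simp
  have q_pos: "q c > 0" if c: "c \<in> S" for c
  proof -
    have L: "L2 M (\<lambda>x. \<Sum>i<k. c i * f i x)"
      by (intro L2_sum L2_scale L2) auto
    have "q c \<ge> 0"
      by (simp add: q_def)
    moreover have "q c \<noteq> 0"
    proof
      assume "q c = 0"
      then have "AE x in M. (\<Sum>i<k. c i * f i x)\<^sup>2 = 0"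
        using L integral_nonneg_eq_0_iff_AE[of M "\<lambda>x. (\<Sum>i<k. c i * f i x)\<^sup>2"]
        by (simp add: q_def L2_def)
      then have "\<forall>i<k. c i = 0"
        using indep[of c] by simp
      then show False
        using c by (simp add: S_def)
    qed
    ultimately show ?thesis
      by simp
  qed
  have cont: "continuous_on S q"
  proof -
    have "q = (\<lambda>c. \<Sum>i<k. \<Sum>j<k. c i * c j * (\<integral>x. f i x * f j x \<partial>M))"
      unfolding q_def by (intro ext L2_lincomb_expand L2)
    moreover have "continuous_on S (\<lambda>c. c i)" for i
      by (rule continuous_on_subset[OF continuous_on_product_coordinates]) auto
    ultimately show ?thesis
      by (simp only:) (intro continuous_intros)
  qed
  obtain \<kappa> where \<kappa>: "\<kappa> > 0" "\<And>c. c \<in> S \<Longrightarrow> \<kappa> \<le> q c"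
  proof (cases "S = {}")
    \<comment> \<open>The sphere is empty only for \<open>k = 0\<close>, where any positive constant
      works.\<close>
    case True
    then show ?thesis
      using that[of 1] by simp
  next
    case False
    then obtain c0 where "c0 \<in> S" "\<And>c. c \<in> S \<Longrightarrow> q c0 \<le> q c"
      using continuous_attains_inf[OF S _ cont] by blast
    then show ?thesis
      using that[of "q c0"] q_pos by blast
  qed
  have "\<kappa> * (\<Sum>i<k. (c i)\<^sup>2) \<le> q c" for c
  proof (cases "(\<Sum>i<k. (c i)\<^sup>2) = 0")
    case True
    then show ?thesis by (simp add: q_def)
  next
    case False
    define N where "N = (\<Sum>i<k. (c i)\<^sup>2)"
    have N: "N > 0"
      using False sum_nonneg[of "{..<k}" "\<lambda>i. (c i)\<^sup>2"] by (simp add: N_def)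
    define c' where "c' i = (1 / sqrt N) * (if i < k then c i else 0)" for i
    have "(\<Sum>i<k. (c' i)\<^sup>2) = (1 / sqrt N)\<^sup>2 * N"
      unfolding c'_def N_def by (simp add: power_mult_distrib sum_divide_distrib power_divide)
    also have "\<dots> = 1"
      using N by (simp add: power_divide)
    finally have "c' \<in> S"
      by (simp add: S_def c'_def)
    then have "\<kappa> \<le> q c'"
      by (rule \<kappa>)
    also have "\<dots> = (1 / sqrt N)\<^sup>2 * q c"
      unfolding c'_def[abs_def] hom q0[of c, symmetric] ..
    also have "\<dots> = q c / N"
      using N by (simp add: power_divide)
    finally show ?thesis
      using N by (simp add: N_def field_simps)
  qed
  then show ?thesis
    using that \<kappa>(1) unfolding q_def by blast
qed

text \<open>This is the tool that identifies objects picked by \<open>SOME\<close>: two weak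
  differentials, or two traces, are limits of one and the same sequence.\<close>

lemma L2_limit_unique:
  assumes L2: "L2 M v" "L2 M w" "\<And>m. L2 M (f m)"
    and lim: "(\<lambda>m. \<integral>x. (f m x - v x)\<^sup>2 \<partial>M) \<longlonglongrightarrow> 0" "(\<lambda>m. \<integral>x. (f m x - w x)\<^sup>2 \<partial>M) \<longlonglongrightarrow> 0"
  shows "AE x in M. v x = w x"
proof -
  have "(\<integral>x. (v x - w x)\<^sup>2 \<partial>M) \<le> 2 * (\<integral>x. (f m x - v x)\<^sup>2 \<partial>M) + 2 * (\<integral>x. (f m x - w x)\<^sup>2 \<partial>M)" for m
    using L2_diff_triangle[OF L2(1) L2(3)[of m] L2(2)] by (simp add: power2_commute)
  moreover have "(\<lambda>m. 2 * (\<integral>x. (f m x - v x)\<^sup>2 \<partial>M) + 2 * (\<integral>x. (f m x - w x)\<^sup>2 \<partial>M)) \<longlonglongrightarrow> 2 * 0 + 2 * 0"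
    by (intro tendsto_intros lim)
  ultimately have "(\<integral>x. (v x - w x)\<^sup>2 \<partial>M) \<le> 0"
    by (intro LIMSEQ_le_const[of _ 0]) auto
  then have "(\<integral>x. (v x - w x)\<^sup>2 \<partial>M) = 0"
    by (intro antisym) auto
  then have "AE x in M. (v x - w x)\<^sup>2 = 0"
    using L2_diff[OF L2(1,2)] integral_nonneg_eq_0_iff_AE[of M "\<lambda>x. (v x - w x)\<^sup>2"]
    by (simp add: L2_def)
  then show ?thesis
    by simp
qed

section \<open>Polar coordinates\<close>

lemma circle_curve_nth [simp]: "circle_curve s t $ 1 = s * cos t" "circle_curve s t $ 2 = s * sin t"
  by (simp_all add: circle_curve_def)

lemma norm_real2: "norm (x :: real^2) = sqrt ((x $ 1)\<^sup>2 + (x $ 2)\<^sup>2)"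
  by (simp add: norm_vec_def L2_set_def sum_2)

lemma inner_real2: "(x :: real^2) \<bullet> y = x $ 1 * y $ 1 + x $ 2 * y $ 2"
  by (simp add: inner_vec_def sum_2)

lemma norm_circle_curve: "norm (circle_curve s t) = \<bar>s\<bar>"
proof -
  have "(s * cos t)\<^sup>2 + (s * sin t)\<^sup>2 = s\<^sup>2 * ((sin t)\<^sup>2 + (cos t)\<^sup>2)"
    by (simp only: power_mult_distrib distrib_left add.commute)
  then show ?thesis
    by (simp add: norm_real2)
qed

lemma circle_curve_eq_iff:
  assumes "0 < s" "0 < s'" "t \<in> {0<..<2*pi}" "t' \<in> {0<..<2*pi}"
    and eq: "circle_curve s t = circle_curve s' t'"
  shows "s = s' \<and> t = t'"
proof -
  have s: "s = s'"
    using arg_cong[OF eq, of norm] assms(1,2) by (simp add: norm_circle_curve)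
  with assms(1) arg_cong[OF eq, of "\<lambda>x. x $ 1"] arg_cong[OF eq, of "\<lambda>x. x $ 2"]
  have "sin t = sin t' \<and> cos t = cos t'"
    by simp
  then obtain n :: int where n: "t = t' + 2 * pi * n"
    using sin_cos_eq_iff by blast
  have "\<bar>2 * pi * n\<bar> < 2 * pi"
    using assms(3,4) n by auto
  then have "2 * pi * \<bar>n\<bar> < 2 * pi * 1"
    by (simp add: abs_mult)
  then have "\<bar>real_of_int n\<bar> < 1"
    by (subst (asm) mult_less_cancel_left_pos) auto
  then have "n = 0"
    by linarith
  with n s show ?thesis
    by simp
qed

lemma continuous_on_vector2:
  fixes f g :: "'a::t2_space \<Rightarrow> real"
  assumes "continuous_on S f" "continuous_on S g"
  shows "continuous_on S (\<lambda>x. vector [f x, g x] :: real^2)"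
proof -
  have "(\<lambda>x. vector [f x, g x] :: real^2) = (\<lambda>x. \<chi> i. if i = 1 then f x else g x)"
    by (auto simp: fun_eq_iff vec_eq_iff forall_2)
  moreover have "continuous_on S (\<lambda>x. (\<chi> i. if i = 1 then f x else g x) :: real^2)"
  proof (rule continuous_on_vec_lambda)
    show "continuous_on S (\<lambda>x. if i = 1 then f x else g x)" for i :: 2
      using assms by (cases "i = 1") auto
  qed
  ultimately show ?thesis
    by (simp only:)
qed

lemma continuous_on_circle_curve [continuous_intros]:
  fixes f g :: "'a::t2_space \<Rightarrow> real"
  assumes "continuous_on S f" "continuous_on S g"
  shows "continuous_on S (\<lambda>x. circle_curve (f x) (g x))"
  unfolding circle_curve_def
  by (intro continuous_intros continuous_on_vector2 continuous_on_cos continuous_on_sin assms)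

lemma measurable_circle_curve [measurable]:
  "(\<lambda>x. circle_curve (fst x) (snd x)) \<in> borel_measurable (borel \<Otimes>\<^sub>M borel)"
  "(\<lambda>x. circle_curve (snd x) (fst x)) \<in> borel_measurable (borel \<Otimes>\<^sub>M borel)"
  unfolding borel_prod
  by (intro borel_measurable_continuous_onI continuous_intros)+

lemma measurable_circle_curve1 [measurable]: "circle_curve s \<in> borel_measurable borel"
  by (intro borel_measurable_continuous_onI continuous_on_circle_curve continuous_on_const continuous_on_id)

lemma measurable_circle_curve2 [measurable]: "(\<lambda>s. circle_curve s t) \<in> borel_measurable borel"
  by (intro borel_measurable_continuous_onI continuous_on_circle_curve continuous_on_const continuous_on_id)

lemma measurable_vector2 [measurable]:
  "(\<lambda>p. vector [fst p, snd p] :: real^2) \<in> borel_measurable (borel \<Otimes>\<^sub>M borel)"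
  unfolding borel_prod
  by (intro borel_measurable_continuous_onI continuous_on_vector2 continuous_intros)

text \<open>Both measures give a box the product of its side lengths, and this determines Lebesgue
  measure. The identity carries Tonelli's theorem, available for pairs, over to
  \<open>real^2\<close>.\<close>

lemma lborel_real2: "(lborel :: (real^2) measure) = distr (lborel \<Otimes>\<^sub>M lborel) borel (\<lambda>p. vector [fst p, snd p])"
proof (rule lborel_eqI)
  fix l u :: "real^2"
  assume lu: "\<And>b. b \<in> Basis \<Longrightarrow> l \<bullet> b \<le> u \<bullet> b"
  have le: "l $ i \<le> u $ i" for i
    using lu[of "axis i 1"] by (simp add: inner_axis)
  have m: "(\<lambda>p. vector [fst p, snd p] :: real^2) \<in> borel_measurable (lborel \<Otimes>\<^sub>M lborel)"
    by simp
  have b: "(\<Prod>b\<in>Basis. (u - l) \<bullet> b) = (u $ 1 - l $ 1) * (u $ 2 - l $ 2)"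
  proof -
    have B: "(Basis :: (real^2) set) = {axis 1 1, axis 2 1}"
      by (auto simp: Basis_vec_def UNIV_2)
    have ne: "(axis 1 1 :: real^2) \<noteq> axis 2 1"
      by (simp add: axis_eq_axis)
    show ?thesis
      unfolding B using ne by (simp add: inner_axis)
  qed
  have v: "(\<lambda>p. vector [fst p, snd p] :: real^2) -` box l u = {l $ 1<..<u $ 1} \<times> {l $ 2<..<u $ 2}"
    by (auto simp: mem_box_cart forall_2)
  show "emeasure (distr (lborel \<Otimes>\<^sub>M lborel) borel (\<lambda>p. vector [fst p, snd p])) (box l u)
      = ennreal (\<Prod>b\<in>Basis. (u - l) \<bullet> b)"
    using le by (simp add: emeasure_distr[OF m] v space_pair_measure b lborel.emeasure_pair_measure_Times
        flip: ennreal_mult)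
qed simp

text \<open>Open ranges of radius and angle make the polar map injective. The price is the slit
  along the nonnegative first axis, a null set.\<close>

lemma polar_image:
  "(\<lambda>y. circle_curve (y $ 1) (y $ 2)) ` {y :: real^2. 0 < y $ 1 \<and> y $ 1 < R \<and> 0 < y $ 2 \<and> y $ 2 < 2 * pi}
     = ball 0 R - {x. x $ 2 = 0 \<and> x $ 1 \<ge> 0}" (is "?g ` ?S = ?B")
proof (intro equalityI subsetI)
  fix x assume "x \<in> ?g ` ?S"
  then obtain y :: "real^2" where y: "y \<in> ?S" and x: "x = circle_curve (y $ 1) (y $ 2)"
    by blast
  have "x \<notin> {x. x $ 2 = 0 \<and> x $ 1 \<ge> 0}"
  proof
    assume "x \<in> {x. x $ 2 = 0 \<and> x $ 1 \<ge> 0}"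
    then have "sin (y $ 2) = 0" "cos (y $ 2) \<ge> 0"
      using y by (auto simp: x zero_le_mult_iff)
    then have "cos (y $ 2) = 1"
      using sin_cos_squared_add[of "y $ 2"] by (simp add: power2_eq_1_iff)
    then obtain n :: int where "y $ 2 = of_int n * 2 * pi"
      using cos_one_2pi_int by blast
    with y have "0 < n" "n < 1"
      by (auto simp: zero_less_mult_iff)
    then show False by simp
  qed
  then show "x \<in> ?B"
    using y by (auto simp: x norm_circle_curve)
next
  fix x :: "real^2" assume x: "x \<in> ?B"
  have "x \<in> circle_curve (norm x) ` {0..2*pi}"
    by (subst circle_curve_image) auto
  then obtain t where t: "t \<in> {0..2*pi}" "x = circle_curve (norm x) t"
    by blast
  have "x \<noteq> 0"
    using x by auto
  have "t \<noteq> 0 \<and> t \<noteq> 2 * pi"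
  proof (rule ccontr)
    assume "\<not> ?thesis"
    then have "x $ 2 = 0" "x $ 1 \<ge> 0"
      by (subst t(2), auto)+
    with x show False by simp
  qed
  with t x \<open>x \<noteq> 0\<close> show "x \<in> ?g ` ?S"
    by (intro image_eqI[where x = "vector [norm x, t]"]) auto
qed

text \<open>An equality of measures yields the polar formula for all nonnegative measurable
  functions at once. For a single Borel set it is the formula for the measure of an injective
  differentiable image, with the radius as Jacobian determinant.\<close>

lemma polar_measure:
  "density lborel (\<lambda>x. indicator (ball 0 R) x) =
   distr (density (lborel \<Otimes>\<^sub>M lborel) (\<lambda>p. ennreal (fst p) * indicator {0<..<R} (fst p) * indicator {0<..<2*pi} (snd p)))
     borel (\<lambda>p. circle_curve (fst p) (snd p))" (is "?M1 = distr ?M2 borel ?c")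
proof (rule measure_eqI)
  show "sets ?M1 = sets (distr ?M2 borel ?c)"
    by simp
next
  fix A assume "A \<in> sets ?M1"
  then have A [measurable]: "A \<in> sets borel"
    by simp
  define g where "g y = circle_curve (y $ 1) (y $ 2)" for y :: "real^2"
  define g' :: "real^2 \<Rightarrow> real^2 \<Rightarrow> real^2" where
    "g' y h = vector [h $ 1 * cos (y $ 2) - y $ 1 * sin (y $ 2) * h $ 2, h $ 1 * sin (y $ 2) + y $ 1 * cos (y $ 2) * h $ 2]" for y h
  define S where "S = {y :: real^2. 0 < y $ 1 \<and> y $ 1 < R \<and> 0 < y $ 2 \<and> y $ 2 < 2 * pi}"
  define T where "T = S \<inter> g -` A"
  have S [measurable]: "S \<in> sets borel"
    unfolding S_def by (intro borel_open open_Collect_conj open_Collect_less continuous_intros)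
  have [measurable]: "g \<in> borel_measurable borel"
    unfolding g_def by (intro borel_measurable_continuous_onI continuous_intros)
  have T [measurable]: "T \<in> sets borel"
    unfolding T_def using S measurable_sets[of g borel borel A] by auto
  have der: "(g has_derivative g' y) (at y within X)" for y X
  proof -
    have v: "vector [a, b] = a *\<^sub>R axis 1 1 + b *\<^sub>R (axis 2 1 :: real^2)" for a b :: real
      by (simp add: vec_eq_iff forall_2 axis_def)
    have d: "((\<lambda>x. x $ i) has_derivative (\<lambda>x. x $ i)) (at y within X)" for i
      by (rule bounded_linear_imp_has_derivative) (rule bounded_linear_vec_nth)
    show ?thesis
      unfolding g_def g'_def circle_curve_def v
      apply (rule has_derivative_eq_rhs)
       apply (rule derivative_eq_intros refl d)+
      apply (simp add: fun_eq_iff vec_eq_iff forall_2 axis_def algebra_simps)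
      done
  qed
  have det: "det (matrix (g' y)) = y $ 1" for y
  proof -
    have "y $ 1 * (cos (y $ 2) * cos (y $ 2)) + y $ 1 * (sin (y $ 2) * sin (y $ 2))
        = y $ 1 * ((cos (y $ 2))\<^sup>2 + (sin (y $ 2))\<^sup>2)"
      by (simp only: power2_eq_square distrib_left)
    then show ?thesis
      by (simp add: det_2 matrix_def g'_def axis_def algebra_simps)
  qed
  have inj: "inj_on g T"
  proof (rule inj_onI)
    fix x y assume "x \<in> T" "y \<in> T" "g x = g y"
    then have "x $ 1 = y $ 1 \<and> x $ 2 = y $ 2"
      by (intro circle_curve_eq_iff) (auto simp: T_def S_def g_def)
    then show "x = y"
      by (simp add: vec_eq_iff forall_2)
  qed
  have im: "g ` T = A \<inter> (ball 0 R - {x. x $ 2 = 0 \<and> x $ 1 \<ge> 0})"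
  proof -
    have "g ` T = A \<inter> g ` S"
      unfolding T_def by blast
    also have "g ` S = ball 0 R - {x. x $ 2 = 0 \<and> x $ 1 \<ge> 0}"
      using polar_image[of R] by (simp add: S_def g_def[abs_def])
    finally show ?thesis .
  qed
  have cl: "closed {x :: real^2. x $ 2 = 0 \<and> x $ 1 \<ge> 0}"
    by (intro closed_Collect_conj closed_Collect_eq closed_Collect_le continuous_intros)
  have imB [measurable]: "g ` T \<in> sets borel"
    unfolding im using cl by (intro sets.Int sets.Diff A borel_open borel_closed) auto
  have "bounded (g ` T)"
    by (rule bounded_subset[of "ball 0 R"]) (auto simp: im)
  then have "g ` T \<in> lmeasurable"
    using imB by (intro bounded_set_imp_lmeasurable) auto
  then have "((\<lambda>x. \<bar>det (matrix (g' x))\<bar>) has_integral measure lebesgue (g ` T)) T"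
    using has_measure_differentiable_image[of T g g' "measure lebesgue (g ` T)"] T der inj by auto
  then have hi: "((\<lambda>x. x $ 1) has_integral measure lebesgue (g ` T)) T"
    by (rule has_integral_eq[rotated]) (auto simp: det T_def S_def)
  have "(\<integral>\<^sup>+y. ennreal (y $ 1) * indicator T y \<partial>lborel) = ennreal (measure lebesgue (g ` T))"
    by (rule nn_integral_has_integral_lebesgue'[OF _ hi]) (auto simp: T_def S_def)
  also have "\<dots> = emeasure lebesgue (g ` T)"
    using \<open>g ` T \<in> lmeasurable\<close> by (simp add: emeasure_eq_measure2 fmeasurableD2)
  also have "\<dots> = emeasure lborel (g ` T)"
    using imB by simp
  also have "\<dots> = emeasure lborel (A \<inter> ball 0 R)"
  proof (rule emeasure_eq_AE)
    have "negligible {x :: real^2. x $ 2 = 0}"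
      by (rule negligible_standard_hyperplane_cart)
    then have "{x :: real^2. x $ 2 = 0} \<in> null_sets lebesgue"
      by (simp add: negligible_iff_null_sets)
    moreover have "{x :: real^2. x $ 2 = 0} \<in> sets lborel"
      by simp
    ultimately have "{x :: real^2. x $ 2 = 0} \<in> null_sets lborel"
      by (subst (asm) null_sets_completion_iff) auto
    then have "AE x in lborel. x \<notin> {x :: real^2. x $ 2 = 0}"
      by (rule AE_not_in)
    then show "AE x in lborel. x \<in> g ` T \<longleftrightarrow> x \<in> A \<inter> ball 0 R"
      by eventually_elim (auto simp: im)
  qed (use imB in auto)
  finally have *: "(\<integral>\<^sup>+y. ennreal (y $ 1) * indicator T y \<partial>lborel) = emeasure lborel (A \<inter> ball 0 R)" .
  have "emeasure (distr ?M2 borel ?c) A =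
     (\<integral>\<^sup>+p. ennreal (fst p) * indicator {0<..<R} (fst p) * indicator {0<..<2*pi} (snd p) * indicator A (?c p) \<partial>(lborel \<Otimes>\<^sub>M lborel))"
    by (subst nn_integral_indicator[symmetric], simp, subst nn_integral_distr, simp, simp, subst nn_integral_density) auto
  also have "\<dots> = (\<integral>\<^sup>+p. ennreal ((vector [fst p, snd p] :: real^2) $ 1) * indicator T (vector [fst p, snd p]) \<partial>(lborel \<Otimes>\<^sub>M lborel))"
    by (intro nn_integral_cong) (auto simp: T_def S_def g_def indicator_def)
  also have "\<dots> = (\<integral>\<^sup>+y. ennreal (y $ 1) * indicator T y \<partial>lborel)"
    by (subst lborel_real2, subst nn_integral_distr) auto
  also have "\<dots> = emeasure ?M1 A"
  proof -
    have "emeasure ?M1 A = (\<integral>\<^sup>+x. indicator (ball 0 R) x * indicator A x \<partial>lborel)"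
      by (rule emeasure_density) (auto intro: borel_measurable_indicator)
    also have "\<dots> = (\<integral>\<^sup>+x. indicator (A \<inter> ball 0 R) x \<partial>lborel)"
      by (intro nn_integral_cong) (auto simp: indicator_def)
    also have "\<dots> = emeasure lborel (A \<inter> ball 0 R)"
      by (rule nn_integral_indicator) auto
    finally show ?thesis
      unfolding * ..
  qed
  finally show "emeasure ?M1 A = emeasure (distr ?M2 borel ?c) A" ..
qed

text \<open>The angle is the outer variable because the estimates below run along a fixed ray.
  Passing from the open to the closed ranges changes null sets only.\<close>

lemma polar_nn_integral:
  assumes [measurable]: "f \<in> borel_measurable borel"
  shows "(\<integral>\<^sup>+x\<in>ball 0 R. f x \<partial>lborel) =
     (\<integral>\<^sup>+t\<in>{0..2*pi}. (\<integral>\<^sup>+s\<in>{0..R}. ennreal s * f (circle_curve s t) \<partial>lborel) \<partial>lborel)"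
proof -
  have "(\<integral>\<^sup>+x\<in>ball 0 R. f x \<partial>lborel) = (\<integral>\<^sup>+x. f x \<partial>(density lborel (\<lambda>x. indicator (ball 0 R) x)))"
    by (subst nn_integral_density) (auto simp: mult.commute intro: borel_measurable_indicator)
  also have "\<dots> = (\<integral>\<^sup>+p. ennreal (fst p) * indicator {0<..<R} (fst p) * indicator {0<..<2*pi} (snd p) * f (circle_curve (fst p) (snd p)) \<partial>(lborel \<Otimes>\<^sub>M lborel))"
    by (subst polar_measure, subst nn_integral_distr, simp, simp, subst nn_integral_density) auto
  also have "\<dots> = (\<integral>\<^sup>+t. (\<integral>\<^sup>+s. ennreal s * indicator {0<..<R} s * indicator {0<..<2*pi} t * f (circle_curve s t) \<partial>lborel) \<partial>lborel)"
    by (subst lborel_pair.nn_integral_snd[symmetric]) auto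
  also have "\<dots> = (\<integral>\<^sup>+t\<in>{0..2*pi}. (\<integral>\<^sup>+s\<in>{0..R}. ennreal s * f (circle_curve s t) \<partial>lborel) \<partial>lborel)"
  proof (rule nn_integral_cong_AE)
    show "AE t in lborel. (\<integral>\<^sup>+s. ennreal s * indicator {0<..<R} s * indicator {0<..<2*pi} t * f (circle_curve s t) \<partial>lborel)
       = (\<integral>\<^sup>+s\<in>{0..R}. ennreal s * f (circle_curve s t) \<partial>lborel) * indicator {0..2*pi} t"
      using AE_lborel_singleton[of 0] AE_lborel_singleton[of "2*pi"]
    proof eventually_elim
      case (elim t)
      have "(\<integral>\<^sup>+s. ennreal s * indicator {0<..<R} s * indicator {0<..<2*pi} t * f (circle_curve s t) \<partial>lborel)
         = (\<integral>\<^sup>+s. (ennreal s * f (circle_curve s t) * indicator {0..R} s) * indicator {0..2*pi} t \<partial>lborel)"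
        by (rule nn_integral_cong_AE, use AE_lborel_singleton[of 0] AE_lborel_singleton[of R] in eventually_elim)
          (use elim in \<open>auto simp: indicator_def\<close>)
      then show ?case
        by (subst (asm) nn_integral_multc) auto
    qed
  qed
  finally show ?thesis .
qed

section \<open>Differentiable functions and radial means\<close>

abbreviation disk :: "real \<Rightarrow> (real^2) measure" where
  "disk R \<equiv> lebesgue_on (ball 0 R)"

abbreviation angles :: "real measure" where
  "angles \<equiv> lebesgue_on {0..2*pi}"

lemma finite_measure_disk: "finite_measure (disk R)"
  by (rule finite_measure_lebesgue_on) simp

lemma finite_measure_angles: "finite_measure angles"
  by (rule finite_measure_lebesgue_on) simp

lemma borel_measurable_disk: "f \<in> borel_measurable borel \<Longrightarrow> f \<in> borel_measurable (disk R)"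
  by (simp add: measurable_completion measurable_restrict_space1)

lemma borel_measurable_angles: "f \<in> borel_measurable borel \<Longrightarrow> f \<in> borel_measurable angles"
  by (simp add: measurable_completion measurable_restrict_space1)

lemma continuous_imp_borel_measurable_disk:
  fixes f :: "real^2 \<Rightarrow> 'b::topological_space"
  shows "continuous_on UNIV f \<Longrightarrow> f \<in> borel_measurable (disk R)"
  by (rule borel_measurable_disk) (rule borel_measurable_continuous_onI)

text \<open>The function spaces are built on the completed measure, while the polar formula and
  Tonelli are used for Borel measure. Nonnegative integrals do not see the difference, so estimates
  are first proved for them.\<close>

lemma nn_integral_disk: "(\<integral>\<^sup>+x. f x \<partial>disk R) = (\<integral>\<^sup>+x\<in>ball 0 R. f x \<partial>lborel)"
  by (simp add: nn_integral_restrict_space nn_integral_completion)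

lemma nn_integral_angles: "(\<integral>\<^sup>+x. f x \<partial>angles) = (\<integral>\<^sup>+x\<in>{0..2*pi}. f x \<partial>lborel)"
  by (simp add: nn_integral_restrict_space nn_integral_completion)

section \<open>Calculus of continuously differentiable functions\<close>

lemma C1_has_derivative:
  assumes "C1 \<phi>"
  shows "(\<phi> has_derivative (\<lambda>h. partials \<phi> x \<bullet> h)) (at x)"
proof -
  have d: "(\<phi> has_derivative frechet_derivative \<phi> (at x)) (at x)"
    using assms by (simp add: C1_def frechet_derivative_works)
  then have lin: "linear (frechet_derivative \<phi> (at x))"
    using has_derivative_linear by blast
  have "frechet_derivative \<phi> (at x) h = partials \<phi> x \<bullet> h" for h
  proof -
    have "h = h $ 1 *\<^sub>R axis 1 1 + h $ 2 *\<^sub>R axis 2 1"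
      by (simp add: vec_eq_iff forall_2 axis_def)
    then have "frechet_derivative \<phi> (at x) h =
        h $ 1 * frechet_derivative \<phi> (at x) (axis 1 1) + h $ 2 * frechet_derivative \<phi> (at x) (axis 2 1)"
      using linear_add[OF lin] linear_scale[OF lin] by (metis real_scaleR_def)
    then show ?thesis
      by (simp add: partials_def inner_real2)
  qed
  then have "frechet_derivative \<phi> (at x) = (\<lambda>h. partials \<phi> x \<bullet> h)"
    by blast
  with d show ?thesis
    by simp
qed

lemma partials_eqI:
  assumes "(\<phi> has_derivative (\<lambda>h. D \<bullet> h)) (at x)"
  shows "partials \<phi> x = D"
  using frechet_derivative_at[OF assms, symmetric]
  by (simp add: partials_def vec_eq_iff inner_axis)

lemma C1I:
  assumes "\<And>x. (\<phi> has_derivative (\<lambda>h. D x \<bullet> h)) (at x)" "continuous_on UNIV D"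
  shows "C1 \<phi>" "partials \<phi> = D"
proof -
  show *: "partials \<phi> = D"
    by (intro ext partials_eqI assms)
  show "C1 \<phi>"
    unfolding C1_def * using assms by (auto simp: differentiable_def)
qed

lemma C1_continuous: "C1 \<phi> \<Longrightarrow> continuous_on S \<phi>"
  using C1_has_derivative has_derivative_continuous
  by (metis continuous_at_imp_continuous_on)

lemma C1_partials_continuous: "C1 \<phi> \<Longrightarrow> continuous_on S (partials \<phi>)"
  by (auto simp: C1_def intro: continuous_on_subset)

lemma C1_add:
  assumes "C1 f" "C1 g"
  shows "C1 (\<lambda>x. f x + g x)" "partials (\<lambda>x. f x + g x) = (\<lambda>x. partials f x + partials g x)"
  by (rule C1I[where D = "\<lambda>x. partials f x + partials g x"],
      auto simp: inner_add_left intro!: has_derivative_add C1_has_derivative continuous_intros C1_partials_continuous assms)+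

lemma C1_scale:
  assumes "C1 f"
  shows "C1 (\<lambda>x. c * f x)" "partials (\<lambda>x. c * f x) = (\<lambda>x. c *\<^sub>R partials f x)"
  by (rule C1I[where D = "\<lambda>x. c *\<^sub>R partials f x"],
      auto intro!: has_derivative_mult_right C1_has_derivative continuous_intros C1_partials_continuous assms)+

lemma C1_const: "C1 (\<lambda>x. c)" "partials (\<lambda>x. c) = (\<lambda>x. 0)"
  by (rule C1I[where D = "\<lambda>x. 0"], auto)+

lemma C1_sum:
  assumes "\<And>i. i \<in> I \<Longrightarrow> C1 (f i)"
  shows "C1 (\<lambda>x. \<Sum>i\<in>I. f i x) \<and> partials (\<lambda>x. \<Sum>i\<in>I. f i x) = (\<lambda>x. \<Sum>i\<in>I. partials (f i) x)"
  using assms by (induction I rule: infinite_finite_induct) (auto simp: C1_const C1_add)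

lemma C1_lincomb:
  assumes "\<And>i. i < k \<Longrightarrow> C1 (f i)"
  shows "C1 (\<lambda>x. \<Sum>i<k. c i * f i x)"
    "partials (\<lambda>x. \<Sum>i<k. c i * f i x) = (\<lambda>x. \<Sum>i<(k::nat). c i *\<^sub>R partials (f i) x)"
  using C1_sum[of "{..<k}" "\<lambda>i x. c i * f i x"] assms by (auto simp: C1_scale)

lemma C1_mult:
  assumes "C1 f" "C1 g"
  shows "C1 (\<lambda>x. f x * g x)" "partials (\<lambda>x. f x * g x) = (\<lambda>x. f x *\<^sub>R partials g x + g x *\<^sub>R partials f x)"
proof -
  have d: "((\<lambda>x. f x * g x) has_derivative (\<lambda>h. (f x *\<^sub>R partials g x + g x *\<^sub>R partials f x) \<bullet> h)) (at x)" for x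
    by (rule has_derivative_eq_rhs[OF has_derivative_mult[OF C1_has_derivative[OF assms(1)] C1_has_derivative[OF assms(2)]]])
      (simp add: fun_eq_iff inner_add_left)
  have c: "continuous_on UNIV (\<lambda>x. f x *\<^sub>R partials g x + g x *\<^sub>R partials f x)"
    by (intro continuous_intros C1_continuous C1_partials_continuous assms)
  show "C1 (\<lambda>x. f x * g x)" "partials (\<lambda>x. f x * g x) = (\<lambda>x. f x *\<^sub>R partials g x + g x *\<^sub>R partials f x)"
    by (rule C1I[OF d c])+
qed

lemma C1_dilate:
  assumes "C1 f"
  shows "C1 (\<lambda>x. f (c *\<^sub>R x))" "partials (\<lambda>x. f (c *\<^sub>R x)) = (\<lambda>x. c *\<^sub>R partials f (c *\<^sub>R x))"
proof -
  have d: "((\<lambda>x. f (c *\<^sub>R x)) has_derivative (\<lambda>h. (c *\<^sub>R partials f (c *\<^sub>R x)) \<bullet> h)) (at x)" for x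
    using has_derivative_compose[of "\<lambda>x. c *\<^sub>R x" "\<lambda>h. c *\<^sub>R h" x UNIV f, OF _ C1_has_derivative[OF assms]]
    by (simp add: bounded_linear_imp_has_derivative bounded_linear_scaleR_right)
  have c: "continuous_on UNIV (\<lambda>x. c *\<^sub>R partials f (c *\<^sub>R x))"
    by (intro continuous_intros continuous_on_compose2[OF C1_partials_continuous[OF assms, of UNIV]]) auto
  show "C1 (\<lambda>x. f (c *\<^sub>R x))" "partials (\<lambda>x. f (c *\<^sub>R x)) = (\<lambda>x. c *\<^sub>R partials f (c *\<^sub>R x))"
    by (rule C1I[OF d c])+
qed

lemma C1_power_nth1: "C1 (\<lambda>x::real^2. (x $ 1) ^ n)"
proof (rule C1I(1)[where D = "\<lambda>x. (real n * (x $ 1) ^ (n - 1)) *\<^sub>R axis 1 1"])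
  fix x :: "real^2"
  have d: "((\<lambda>x::real^2. x $ 1) has_derivative (\<lambda>x. x $ 1)) (at x)"
    by (rule bounded_linear_imp_has_derivative) (rule bounded_linear_vec_nth)
  show "((\<lambda>x::real^2. (x $ 1) ^ n) has_derivative (\<lambda>h. ((real n * (x $ 1) ^ (n - 1)) *\<^sub>R axis 1 1) \<bullet> h)) (at x)"
    by (rule has_derivative_eq_rhs[OF has_derivative_power[OF d]])
      (auto simp: inner_axis' mult_ac)
next
  show "continuous_on UNIV (\<lambda>x::real^2. (real n * (x $ 1) ^ (n - 1)) *\<^sub>R axis 1 1 :: real^2)"
    by (intro continuous_intros)
qed

section \<open>Square integrability of continuous functions on the disk and the circle\<close>

lemma bounded_on_disk:
  fixes f :: "real^2 \<Rightarrow> real"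
  assumes "continuous_on (cball 0 R) f"
  obtains B where "\<And>x. x \<in> space (disk R) \<Longrightarrow> \<bar>f x\<bar> \<le> B"
proof -
  have "compact (f ` cball 0 R)"
    by (intro compact_continuous_image assms compact_cball)
  then obtain B where "\<And>y. y \<in> f ` cball 0 R \<Longrightarrow> norm y \<le> B"
    using compact_imp_bounded bounded_iff by metis
  then show ?thesis
    by (intro that[of B]) auto
qed

lemma continuous_L2_disk:
  fixes f :: "real^2 \<Rightarrow> real"
  assumes "continuous_on UNIV f"
  shows "L2 (disk R) f"
proof -
  obtain B where "\<And>x. x \<in> space (disk R) \<Longrightarrow> \<bar>f x\<bar> \<le> B"
    using bounded_on_disk[OF continuous_on_subset[OF assms]] by blast
  then show ?thesis
    by (intro finite_measure.L2_bounded[OF finite_measure_disk] continuous_imp_borel_measurable_disk assms)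
qed

lemma C1_L2: "C1 \<phi> \<Longrightarrow> L2 (disk R) \<phi>"
  by (intro continuous_L2_disk C1_continuous)

lemma C1_partials_L2: "C1 \<phi> \<Longrightarrow> L2 (disk R) (\<lambda>x. partials \<phi> x $ i)"
  by (intro continuous_L2_disk continuous_intros C1_partials_continuous)

lemma continuous_circle_L2:
  fixes f :: "real^2 \<Rightarrow> real"
  assumes "continuous_on UNIV f"
  shows "L2 angles (\<lambda>t. f (circle_curve R t))"
proof -
  have c: "continuous_on UNIV (\<lambda>t. f (circle_curve R t))"
    by (intro continuous_on_compose2[OF assms] continuous_intros) auto
  then have m: "(\<lambda>t. f (circle_curve R t)) \<in> borel_measurable angles"
    by (intro borel_measurable_angles borel_measurable_continuous_onI)
  have "compact ((\<lambda>t. f (circle_curve R t)) ` {0..2*pi})"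
    using c by (intro compact_continuous_image) (auto intro: continuous_on_subset)
  then obtain B where "\<And>y. y \<in> (\<lambda>t. f (circle_curve R t)) ` {0..2*pi} \<Longrightarrow> norm y \<le> B"
    using compact_imp_bounded bounded_iff by metis
  then have "\<bar>f (circle_curve R t)\<bar> \<le> B" if "t \<in> space angles" for t
    using that by auto
  then show ?thesis
    by (intro finite_measure.L2_bounded[OF finite_measure_angles] m)
qed

text \<open>The factor \<open>s\<close> is the Jacobian of polar coordinates. Thanks to it the
  passage from \<open>f\<close> to its radial means is bounded from square-integrable functions on
  the disk to those of the angle.\<close>

definition radial_mean :: "real \<Rightarrow> (real^2 \<Rightarrow> real) \<Rightarrow> real \<Rightarrow> real" where
  "radial_mean R f t = (\<integral>s. s * f (circle_curve s t) * indicator {0..R} s \<partial>lborel)"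

lemma measurable_radial_mean [measurable]:
  assumes [measurable]: "f \<in> borel_measurable borel"
  shows "radial_mean R f \<in> borel_measurable borel"
proof -
  show ?thesis
    unfolding radial_mean_def[abs_def] by measurable
qed

text \<open>Cauchy-Schwarz with \<open>s\<close> split as \<open>sqrt s * sqrt s\<close>. The
  constant \<open>R\<^sup>2 / 2\<close> is the integral of \<open>s\<close> over
  \<open>{0..R}\<close>.\<close>

lemma radial_mean_square_le:
  assumes [measurable]: "f \<in> borel_measurable borel" and R: "R > 0"
  shows "ennreal ((radial_mean R f t)\<^sup>2) \<le> ennreal (R\<^sup>2 / 2) * (\<integral>\<^sup>+s\<in>{0..R}. ennreal s * ennreal ((f (circle_curve s t))\<^sup>2) \<partial>lborel)"
proof -
  define h where "h s = s * f (circle_curve s t) * indicator {0..R} s" for s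
  have [measurable]: "h \<in> borel_measurable borel"
    unfolding h_def by measurable
  have "ennreal \<bar>radial_mean R f t\<bar> \<le> (\<integral>\<^sup>+s. ennreal \<bar>h s\<bar> \<partial>lborel)"
  proof (cases "integrable lborel h")
    case True
    then show ?thesis
      using integral_norm_bound_ennreal[OF True] by (simp add: radial_mean_def h_def[abs_def])
  next
    \<comment> \<open>On a ray where \<open>h\<close> is not integrable the Bochner integral is 0 by
      default, so the bound persists.\<close>
    case False
    then show ?thesis
      by (simp add: radial_mean_def not_integrable_integral_eq flip: h_def)
  qed
  also have "\<dots> = (\<integral>\<^sup>+s. ennreal (sqrt s * indicator {0..R} s) * ennreal (sqrt s * \<bar>f (circle_curve s t)\<bar> * indicator {0..R} s) \<partial>lborel)"
    by (intro nn_integral_cong) (auto simp: h_def indicator_def abs_mult simp flip: ennreal_mult mult.assoc)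
  finally have "(ennreal \<bar>radial_mean R f t\<bar>)\<^sup>2 \<le> (\<integral>\<^sup>+s. ennreal (sqrt s * indicator {0..R} s) * ennreal (sqrt s * \<bar>f (circle_curve s t)\<bar> * indicator {0..R} s) \<partial>lborel)\<^sup>2"
    by (rule power_mono) simp
  also have "\<dots> \<le> (\<integral>\<^sup>+s. (ennreal (sqrt s * indicator {0..R} s))\<^sup>2 \<partial>lborel) * (\<integral>\<^sup>+s. (ennreal (sqrt s * \<bar>f (circle_curve s t)\<bar> * indicator {0..R} s))\<^sup>2 \<partial>lborel)"
    by (rule Cauchy_Schwarz_nn_integral) measurable
  also have "(\<integral>\<^sup>+s. (ennreal (sqrt s * indicator {0..R} s))\<^sup>2 \<partial>lborel) = (\<integral>\<^sup>+s. ennreal s * indicator {0..R} s \<partial>lborel)"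
    by (intro nn_integral_cong) (auto simp: indicator_def ennreal_power)
  also have "\<dots> = ennreal (R\<^sup>2 / 2 - 0\<^sup>2 / 2)"
    by (rule nn_integral_FTC_Icc) (use R in \<open>auto intro!: derivative_eq_intros\<close>)
  also have "(\<integral>\<^sup>+s. (ennreal (sqrt s * \<bar>f (circle_curve s t)\<bar> * indicator {0..R} s))\<^sup>2 \<partial>lborel)
     = (\<integral>\<^sup>+s\<in>{0..R}. ennreal s * ennreal ((f (circle_curve s t))\<^sup>2) \<partial>lborel)"
    by (intro nn_integral_cong) (auto simp: indicator_def ennreal_power power_mult_distrib ennreal_mult)
  finally show ?thesis
    by (simp add: ennreal_power)
qed

lemma radial_mean_L2_bound:
  assumes [measurable]: "f \<in> borel_measurable borel" and R: "R > 0"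
  shows "(\<integral>\<^sup>+t. ennreal ((radial_mean R f t)\<^sup>2) \<partial>angles) \<le> ennreal (R\<^sup>2 / 2) * (\<integral>\<^sup>+x. ennreal ((f x)\<^sup>2) \<partial>disk R)"
proof -
  have [measurable]: "(\<lambda>t. \<integral>\<^sup>+s\<in>{0..R}. ennreal s * ennreal ((f (circle_curve s t))\<^sup>2) \<partial>lborel) \<in> borel_measurable borel"
  proof -
      show ?thesis
      by measurable
  qed
  have "(\<integral>\<^sup>+t. ennreal ((radial_mean R f t)\<^sup>2) \<partial>angles)
     \<le> (\<integral>\<^sup>+t. ennreal (R\<^sup>2 / 2) * (\<integral>\<^sup>+s\<in>{0..R}. ennreal s * ennreal ((f (circle_curve s t))\<^sup>2) \<partial>lborel) \<partial>angles)"
    by (intro nn_integral_mono radial_mean_square_le assms)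
  also have "\<dots> = ennreal (R\<^sup>2 / 2) * (\<integral>\<^sup>+t. (\<integral>\<^sup>+s\<in>{0..R}. ennreal s * ennreal ((f (circle_curve s t))\<^sup>2) \<partial>lborel) \<partial>angles)"
    by (intro nn_integral_cmult borel_measurable_angles) simp
  also have "(\<integral>\<^sup>+t. (\<integral>\<^sup>+s\<in>{0..R}. ennreal s * ennreal ((f (circle_curve s t))\<^sup>2) \<partial>lborel) \<partial>angles)
     = (\<integral>\<^sup>+x. ennreal ((f x)\<^sup>2) \<partial>disk R)"
    unfolding nn_integral_disk nn_integral_angles by (rule polar_nn_integral[symmetric]) simp
  finally show ?thesis .
qed

lemma has_vector_derivative_circle_curve:
  "(circle_curve s has_vector_derivative vector [- s * sin t, s * cos t]) (at t)"
  "((\<lambda>s. circle_curve s t) has_vector_derivative vector [cos t, sin t]) (at s)"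
proof -
  have v: "vector [a, b] = a *\<^sub>R axis 1 1 + b *\<^sub>R (axis 2 1 :: real^2)" for a b :: real
    by (simp add: vec_eq_iff forall_2 axis_def)
  show "(circle_curve s has_vector_derivative vector [- s * sin t, s * cos t]) (at t)"
    unfolding circle_curve_def v has_vector_derivative_def
    by (rule derivative_eq_intros refl | simp add: fun_eq_iff vec_eq_iff forall_2 axis_def)+
  show "((\<lambda>s. circle_curve s t) has_vector_derivative vector [cos t, sin t]) (at s)"
    unfolding circle_curve_def
    by (rule derivative_eq_intros refl | simp)+
qed

lemma C1_radial_derivative:
  assumes "C1 \<phi>"
  shows "((\<lambda>s. \<phi> (circle_curve s t)) has_real_derivative partials \<phi> (circle_curve s t) \<bullet> vector [cos t, sin t]) (at s)"
proof -
  have "((\<lambda>s. \<phi> (circle_curve s t)) has_derivative (\<lambda>h. partials \<phi> (circle_curve s t) \<bullet> (h *\<^sub>R vector [cos t, sin t]))) (at s)"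
    using has_derivative_compose[of "\<lambda>s. circle_curve s t" "\<lambda>h. h *\<^sub>R vector [cos t, sin t]" s UNIV \<phi>, OF _ C1_has_derivative[OF assms]]
      has_vector_derivative_circle_curve(2)[of t s]
    by (simp add: has_vector_derivative_def)
  then show ?thesis
    by (simp add: has_field_derivative_def mult.commute[of _ "partials \<phi> (circle_curve s t) \<bullet> vector [cos t, sin t]"])
qed

text \<open>Fundamental theorem of calculus for \<open>s\<^sup>2 * \<phi>\<close>. The factor
  \<open>s\<^sup>2\<close> removes the boundary term at the centre, so that only the value on the
  circle survives.\<close>

lemma C1_radial_mean:
  assumes "C1 \<phi>" "R > 0"
  shows "integrable lborel (\<lambda>s. s * (2 * \<phi> (circle_curve s t) + circle_curve s t \<bullet> partials \<phi> (circle_curve s t)) * indicator {0..R} s)"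
    and "radial_mean R (\<lambda>x. 2 * \<phi> x + x \<bullet> partials \<phi> x) t = R\<^sup>2 * \<phi> (circle_curve R t)"
proof -
  define f where "f s = s * (2 * \<phi> (circle_curve s t) + circle_curve s t \<bullet> partials \<phi> (circle_curve s t))" for s
  have c: "continuous_on UNIV f"
    unfolding f_def
    by (intro continuous_intros continuous_on_compose2[OF C1_continuous[OF assms(1), of UNIV]]
        continuous_on_compose2[OF C1_partials_continuous[OF assms(1), of UNIV]]) auto
  have "has_bochner_integral lborel (\<lambda>s. f s * indicator {0..R} s) (R\<^sup>2 * \<phi> (circle_curve R t) - 0\<^sup>2 * \<phi> (circle_curve 0 t))"
  proof (rule has_bochner_integral_FTC_Icc_real)
    fix s
    have "circle_curve s t = s *\<^sub>R vector [cos t, sin t]"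
      by (simp add: circle_curve_def)
    then show "((\<lambda>s. s\<^sup>2 * \<phi> (circle_curve s t)) has_real_derivative f s) (at s)"
      unfolding f_def
      by (auto intro!: derivative_eq_intros C1_radial_derivative assms simp: algebra_simps power2_eq_square inner_commute)
  qed (use assms c in \<open>auto simp: continuous_on_eq_continuous_at\<close>)
  then show "integrable lborel (\<lambda>s. s * (2 * \<phi> (circle_curve s t) + circle_curve s t \<bullet> partials \<phi> (circle_curve s t)) * indicator {0..R} s)"
    "radial_mean R (\<lambda>x. 2 * \<phi> x + x \<bullet> partials \<phi> x) t = R\<^sup>2 * \<phi> (circle_curve R t)"
    by (auto simp: has_bochner_integral_iff f_def radial_mean_def)
qed

section \<open>Traces\<close>

text \<open>Values along single rays are meaningful for Borel functions only through the polar
  formula, so a function of the completed measure is first corrected on a null set.\<close>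

lemma borel_representative:
  fixes f :: "real^2 \<Rightarrow> real"
  assumes "f \<in> borel_measurable (disk R)"
  obtains f' where "f' \<in> borel_measurable borel" "AE x in disk R. f x = f' x"
proof -
  have "(\<lambda>x. indicator (ball 0 R) x *\<^sub>R f x) \<in> borel_measurable lebesgue"
    using assms by (subst (asm) borel_measurable_restrict_space_iff) auto
  then obtain f' where f': "f' \<in> borel_measurable lborel" "AE x in lborel. indicator (ball 0 R) x *\<^sub>R f x = f' x"
    using completion_ex_borel_measurable_real by blast
  have "AE x in lebesgue. indicator (ball 0 R) x *\<^sub>R f x = f' x"
    by (rule AE_completion[OF f'(2)])
  then have "AE x in lebesgue. x \<in> ball 0 R \<longrightarrow> f x = f' x"
    by eventually_elim auto
  then have "AE x in disk R. f x = f' x"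
    by (subst AE_restrict_space_iff) auto
  with f'(1) show ?thesis
    using that by simp
qed

text \<open>By the polar formula the square integral is finite on almost every ray, and
  \<open>\<bar>a\<bar> \<le> 1 + a\<^sup>2\<close> turns this into integrability on a ray of finite
  length. Only then is the radial mean additive, since nonintegrable functions have integral 0 by
  default.\<close>

lemma radial_integrable_AE:
  assumes [measurable]: "f \<in> borel_measurable borel" and fin: "(\<integral>\<^sup>+x. ennreal ((f x)\<^sup>2) \<partial>disk R) < \<infinity>" and R: "R > 0"
  shows "AE t in angles. integrable lborel (\<lambda>s. s * f (circle_curve s t) * indicator {0..R} s)"
proof -
  define q where "q t = (\<integral>\<^sup>+s\<in>{0..R}. ennreal s * ennreal ((f (circle_curve s t))\<^sup>2) \<partial>lborel)" for t
  have [measurable]: "q \<in> borel_measurable borel"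
    unfolding q_def by measurable
  have "(\<integral>\<^sup>+t. q t \<partial>angles) = (\<integral>\<^sup>+x. ennreal ((f x)\<^sup>2) \<partial>disk R)"
    unfolding nn_integral_disk nn_integral_angles q_def by (rule polar_nn_integral[symmetric]) simp
  then have "AE t in angles. q t \<noteq> \<infinity>"
    using fin by (intro nn_integral_PInf_AE borel_measurable_angles) auto
  then show ?thesis
  proof eventually_elim
    case (elim t)
    have "(\<integral>\<^sup>+s. ennreal (norm (s * f (circle_curve s t) * indicator {0..R} s)) \<partial>lborel)
       \<le> (\<integral>\<^sup>+s. ennreal s * indicator {0..R} s + ennreal s * ennreal ((f (circle_curve s t))\<^sup>2) * indicator {0..R} s \<partial>lborel)"
    proof (intro nn_integral_mono)
      fix s :: real
      have "\<bar>a\<bar> \<le> 1 + a\<^sup>2" for a :: real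
      proof (cases "\<bar>a\<bar> \<le> 1")
        case False
        then have "\<bar>a\<bar> * 1 \<le> \<bar>a\<bar> * \<bar>a\<bar>"
          by (intro mult_left_mono) auto
        then show ?thesis
          by (simp add: power2_eq_square)
      qed (use zero_le_power2[of a] in linarith)
      then have "s * \<bar>f (circle_curve s t)\<bar> \<le> s * (1 + (f (circle_curve s t))\<^sup>2)" if "s \<ge> 0"
        using that by (intro mult_left_mono)
      then show "ennreal (norm (s * f (circle_curve s t) * indicator {0..R} s))
         \<le> ennreal s * indicator {0..R} s + ennreal s * ennreal ((f (circle_curve s t))\<^sup>2) * indicator {0..R} s"
        by (auto simp: indicator_def abs_mult algebra_simps simp flip: ennreal_mult ennreal_plus intro!: ennreal_leI)
    qed
    also have "\<dots> = (\<integral>\<^sup>+s. ennreal s * indicator {0..R} s \<partial>lborel) + q t"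
      unfolding q_def by (intro nn_integral_add) auto
    also have "(\<integral>\<^sup>+s. ennreal s * indicator {0..R} s \<partial>lborel) = ennreal (R\<^sup>2 / 2 - 0\<^sup>2 / 2)"
      by (rule nn_integral_FTC_Icc) (use R in \<open>auto intro!: derivative_eq_intros\<close>)
    also have "\<dots> + q t < \<infinity>"
      using elim by (simp add: top.not_eq_extremum)
    finally show ?case
      by (intro integrableI_bounded) auto
  qed
qed

definition V2 :: "'a measure \<Rightarrow> ('a \<Rightarrow> real^2) \<Rightarrow> bool" where
  "V2 M p \<longleftrightarrow> (\<forall>i. L2 M (\<lambda>x. p x $ i))"

lemma V2_nth: "V2 M p \<Longrightarrow> L2 M (\<lambda>x. p x $ i)"
  by (simp add: V2_def)

lemma V2_diff: "V2 M p \<Longrightarrow> V2 M q \<Longrightarrow> V2 M (\<lambda>x. p x - q x)"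
  by (simp add: V2_def L2_diff)

lemma V2_lincomb: "(\<And>i. i < k \<Longrightarrow> V2 M (p i)) \<Longrightarrow> V2 M (\<lambda>x. \<Sum>i<(k::nat). c i *\<^sub>R p i x)"
  unfolding V2_def sum_component vector_scaleR_component real_scaleR_def
  by (intro allI L2_sum L2_scale) auto

lemma V2_integrable: "V2 M p \<Longrightarrow> integrable M (\<lambda>x. p x \<bullet> p x)"
  unfolding inner_real2 using L2_integrable[OF V2_nth, of M p] by (simp flip: power2_eq_square)

lemma V2_integral: "V2 M p \<Longrightarrow> (\<integral>x. p x \<bullet> p x \<partial>M) = (\<integral>x. (p x $ 1)\<^sup>2 \<partial>M) + (\<integral>x. (p x $ 2)\<^sup>2 \<partial>M)"
  unfolding inner_real2 using L2_integrable[OF V2_nth, of M p] by (simp flip: power2_eq_square)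

lemma C1_partials_V2: "C1 \<phi> \<Longrightarrow> V2 (disk R) (partials \<phi>)"
  by (simp add: V2_def C1_partials_L2)

text \<open>The squared \<open>H1\<close> distance of \<open>\<phi>\<close> from the pair of
  \<open>u\<close> and a weak differential \<open>p\<close>. It is taken in flat coordinates, so
  that one density theorem and one trace theorem serve all three geometries.\<close>

definition dist_H1 :: "real \<Rightarrow> (real^2 \<Rightarrow> real) \<Rightarrow> (real^2 \<Rightarrow> real^2) \<Rightarrow> (real^2 \<Rightarrow> real) \<Rightarrow> real" where
  "dist_H1 R u p \<phi> = (\<integral>x. (\<phi> x - u x)\<^sup>2 \<partial>disk R) + (\<integral>x. (partials \<phi> x - p x) \<bullet> (partials \<phi> x - p x) \<partial>disk R)"

lemma L2_coordinate_inner: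
  assumes "V2 (disk R) p"
  shows "L2 (disk R) (\<lambda>x. x \<bullet> p x)"
proof -
  have "L2 (disk R) (\<lambda>x. x $ i * p x $ i)" for i :: 2
  proof (rule L2_mult_bounded[OF V2_nth[OF assms]])
    show "(\<lambda>x. x $ i) \<in> borel_measurable (disk R)"
      by (intro continuous_imp_borel_measurable_disk continuous_intros)
    show "\<bar>x $ i\<bar> \<le> R" if "x \<in> space (disk R)" for x
      using that component_le_norm_cart[of x i] by auto
  qed
  then show ?thesis
    unfolding inner_real2 by (intro L2_add)
qed

text \<open>
  The trace of \<open>u\<close> at \<open>R e\<close> is \<open>R\<^sup>-\<^sup>2\<close> times the integral of \<open>(2 u + x \<bullet> \<nabla>u) s\<close> along the radius: for
  a differentiable \<open>u\<close> the integrand is the derivative of \<open>s\<^sup>2 u(s e)\<close>, and the formula is continuous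
  in \<open>H\<^sup>1\<close>.
\<close>

lemma trace_exists:
  assumes R: "R > 0" and u: "L2 (disk R) u" and p: "V2 (disk R) p"
  obtains w where "L2 angles w"
    "\<And>\<phi>. C1 \<phi> \<Longrightarrow> (\<integral>t. (\<phi> (circle_curve R t) - w t)\<^sup>2 \<partial>angles) \<le> (4 / R\<^sup>2 + 1) * dist_H1 R u p \<phi>"
proof -
  have L0: "L2 (disk R) (\<lambda>x. 2 * u x + x \<bullet> p x)"
    by (intro L2_add L2_scale L2_coordinate_inner u p)
  then obtain f where f [measurable]: "f \<in> borel_measurable borel" and feq: "AE x in disk R. 2 * u x + x \<bullet> p x = f x"
    using borel_representative L2_measurable by blast
  have Lf: "L2 (disk R) f"
    using feq by (intro L2_cong_AE[OF L0] borel_measurable_disk f) auto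
  have fin: "(\<integral>\<^sup>+x. ennreal ((f x)\<^sup>2) \<partial>disk R) < \<infinity>"
    using L2_integrable[OF Lf] by (simp add: integrable_iff_bounded)
  define w where "w t = radial_mean R f t / R\<^sup>2" for t
  have w [measurable]: "w \<in> borel_measurable borel"
    unfolding w_def by simp
  have bound: "(\<integral>\<^sup>+t. ennreal ((\<phi> (circle_curve R t) - w t)\<^sup>2) \<partial>angles) \<le> ennreal ((4 / R\<^sup>2 + 1) * dist_H1 R u p \<phi>)"
    if \<phi>: "C1 \<phi>" for \<phi>
  proof -
    define g where "g x = 2 * \<phi> x + x \<bullet> partials \<phi> x" for x
    have g [measurable]: "g \<in> borel_measurable borel"
      unfolding g_def
      by (intro borel_measurable_continuous_onI continuous_intros C1_continuous C1_partials_continuous \<phi>)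
    have "AE t in angles. ennreal ((\<phi> (circle_curve R t) - w t)\<^sup>2) = ennreal (1 / R ^ 4) * ennreal ((radial_mean R (\<lambda>x. g x - f x) t)\<^sup>2)"
      using radial_integrable_AE[OF f fin R]
    proof eventually_elim
      case (elim t)
      have "radial_mean R (\<lambda>x. g x - f x) t = radial_mean R g t - radial_mean R f t"
        unfolding radial_mean_def
        by (subst Bochner_Integration.integral_diff[symmetric])
          (use elim C1_radial_mean(1)[OF \<phi> R] in \<open>auto simp: g_def left_diff_distrib right_diff_distrib\<close>)
      also have "\<dots> = R\<^sup>2 * (\<phi> (circle_curve R t) - w t)"
        using R C1_radial_mean(2)[OF \<phi> R] by (simp add: g_def[abs_def] w_def right_diff_distrib)
      finally have "(\<phi> (circle_curve R t) - w t)\<^sup>2 = (1 / R ^ 4) * (radial_mean R (\<lambda>x. g x - f x) t)\<^sup>2"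
        using R by (simp add: power_mult_distrib)
      then show ?case
        by (simp add: ennreal_mult'[symmetric])
    qed
    then have "(\<integral>\<^sup>+t. ennreal ((\<phi> (circle_curve R t) - w t)\<^sup>2) \<partial>angles)
        = (\<integral>\<^sup>+t. ennreal (1 / R ^ 4) * ennreal ((radial_mean R (\<lambda>x. g x - f x) t)\<^sup>2) \<partial>angles)"
      by (rule nn_integral_cong_AE)
    also have "\<dots> = ennreal (1 / R ^ 4) * (\<integral>\<^sup>+t. ennreal ((radial_mean R (\<lambda>x. g x - f x) t)\<^sup>2) \<partial>angles)"
      by (intro nn_integral_cmult borel_measurable_angles) simp
    also have "\<dots> \<le> ennreal (1 / R ^ 4) * (ennreal (R\<^sup>2 / 2) * (\<integral>\<^sup>+x. ennreal ((g x - f x)\<^sup>2) \<partial>disk R))"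
      by (intro mult_left_mono radial_mean_L2_bound R) auto
    also have "\<dots> = ennreal (1 / (2 * R\<^sup>2)) * (\<integral>\<^sup>+x. ennreal ((g x - f x)\<^sup>2) \<partial>disk R)"
    proof -
      have "1 / R ^ 4 * (R\<^sup>2 / 2) = 1 / (2 * R\<^sup>2)"
        using R by (simp add: power4_eq_xxxx power2_eq_square)
      moreover have "ennreal (1 / R ^ 4) * (ennreal (R\<^sup>2 / 2) * X) = ennreal (1 / R ^ 4 * (R\<^sup>2 / 2)) * X" for X
        using R by (subst ennreal_mult') (auto simp: mult.assoc)
      ultimately show ?thesis
        by (simp only:)
    qed
    \<comment> \<open>Young with \<open>e = 1\<close> and Cauchy-Schwarz with
      \<open>norm x \<le> R\<close> give the coefficients 8 and \<open>2 * R\<^sup>2\<close>. The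
      prefactor \<open>1 / (2 * R\<^sup>2)\<close> turns them into \<open>4 / R\<^sup>2\<close> and
      1, whose sum is the constant of the statement.\<close>
    also have "(\<integral>\<^sup>+x. ennreal ((g x - f x)\<^sup>2) \<partial>disk R)
        \<le> (\<integral>\<^sup>+x. ennreal (8 * (\<phi> x - u x)\<^sup>2 + 2 * R\<^sup>2 * ((partials \<phi> x - p x) \<bullet> (partials \<phi> x - p x))) \<partial>disk R)"
    proof (rule nn_integral_mono_AE)
      show "AE x in disk R. ennreal ((g x - f x)\<^sup>2) \<le> ennreal (8 * (\<phi> x - u x)\<^sup>2 + 2 * R\<^sup>2 * ((partials \<phi> x - p x) \<bullet> (partials \<phi> x - p x)))"
        using feq AE_space
      proof eventually_elim
        case (elim x)
        define q where "q = partials \<phi> x - p x"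
        have "g x - f x = 2 * (\<phi> x - u x) + x \<bullet> q"
          using elim by (simp add: g_def q_def inner_diff_right)
        then have "(g x - f x)\<^sup>2 \<le> 2 * (2 * (\<phi> x - u x))\<^sup>2 + 2 * (x \<bullet> q)\<^sup>2"
          using square_sum_le_young[of 1 "2 * (\<phi> x - u x)" "x \<bullet> q"] by simp
        also have "(x \<bullet> q)\<^sup>2 \<le> (x \<bullet> x) * (q \<bullet> q)"
          by (rule Cauchy_Schwarz_ineq)
        also have "\<dots> \<le> R\<^sup>2 * (q \<bullet> q)"
          using elim by (intro mult_right_mono) (auto simp: dot_square_norm power_mono)
        also have "2 * (2 * (\<phi> x - u x))\<^sup>2 = 8 * (\<phi> x - u x)\<^sup>2"
          by (simp only: power_mult_distrib) simp
        finally show ?case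
          by (intro ennreal_leI) (simp add: q_def mult.assoc)
      qed
    qed
    also have "\<dots> = ennreal (\<integral>x. 8 * (\<phi> x - u x)\<^sup>2 + 2 * R\<^sup>2 * ((partials \<phi> x - p x) \<bullet> (partials \<phi> x - p x)) \<partial>disk R)"
      by (intro nn_integral_eq_integral Bochner_Integration.integrable_add integrable_mult_right L2_integrable V2_integrable L2_diff V2_diff
          C1_L2 C1_partials_V2 u p \<phi>) auto
    also have "(\<integral>x. 8 * (\<phi> x - u x)\<^sup>2 + 2 * R\<^sup>2 * ((partials \<phi> x - p x) \<bullet> (partials \<phi> x - p x)) \<partial>disk R)
        = 8 * (\<integral>x. (\<phi> x - u x)\<^sup>2 \<partial>disk R) + 2 * R\<^sup>2 * (\<integral>x. (partials \<phi> x - p x) \<bullet> (partials \<phi> x - p x) \<partial>disk R)"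
      using L2_integrable[OF L2_diff[OF C1_L2[OF \<phi>] u]] V2_integrable[OF V2_diff[OF C1_partials_V2[OF \<phi>] p]]
      by simp
    also have "ennreal (1 / (2 * R\<^sup>2)) * ennreal \<dots> = ennreal (1 / (2 * R\<^sup>2) * (8 * (\<integral>x. (\<phi> x - u x)\<^sup>2 \<partial>disk R) + 2 * R\<^sup>2 * (\<integral>x. (partials \<phi> x - p x) \<bullet> (partials \<phi> x - p x) \<partial>disk R)))"
      by (subst ennreal_mult') (auto intro!: add_nonneg_nonneg)
    also have "\<dots> \<le> ennreal ((4 / R\<^sup>2 + 1) * dist_H1 R u p \<phi>)"
    proof (rule ennreal_leI)
      have "0 \<le> (\<integral>x. (\<phi> x - u x)\<^sup>2 \<partial>disk R)" "0 \<le> 4 / R\<^sup>2 * (\<integral>x. (partials \<phi> x - p x) \<bullet> (partials \<phi> x - p x) \<partial>disk R)"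
        by (auto intro!: mult_nonneg_nonneg)
      then show "1 / (2 * R\<^sup>2) * (8 * (\<integral>x. (\<phi> x - u x)\<^sup>2 \<partial>disk R) + 2 * R\<^sup>2 * (\<integral>x. (partials \<phi> x - p x) \<bullet> (partials \<phi> x - p x) \<partial>disk R))
        \<le> (4 / R\<^sup>2 + 1) * dist_H1 R u p \<phi>"
        using R by (simp add: dist_H1_def algebra_simps)
    qed
    finally show ?thesis by (simp add: mult_left_mono)
  qed
  have wL2: "L2 angles w"
    unfolding L2_def
  proof
    show wm: "w \<in> borel_measurable angles"
      by (rule borel_measurable_angles) simp
    \<comment> \<open>The bound for the zero function is the square integrability of
      \<open>w\<close> itself.\<close>
    have "(\<integral>\<^sup>+t. ennreal ((w t)\<^sup>2) \<partial>angles) \<le> ennreal ((4 / R\<^sup>2 + 1) * dist_H1 R u p (\<lambda>x. 0))"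
      using bound[of "\<lambda>x. 0"] by (simp add: C1_const)
    also have "\<dots> < \<infinity>"
      by simp
    finally show "integrable angles (\<lambda>t. (w t)\<^sup>2)"
      using wm by (intro integrableI_bounded) auto
  qed
  moreover have "(\<integral>t. (\<phi> (circle_curve R t) - w t)\<^sup>2 \<partial>angles) \<le> (4 / R\<^sup>2 + 1) * dist_H1 R u p \<phi>" if \<phi>: "C1 \<phi>" for \<phi>
  proof -
    have "L2 angles (\<lambda>t. \<phi> (circle_curve R t) - w t)"
      by (intro L2_diff continuous_circle_L2 C1_continuous \<phi> wL2)
    then have "ennreal (\<integral>t. (\<phi> (circle_curve R t) - w t)\<^sup>2 \<partial>angles) \<le> ennreal ((4 / R\<^sup>2 + 1) * dist_H1 R u p \<phi>)"
      using bound[OF \<phi>] by (subst nn_integral_eq_integral[symmetric]) (auto simp: L2_def)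
    moreover have "0 \<le> (4 / R\<^sup>2 + 1) * dist_H1 R u p \<phi>"
      by (auto simp: dist_H1_def intro!: mult_nonneg_nonneg add_nonneg_nonneg)
    ultimately show ?thesis
      by (simp add: ennreal_le_iff)
  qed
  ultimately show ?thesis
    using that by blast
qed

section \<open>Mollification\<close>

text \<open>Tests in \<open>C1_test\<close> are only required to be \<open>C1\<close>. The squared
  positive part of a quadratic has this regularity, vanishes outside the unit disk, and has a Taylor
  error that can be estimated by hand.\<close>

definition bump :: "real^2 \<Rightarrow> real" where
  "bump y = (max 0 (1 - y \<bullet> y))\<^sup>2"

definition dbump :: "real^2 \<Rightarrow> real^2" where
  "dbump y = (- 4 * max 0 (1 - y \<bullet> y)) *\<^sub>R y"

definition bump_mass :: real where
  "bump_mass = (\<integral>y. bump y \<partial>lborel)"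

text \<open>The derivative \<open>2 * max 0 s\<close> of the squared positive part is Lipschitz with
  constant 2, which bounds the remainder by \<open>t\<^sup>2\<close>.\<close>

lemma pos_part_square_taylor: "\<bar>(max 0 (s + t))\<^sup>2 - (max 0 s)\<^sup>2 - 2 * max 0 s * t\<bar> \<le> (t::real)\<^sup>2"
proof -
  consider "s \<ge> 0" "s + t \<ge> 0" | "s \<ge> 0" "s + t < 0" | "s < 0" "s + t \<ge> 0" | "s < 0" "s + t < 0"
    by linarith
  then show ?thesis
  proof cases
    case 1
    then show ?thesis
      by (simp add: max_def power2_eq_square algebra_simps)
  next
    case 2
    have "0 \<le> s * (- 2 * t - s)"
      using 2 by (intro mult_nonneg_nonneg) auto
    moreover have "0 \<le> (s + t)\<^sup>2"
      by simp
    ultimately show ?thesis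
      using 2 by (simp add: max_def power2_eq_square algebra_simps)
  next
    case 3
    then have "(s + t)\<^sup>2 \<le> t\<^sup>2"
      by (intro power_mono) auto
    then show ?thesis
      using 3 by (simp add: max_def)
  next
    case 4
    then show ?thesis
      by (simp add: max_def)
  qed
qed

text \<open>Chain rule with an explicit remainder, uniform for bounded \<open>y\<close>. Integrating
  this remainder replaces a theorem on differentiation under the integral sign in
  \<open>smooth_taylor\<close>.\<close>

lemma bump_taylor: "\<bar>bump (y + k) - bump y - dbump y \<bullet> k\<bar> \<le> ((2 * norm y + norm k)\<^sup>2 + 2) * (norm k)\<^sup>2"
proof -
  define s where "s = 1 - y \<bullet> y"
  define t where "t = - 2 * (y \<bullet> k) - k \<bullet> k"
  have b: "bump (y + k) = (max 0 (s + t))\<^sup>2"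
    by (simp add: bump_def s_def t_def inner_add_left inner_add_right inner_commute algebra_simps)
  have "bump (y + k) - bump y - dbump y \<bullet> k = ((max 0 (s + t))\<^sup>2 - (max 0 s)\<^sup>2 - 2 * max 0 s * t) - 2 * max 0 s * (k \<bullet> k)"
    unfolding b by (simp add: bump_def dbump_def s_def[symmetric] t_def algebra_simps)
  also have "\<bar>\<dots>\<bar> \<le> \<bar>(max 0 (s + t))\<^sup>2 - (max 0 s)\<^sup>2 - 2 * max 0 s * t\<bar> + \<bar>2 * max 0 s * (k \<bullet> k)\<bar>"
    by (rule abs_triangle_ineq4)
  also have "\<dots> \<le> t\<^sup>2 + 2 * (norm k)\<^sup>2"
  proof (rule add_mono[OF pos_part_square_taylor])
    have "max 0 s \<le> 1"
      by (simp add: s_def)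
    then have "max 0 s * (k \<bullet> k) \<le> 1 * (k \<bullet> k)"
      by (intro mult_right_mono) auto
    then show "\<bar>2 * max 0 s * (k \<bullet> k)\<bar> \<le> 2 * (norm k)\<^sup>2"
      by (simp add: abs_mult power2_norm_eq_inner)
  qed
  also have "t\<^sup>2 \<le> ((2 * norm y + norm k) * norm k)\<^sup>2"
  proof -
    have "\<bar>t\<bar> \<le> 2 * \<bar>y \<bullet> k\<bar> + k \<bullet> k"
      unfolding t_def by (smt (verit) inner_ge_zero)
    also have "\<dots> \<le> 2 * (norm y * norm k) + norm k * norm k"
      using Cauchy_Schwarz_ineq2[of y k] by (simp add: dot_square_norm power2_eq_square)
    finally have "\<bar>t\<bar> \<le> (2 * norm y + norm k) * norm k"
      by (simp add: algebra_simps)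
    then show ?thesis
      using power_mono[of "\<bar>t\<bar>" _ 2] by simp
  qed
  finally show ?thesis
    unfolding power_mult_distrib by (simp only: distrib_right)
qed

lemma quadratic_error_has_derivative:
  fixes f :: "real^2 \<Rightarrow> real"
  assumes "\<And>h. norm h \<le> 1 \<Longrightarrow> \<bar>f (x + h) - f x - D \<bullet> h\<bar> \<le> C * (norm h)\<^sup>2"
  shows "(f has_derivative (\<lambda>h. D \<bullet> h)) (at x)"
proof (rule has_derivativeI_sandwich[where e = 1 and H = "\<lambda>y. C * norm (y - x)"])
  show "bounded_linear (\<lambda>h. D \<bullet> h)"
    by (rule bounded_linear_inner_right)
  show "norm (f y - f x - D \<bullet> (y - x)) / norm (y - x) \<le> C * norm (y - x)" if "y \<noteq> x" "dist y x < 1" for y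
    using assms[of "y - x"] that by (simp add: dist_norm divide_le_eq power2_eq_square mult.assoc)
  have "((\<lambda>y. C * norm (y - x)) \<longlongrightarrow> C * norm (x - x)) (at x)"
    by (intro tendsto_intros)
  then show "((\<lambda>y. C * norm (y - x)) \<longlongrightarrow> 0) (at x)"
    by simp
qed simp

lemma continuous_bump: "continuous_on UNIV bump" "continuous_on UNIV dbump"
  unfolding bump_def[abs_def] dbump_def[abs_def] by (intro continuous_intros)+

lemma C1_bump: "C1 bump" "partials bump = dbump"
proof -
  have "(bump has_derivative (\<lambda>h. dbump y \<bullet> h)) (at y)" for y
  proof (rule quadratic_error_has_derivative)
    fix h :: "real^2" assume h: "norm h \<le> 1"
    have "((2 * norm y + norm h)\<^sup>2 + 2) * (norm h)\<^sup>2 \<le> ((2 * norm y + 1)\<^sup>2 + 2) * (norm h)\<^sup>2"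
      using h by (intro mult_right_mono add_mono power_mono) auto
    then show "\<bar>bump (y + h) - bump y - dbump y \<bullet> h\<bar> \<le> ((2 * norm y + 1)\<^sup>2 + 2) * (norm h)\<^sup>2"
      using bump_taylor[of y h] by linarith
  qed
  then show "C1 bump" "partials bump = dbump"
    by (auto intro: C1I continuous_bump)
qed

lemma bump_bounds: "0 \<le> bump y" "bump y \<le> 1" "norm (dbump y) \<le> 4"
proof -
  show "0 \<le> bump y"
    by (simp add: bump_def)
  have m: "0 \<le> max 0 (1 - y \<bullet> y)" "max 0 (1 - y \<bullet> y) \<le> 1"
    by auto
  then show "bump y \<le> 1"
    unfolding bump_def by (rule power_le_one)
  show "norm (dbump y) \<le> 4"
  proof (cases "y \<bullet> y \<le> 1")
    case True
    then have "norm y \<le> 1"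
      by (simp add: norm_eq_sqrt_inner)
    then have "max 0 (1 - y \<bullet> y) * norm y \<le> 1 * 1"
      using m by (intro mult_mono) auto
    then show ?thesis
      using m by (simp add: dbump_def)
  qed (simp add: dbump_def)
qed

lemma bump_eq_0: "norm y \<ge> 1 \<Longrightarrow> bump y = 0"
  by (simp add: bump_def norm_eq_sqrt_inner max_def)

lemma bump_measurable [measurable]: "bump \<in> borel_measurable borel" "dbump \<in> borel_measurable borel"
  using continuous_bump by (auto intro: borel_measurable_continuous_onI)

lemma integrable_bump: "integrable lborel bump"
proof (rule Bochner_Integration.integrable_bound)
  show "integrable lborel (\<lambda>x :: real^2. indicator (cball 0 1) x :: real)"
    using emeasure_bounded_finite[OF bounded_cball, of "0::real^2" 1] by (intro integrable_real_indicator) auto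
  show "AE x in lborel. norm (bump x) \<le> norm (indicator (cball 0 1) x :: real)"
    using bump_bounds by (auto simp: indicator_def bump_eq_0)
qed simp

lemma bump_mass_pos: "bump_mass > 0"
proof -
  have "0 \<le> bump_mass"
    unfolding bump_mass_def by (intro Bochner_Integration.integral_nonneg) (simp add: bump_bounds)
  moreover have "bump_mass \<noteq> 0"
  proof
    assume "bump_mass = 0"
    then have "AE x in lborel. bump x = 0"
      using integral_nonneg_eq_0_iff_AE[OF integrable_bump] by (simp add: bump_bounds bump_mass_def)
    then have "AE x in lborel. (x :: real^2) \<notin> ball 0 1"
      by eventually_elim (auto simp: bump_def norm_eq_sqrt_inner)
    then have "emeasure lborel (ball 0 1 :: (real^2) set) = 0"
      by (subst (asm) AE_iff_measurable[of "ball 0 1"]) auto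
    then have "measure lborel (ball 0 1 :: (real^2) set) = 0"
      by (simp add: measure_def)
    then show False
      using content_ball_pos[of 1 "0::real^2"] by simp
  qed
  ultimately show ?thesis
    by simp
qed

lemma nn_integral_bump: "(\<integral>\<^sup>+y. ennreal (bump y) \<partial>lborel) = ennreal bump_mass"
  unfolding bump_mass_def by (intro nn_integral_eq_integral integrable_bump) (simp add: bump_bounds)

lemma nn_integral_affine2:
  fixes c :: real and f :: "real^2 \<Rightarrow> ennreal"
  assumes [measurable]: "f \<in> borel_measurable borel" and c: "c \<noteq> 0"
  shows "(\<integral>\<^sup>+x. f x \<partial>lborel) = ennreal (c\<^sup>2) * (\<integral>\<^sup>+x. f (t + c *\<^sub>R x) \<partial>lborel)"
  by (subst lborel_affine[OF c, of t])
     (simp add: nn_integral_density nn_integral_distr nn_integral_cmult)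

text \<open>The bump is centred at the contracted point \<open>\<tau> *\<^sub>R x\<close> instead of
  \<open>x\<close>. If \<open>\<tau> * R + \<rho> < R\<close>, its support stays inside the disk for
  every \<open>x\<close> of the disk, so that functions known only there can be mollified right up
  to the boundary.\<close>

definition kernel :: "real \<Rightarrow> real \<Rightarrow> real^2 \<Rightarrow> real^2 \<Rightarrow> real" where
  "kernel \<tau> \<rho> x z = bump ((1 / \<rho>) *\<^sub>R (z - \<tau> *\<^sub>R x))"

definition smooth :: "real \<Rightarrow> real \<Rightarrow> real \<Rightarrow> (real^2 \<Rightarrow> real) \<Rightarrow> real^2 \<Rightarrow> real" where
  "smooth R \<tau> \<rho> f x = (1 / (\<rho>\<^sup>2 * bump_mass)) * (\<integral>z. kernel \<tau> \<rho> x z * f z \<partial>disk R)"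

lemma kernel_measurable [measurable]:
  "(\<lambda>p. kernel \<tau> \<rho> (fst p) (snd p)) \<in> borel_measurable (borel \<Otimes>\<^sub>M borel)"
  "kernel \<tau> \<rho> x \<in> borel_measurable borel"
  "(\<lambda>x. kernel \<tau> \<rho> x z) \<in> borel_measurable borel"
  unfolding kernel_def by measurable

lemma kernel_bounds: "0 \<le> kernel \<tau> \<rho> x z" "kernel \<tau> \<rho> x z \<le> 1"
  by (simp_all add: kernel_def bump_bounds)

lemma kernel_eq_0: "\<rho> > 0 \<Longrightarrow> norm (z - \<tau> *\<^sub>R x) \<ge> \<rho> \<Longrightarrow> kernel \<tau> \<rho> x z = 0"
  by (simp add: kernel_def bump_eq_0)

lemma nn_integral_kernel_left:
  assumes "\<rho> > 0"
  shows "(\<integral>\<^sup>+z. ennreal (kernel \<tau> \<rho> x z) \<partial>lborel) = ennreal (\<rho>\<^sup>2 * bump_mass)"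
proof -
  have "ennreal bump_mass = ennreal ((1 / \<rho>)\<^sup>2) * (\<integral>\<^sup>+z. ennreal (kernel \<tau> \<rho> x z) \<partial>lborel)"
    using nn_integral_affine2[of "\<lambda>y. ennreal (bump y)" "1 / \<rho>" "- (\<tau> / \<rho>) *\<^sub>R x"] assms
    by (simp add: nn_integral_bump kernel_def scaleR_diff_right)
  then have "ennreal (\<rho>\<^sup>2) * ennreal bump_mass = ennreal (\<rho>\<^sup>2) * ennreal ((1 / \<rho>)\<^sup>2) * (\<integral>\<^sup>+z. ennreal (kernel \<tau> \<rho> x z) \<partial>lborel)"
    by (simp add: mult.assoc)
  also have "ennreal (\<rho>\<^sup>2) * ennreal ((1 / \<rho>)\<^sup>2) = 1"
    using assms by (simp add: power_divide flip: ennreal_mult)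
  finally show ?thesis
    using bump_mass_pos by (simp add: ennreal_mult)
qed

text \<open>The substitution in \<open>x\<close> scales by \<open>\<tau> / \<rho>\<close> and not by
  \<open>1 / \<rho>\<close> as the one in \<open>z\<close>. The asymmetry is the source of the
  factor \<open>1 / \<tau>\<^sup>2\<close> in \<open>smooth_L2_bound\<close>.\<close>

lemma nn_integral_kernel_right:
  assumes "\<rho> > 0" "\<tau> > 0"
  shows "(\<integral>\<^sup>+x. ennreal (kernel \<tau> \<rho> x z) \<partial>lborel) = ennreal (\<rho>\<^sup>2 * bump_mass / \<tau>\<^sup>2)"
proof -
  have "ennreal bump_mass = ennreal ((- \<tau> / \<rho>)\<^sup>2) * (\<integral>\<^sup>+x. ennreal (kernel \<tau> \<rho> x z) \<partial>lborel)"
    using nn_integral_affine2[of "\<lambda>y. ennreal (bump y)" "- \<tau> / \<rho>" "(1 / \<rho>) *\<^sub>R z"] assms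
    by (simp add: nn_integral_bump kernel_def scaleR_diff_right)
  then have "ennreal ((\<rho> / \<tau>)\<^sup>2) * ennreal bump_mass = ennreal ((\<rho> / \<tau>)\<^sup>2) * ennreal ((- \<tau> / \<rho>)\<^sup>2) * (\<integral>\<^sup>+x. ennreal (kernel \<tau> \<rho> x z) \<partial>lborel)"
    by (simp add: mult.assoc)
  also have "ennreal ((\<rho> / \<tau>)\<^sup>2) * ennreal ((- \<tau> / \<rho>)\<^sup>2) = 1"
    using assms by (simp add: power_divide flip: ennreal_mult)
  finally show ?thesis
    using bump_mass_pos by (simp add: ennreal_mult'[symmetric] power_divide)
qed

lemma nn_integral_disk_le: "(\<integral>\<^sup>+x. f x \<partial>disk R) \<le> (\<integral>\<^sup>+x. f x \<partial>lborel)"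
  unfolding nn_integral_disk by (intro nn_integral_mono) (auto simp: indicator_def)

text \<open>No kernel mass is lost at the boundary, so after normalisation constants are reproduced
  exactly on the whole disk.\<close>

lemma integral_kernel_disk:
  assumes "\<rho> > 0" and sub: "\<tau> \<ge> 0" "\<tau> * R + \<rho> \<le> R" and x: "x \<in> ball 0 R"
  shows "(\<integral>z. kernel \<tau> \<rho> x z \<partial>disk R) = \<rho>\<^sup>2 * bump_mass"
proof -
  have 0: "kernel \<tau> \<rho> x z = 0" if "z \<notin> ball 0 R" for z
  proof (rule kernel_eq_0)
    have "\<tau> * norm x \<le> \<tau> * R"
      using x sub by (intro mult_left_mono) auto
    then have "norm (\<tau> *\<^sub>R x) \<le> R - \<rho>"
      using sub by simp
    then show "\<rho> \<le> norm (z - \<tau> *\<^sub>R x)"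
      using that norm_triangle_ineq2[of z "\<tau> *\<^sub>R x"] by auto
  qed fact
  have "(\<integral>\<^sup>+z. ennreal (kernel \<tau> \<rho> x z) \<partial>disk R) = (\<integral>\<^sup>+z. ennreal (kernel \<tau> \<rho> x z) \<partial>lborel)"
    unfolding nn_integral_disk by (intro nn_integral_cong) (auto simp: indicator_def 0 simp del: mem_ball_0)
  also have "\<dots> = ennreal (\<rho>\<^sup>2 * bump_mass)"
    by (rule nn_integral_kernel_left[OF assms(1)])
  finally show ?thesis
    using bump_mass_pos by (intro integral_eq_nn_integral[THEN trans])
      (auto simp: kernel_bounds intro!: borel_measurable_disk)
qed

lemma L2_kernel_integrable:
  assumes "L2 (disk R) f"
  shows "integrable (disk R) (\<lambda>z. kernel \<tau> \<rho> x z * f z)"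
proof (rule L2_mult_integrable[OF _ assms])
  show "L2 (disk R) (kernel \<tau> \<rho> x)"
    using kernel_bounds by (intro finite_measure.L2_bounded[OF finite_measure_disk, where B = 1] borel_measurable_disk) auto
qed

lemma smooth_add:
  assumes "L2 (disk R) f" "L2 (disk R) g"
  shows "smooth R \<tau> \<rho> (\<lambda>x. f x + g x) x = smooth R \<tau> \<rho> f x + smooth R \<tau> \<rho> g x"
  unfolding smooth_def using L2_kernel_integrable[OF assms(1)] L2_kernel_integrable[OF assms(2)]
  by (simp add: distrib_left)

lemma smooth_square_le:
  assumes f: "L2 (disk R) f" and \<rho>: "\<rho> > 0"
  shows "ennreal ((smooth R \<tau> \<rho> f x)\<^sup>2) \<le> ennreal (1 / (\<rho>\<^sup>2 * bump_mass)) * (\<integral>\<^sup>+z. ennreal (kernel \<tau> \<rho> x z) * ennreal ((f z)\<^sup>2) \<partial>disk R)"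
proof -
  define c where "c = 1 / (\<rho>\<^sup>2 * bump_mass)"
  have c: "c > 0"
    using \<rho> bump_mass_pos by (simp add: c_def)
  have [measurable]: "f \<in> borel_measurable (disk R)" "kernel \<tau> \<rho> x \<in> borel_measurable (disk R)"
    using f by (auto simp: L2_def intro: borel_measurable_disk)
  have "ennreal \<bar>\<integral>z. kernel \<tau> \<rho> x z * f z \<partial>disk R\<bar> \<le> (\<integral>\<^sup>+z. ennreal \<bar>kernel \<tau> \<rho> x z * f z\<bar> \<partial>disk R)"
    using integral_norm_bound_ennreal[OF L2_kernel_integrable[OF f]] by simp
  also have "\<dots> = (\<integral>\<^sup>+z. ennreal (sqrt (kernel \<tau> \<rho> x z)) * ennreal (sqrt (kernel \<tau> \<rho> x z) * \<bar>f z\<bar>) \<partial>disk R)"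
    by (intro nn_integral_cong) (auto simp: abs_mult kernel_bounds simp flip: ennreal_mult mult.assoc)
  finally have "(ennreal \<bar>\<integral>z. kernel \<tau> \<rho> x z * f z \<partial>disk R\<bar>)\<^sup>2
     \<le> (\<integral>\<^sup>+z. ennreal (sqrt (kernel \<tau> \<rho> x z)) * ennreal (sqrt (kernel \<tau> \<rho> x z) * \<bar>f z\<bar>) \<partial>disk R)\<^sup>2"
    by (rule power_mono) simp
  also have "\<dots> \<le> (\<integral>\<^sup>+z. (ennreal (sqrt (kernel \<tau> \<rho> x z)))\<^sup>2 \<partial>disk R) * (\<integral>\<^sup>+z. (ennreal (sqrt (kernel \<tau> \<rho> x z) * \<bar>f z\<bar>))\<^sup>2 \<partial>disk R)"
    by (rule Cauchy_Schwarz_nn_integral) measurable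
  also have "(\<integral>\<^sup>+z. (ennreal (sqrt (kernel \<tau> \<rho> x z)))\<^sup>2 \<partial>disk R) = (\<integral>\<^sup>+z. ennreal (kernel \<tau> \<rho> x z) \<partial>disk R)"
    by (simp add: ennreal_power kernel_bounds)
  also have "(\<integral>\<^sup>+z. (ennreal (sqrt (kernel \<tau> \<rho> x z) * \<bar>f z\<bar>))\<^sup>2 \<partial>disk R) = (\<integral>\<^sup>+z. ennreal (kernel \<tau> \<rho> x z) * ennreal ((f z)\<^sup>2) \<partial>disk R)"
    by (intro nn_integral_cong) (simp add: ennreal_power kernel_bounds power_mult_distrib ennreal_mult)
  also have "(\<integral>\<^sup>+z. ennreal (kernel \<tau> \<rho> x z) \<partial>disk R) \<le> ennreal (1 / c)"
    using nn_integral_disk_le[of R "\<lambda>z. ennreal (kernel \<tau> \<rho> x z)"] by (simp add: nn_integral_kernel_left[OF \<rho>] c_def)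
  finally have *: "(ennreal \<bar>\<integral>z. kernel \<tau> \<rho> x z * f z \<partial>disk R\<bar>)\<^sup>2
     \<le> ennreal (1 / c) * (\<integral>\<^sup>+z. ennreal (kernel \<tau> \<rho> x z) * ennreal ((f z)\<^sup>2) \<partial>disk R)"
    by (simp add: mult_right_mono)
  have "ennreal ((smooth R \<tau> \<rho> f x)\<^sup>2) = ennreal (c\<^sup>2) * (ennreal \<bar>\<integral>z. kernel \<tau> \<rho> x z * f z \<partial>disk R\<bar>)\<^sup>2"
    by (simp add: smooth_def c_def[symmetric] power_mult_distrib ennreal_power ennreal_mult)
  also have "\<dots> \<le> ennreal (c\<^sup>2) * (ennreal (1 / c) * (\<integral>\<^sup>+z. ennreal (kernel \<tau> \<rho> x z) * ennreal ((f z)\<^sup>2) \<partial>disk R))"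
    by (rule mult_left_mono[OF *]) simp
  also have "\<dots> = ennreal (c\<^sup>2 * (1 / c)) * (\<integral>\<^sup>+z. ennreal (kernel \<tau> \<rho> x z) * ennreal ((f z)\<^sup>2) \<partial>disk R)"
    using c by (subst ennreal_mult) (auto simp: mult.assoc)
  also have "c\<^sup>2 * (1 / c) = c"
    using c by (simp add: power2_eq_square)
  finally show ?thesis
    by (simp add: c_def)
qed

lemma smooth_measurable:
  assumes "f \<in> borel_measurable (disk R)"
  shows "smooth R \<tau> \<rho> f \<in> borel_measurable (disk R)"
proof -
  interpret finite_measure "disk R"
    by (rule finite_measure_disk)
  have m: "f \<in> borel_measurable (disk R)"
    by fact
  have [measurable]: "fst \<in> borel_measurable (disk R \<Otimes>\<^sub>M disk R)" "snd \<in> borel_measurable (disk R \<Otimes>\<^sub>M disk R)"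
    by (auto intro!: measurable_compose[OF measurable_fst] measurable_compose[OF measurable_snd] borel_measurable_disk[of "\<lambda>x. x"])
  have [measurable]: "(\<lambda>p. f (snd p)) \<in> borel_measurable (disk R \<Otimes>\<^sub>M disk R)"
    using m by (rule measurable_compose[OF measurable_snd])
  have [measurable]: "(\<lambda>p. kernel \<tau> \<rho> (fst p) (snd p)) \<in> borel_measurable (disk R \<Otimes>\<^sub>M disk R)"
    unfolding kernel_def by measurable
  have "(\<lambda>(x, z). kernel \<tau> \<rho> x z * f z) \<in> borel_measurable (disk R \<Otimes>\<^sub>M disk R)"
    unfolding case_prod_beta by measurable
  then have "(\<lambda>x. \<integral>z. kernel \<tau> \<rho> x z * f z \<partial>disk R) \<in> borel_measurable (disk R)"
    by (rule borel_measurable_lebesgue_integral)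
  then show ?thesis
    unfolding smooth_def[abs_def] by (intro borel_measurable_times) auto
qed

text \<open>Schur's test: Cauchy-Schwarz against the kernel in \<open>z\<close>, then Tonelli and
  the total mass of the kernel in \<open>x\<close>.\<close>

lemma smooth_L2_bound:
  assumes f: "L2 (disk R) f" and \<rho>: "\<rho> > 0" and \<tau>: "\<tau> > 0"
  shows "L2 (disk R) (smooth R \<tau> \<rho> f)" "(\<integral>x. (smooth R \<tau> \<rho> f x)\<^sup>2 \<partial>disk R) \<le> (1 / \<tau>\<^sup>2) * (\<integral>x. (f x)\<^sup>2 \<partial>disk R)"
proof -
  interpret finite_measure "disk R"
    by (rule finite_measure_disk)
  have sf: "sigma_finite_measure (disk R)" ..
  interpret pair_sigma_finite "disk R" "disk R" ..
  define c where "c = 1 / (\<rho>\<^sup>2 * bump_mass)"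
  have c: "c > 0"
    using \<rho> bump_mass_pos by (simp add: c_def)
  have m [measurable]: "f \<in> borel_measurable (disk R)"
    using f by (simp add: L2_def)
  have [measurable]: "fst \<in> borel_measurable (disk R \<Otimes>\<^sub>M disk R)" "snd \<in> borel_measurable (disk R \<Otimes>\<^sub>M disk R)"
    by (auto intro!: measurable_compose[OF measurable_fst] measurable_compose[OF measurable_snd] borel_measurable_disk[of "\<lambda>x. x"])
  have [measurable]: "(\<lambda>p. f (snd p)) \<in> borel_measurable (disk R \<Otimes>\<^sub>M disk R)"
    using m by (rule measurable_compose[OF measurable_snd])
  have [measurable]: "(\<lambda>p. kernel \<tau> \<rho> (fst p) (snd p)) \<in> borel_measurable (disk R \<Otimes>\<^sub>M disk R)"
    unfolding kernel_def by measurable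
  have [measurable]: "kernel \<tau> \<rho> x \<in> borel_measurable (disk R)" "(\<lambda>x. kernel \<tau> \<rho> x z) \<in> borel_measurable (disk R)" for x z
    by (auto intro: borel_measurable_disk)
  have pm: "(\<lambda>(x, z). ennreal (kernel \<tau> \<rho> x z) * ennreal ((f z)\<^sup>2)) \<in> borel_measurable (disk R \<Otimes>\<^sub>M disk R)"
    unfolding case_prod_beta by measurable
  have "(\<integral>\<^sup>+x. ennreal ((smooth R \<tau> \<rho> f x)\<^sup>2) \<partial>disk R)
     \<le> (\<integral>\<^sup>+x. ennreal c * (\<integral>\<^sup>+z. ennreal (kernel \<tau> \<rho> x z) * ennreal ((f z)\<^sup>2) \<partial>disk R) \<partial>disk R)"
    unfolding c_def by (intro nn_integral_mono smooth_square_le f \<rho>)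
  also have "\<dots> = ennreal c * (\<integral>\<^sup>+x. (\<integral>\<^sup>+z. ennreal (kernel \<tau> \<rho> x z) * ennreal ((f z)\<^sup>2) \<partial>disk R) \<partial>disk R)"
    using sigma_finite_measure.borel_measurable_nn_integral[OF sf pm] by (intro nn_integral_cmult) simp
  also have "(\<integral>\<^sup>+x. (\<integral>\<^sup>+z. ennreal (kernel \<tau> \<rho> x z) * ennreal ((f z)\<^sup>2) \<partial>disk R) \<partial>disk R)
      = (\<integral>\<^sup>+z. (\<integral>\<^sup>+x. ennreal (kernel \<tau> \<rho> x z) * ennreal ((f z)\<^sup>2) \<partial>disk R) \<partial>disk R)"
    using Fubini'[OF pm] by simp
  also have "\<dots> = (\<integral>\<^sup>+z. (\<integral>\<^sup>+x. ennreal (kernel \<tau> \<rho> x z) \<partial>disk R) * ennreal ((f z)\<^sup>2) \<partial>disk R)"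
    by (intro nn_integral_cong nn_integral_multc) measurable
  also have "\<dots> \<le> (\<integral>\<^sup>+z. ennreal (1 / (c * \<tau>\<^sup>2)) * ennreal ((f z)\<^sup>2) \<partial>disk R)"
  proof (intro nn_integral_mono mult_right_mono)
    fix z
    show "(\<integral>\<^sup>+x. ennreal (kernel \<tau> \<rho> x z) \<partial>disk R) \<le> ennreal (1 / (c * \<tau>\<^sup>2))"
      using nn_integral_disk_le[of R "\<lambda>x. ennreal (kernel \<tau> \<rho> x z)"]
      by (simp add: nn_integral_kernel_right[OF \<rho> \<tau>] c_def)
  qed auto
  also have "\<dots> = ennreal (1 / (c * \<tau>\<^sup>2)) * (\<integral>\<^sup>+z. ennreal ((f z)\<^sup>2) \<partial>disk R)"
    by (rule nn_integral_cmult) simp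
  also have "(\<integral>\<^sup>+z. ennreal ((f z)\<^sup>2) \<partial>disk R) = ennreal (\<integral>z. (f z)\<^sup>2 \<partial>disk R)"
    using f by (intro nn_integral_eq_integral) (auto simp: L2_def)
  also have "ennreal c * (ennreal (1 / (c * \<tau>\<^sup>2)) * ennreal (\<integral>z. (f z)\<^sup>2 \<partial>disk R)) = ennreal ((1 / \<tau>\<^sup>2) * (\<integral>z. (f z)\<^sup>2 \<partial>disk R))"
    using c \<tau> by (simp flip: ennreal_mult)
  finally have b: "(\<integral>\<^sup>+x. ennreal ((smooth R \<tau> \<rho> f x)\<^sup>2) \<partial>disk R) \<le> ennreal ((1 / \<tau>\<^sup>2) * (\<integral>z. (f z)\<^sup>2 \<partial>disk R))"
    by (simp add: mult_left_mono)
  have "integrable (disk R) (\<lambda>x. (smooth R \<tau> \<rho> f x)\<^sup>2)"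
    using smooth_measurable[OF m] le_less_trans[OF b] by (intro integrableI_bounded) auto
  then show L: "L2 (disk R) (smooth R \<tau> \<rho> f)"
    using smooth_measurable[OF m] by (simp add: L2_def)
  have "ennreal (\<integral>x. (smooth R \<tau> \<rho> f x)\<^sup>2 \<partial>disk R) \<le> ennreal ((1 / \<tau>\<^sup>2) * (\<integral>z. (f z)\<^sup>2 \<partial>disk R))"
    using b L by (subst nn_integral_eq_integral[symmetric]) (auto simp: L2_def)
  then show "(\<integral>x. (smooth R \<tau> \<rho> f x)\<^sup>2 \<partial>disk R) \<le> (1 / \<tau>\<^sup>2) * (\<integral>x. (f x)\<^sup>2 \<partial>disk R)"
    by (subst (asm) ennreal_le_iff) auto
qed

section \<open>Differentiating a mollified function\<close>

lemma C1_kernel_right: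
  shows "C1 (kernel \<tau> \<rho> x)" "partials (kernel \<tau> \<rho> x) = (\<lambda>z. (1 / \<rho>) *\<^sub>R dbump ((1 / \<rho>) *\<^sub>R (z - \<tau> *\<^sub>R x)))"
proof -
  have d: "(kernel \<tau> \<rho> x has_derivative (\<lambda>h. ((1 / \<rho>) *\<^sub>R dbump ((1 / \<rho>) *\<^sub>R (z - \<tau> *\<^sub>R x))) \<bullet> h)) (at z)" for z
  proof -
    have "((\<lambda>z. (1 / \<rho>) *\<^sub>R (z - \<tau> *\<^sub>R x)) has_derivative (\<lambda>h. (1 / \<rho>) *\<^sub>R h)) (at z)"
      by (rule derivative_eq_intros refl | simp)+
    from has_derivative_compose[OF this C1_has_derivative[OF C1_bump(1)]] show ?thesis
      by (simp add: kernel_def[abs_def] C1_bump(2))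
  qed
  have c: "continuous_on UNIV (\<lambda>z. (1 / \<rho>) *\<^sub>R dbump ((1 / \<rho>) *\<^sub>R (z - \<tau> *\<^sub>R x)))"
    by (intro continuous_intros continuous_on_compose2[OF continuous_bump(2)]) auto
  show "C1 (kernel \<tau> \<rho> x)" "partials (kernel \<tau> \<rho> x) = (\<lambda>z. (1 / \<rho>) *\<^sub>R dbump ((1 / \<rho>) *\<^sub>R (z - \<tau> *\<^sub>R x)))"
    by (rule C1I[OF d c])+
qed

text \<open>The derivative of the kernel in \<open>x\<close> is \<open>- \<tau>\<close> times its
  derivative in \<open>z\<close>. It is written in the latter form because a weak differential of
  \<open>f\<close> can absorb a derivative in \<open>z\<close>.\<close>

definition dsmooth :: "real \<Rightarrow> real \<Rightarrow> real \<Rightarrow> (real^2 \<Rightarrow> real) \<Rightarrow> real^2 \<Rightarrow> real^2" where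
  "dsmooth R \<tau> \<rho> f x = (\<chi> i. (1 / (\<rho>\<^sup>2 * bump_mass)) * (\<integral>z. - \<tau> * (f z * partials (kernel \<tau> \<rho> x) z $ i) \<partial>disk R))"

lemma L2_dkernel_integrable:
  assumes "L2 (disk R) f"
  shows "integrable (disk R) (\<lambda>z. f z * partials (kernel \<tau> \<rho> x) z $ i)"
  by (intro L2_mult_integrable assms C1_partials_L2 C1_kernel_right)

lemma smooth_taylor:
  assumes f: "L2 (disk R) f" and \<rho>: "\<rho> > 0" and \<tau>: "\<tau> > 0"
  shows "\<exists>C. \<forall>h. norm h \<le> 1 \<longrightarrow> \<bar>smooth R \<tau> \<rho> f (x + h) - smooth R \<tau> \<rho> f x - dsmooth R \<tau> \<rho> f x \<bullet> h\<bar> \<le> C * (norm h)\<^sup>2"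
proof -
  define c where "c = 1 / (\<rho>\<^sup>2 * bump_mass)"
  have c: "c > 0"
    using \<rho> bump_mass_pos by (simp add: c_def)
  \<comment> \<open>A bound for the argument of the bump over all \<open>z\<close> in the disk; it
    makes the Taylor constant \<open>C\<close> independent of \<open>z\<close> and
    \<open>h\<close>.\<close>
  define Y where "Y = (\<bar>R\<bar> + \<tau> * norm x) / \<rho>"
  define C where "C = ((2 * Y + \<tau> / \<rho>)\<^sup>2 + 2) * (\<tau> / \<rho>)\<^sup>2"
  have fi: "integrable (disk R) f"
    by (rule finite_measure.L2_imp_integrable[OF finite_measure_disk f])
  have "\<bar>smooth R \<tau> \<rho> f (x + h) - smooth R \<tau> \<rho> f x - dsmooth R \<tau> \<rho> f x \<bullet> h\<bar> \<le> c * C * (\<integral>z. \<bar>f z\<bar> \<partial>disk R) * (norm h)\<^sup>2"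
    if h: "norm h \<le> 1" for h
  proof -
    \<comment> \<open>The Taylor error of the kernel in the variable \<open>x\<close>. The sign of
      the last term is positive because the derivative in \<open>x\<close> is
      \<open>- \<tau>\<close> times the one in \<open>z\<close>.\<close>
    define E where "E z = kernel \<tau> \<rho> (x + h) z - kernel \<tau> \<rho> x z + \<tau> * (partials (kernel \<tau> \<rho> x) z \<bullet> h)" for z
    have E: "\<bar>E z\<bar> \<le> C * (norm h)\<^sup>2" if z: "z \<in> space (disk R)" for z
    proof -
      define y where "y = (1 / \<rho>) *\<^sub>R (z - \<tau> *\<^sub>R x)"
      define k where "k = - (\<tau> / \<rho>) *\<^sub>R h"
      have k: "norm k = \<tau> / \<rho> * norm h"
        using \<tau> \<rho> by (simp add: k_def)
      have k1: "norm k \<le> \<tau> / \<rho>"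
        using mult_left_mono[OF h, of "\<tau> / \<rho>"] \<tau> \<rho> by (simp add: k)
      have "norm (z - \<tau> *\<^sub>R x) \<le> \<bar>R\<bar> + \<tau> * norm x"
        using z \<tau> norm_triangle_ineq4[of z "\<tau> *\<^sub>R x"] by auto
      then have y: "norm y \<le> Y"
        using \<rho> by (simp add: y_def Y_def divide_right_mono)
      have "y + k = (1 / \<rho>) *\<^sub>R (z - \<tau> *\<^sub>R (x + h))"
        by (simp add: y_def k_def algebra_simps)
      then have "E z = bump (y + k) - bump y - dbump y \<bullet> k"
        by (simp add: E_def kernel_def C1_kernel_right(2) y_def k_def)
      also have "\<bar>\<dots>\<bar> \<le> ((2 * norm y + norm k)\<^sup>2 + 2) * (norm k)\<^sup>2"
        by (rule bump_taylor)
      also have "\<dots> \<le> ((2 * Y + \<tau> / \<rho>)\<^sup>2 + 2) * (norm k)\<^sup>2"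
        using y k1 by (intro mult_right_mono add_mono power_mono) auto
      also have "\<dots> = C * (norm h)\<^sup>2"
        unfolding k C_def power_mult_distrib by (simp only: mult.assoc)
      finally show ?thesis .
    qed
    have i1: "integrable (disk R) (\<lambda>z. kernel \<tau> \<rho> (x + h) z * f z)" "integrable (disk R) (\<lambda>z. kernel \<tau> \<rho> x z * f z)"
      by (rule L2_kernel_integrable[OF f])+
    have i2: "integrable (disk R) (\<lambda>z. f z * partials (kernel \<tau> \<rho> x) z $ i)" for i
      by (rule L2_dkernel_integrable[OF f])
    have "dsmooth R \<tau> \<rho> f x \<bullet> h = c * (- \<tau> * ((\<integral>z. f z * partials (kernel \<tau> \<rho> x) z $ 1 \<partial>disk R) * h $ 1 + (\<integral>z. f z * partials (kernel \<tau> \<rho> x) z $ 2 \<partial>disk R) * h $ 2))"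
      by (simp add: dsmooth_def inner_real2 c_def[symmetric]) (simp only: algebra_simps)
    also have "\<dots> = c * (- \<tau> * (\<integral>z. f z * partials (kernel \<tau> \<rho> x) z $ 1 * h $ 1 + f z * partials (kernel \<tau> \<rho> x) z $ 2 * h $ 2 \<partial>disk R))"
      using i2[of 1] i2[of 2] by simp
    also have "(\<integral>z. f z * partials (kernel \<tau> \<rho> x) z $ 1 * h $ 1 + f z * partials (kernel \<tau> \<rho> x) z $ 2 * h $ 2 \<partial>disk R) = (\<integral>z. f z * (partials (kernel \<tau> \<rho> x) z \<bullet> h) \<partial>disk R)"
      by (simp add: inner_real2 distrib_left mult.assoc)
    finally have d: "dsmooth R \<tau> \<rho> f x \<bullet> h = c * (- \<tau> * (\<integral>z. f z * (partials (kernel \<tau> \<rho> x) z \<bullet> h) \<partial>disk R))" .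
    have i3: "integrable (disk R) (\<lambda>z. f z * (partials (kernel \<tau> \<rho> x) z \<bullet> h))"
      using i2[of 1] i2[of 2] by (simp add: inner_real2 distrib_left mult.assoc[symmetric])
    have "smooth R \<tau> \<rho> f (x + h) - smooth R \<tau> \<rho> f x - dsmooth R \<tau> \<rho> f x \<bullet> h
        = c * ((\<integral>z. kernel \<tau> \<rho> (x + h) z * f z \<partial>disk R) - (\<integral>z. kernel \<tau> \<rho> x z * f z \<partial>disk R) + \<tau> * (\<integral>z. f z * (partials (kernel \<tau> \<rho> x) z \<bullet> h) \<partial>disk R))"
    proof -
      have sm: "smooth R \<tau> \<rho> f y = c * (\<integral>z. kernel \<tau> \<rho> y z * f z \<partial>disk R)" for y
        by (simp add: smooth_def c_def)
      show ?thesis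
        unfolding d sm by (simp add: algebra_simps)
    qed
    also have "\<dots> = c * (\<integral>z. kernel \<tau> \<rho> (x + h) z * f z - kernel \<tau> \<rho> x z * f z + \<tau> * (f z * (partials (kernel \<tau> \<rho> x) z \<bullet> h)) \<partial>disk R)"
      using i1 i3 by simp
    also have "\<dots> = c * (\<integral>z. E z * f z \<partial>disk R)"
      by (simp add: E_def algebra_simps)
    finally have eq: "smooth R \<tau> \<rho> f (x + h) - smooth R \<tau> \<rho> f x - dsmooth R \<tau> \<rho> f x \<bullet> h = c * (\<integral>z. E z * f z \<partial>disk R)" .
    have "\<bar>\<integral>z. E z * f z \<partial>disk R\<bar> \<le> (\<integral>z. C * (norm h)\<^sup>2 * \<bar>f z\<bar> \<partial>disk R)"
    proof (rule integral_abs_bound_integral)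
      show "integrable (disk R) (\<lambda>z. E z * f z)"
      proof -
        have "integrable (disk R) (\<lambda>z. kernel \<tau> \<rho> (x + h) z * f z - kernel \<tau> \<rho> x z * f z + \<tau> * (f z * (partials (kernel \<tau> \<rho> x) z \<bullet> h)))"
          using i1 i3 by simp
        then show ?thesis
          by (simp add: E_def algebra_simps)
      qed
      show "\<bar>E z * f z\<bar> \<le> C * (norm h)\<^sup>2 * \<bar>f z\<bar>" if "z \<in> space (disk R)" for z
        using E[OF that] by (simp add: abs_mult mult_right_mono)
    qed (use fi in simp)
    also have "\<dots> = C * (norm h)\<^sup>2 * (\<integral>z. \<bar>f z\<bar> \<partial>disk R)"
      by simp
    finally show ?thesis
      unfolding eq using c by (simp add: abs_mult mult.assoc mult_left_mono mult.commute[of "(norm h)\<^sup>2"])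
  qed
  then show ?thesis
    by blast
qed

lemma continuous_dsmooth:
  assumes f: "L2 (disk R) f"
  shows "continuous_on UNIV (dsmooth R \<tau> \<rho> f)"
proof -
  have fi: "integrable (disk R) f"
    by (rule finite_measure.L2_imp_integrable[OF finite_measure_disk f])
  have "continuous_on UNIV (\<lambda>x. \<integral>z. - \<tau> * (f z * partials (kernel \<tau> \<rho> x) z $ i) \<partial>disk R)" for i
    unfolding continuous_on_eq_continuous_within
  proof (intro ballI continuous_within_sequentiallyI)
    fix x and X :: "nat \<Rightarrow> real^2" assume X: "X \<longlonglongrightarrow> x"
    show "(\<lambda>n. \<integral>z. - \<tau> * (f z * partials (kernel \<tau> \<rho> (X n)) z $ i) \<partial>disk R)
        \<longlonglongrightarrow> (\<integral>z. - \<tau> * (f z * partials (kernel \<tau> \<rho> x) z $ i) \<partial>disk R)"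
    proof (rule integral_dominated_convergence)
      show "integrable (disk R) (\<lambda>z. \<bar>\<tau>\<bar> * (\<bar>f z\<bar> * (\<bar>1 / \<rho>\<bar> * 4)))"
        using fi by simp
      show "(\<lambda>z. - \<tau> * (f z * partials (kernel \<tau> \<rho> x) z $ i)) \<in> borel_measurable (disk R)" for x
        using L2_dkernel_integrable[OF f, of \<tau> \<rho> x i] by (intro borel_measurable_integrable integrable_mult_right)
      then show "(\<lambda>z. - \<tau> * (f z * partials (kernel \<tau> \<rho> (X n)) z $ i)) \<in> borel_measurable (disk R)" for n
        .
      have "(\<lambda>n. partials (kernel \<tau> \<rho> (X n)) z) \<longlonglongrightarrow> partials (kernel \<tau> \<rho> x) z" for z
      proof -
        have "continuous_on UNIV (\<lambda>x. (1 / \<rho>) *\<^sub>R dbump ((1 / \<rho>) *\<^sub>R (z - \<tau> *\<^sub>R x)))"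
          by (intro continuous_intros continuous_on_compose2[OF continuous_bump(2)]) auto
        then show ?thesis
          using X unfolding C1_kernel_right(2) continuous_on_sequentially by (auto simp: o_def)
      qed
      then show "AE z in disk R. (\<lambda>n. - \<tau> * (f z * partials (kernel \<tau> \<rho> (X n)) z $ i)) \<longlonglongrightarrow> - \<tau> * (f z * partials (kernel \<tau> \<rho> x) z $ i)"
        by (intro AE_I2 tendsto_intros)
      have "\<bar>partials (kernel \<tau> \<rho> x) z $ i\<bar> \<le> \<bar>1 / \<rho>\<bar> * 4" for x z
        using component_le_norm_cart[of "dbump ((1 / \<rho>) *\<^sub>R (z - \<tau> *\<^sub>R x))" i] bump_bounds(3)[of "(1 / \<rho>) *\<^sub>R (z - \<tau> *\<^sub>R x)"]
        unfolding C1_kernel_right(2) vector_scaleR_component real_scaleR_def abs_mult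
        by (intro mult_left_mono) auto
      then show "AE z in disk R. norm (- \<tau> * (f z * partials (kernel \<tau> \<rho> (X n)) z $ i)) \<le> \<bar>\<tau>\<bar> * (\<bar>f z\<bar> * (\<bar>1 / \<rho>\<bar> * 4))" for n
        unfolding real_norm_def abs_mult abs_minus_cancel by (intro AE_I2 mult_left_mono) auto
    qed
  qed
  then show ?thesis
    unfolding dsmooth_def[abs_def] by (intro continuous_on_vec_lambda continuous_intros)
qed

lemma C1_smooth:
  assumes "L2 (disk R) f" "\<rho> > 0" "\<tau> > 0"
  shows "C1 (smooth R \<tau> \<rho> f)" "partials (smooth R \<tau> \<rho> f) = dsmooth R \<tau> \<rho> f"
proof -
  have d: "(smooth R \<tau> \<rho> f has_derivative (\<lambda>h. dsmooth R \<tau> \<rho> f x \<bullet> h)) (at x)" for x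
    using smooth_taylor[OF assms, of x] quadratic_error_has_derivative by blast
  show "C1 (smooth R \<tau> \<rho> f)" "partials (smooth R \<tau> \<rho> f) = dsmooth R \<tau> \<rho> f"
    by (rule C1I[OF d continuous_dsmooth[OF assms(1)]])+
qed

text \<open>As a function of \<open>z\<close> the kernel is an admissible test function, supported
  in the closed ball of radius \<open>\<rho>\<close> about \<open>\<tau> *\<^sub>R x\<close>. The
  minus sign of integration by parts cancels the one in \<open>dsmooth\<close>, and the factor
  \<open>\<tau>\<close> remains.\<close>

lemma dsmooth_weak_diff:
  assumes wd: "weak_diff (ball 0 R) u p" and \<rho>: "\<rho> > 0" and \<tau>: "\<tau> > 0" "\<tau> * R + \<rho> < R" and x: "x \<in> ball 0 R"
  shows "dsmooth R \<tau> \<rho> u x $ i = \<tau> * smooth R \<tau> \<rho> (\<lambda>z. p z $ i) x"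
proof -
  have "C1_test (ball 0 R) (kernel \<tau> \<rho> x)"
    unfolding C1_test_def
  proof (intro conjI exI[of _ "cball (\<tau> *\<^sub>R x) \<rho>"] allI impI)
    show "C1 (kernel \<tau> \<rho> x)"
      by (rule C1_kernel_right)
    show "cball (\<tau> *\<^sub>R x) \<rho> \<subseteq> ball 0 R"
    proof
      fix z assume "z \<in> cball (\<tau> *\<^sub>R x) \<rho>"
      then have "norm (z - \<tau> *\<^sub>R x) \<le> \<rho>"
        by (simp add: dist_norm norm_minus_commute)
      moreover have "norm z \<le> norm (\<tau> *\<^sub>R x) + norm (z - \<tau> *\<^sub>R x)"
        using norm_triangle_ineq[of "\<tau> *\<^sub>R x" "z - \<tau> *\<^sub>R x"] by simp
      moreover have "\<tau> * norm x \<le> \<tau> * R"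
        using x \<tau> by (intro mult_left_mono) auto
      moreover have "norm (\<tau> *\<^sub>R x) = \<tau> * norm x"
        using \<tau> by simp
      ultimately have "norm z < R"
        using \<tau>(2) by linarith
      then show "z \<in> ball 0 R"
        by simp
    qed
    show "kernel \<tau> \<rho> x z = 0" if "z \<notin> cball (\<tau> *\<^sub>R x) \<rho>" for z
      using that by (intro kernel_eq_0[OF \<rho>]) (simp add: dist_norm norm_minus_commute)
  qed simp
  then have "(\<integral>z. u z * partials (kernel \<tau> \<rho> x) z $ i \<partial>disk R) = - (\<integral>z. p z $ i * kernel \<tau> \<rho> x z \<partial>disk R)"
    using wd by (simp add: weak_diff_def)
  then show ?thesis
    by (simp add: dsmooth_def smooth_def mult.commute)
qed

text \<open>With contraction \<open>1 - 2 * shrink m\<close> and radius \<open>R * shrink m\<close>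
  the support condition holds with room \<open>R * shrink m\<close>. The shift by 4 keeps the
  contraction at least \<open>1 / 2\<close>, hence the operator bound 4 in
  \<open>mollify_L2\<close>, uniform in \<open>m\<close>.\<close>

definition shrink :: "nat \<Rightarrow> real" where
  "shrink m = 1 / (real m + 4)"

definition mollify :: "real \<Rightarrow> nat \<Rightarrow> (real^2 \<Rightarrow> real) \<Rightarrow> real^2 \<Rightarrow> real" where
  "mollify R m f = smooth R (1 - 2 * shrink m) (R * shrink m) f"

lemma shrink_bounds: "0 < shrink m" "shrink m \<le> 1 / 4" "1 - 2 * shrink m \<ge> 1 / 2"
  by (simp_all add: shrink_def field_simps)

lemma shrink_tendsto: "shrink \<longlonglongrightarrow> 0"
proof -
  have "(\<lambda>m. 1 / real (m + 4)) \<longlonglongrightarrow> 0"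
    by (rule LIMSEQ_ignore_initial_segment[OF lim_1_over_n])
  then show ?thesis
    by (simp add: shrink_def[abs_def])
qed

lemma mollify_L2:
  assumes "L2 (disk R) f" "R > 0"
  shows "L2 (disk R) (mollify R m f)" "(\<integral>x. (mollify R m f x)\<^sup>2 \<partial>disk R) \<le> 4 * (\<integral>x. (f x)\<^sup>2 \<partial>disk R)"
proof -
  define \<tau> where "\<tau> = 1 - 2 * shrink m"
  have \<tau>: "\<tau> \<ge> 1 / 2" "\<tau> > 0"
    using shrink_bounds[of m] by (simp_all add: \<tau>_def)
  have \<rho>: "R * shrink m > 0"
    using assms shrink_bounds by simp
  show "L2 (disk R) (mollify R m f)"
    using smooth_L2_bound(1)[OF assms(1) \<rho> \<tau>(2)] by (simp add: mollify_def \<tau>_def)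
  have "(1 / 2)\<^sup>2 \<le> \<tau>\<^sup>2"
    using \<tau> by (intro power_mono) auto
  then have "1 / \<tau>\<^sup>2 \<le> 4"
    using \<tau> by (simp add: field_simps power2_eq_square)
  then have "1 / \<tau>\<^sup>2 * (\<integral>x. (f x)\<^sup>2 \<partial>disk R) \<le> 4 * (\<integral>x. (f x)\<^sup>2 \<partial>disk R)"
    by (intro mult_right_mono) auto
  with smooth_L2_bound(2)[OF assms(1) \<rho> \<tau>(2)] show "(\<integral>x. (mollify R m f x)\<^sup>2 \<partial>disk R) \<le> 4 * (\<integral>x. (f x)\<^sup>2 \<partial>disk R)"
    by (simp add: mollify_def \<tau>_def)
qed

lemma mollify_continuous_close:
  fixes g :: "real^2 \<Rightarrow> real"
  assumes g: "continuous_on UNIV g" and R: "R > 0" and e: "e > 0"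
  shows "\<forall>\<^sub>F m in sequentially. \<forall>x\<in>ball 0 R. \<bar>mollify R m g x - g x\<bar> \<le> e"
proof -
  have "uniformly_continuous_on (cball 0 R) g"
    by (intro compact_uniformly_continuous continuous_on_subset[OF g]) auto
  then obtain d where d: "d > 0" "\<And>x z. x \<in> cball 0 R \<Longrightarrow> z \<in> cball 0 R \<Longrightarrow> dist z x < d \<Longrightarrow> dist (g z) (g x) < e"
    using e unfolding uniformly_continuous_on_def by metis
  \<comment> \<open>Points of the kernel's support are within \<open>R * shrink m\<close> of the
    contracted point, which is within \<open>2 * R * shrink m\<close> of \<open>x\<close>.\<close>
  have "(\<lambda>m. 3 * R * shrink m) \<longlonglongrightarrow> 3 * R * 0"
    by (intro tendsto_intros shrink_tendsto)
  then have "\<forall>\<^sub>F m in sequentially. 3 * R * shrink m < d"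
    using d(1) by (simp add: order_tendstoD)
  then show ?thesis
  proof eventually_elim
    case (elim m)
    define \<tau> where "\<tau> = 1 - 2 * shrink m"
    define \<rho> where "\<rho> = R * shrink m"
    have \<tau>: "\<tau> > 0" "\<tau> * R + \<rho> \<le> R" and \<rho>: "\<rho> > 0"
      using shrink_bounds[of m] R by (simp_all add: \<tau>_def \<rho>_def algebra_simps)
    define c where "c = 1 / (\<rho>\<^sup>2 * bump_mass)"
    have c: "c > 0"
      using \<rho> bump_mass_pos by (simp add: c_def)
    show ?case
    proof
      fix x :: "real^2" assume x: "x \<in> ball 0 R"
      have gL: "L2 (disk R) g" and kL: "L2 (disk R) (kernel \<tau> \<rho> x)"
        using g by (auto intro: continuous_L2_disk C1_L2 C1_kernel_right)
      have one: "c * (\<integral>z. kernel \<tau> \<rho> x z \<partial>disk R) = 1"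
        using integral_kernel_disk[OF \<rho> _ \<tau>(2) x] \<tau>(1) c bump_mass_pos \<rho> by (simp add: c_def)
      have ki: "integrable (disk R) (kernel \<tau> \<rho> x)"
        by (rule finite_measure.L2_imp_integrable[OF finite_measure_disk kL])
      have ki2: "integrable (disk R) (\<lambda>z. kernel \<tau> \<rho> x z * g z)"
        by (rule L2_kernel_integrable[OF gL])
      have "mollify R m g x - g x = c * (\<integral>z. kernel \<tau> \<rho> x z * g z \<partial>disk R) - (c * (\<integral>z. kernel \<tau> \<rho> x z \<partial>disk R)) * g x"
        unfolding one by (simp add: mollify_def smooth_def c_def \<tau>_def \<rho>_def)
      also have "\<dots> = c * (\<integral>z. kernel \<tau> \<rho> x z * g z - kernel \<tau> \<rho> x z * g x \<partial>disk R)"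
        using ki ki2 by (simp add: algebra_simps)
      finally have eq: "mollify R m g x - g x = c * (\<integral>z. kernel \<tau> \<rho> x z * g z - kernel \<tau> \<rho> x z * g x \<partial>disk R)" .
      have "\<bar>\<integral>z. kernel \<tau> \<rho> x z * g z - kernel \<tau> \<rho> x z * g x \<partial>disk R\<bar> \<le> (\<integral>z. kernel \<tau> \<rho> x z * e \<partial>disk R)"
      proof (rule integral_abs_bound_integral)
        fix z assume z: "z \<in> space (disk R)"
        show "\<bar>kernel \<tau> \<rho> x z * g z - kernel \<tau> \<rho> x z * g x\<bar> \<le> kernel \<tau> \<rho> x z * e"
        proof (cases "norm (z - \<tau> *\<^sub>R x) < \<rho>")
          case True
          have "z - x = (z - \<tau> *\<^sub>R x) - (2 * shrink m) *\<^sub>R x"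
            by (simp add: \<tau>_def algebra_simps)
          then have "norm (z - x) \<le> norm (z - \<tau> *\<^sub>R x) + norm ((2 * shrink m) *\<^sub>R x)"
            by (metis norm_triangle_ineq4)
          moreover have "2 * shrink m * norm x \<le> 2 * shrink m * R"
            using x shrink_bounds(1)[of m] by (intro mult_left_mono) auto
          moreover have "norm ((2 * shrink m) *\<^sub>R x) = 2 * shrink m * norm x"
            using shrink_bounds(1)[of m] by simp
          moreover have "\<rho> + 2 * shrink m * R = 3 * R * shrink m"
            by (simp add: \<rho>_def)
          ultimately have "dist z x < d"
            using True elim unfolding dist_norm by linarith
          then have "\<bar>g z - g x\<bar> \<le> e"
            using d(2)[of x z] x z by (auto simp: dist_real_def)
          then have "kernel \<tau> \<rho> x z * \<bar>g z - g x\<bar> \<le> kernel \<tau> \<rho> x z * e"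
            by (intro mult_left_mono kernel_bounds)
          then show ?thesis
            by (simp add: abs_mult kernel_bounds flip: right_diff_distrib)
        next
          case False
          then show ?thesis
            by (simp add: kernel_eq_0[OF \<rho>])
        qed
      qed (use ki ki2 in auto)
      then have "c * \<bar>\<integral>z. kernel \<tau> \<rho> x z * g z - kernel \<tau> \<rho> x z * g x \<partial>disk R\<bar> \<le> c * (\<integral>z. kernel \<tau> \<rho> x z * e \<partial>disk R)"
        using c by (intro mult_left_mono) auto
      also have "\<dots> = e"
        using one by simp
      finally show "\<bar>mollify R m g x - g x\<bar> \<le> e"
        unfolding eq using c by (simp add: abs_mult)
    qed
  qed
qed

section \<open>Convergence of mollification in square mean\<close>

lemma L2_truncation_tendsto:
  assumes f: "L2 M f"
  shows "(\<lambda>n. \<integral>x. (f x - max (- real n) (min (real n) (f x)))\<^sup>2 \<partial>M) \<longlonglongrightarrow> 0"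
proof -
  have [measurable]: "f \<in> borel_measurable M"
    using f by (simp add: L2_def)
  have "(\<lambda>n. \<integral>x. (f x - max (- real n) (min (real n) (f x)))\<^sup>2 \<partial>M) \<longlonglongrightarrow> (\<integral>x. 0 \<partial>M)"
  proof (rule integral_dominated_convergence)
    show "integrable M (\<lambda>x. (f x)\<^sup>2)"
      using f by (simp add: L2_def)
    show "AE x in M. (\<lambda>n. (f x - max (- real n) (min (real n) (f x)))\<^sup>2) \<longlonglongrightarrow> 0"
    proof (intro AE_I2 tendsto_eventually)
      fix x
      obtain N :: nat where N: "\<bar>f x\<bar> \<le> real N"
        using real_arch_simple by blast
      show "\<forall>\<^sub>F n in sequentially. (f x - max (- real n) (min (real n) (f x)))\<^sup>2 = 0"
        using eventually_ge_at_top[of N]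
      proof eventually_elim
        case (elim n)
        then have "\<bar>f x\<bar> \<le> real n"
          using N by linarith
        then have "max (- real n) (min (real n) (f x)) = f x"
          by (auto simp: max_def min_def abs_le_iff)
        then show ?case
          by simp
      qed
    qed
    show "AE x in M. norm ((f x - max (- real n) (min (real n) (f x)))\<^sup>2) \<le> (f x)\<^sup>2" for n
    proof (intro AE_I2)
      fix x
      have "\<bar>f x - max (- real n) (min (real n) (f x))\<bar> \<le> \<bar>f x\<bar>"
        by (auto simp: max_def min_def abs_if)
      then show "norm ((f x - max (- real n) (min (real n) (f x)))\<^sup>2) \<le> (f x)\<^sup>2"
        by (simp add: abs_le_square_iff)
    qed
  qed measurable
  then show ?thesis
    by simp
qed

text \<open>A Lebesgue measurable function is an almost everywhere limit of continuous ones, but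
  without any bound. Truncating \<open>f\<close> and the approximants at the same height gives the
  dominating constant \<open>(2 * M)\<^sup>2\<close> on a set of finite measure.\<close>

lemma continuous_dense_L2:
  assumes f: "L2 (disk R) f" and e: "e > 0"
  obtains g where "continuous_on UNIV g" "(\<integral>x. (f x - g x)\<^sup>2 \<partial>disk R) < e"
proof -
  interpret finite_measure "disk R"
    by (rule finite_measure_disk)
  have fm [measurable]: "f \<in> borel_measurable (disk R)"
    using f by (simp add: L2_def)
  have "\<forall>\<^sub>F n in sequentially. (\<integral>x. (f x - max (- real n) (min (real n) (f x)))\<^sup>2 \<partial>disk R) < e / 4"
    using L2_truncation_tendsto[OF f] e by (intro order_tendstoD) auto
  then obtain M where M: "(\<integral>x. (f x - max (- real M) (min (real M) (f x)))\<^sup>2 \<partial>disk R) < e / 4"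
    by (auto simp: eventually_sequentially)
  define cut where "cut y = max (- real M) (min (real M) y)" for y
  have cut: "\<bar>cut y\<bar> \<le> real M" for y
    by (auto simp: cut_def)
  have cutc: "continuous_on UNIV cut"
    unfolding cut_def by (intro continuous_intros)
  have cutm [measurable]: "cut \<in> borel_measurable borel"
    using cutc by (rule borel_measurable_continuous_onI)
  have "f measurable_on (ball 0 R)"
    using fm by (simp add: measurable_on_iff_borel_measurable)
  then obtain N h where N: "negligible N" and h: "\<And>n. continuous_on UNIV (h n)"
    and lim: "\<And>x. x \<notin> N \<Longrightarrow> (\<lambda>n. h n x) \<longlonglongrightarrow> (if x \<in> ball 0 R then f x else (0::real))"
    unfolding measurable_on_def by blast
  have gc: "continuous_on UNIV (\<lambda>x. cut (h n x))" for n
    by (intro continuous_on_compose2[OF cutc h]) auto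
  have [measurable]: "(\<lambda>x. cut (h n x)) \<in> borel_measurable (disk R)" for n
    by (rule continuous_imp_borel_measurable_disk[OF gc])
  have "(\<lambda>n. \<integral>x. (cut (f x) - cut (h n x))\<^sup>2 \<partial>disk R) \<longlonglongrightarrow> (\<integral>x. 0 \<partial>disk R)"
  proof (rule integral_dominated_convergence)
    show "integrable (disk R) (\<lambda>x. (2 * real M)\<^sup>2)"
      by simp
    have "AE x in lebesgue. x \<notin> N"
      using N by (intro AE_not_in) (simp add: negligible_iff_null_sets)
    then have "AE x in disk R. x \<notin> N"
      by (subst AE_restrict_space_iff) auto
    then show "AE x in disk R. (\<lambda>n. (cut (f x) - cut (h n x))\<^sup>2) \<longlonglongrightarrow> 0"
      using AE_space
    proof eventually_elim
      case (elim x)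
      then have "(\<lambda>n. h n x) \<longlonglongrightarrow> f x"
        using lim[of x] by auto
      then have "(\<lambda>n. cut (h n x)) \<longlonglongrightarrow> cut (f x)"
        by (intro continuous_on_tendsto_compose[OF cutc]) auto
      then have "(\<lambda>n. (cut (f x) - cut (h n x))\<^sup>2) \<longlonglongrightarrow> (cut (f x) - cut (f x))\<^sup>2"
        by (intro tendsto_intros)
      then show ?case
        by simp
    qed
    show "AE x in disk R. norm ((cut (f x) - cut (h n x))\<^sup>2) \<le> (2 * real M)\<^sup>2" for n
    proof (intro AE_I2)
      fix x
      have "\<bar>cut (f x) - cut (h n x)\<bar> \<le> 2 * real M"
        using cut[of "f x"] cut[of "h n x"] by linarith
      then show "norm ((cut (f x) - cut (h n x))\<^sup>2) \<le> (2 * real M)\<^sup>2"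
        using power_mono[of "\<bar>cut (f x) - cut (h n x)\<bar>" "2 * real M" 2] by simp
    qed
  qed measurable
  then have "\<forall>\<^sub>F n in sequentially. (\<integral>x. (cut (f x) - cut (h n x))\<^sup>2 \<partial>disk R) < e / 4"
    using e by (intro order_tendstoD) auto
  then obtain n where n: "(\<integral>x. (cut (f x) - cut (h n x))\<^sup>2 \<partial>disk R) < e / 4"
    by (auto simp: eventually_sequentially)
  have cL: "L2 (disk R) (\<lambda>x. cut (f x))"
    by (rule L2_bounded[where B = "real M"]) (use cut in auto)
  have "(\<integral>x. (f x - cut (h n x))\<^sup>2 \<partial>disk R) \<le> 2 * (\<integral>x. (f x - cut (f x))\<^sup>2 \<partial>disk R) + 2 * (\<integral>x. (cut (f x) - cut (h n x))\<^sup>2 \<partial>disk R)"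
    by (rule L2_diff_triangle[OF f cL continuous_L2_disk[OF gc]])
  also have "\<dots> < e"
    using n M by (simp add: cut_def)
  finally show ?thesis
    using gc by (intro that)
qed

text \<open>Uniform boundedness of the operators transfers convergence from the dense class of
  continuous functions, where it is uniform on the disk.\<close>

lemma mollify_tendsto:
  assumes f: "L2 (disk R) f" and R: "R > 0"
  shows "(\<lambda>m. \<integral>x. (mollify R m f x - f x)\<^sup>2 \<partial>disk R) \<longlonglongrightarrow> 0"
proof (rule LIMSEQ_I)
  fix e :: real assume e: "e > 0"
  interpret finite_measure "disk R"
    by (rule finite_measure_disk)
  define A where "A = measure (disk R) (space (disk R)) + 1"
  have A: "A > 0"
    unfolding A_def by (simp add: add_nonneg_pos)
  define a where "a = sqrt (e / (8 * A))"
  have a: "a > 0" "a\<^sup>2 = e / (8 * A)"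
    using e A by (simp_all add: a_def)
  \<comment> \<open>With the operator bound 4 the three pieces of the error are at most
    \<open>e / 10\<close>, \<open>e / 8\<close> and \<open>e / 40\<close>; splitting the square
    twice gives \<open>2 * e / 10 + 4 * e / 8 + 4 * e / 40\<close>, which is less than
    \<open>e\<close>. The number \<open>a\<close> is chosen to make the middle piece
    \<open>e / 8\<close>.\<close>
  obtain g where g: "continuous_on UNIV g" and fg: "(\<integral>x. (f x - g x)\<^sup>2 \<partial>disk R) < e / 40"
    using continuous_dense_L2[OF f, of "e / 40"] e by auto
  have gL: "L2 (disk R) g"
    by (rule continuous_L2_disk[OF g])
  have "\<forall>\<^sub>F m in sequentially. (\<integral>x. (mollify R m f x - f x)\<^sup>2 \<partial>disk R) < e"
    using mollify_continuous_close[OF g R a(1)]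
  proof eventually_elim
    case (elim m)
    have fgL: "L2 (disk R) (\<lambda>x. f x - g x)"
      by (intro L2_diff f gL)
    have split: "mollify R m f x = mollify R m (\<lambda>x. f x - g x) x + mollify R m g x" for x
      unfolding mollify_def using smooth_add[OF fgL gL, of "1 - 2 * shrink m" "R * shrink m" x] by simp
    have 1: "(\<integral>x. (mollify R m g x - g x)\<^sup>2 \<partial>disk R) \<le> e / 8"
    proof -
      have "(\<integral>x. (mollify R m g x - g x)\<^sup>2 \<partial>disk R) \<le> (\<integral>x. a\<^sup>2 \<partial>disk R)"
      proof (rule integral_mono)
        show "integrable (disk R) (\<lambda>x. (mollify R m g x - g x)\<^sup>2)"
          by (intro L2_integrable L2_diff mollify_L2 gL R)
        show "(mollify R m g x - g x)\<^sup>2 \<le> a\<^sup>2" if "x \<in> space (disk R)" for x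
          using elim that power_mono[of "\<bar>mollify R m g x - g x\<bar>" a 2] by auto
      qed simp
      also have "\<dots> = measure (disk R) (space (disk R)) * (e / (8 * A))"
        using a by simp
      also have "\<dots> \<le> A * (e / (8 * A))"
        using e A by (intro mult_right_mono) (auto simp: A_def)
      also have "\<dots> = e / 8"
        using A by simp
      finally show ?thesis .
    qed
    have 2: "(\<integral>x. (mollify R m (\<lambda>x. f x - g x) x)\<^sup>2 \<partial>disk R) < e / 10"
      using mollify_L2(2)[OF fgL R, of m] fg by linarith
    have 3: "(\<integral>x. (g x - f x)\<^sup>2 \<partial>disk R) < e / 40"
      using fg by (simp add: power2_commute)
    have L1: "L2 (disk R) (\<lambda>x. mollify R m (\<lambda>x. f x - g x) x)"
      by (rule mollify_L2(1)[OF fgL R])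
    have L2': "L2 (disk R) (\<lambda>x. mollify R m g x - g x)" and L3: "L2 (disk R) (\<lambda>x. g x - f x)"
      by (intro L2_diff mollify_L2 gL R f)+
    have "(\<integral>x. (mollify R m f x - f x)\<^sup>2 \<partial>disk R)
        = (\<integral>x. (mollify R m (\<lambda>x. f x - g x) x + ((mollify R m g x - g x) + (g x - f x)))\<^sup>2 \<partial>disk R)"
      by (simp add: split add_diff_eq)
    also have "\<dots> \<le> 2 * (\<integral>x. (mollify R m (\<lambda>x. f x - g x) x)\<^sup>2 \<partial>disk R) + 2 * (\<integral>x. ((mollify R m g x - g x) + (g x - f x))\<^sup>2 \<partial>disk R)"
      by (intro L2_add_bound L1 L2_add L2' L3)
    finally have 4: "(\<integral>x. (mollify R m f x - f x)\<^sup>2 \<partial>disk R) \<le> 2 * (\<integral>x. (mollify R m (\<lambda>x. f x - g x) x)\<^sup>2 \<partial>disk R) + 2 * (\<integral>x. ((mollify R m g x - g x) + (g x - f x))\<^sup>2 \<partial>disk R)" .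
    have 5: "(\<integral>x. ((mollify R m g x - g x) + (g x - f x))\<^sup>2 \<partial>disk R)
        \<le> 2 * (\<integral>x. (mollify R m g x - g x)\<^sup>2 \<partial>disk R) + 2 * (\<integral>x. (g x - f x)\<^sup>2 \<partial>disk R)"
      by (intro L2_add_bound L2' L3)
    show ?case
      using 1 2 3 4 5 e by linarith
  qed
  then show "\<exists>n0. \<forall>m\<ge>n0. norm ((\<integral>x. (mollify R m f x - f x)\<^sup>2 \<partial>disk R) - 0) < e"
    by (simp add: eventually_sequentially)
qed

section \<open>Density of \<open>C1\<close> functions in \<open>H1\<close>, and uniqueness of the
  weak differential\<close>

lemma partials_mollify:
  assumes u: "L2 (disk R) u" and R: "R > 0" and wd: "weak_diff (ball 0 R) u p" and x: "x \<in> ball 0 R"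
  shows "partials (mollify R m u) x $ i = (1 - 2 * shrink m) * mollify R m (\<lambda>x. p x $ i) x"
proof -
  have "(1 - 2 * shrink m) * R + R * shrink m < R"
    using R shrink_bounds[of m] by (simp add: algebra_simps)
  then show ?thesis
    using dsmooth_weak_diff[OF wd, of "R * shrink m" "1 - 2 * shrink m" x i] R shrink_bounds[of m] x
      C1_smooth(2)[OF u, of "R * shrink m" "1 - 2 * shrink m"]
    by (simp add: mollify_def[abs_def])
qed

lemma C1_mollify:
  assumes "L2 (disk R) u" "R > 0"
  shows "C1 (mollify R m u)"
proof -
  have "smooth R (1 - 2 * shrink m) (R * shrink m) u = mollify R m u"
    by (simp add: mollify_def[abs_def])
  then show ?thesis
    using C1_smooth(1)[OF assms(1), of "R * shrink m" "1 - 2 * shrink m"] assms(2) shrink_bounds[of m] by auto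
qed

text \<open>The derivative of the mollified function is the mollified \<open>p\<close> times
  \<open>1 - 2 * shrink m\<close>. Its error therefore has two sources, the mollification of
  \<open>p\<close> and the missing fraction \<open>2 * shrink m\<close> of \<open>p\<close>, and
  both vanish in the limit.\<close>

lemma C1_dense_H1:
  assumes u: "L2 (disk R) u" and p: "V2 (disk R) p" and wd: "weak_diff (ball 0 R) u p" and R: "R > 0"
  shows "(\<lambda>m. dist_H1 R u p (mollify R m u)) \<longlonglongrightarrow> 0"
proof -
  have lim: "(\<lambda>m. \<integral>x. (partials (mollify R m u) x $ i - p x $ i)\<^sup>2 \<partial>disk R) \<longlonglongrightarrow> 0" for i
  proof (rule tendsto_sandwich[OF _ _ tendsto_const])
    have pi: "L2 (disk R) (\<lambda>x. p x $ i)"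
      by (rule V2_nth[OF p])
    let ?B = "\<lambda>m. 2 * ((1 - 2 * shrink m)\<^sup>2 * (\<integral>x. (mollify R m (\<lambda>x. p x $ i) x - p x $ i)\<^sup>2 \<partial>disk R)) + 2 * ((2 * shrink m)\<^sup>2 * (\<integral>x. (p x $ i)\<^sup>2 \<partial>disk R))"
    show "\<forall>\<^sub>F m in sequentially. 0 \<le> (\<integral>x. (partials (mollify R m u) x $ i - p x $ i)\<^sup>2 \<partial>disk R)"
      by simp
    show "\<forall>\<^sub>F m in sequentially. (\<integral>x. (partials (mollify R m u) x $ i - p x $ i)\<^sup>2 \<partial>disk R) \<le> ?B m"
    proof (intro always_eventually allI)
      fix m
      have "(\<integral>x. (partials (mollify R m u) x $ i - p x $ i)\<^sup>2 \<partial>disk R)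
        = (\<integral>x. ((1 - 2 * shrink m) * (mollify R m (\<lambda>x. p x $ i) x - p x $ i) + (- (2 * shrink m)) * p x $ i)\<^sup>2 \<partial>disk R)"
      proof (rule Bochner_Integration.integral_cong[OF refl])
        fix x assume "x \<in> space (disk R)"
        then have "partials (mollify R m u) x $ i = (1 - 2 * shrink m) * mollify R m (\<lambda>x. p x $ i) x"
          by (intro partials_mollify u R wd) simp
        then show "(partials (mollify R m u) x $ i - p x $ i)\<^sup>2 = ((1 - 2 * shrink m) * (mollify R m (\<lambda>x. p x $ i) x - p x $ i) + (- (2 * shrink m)) * p x $ i)\<^sup>2"
          by (simp only:) (simp add: algebra_simps)
      qed
      also have "\<dots> \<le> 2 * (\<integral>x. ((1 - 2 * shrink m) * (mollify R m (\<lambda>x. p x $ i) x - p x $ i))\<^sup>2 \<partial>disk R) + 2 * (\<integral>x. ((- (2 * shrink m)) * p x $ i)\<^sup>2 \<partial>disk R)"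
        by (intro L2_add_bound L2_scale L2_diff mollify_L2 pi R)
      also have "\<dots> = ?B m"
        unfolding power_mult_distrib by simp
      finally show "(\<integral>x. (partials (mollify R m u) x $ i - p x $ i)\<^sup>2 \<partial>disk R) \<le> ?B m" .
    qed
    have "?B \<longlonglongrightarrow> 2 * ((1 - 2 * 0)\<^sup>2 * 0) + 2 * ((2 * 0)\<^sup>2 * (\<integral>x. (p x $ i)\<^sup>2 \<partial>disk R))"
      by (intro tendsto_intros shrink_tendsto mollify_tendsto pi R)
    then show "?B \<longlonglongrightarrow> 0"
      by simp
  qed
  have "V2 (disk R) (\<lambda>x. partials (mollify R m u) x - p x)" for m
    by (intro V2_diff C1_partials_V2 C1_mollify u R p)
  then have "dist_H1 R u p (mollify R m u) = (\<integral>x. (mollify R m u x - u x)\<^sup>2 \<partial>disk R)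
      + ((\<integral>x. (partials (mollify R m u) x $ 1 - p x $ 1)\<^sup>2 \<partial>disk R) + (\<integral>x. (partials (mollify R m u) x $ 2 - p x $ 2)\<^sup>2 \<partial>disk R))" for m
    by (simp add: dist_H1_def V2_integral)
  moreover have "(\<lambda>m. (\<integral>x. (mollify R m u x - u x)\<^sup>2 \<partial>disk R)
      + ((\<integral>x. (partials (mollify R m u) x $ 1 - p x $ 1)\<^sup>2 \<partial>disk R) + (\<integral>x. (partials (mollify R m u) x $ 2 - p x $ 2)\<^sup>2 \<partial>disk R))) \<longlonglongrightarrow> 0 + (0 + 0)"
    by (intro tendsto_add mollify_tendsto u R lim)
  ultimately show ?thesis
    by simp
qed

text \<open>Both candidates have the same mollifications, because each of these is the derivative of
  the mollified \<open>u\<close> divided by the nonzero number \<open>1 - 2 * shrink m\<close>.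
  Hence both are limits of one sequence.\<close>

lemma weak_diff_unique:
  assumes u: "L2 (disk R) u" and p: "V2 (disk R) p" "V2 (disk R) q"
    and wd: "weak_diff (ball 0 R) u p" "weak_diff (ball 0 R) u q" and R: "R > 0"
  shows "AE x in disk R. p x = q x"
proof -
  have "AE x in disk R. p x $ i = q x $ i" for i
  proof (rule L2_limit_unique[where f = "\<lambda>m. mollify R m (\<lambda>x. p x $ i)"])
    have pi: "L2 (disk R) (\<lambda>x. p x $ i)" and qi: "L2 (disk R) (\<lambda>x. q x $ i)"
      by (intro V2_nth p)+
    show "L2 (disk R) (\<lambda>x. p x $ i)" "L2 (disk R) (\<lambda>x. q x $ i)"
      by fact+
    show "L2 (disk R) (mollify R m (\<lambda>x. p x $ i))" for m
      by (intro mollify_L2 pi R)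
    show "(\<lambda>m. \<integral>x. (mollify R m (\<lambda>x. p x $ i) x - p x $ i)\<^sup>2 \<partial>disk R) \<longlonglongrightarrow> 0"
      by (intro mollify_tendsto pi R)
    have "mollify R m (\<lambda>x. p x $ i) x = mollify R m (\<lambda>x. q x $ i) x" if "x \<in> ball 0 R" for m x
      using partials_mollify[OF u R wd(1) that, of m i] partials_mollify[OF u R wd(2) that, of m i] shrink_bounds(3)[of m]
      by simp
    then have "(\<integral>x. (mollify R m (\<lambda>x. p x $ i) x - q x $ i)\<^sup>2 \<partial>disk R) = (\<integral>x. (mollify R m (\<lambda>x. q x $ i) x - q x $ i)\<^sup>2 \<partial>disk R)" for m
      by (intro Bochner_Integration.integral_cong) auto
    then show "(\<lambda>m. \<integral>x. (mollify R m (\<lambda>x. p x $ i) x - q x $ i)\<^sup>2 \<partial>disk R) \<longlonglongrightarrow> 0"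
      using mollify_tendsto[OF qi R] by simp
  qed
  from this[of 1] this[of 2] show ?thesis
    by eventually_elim (simp add: vec_eq_iff forall_2)
qed

section \<open>Conformal metrics on a disk\<close>

text \<open>Compares the combination of \<open>g\<close> with that of \<open>f\<close> for all
  coefficients at once, with the error measured by the coefficient norm. A lower mass bound such as
  \<open>L2_indep_lower\<close> later absorbs that norm.\<close>

lemma L2_lincomb_young:
  fixes f g :: "nat \<Rightarrow> 'a \<Rightarrow> real"
  assumes f: "\<And>i. i < k \<Longrightarrow> L2 M (f i)" and g: "\<And>i. i < k \<Longrightarrow> L2 M (g i)" and e: "e > 0"
  shows "(\<integral>x. (\<Sum>i<k. c i * g i x)\<^sup>2 \<partial>M) \<le> (1 + e) * (\<integral>x. (\<Sum>i<k. c i * f i x)\<^sup>2 \<partial>M)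
    + (1 + 1 / e) * ((\<Sum>i<k. (c i)\<^sup>2) * (\<Sum>i<k. \<integral>x. (g i x - f i x)\<^sup>2 \<partial>M))"
proof -
  have d: "L2 M (\<lambda>x. g i x - f i x)" if "i < k" for i
    by (intro L2_diff f g that)
  have "(\<integral>x. (\<Sum>i<k. c i * g i x)\<^sup>2 \<partial>M) = (\<integral>x. ((\<Sum>i<k. c i * f i x) + (\<Sum>i<k. c i * (g i x - f i x)))\<^sup>2 \<partial>M)"
    by (simp add: right_diff_distrib sum_subtractf)
  also have "\<dots> \<le> (1 + e) * (\<integral>x. (\<Sum>i<k. c i * f i x)\<^sup>2 \<partial>M) + (1 + 1 / e) * (\<integral>x. (\<Sum>i<k. c i * (g i x - f i x))\<^sup>2 \<partial>M)"
    by (intro L2_young L2_sum L2_scale f d e) auto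
  also have "\<dots> \<le> (1 + e) * (\<integral>x. (\<Sum>i<k. c i * f i x)\<^sup>2 \<partial>M) + (1 + 1 / e) * ((\<Sum>i<k. (c i)\<^sup>2) * (\<Sum>i<k. \<integral>x. (g i x - f i x)\<^sup>2 \<partial>M))"
    using e d by (intro add_left_mono mult_left_mono L2_lincomb_bound) auto
  finally show ?thesis .
qed

text \<open>Difference quotients have integral 0 by translation invariance. They converge to the
  derivative, dominated by the Lipschitz constant on a ball enlarged by 1, since all shifts have
  length at most 1.\<close>

lemma C1_compact_support_integral_partials:
  assumes f: "C1 f" and K: "compact K" "\<And>x. x \<notin> K \<Longrightarrow> f x = 0"
  shows "(\<integral>x. partials f x $ i \<partial>lborel) = 0"
proof -
  have p0: "partials f x = 0" if "x \<notin> K" for x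
  proof (rule partials_eqI)
    have "open (- K)"
      using K by (simp add: compact_imp_closed open_Compl)
    moreover have e: "((\<bullet>) (0 :: real^2)) = (\<lambda>h. 0)"
      by (simp add: fun_eq_iff)
    ultimately show "(f has_derivative (\<lambda>h. 0 \<bullet> h)) (at x)"
      using that K(2) unfolding e by (intro has_derivative_transform_within_open[OF has_derivative_const]) auto
  qed
  have "compact (partials f ` K)"
    by (intro compact_continuous_image C1_partials_continuous f K)
  then obtain B where B: "\<And>x. x \<in> K \<Longrightarrow> norm (partials f x) \<le> B"
    using compact_imp_bounded[of "partials f ` K"] by (auto simp: bounded_iff)
  have B': "norm (partials f x) \<le> \<bar>B\<bar>" for x
    using p0[of x] B[of x] by (cases "x \<in> K") auto
  obtain r where r: "\<And>x. x \<in> K \<Longrightarrow> norm x \<le> r"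
    using compact_imp_bounded[OF K(1)] by (auto simp: bounded_iff)
  define e where "e = (axis i 1 :: real^2)"
  have ne: "norm e = 1"
    by (simp add: e_def)
  define g where "g n x = (real n + 1) * (f (x + (1 / (real n + 1)) *\<^sub>R e) - f x)" for n x
  have lip: "\<bar>f (x + h) - f x\<bar> \<le> \<bar>B\<bar> * norm h" for x h
  proof -
    have "norm (f (x + h) - f x) \<le> \<bar>B\<bar> * norm (x + h - x)"
    proof (rule differentiable_bound[where S = UNIV and f' = "\<lambda>x h. partials f x \<bullet> h"])
      show "onorm ((\<bullet>) (partials f y)) \<le> \<bar>B\<bar>" for y
        by (rule onorm_le) (rule order_trans[OF _ mult_right_mono[OF B'[of y]]], auto simp: Cauchy_Schwarz_ineq2)
    qed (auto intro: C1_has_derivative f)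
    then show ?thesis
      by simp
  qed
  have fm [measurable]: "f \<in> borel_measurable borel"
    by (intro borel_measurable_continuous_onI C1_continuous f)
  have fc: "continuous_on UNIV f"
    by (rule C1_continuous[OF f])
  have "compact (f ` K)"
    by (intro compact_continuous_image C1_continuous f K)
  then obtain F where F: "\<And>x. x \<in> K \<Longrightarrow> norm (f x) \<le> F"
    using compact_imp_bounded[of "f ` K"] by (auto simp: bounded_iff)
  have fi: "integrable lborel f"
  proof (rule Bochner_Integration.integrable_bound)
    show "integrable lborel (\<lambda>x::real^2. F * indicator (cball 0 r) x)"
      using emeasure_bounded_finite[OF bounded_cball, of "0::real^2" r] by (intro integrable_mult_right integrable_real_indicator) auto
    show "AE x in lborel. norm (f x) \<le> norm (F * indicator (cball 0 r) x)"
    proof (intro AE_I2)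
      fix x
      show "norm (f x) \<le> norm (F * indicator (cball 0 r) x)"
        using F[of x] r[of x] K(2)[of x] by (cases "x \<in> K") auto
    qed
  qed simp
  have shift: "integrable lborel (\<lambda>x. f (x + h))" "(\<integral>x. f (x + h) \<partial>lborel) = (\<integral>x. f x \<partial>lborel)" for h
  proof -
    have eq: "lborel = distr lborel borel ((+) h)"
      using lborel_affine[of 1 h] by (simp add: density_1)
    have "integrable (distr lborel borel ((+) h)) f"
      using fi eq by simp
    then show "integrable lborel (\<lambda>x. f (x + h))"
      by (subst (asm) integrable_distr_eq) (auto simp: add.commute)
    have "(\<integral>x. f x \<partial>lborel) = (\<integral>x. f x \<partial>distr lborel borel ((+) h))"
      using eq by simp
    also have "\<dots> = (\<integral>x. f (x + h) \<partial>lborel)"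
      by (subst integral_distr) (auto simp: add.commute)
    finally show "(\<integral>x. f (x + h) \<partial>lborel) = (\<integral>x. f x \<partial>lborel)" ..
  qed
  have g0: "(\<integral>x. g n x \<partial>lborel) = 0" for n
    unfolding g_def using shift fi by simp
  have "(\<lambda>n. \<integral>x. g n x \<partial>lborel) \<longlonglongrightarrow> (\<integral>x. partials f x $ i \<partial>lborel)"
  proof (rule integral_dominated_convergence)
    show "integrable lborel (\<lambda>x::real^2. \<bar>B\<bar> * indicator (cball 0 (r + 1)) x)"
      using emeasure_bounded_finite[OF bounded_cball, of "0::real^2" "r + 1"] by (intro integrable_mult_right integrable_real_indicator) auto
    show "(\<lambda>x. partials f x $ i) \<in> borel_measurable lborel"
      using C1_partials_continuous[OF f, of UNIV] by (auto intro!: borel_measurable_continuous_onI continuous_intros)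
    show "g n \<in> borel_measurable lborel" for n
      unfolding g_def by measurable
    show "AE x in lborel. (\<lambda>n. g n x) \<longlonglongrightarrow> partials f x $ i"
    proof (intro AE_I2)
      fix x
      have "((\<lambda>s. f (x + s *\<^sub>R e)) has_real_derivative partials f x \<bullet> e) (at 0)"
      proof -
        have d: "((\<lambda>s. x + s *\<^sub>R e) has_derivative (\<lambda>s. s *\<^sub>R e)) (at 0)"
          by (rule derivative_eq_intros refl | simp)+
        have "(f has_derivative (\<lambda>h. partials f x \<bullet> h)) (at (x + 0 *\<^sub>R e))"
          using C1_has_derivative[OF f, of x] by simp
        from has_derivative_compose[OF d this] show ?thesis
          by (simp add: has_field_derivative_def mult.commute[of _ "partials f x \<bullet> e"])
      qed
      then have D: "((\<lambda>s. (f (x + s *\<^sub>R e) - f x) / s) \<longlongrightarrow> partials f x $ i) (at 0)"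
        by (simp add: DERIV_def e_def inner_axis)
      have "(\<lambda>n. 1 / (real n + 1)) \<longlonglongrightarrow> 0"
        using LIMSEQ_inverse_real_of_nat by (simp add: inverse_eq_divide add.commute)
      then have "filterlim (\<lambda>n. 1 / (real n + 1)) (at 0) sequentially"
        by (auto simp: filterlim_at eventually_sequentially)
      from filterlim_compose[OF D this] show "(\<lambda>n. g n x) \<longlonglongrightarrow> partials f x $ i"
        by (simp add: g_def mult.commute)
    qed
    show "AE x in lborel. norm (g n x) \<le> \<bar>B\<bar> * indicator (cball 0 (r + 1)) x" for n
    proof (intro AE_I2)
      fix x :: "real^2"
      define h where "h = (1 / (real n + 1)) *\<^sub>R e"
      have h: "norm h = 1 / (real n + 1)"
        by (simp add: h_def ne)
      have h1: "norm h \<le> 1"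
        by (simp add: h field_simps)
      show "norm (g n x) \<le> \<bar>B\<bar> * indicator (cball 0 (r + 1)) x"
      proof (cases "x \<in> cball 0 (r + 1)")
        case True
        have "\<bar>g n x\<bar> = (real n + 1) * \<bar>f (x + h) - f x\<bar>"
          by (simp add: g_def h_def abs_mult)
        also have "\<dots> \<le> (real n + 1) * (\<bar>B\<bar> * norm h)"
          by (intro mult_left_mono lip) auto
        also have "\<dots> = \<bar>B\<bar>"
          by (simp add: h)
        finally show ?thesis
          using True by simp
      next
        case False
        then have "norm x > r + 1"
          by simp
        moreover have "norm (x + h) \<ge> norm x - norm h"
          using norm_triangle_ineq4[of "x + h" h] by simp
        ultimately have "x \<notin> K" "x + h \<notin> K"
          using r[of x] r[of "x + h"] h1 by auto
        then show ?thesis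
          using K(2) by (simp add: g_def h_def[symmetric] del: One_nat_def)
      qed
    qed
  qed
  then show ?thesis
    by (simp add: g0 LIMSEQ_const_iff)
qed

text \<open>Integration by parts is the product rule for \<open>f * \<phi>\<close>, whose derivative
  has integral 0 because \<open>\<phi>\<close> has compact support.\<close>

lemma C1_weak_diff:
  assumes f: "C1 f"
  shows "weak_diff (ball 0 R) f (partials f)"
  unfolding weak_diff_def
proof (intro allI impI)
  fix \<phi> i assume "C1_test (ball 0 R) \<phi>"
  then obtain K where \<phi>: "C1 \<phi>" and K: "compact K" "K \<subseteq> ball 0 R" "\<And>x. x \<notin> K \<Longrightarrow> \<phi> x = 0"
    unfolding C1_test_def by blast
  have i: "integrable (disk R) (\<lambda>x. f x * partials \<phi> x $ i)" "integrable (disk R) (\<lambda>x. partials f x $ i * \<phi> x)"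
    by (intro L2_mult_integrable C1_L2 C1_partials_L2 f \<phi>)+
  have pm: "(\<lambda>x. partials (\<lambda>x. f x * \<phi> x) x $ i) \<in> borel_measurable borel"
    by (intro borel_measurable_continuous_onI continuous_intros C1_partials_continuous C1_mult f \<phi>)
  have p0: "partials (\<lambda>x. f x * \<phi> x) x = 0" if "x \<notin> K" for x
  proof (rule partials_eqI)
    have "open (- K)"
      using K by (simp add: compact_imp_closed open_Compl)
    moreover have e: "((\<bullet>) (0 :: real^2)) = (\<lambda>h. 0)"
      by (simp add: fun_eq_iff)
    ultimately show "((\<lambda>x. f x * \<phi> x) has_derivative (\<lambda>h. 0 \<bullet> h)) (at x)"
      using that K(3) unfolding e by (intro has_derivative_transform_within_open[OF has_derivative_const]) auto
  qed
  have "(\<integral>x. f x * partials \<phi> x $ i \<partial>disk R) + (\<integral>x. partials f x $ i * \<phi> x \<partial>disk R)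
      = (\<integral>x. partials (\<lambda>x. f x * \<phi> x) x $ i \<partial>disk R)"
    unfolding C1_mult(2)[OF f \<phi>] using i by (simp add: mult.commute)
  also have "\<dots> = (\<integral>x. indicator (ball 0 R) x *\<^sub>R partials (\<lambda>x. f x * \<phi> x) x $ i \<partial>lebesgue)"
    by (rule integral_restrict_space) simp
  also have "\<dots> = (\<integral>x. partials (\<lambda>x. f x * \<phi> x) x $ i \<partial>lebesgue)"
  proof (intro Bochner_Integration.integral_cong refl)
    fix x
    show "indicator (ball 0 R) x *\<^sub>R partials (\<lambda>x. f x * \<phi> x) x $ i = partials (\<lambda>x. f x * \<phi> x) x $ i"
      using subsetD[OF K(2), of x] p0[of x] by (cases "x \<in> K") (simp_all add: indicator_def)
  qed
  also have "\<dots> = (\<integral>x. partials (\<lambda>x. f x * \<phi> x) x $ i \<partial>lborel)"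
    using pm by (intro integral_completion) simp
  also have "\<dots> = 0"
    by (rule C1_compact_support_integral_partials[OF C1_mult(1)[OF f \<phi>] K(1)]) (simp add: K(3))
  finally show "(\<integral>x. f x * partials \<phi> x $ i \<partial>disk R) = - (\<integral>x. partials f x $ i * \<phi> x \<partial>disk R)"
    by simp
qed

text \<open>The common form of the three geometries. Continuity and positivity of \<open>w\<close>
  on the closed disk bound it between positive constants, which makes the function spaces flat;
  constancy on the circle makes length a constant multiple of the angle.\<close>

locale conformal_disk =
  fixes g :: "real^2 \<Rightarrow> real^2^2" and R :: real and w :: "real^2 \<Rightarrow> real" and b :: real
  assumes R: "R > 0"
    and conformal: "norm z \<le> R \<Longrightarrow> g z = mat ((w z)\<^sup>2)"
    and w_continuous: "continuous_on (cball 0 R) w"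
    and w_pos: "norm z \<le> R \<Longrightarrow> w z > 0"
    and w_boundary: "norm z = R \<Longrightarrow> w z = b"
begin

lemma b_pos: "b > 0"
  using w_pos[of "circle_curve R 0"] w_boundary[of "circle_curve R 0"] R by (simp add: norm_circle_curve)

lemma w_measurable [measurable]: "w \<in> borel_measurable (disk R)"
  by (intro continuous_imp_measurable_on_sets_lebesgue continuous_on_subset[OF w_continuous]) auto

lemma w_bounds: obtains m M where "m > 0" "M > 0" "\<And>x. x \<in> space (disk R) \<Longrightarrow> m \<le> (w x)\<^sup>2 \<and> (w x)\<^sup>2 \<le> M"
proof -
  have c: "continuous_on (cball 0 R) (\<lambda>x. (w x)\<^sup>2)"
    by (intro continuous_intros w_continuous)
  have ne: "cball (0::real^2) R \<noteq> {}"
    using R by simp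
  obtain x0 where x0: "x0 \<in> cball 0 R" "\<And>x. x \<in> cball 0 R \<Longrightarrow> (w x0)\<^sup>2 \<le> (w x)\<^sup>2"
    using continuous_attains_inf[OF compact_cball ne c] by blast
  obtain x1 where x1: "x1 \<in> cball 0 R" "\<And>x. x \<in> cball 0 R \<Longrightarrow> (w x)\<^sup>2 \<le> (w x1)\<^sup>2"
    using continuous_attains_sup[OF compact_cball ne c] by blast
  show ?thesis
  proof (rule that[of "(w x0)\<^sup>2" "(w x1)\<^sup>2"])
    show "(w x0)\<^sup>2 > 0" "(w x1)\<^sup>2 > 0"
      using w_pos[of x0] w_pos[of x1] x0(1) x1(1) by auto
    show "(w x0)\<^sup>2 \<le> (w x)\<^sup>2 \<and> (w x)\<^sup>2 \<le> (w x1)\<^sup>2" if "x \<in> space (disk R)" for x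
      using x0(2)[of x] x1(2)[of x] that by auto
  qed
qed

lemma area_measure_eq: "area_measure g (ball 0 R) = density (disk R) (\<lambda>x. ennreal ((w x)\<^sup>2))"
proof -
  have eq: "sqrt (det (g x)) = (w x)\<^sup>2" if "x \<in> space (disk R)" for x
  proof -
    have "det (g x) = ((w x)\<^sup>2)\<^sup>2"
      using that by (simp add: conformal det_2 mat_def power2_eq_square)
    then show ?thesis
      by (simp only: real_sqrt_abs abs_power2)
  qed
  have m1: "(\<lambda>x. ennreal ((w x)\<^sup>2)) \<in> borel_measurable (disk R)"
    by measurable
  have m2: "(\<lambda>x. ennreal (sqrt (det (g x)))) \<in> borel_measurable (disk R)"
    using m1 by (subst measurable_cong[where g = "\<lambda>x. ennreal ((w x)\<^sup>2)"]) (simp_all add: eq)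
  show ?thesis
    unfolding area_measure_def by (rule density_cong[OF m2 m1]) (auto intro!: AE_I2 simp: eq)
qed

lemma borel_measurable_area: "borel_measurable (area_measure g (ball 0 R)) = borel_measurable (disk R)"
  unfolding area_measure_eq by (rule measurable_cong_sets) auto

lemma AE_area: "(AE x in area_measure g (ball 0 R). P x) \<longleftrightarrow> (AE x in disk R. P x)"
proof -
  have "(AE x in area_measure g (ball 0 R). P x) \<longleftrightarrow> (AE x in disk R. 0 < ennreal ((w x)\<^sup>2) \<longrightarrow> P x)"
    unfolding area_measure_eq by (rule AE_density) measurable
  also have "\<dots> \<longleftrightarrow> (AE x in disk R. P x)"
    using w_pos by (intro AE_cong) (auto simp: less_imp_neq[symmetric])
  finally show ?thesis .
qed

lemma integral_area:
  fixes f :: "real^2 \<Rightarrow> real"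
  assumes "f \<in> borel_measurable (disk R)"
  shows "(\<integral>x. f x \<partial>area_measure g (ball 0 R)) = (\<integral>x. (w x)\<^sup>2 * f x \<partial>disk R)"
    and "integrable (area_measure g (ball 0 R)) f \<longleftrightarrow> integrable (disk R) (\<lambda>x. (w x)\<^sup>2 * f x)"
  unfolding area_measure_eq using assms by (auto simp: integral_density integrable_density)

lemma integrable_weight_iff:
  fixes f :: "real^2 \<Rightarrow> real"
  assumes f [measurable]: "f \<in> borel_measurable (disk R)"
  shows "integrable (disk R) (\<lambda>x. (w x)\<^sup>2 * f x) \<longleftrightarrow> integrable (disk R) f"
proof -
  obtain m M where m: "m > 0" and M: "M > 0" and b: "\<And>x. x \<in> space (disk R) \<Longrightarrow> m \<le> (w x)\<^sup>2 \<and> (w x)\<^sup>2 \<le> M"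
    using w_bounds by blast
  show ?thesis
  proof
    assume i: "integrable (disk R) (\<lambda>x. (w x)\<^sup>2 * f x)"
    show "integrable (disk R) f"
    proof (rule Bochner_Integration.integrable_bound)
      show "integrable (disk R) (\<lambda>x. (1 / m) * ((w x)\<^sup>2 * f x))"
        using i by (rule integrable_mult_right)
      show "AE x in disk R. norm (f x) \<le> norm (1 / m * ((w x)\<^sup>2 * f x))"
      proof (intro AE_I2)
        fix x assume "x \<in> space (disk R)"
        then have "m * \<bar>f x\<bar> \<le> (w x)\<^sup>2 * \<bar>f x\<bar>"
          using b by (intro mult_right_mono) auto
        then show "norm (f x) \<le> norm (1 / m * ((w x)\<^sup>2 * f x))"
          using m by (simp add: abs_mult field_simps)
      qed
    qed simp
  next
    assume i: "integrable (disk R) f"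
    show "integrable (disk R) (\<lambda>x. (w x)\<^sup>2 * f x)"
    proof (rule Bochner_Integration.integrable_bound)
      show "integrable (disk R) (\<lambda>x. M * f x)"
        using i by (rule integrable_mult_right)
      show "AE x in disk R. norm ((w x)\<^sup>2 * f x) \<le> norm (M * f x)"
        using b M by (intro AE_I2) (simp add: abs_mult mult_right_mono)
    qed measurable
  qed
qed

lemma conorm2_eq:
  assumes "norm x \<le> R"
  shows "conorm2 g x p = p \<bullet> p / (w x)\<^sup>2"
proof -
  have w: "w x > 0"
    by (rule w_pos[OF assms])
  have "matrix_inv (mat ((w x)\<^sup>2) :: real^2^2) = mat (1 / (w x)\<^sup>2)"
  proof -
    let ?A = "mat ((w x)\<^sup>2) :: real^2^2" and ?B = "mat (1 / (w x)\<^sup>2) :: real^2^2"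
    have AB: "?A ** ?B = mat 1" "?B ** ?A = mat 1"
      using w by (auto simp: matrix_matrix_mult_def mat_def vec_eq_iff forall_2 sum_2)
    then have "?A ** matrix_inv ?A = mat 1 \<and> matrix_inv ?A ** ?A = mat 1"
      unfolding matrix_inv_def by (intro someI[of "\<lambda>X. ?A ** X = mat 1 \<and> X ** ?A = mat 1" ?B]) auto
    then have "?B ** (?A ** matrix_inv ?A) = ?B"
      by simp
    then show ?thesis
      by (simp add: matrix_mul_assoc AB)
  qed
  moreover have "(mat c :: real^2^2) *v p = c *\<^sub>R p" for c
    by (simp add: matrix_vector_mult_def mat_def vec_eq_iff forall_2 sum_2)
  ultimately show ?thesis
    using conformal[OF assms] by (simp add: conorm2_def)
qed

lemma conorm2_measurable:
  assumes [measurable]: "\<And>i. (\<lambda>x. p x $ i) \<in> borel_measurable (disk R)"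
  shows "(\<lambda>x. conorm2 g x (p x)) \<in> borel_measurable (disk R)"
proof (subst measurable_cong)
  show "conorm2 g x (p x) = (p x \<bullet> p x) / (w x)\<^sup>2" if "x \<in> space (disk R)" for x
    using that by (simp add: conorm2_eq)
  show "(\<lambda>x. (p x \<bullet> p x) / (w x)\<^sup>2) \<in> borel_measurable (disk R)"
    unfolding inner_real2 by measurable
qed

text \<open>Conformal invariance of the Dirichlet integral: in dimension two the area factor
  \<open>(w x)\<^sup>2\<close> is the inverse of the factor in the squared length of
  covectors.\<close>

lemma weight_conorm2: "x \<in> space (disk R) \<Longrightarrow> (w x)\<^sup>2 * conorm2 g x p = p \<bullet> p"
  using w_pos[of x] by (simp add: conorm2_eq)

lemma length_measure_eq: "length_measure g (circle_curve R) = density angles (\<lambda>t. ennreal (b * R))"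
proof -
  have "sqrt (vector_derivative (circle_curve R) (at t) \<bullet> (g (circle_curve R t) *v vector_derivative (circle_curve R) (at t))) = b * R" for t
  proof -
    have vd: "vector_derivative (circle_curve R) (at t) = vector [- R * sin t, R * cos t]"
      by (rule vector_derivative_at[OF has_vector_derivative_circle_curve(1)])
    have "norm (circle_curve R t) = R"
      using R by (simp add: norm_circle_curve)
    then have g: "g (circle_curve R t) = mat (b\<^sup>2)"
      using conformal[of "circle_curve R t"] w_boundary[of "circle_curve R t"] by simp
    have m: "(mat c :: real^2^2) *v p = c *\<^sub>R p" for c p
      by (simp add: matrix_vector_mult_def mat_def vec_eq_iff forall_2 sum_2)
    have "vector [- R * sin t, R * cos t] \<bullet> (vector [- R * sin t, R * cos t] :: real^2) = R\<^sup>2 * ((sin t)\<^sup>2 + (cos t)\<^sup>2)"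
      unfolding inner_real2 by (simp add: power2_eq_square) (simp only: algebra_simps)
    then have "vector [- R * sin t, R * cos t] \<bullet> (g (circle_curve R t) *v (vector [- R * sin t, R * cos t] :: real^2)) = (b * R)\<^sup>2"
      unfolding g m by (simp add: power_mult_distrib)
    then show ?thesis
      unfolding vd using b_pos R by simp
  qed
  then show ?thesis
    unfolding length_measure_def by simp
qed

lemma integral_length:
  fixes f :: "real \<Rightarrow> real"
  assumes "f \<in> borel_measurable angles"
  shows "(\<integral>t. f t \<partial>length_measure g (circle_curve R)) = b * R * (\<integral>t. f t \<partial>angles)"
    and "integrable (length_measure g (circle_curve R)) f \<longleftrightarrow> integrable angles f"
  unfolding length_measure_eq using assms b_pos R by (auto simp: integral_density integrable_density)

lemma borel_measurable_length: "borel_measurable (length_measure g (circle_curve R)) = borel_measurable angles"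
  unfolding length_measure_eq by (rule measurable_cong_sets) auto

lemma V2_measurable: "p \<in> borel_measurable (disk R) \<longleftrightarrow> (\<forall>i. (\<lambda>x. (p x :: real^2) $ i) \<in> borel_measurable (disk R))"
proof -
  have B: "(Basis :: (real^2) set) = range (\<lambda>i. axis i 1)"
    by (auto simp: Basis_vec_def)
  show ?thesis
    unfolding borel_measurable_euclidean_space[of p] B by (simp add: inner_axis)
qed

text \<open>Two-sided bounds on \<open>w\<close> make the Riemannian space coincide with the flat
  one. From here on the metric enters only through the quotient.\<close>

lemma H1_pair_iff: "H1_pair g (ball 0 R) u p \<longleftrightarrow> L2 (disk R) u \<and> V2 (disk R) p \<and> weak_diff (ball 0 R) u p"
proof -
  have u: "integrable (area_measure g (ball 0 R)) (\<lambda>x. (u x)\<^sup>2) \<longleftrightarrow> integrable (disk R) (\<lambda>x. (u x)\<^sup>2)"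
    if "u \<in> borel_measurable (disk R)"
    using that by (simp add: integral_area(2) integrable_weight_iff)
  have p: "integrable (area_measure g (ball 0 R)) (\<lambda>x. conorm2 g x (p x)) \<longleftrightarrow> V2 (disk R) p"
    if pm: "p \<in> borel_measurable (disk R)"
  proof -
    have [measurable]: "(\<lambda>x. p x $ i) \<in> borel_measurable (disk R)" for i
      using pm by (simp add: V2_measurable)
    have cm: "(\<lambda>x. conorm2 g x (p x)) \<in> borel_measurable (disk R)"
      by (intro conorm2_measurable) measurable
    have "integrable (area_measure g (ball 0 R)) (\<lambda>x. conorm2 g x (p x)) \<longleftrightarrow> integrable (disk R) (\<lambda>x. p x \<bullet> p x)"
      unfolding integral_area(2)[OF cm] by (intro Bochner_Integration.integrable_cong) (simp_all add: weight_conorm2 del: space_restrict_space)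
    also have "\<dots> \<longleftrightarrow> V2 (disk R) p"
    proof
      assume i: "integrable (disk R) (\<lambda>x. p x \<bullet> p x)"
      have "integrable (disk R) (\<lambda>x. (p x $ j)\<^sup>2)" for j
      proof (rule Bochner_Integration.integrable_bound[OF i])
        have "(p x $ j)\<^sup>2 \<le> p x \<bullet> p x" for x
          using power_mono[OF component_le_norm_cart[of "p x" j], of 2] by (simp add: power2_norm_eq_inner)
        then show "AE x in disk R. norm ((p x $ j)\<^sup>2) \<le> norm (p x \<bullet> p x)"
          by (intro AE_I2) simp
      qed measurable
      then show "V2 (disk R) p"
        by (simp add: V2_def L2_def)
    qed (rule V2_integrable)
    finally show ?thesis .
  qed
  show ?thesis
    unfolding H1_pair_def borel_measurable_area using u p V2_measurable[of p] by (auto simp: L2_def V2_def)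
qed

lemma integral_conorm2_area:
  assumes "V2 (disk R) p"
  shows "(\<integral>x. conorm2 g x (p x) \<partial>area_measure g (ball 0 R)) = (\<integral>x. p x \<bullet> p x \<partial>disk R)"
proof -
  have [measurable]: "(\<lambda>x. p x $ i) \<in> borel_measurable (disk R)" for i
    using assms by (simp add: V2_def L2_def)
  have cm: "(\<lambda>x. conorm2 g x (p x)) \<in> borel_measurable (disk R)"
    by (intro conorm2_measurable) measurable
  show ?thesis
    unfolding integral_area(1)[OF cm] by (intro Bochner_Integration.integral_cong) (simp_all add: weight_conorm2 del: space_restrict_space)
qed

end

section \<open>Admissible levels and the min-max value\<close>

text \<open>On \<open>C1\<close> functions this is the numerator of the Robin quotient if
  \<open>a\<close> is the Robin parameter times the length per unit angle.\<close>

definition energy :: "real \<Rightarrow> real \<Rightarrow> (real^2 \<Rightarrow> real) \<Rightarrow> real" where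
  "energy R a \<phi> = (\<integral>x. partials \<phi> x \<bullet> partials \<phi> x \<partial>disk R) + a * (\<integral>t. (\<phi> (circle_curve R t))\<^sup>2 \<partial>angles)"

definition mass :: "real \<Rightarrow> (real^2 \<Rightarrow> real) \<Rightarrow> (real^2 \<Rightarrow> real) \<Rightarrow> real" where
  "mass R \<rho> \<phi> = (\<integral>x. \<rho> x * (\<phi> x)\<^sup>2 \<partial>disk R)"

text \<open>\<open>M\<close> bounds the Rayleigh quotient on some \<open>k\<close>-dimensional space
  of \<open>C1\<close> functions. Positivity of the mass for nonzero coefficients encodes
  independence, and clearing the denominator avoids both a quotient and a supremum.\<close>

definition admissible :: "real \<Rightarrow> real \<Rightarrow> (real^2 \<Rightarrow> real) \<Rightarrow> nat \<Rightarrow> real \<Rightarrow> bool" where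
  "admissible R a \<rho> k M \<longleftrightarrow> (\<exists>\<phi> :: nat \<Rightarrow> real^2 \<Rightarrow> real. (\<forall>i<k. C1 (\<phi> i)) \<and>
     (\<forall>c. (\<exists>i<k. c i \<noteq> 0) \<longrightarrow>
        0 < mass R \<rho> (\<lambda>x. \<Sum>i<k. c i * \<phi> i x) \<and>
        energy R a (\<lambda>x. \<Sum>i<k. c i * \<phi> i x) \<le> M * mass R \<rho> (\<lambda>x. \<Sum>i<k. c i * \<phi> i x)))"

lemma energy_nonneg: "a \<ge> 0 \<Longrightarrow> energy R a \<phi> \<ge> 0"
  by (simp add: energy_def)

lemma admissible_nonneg:
  assumes "admissible R a \<rho> k M" "k \<ge> 1" "a \<ge> 0"
  shows "M \<ge> 0"
proof -
  obtain \<phi> where *: "\<And>c :: nat \<Rightarrow> real. \<exists>i<k. c i \<noteq> 0 \<Longrightarrow> 0 < mass R \<rho> (\<lambda>x. \<Sum>i<k. c i * \<phi> i x) \<and>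
        energy R a (\<lambda>x. \<Sum>i<k. c i * \<phi> i x) \<le> M * mass R \<rho> (\<lambda>x. \<Sum>i<k. c i * \<phi> i x)"
    using assms(1) unfolding admissible_def by blast
  have "\<exists>i<k. (1::real) \<noteq> 0"
    using assms(2) by (intro exI[of _ 0]) simp
  then have "0 < mass R \<rho> (\<lambda>x. \<Sum>i<k. 1 * \<phi> i x) \<and> energy R a (\<lambda>x. \<Sum>i<k. 1 * \<phi> i x) \<le> M * mass R \<rho> (\<lambda>x. \<Sum>i<k. 1 * \<phi> i x)"
    by (rule *)
  with energy_nonneg[OF assms(3), of R "\<lambda>x. \<Sum>i<k. 1 * \<phi> i x"] show ?thesis
    by (smt (verit) mult_neg_pos)
qed

section \<open>Linear combinations of weak differentials, energies and traces\<close>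

lemma weak_diff_lincomb:
  assumes "\<And>i. i < k \<Longrightarrow> L2 (disk R) (u i)" "\<And>i. i < k \<Longrightarrow> V2 (disk R) (p i)"
    and wd: "\<And>i. i < k \<Longrightarrow> weak_diff (ball 0 R) (u i) (p i)"
  shows "weak_diff (ball 0 R) (\<lambda>x. \<Sum>i<k. c i * u i x) (\<lambda>x. \<Sum>i<(k::nat). c i *\<^sub>R p i x)"
  unfolding weak_diff_def
proof (intro allI impI)
  fix \<phi> j assume t: "C1_test (ball 0 R) \<phi>"
  then have \<phi>: "C1 \<phi>"
    by (simp add: C1_test_def)
  have i: "integrable (disk R) (\<lambda>x. c i * (u i x * partials \<phi> x $ j))" "integrable (disk R) (\<lambda>x. c i * (p i x $ j * \<phi> x))" if "i < k" for i
    by (intro integrable_mult_right L2_mult_integrable assms V2_nth C1_L2 C1_partials_L2 \<phi> that)+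
  have "(\<integral>x. (\<Sum>i<k. c i * u i x) * partials \<phi> x $ j \<partial>disk R) = (\<integral>x. (\<Sum>i<k. c i * (u i x * partials \<phi> x $ j)) \<partial>disk R)"
    by (simp add: sum_distrib_right mult.assoc)
  also have "\<dots> = (\<Sum>i<k. c i * (\<integral>x. u i x * partials \<phi> x $ j \<partial>disk R))"
    using i by (subst Bochner_Integration.integral_sum) auto
  also have "\<dots> = (\<Sum>i<k. c i * - (\<integral>x. p i x $ j * \<phi> x \<partial>disk R))"
    using wd t by (intro sum.cong refl arg_cong2[where f = "(*)"]) (simp add: weak_diff_def)
  also have "\<dots> = - (\<Sum>i<k. \<integral>x. c i * (p i x $ j * \<phi> x) \<partial>disk R)"
    by (simp add: sum_negf)
  also have "(\<Sum>i<k. \<integral>x. c i * (p i x $ j * \<phi> x) \<partial>disk R) = (\<integral>x. (\<Sum>i<k. c i * (p i x $ j * \<phi> x)) \<partial>disk R)"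
    using i by (subst Bochner_Integration.integral_sum) auto
  also have "\<dots> = (\<integral>x. (\<Sum>i<k. c i *\<^sub>R p i x) $ j * \<phi> x \<partial>disk R)"
    by (simp add: sum_distrib_right mult.assoc)
  finally show "(\<integral>x. (\<Sum>i<k. c i * u i x) * partials \<phi> x $ j \<partial>disk R) = - (\<integral>x. (\<Sum>i<k. c i *\<^sub>R p i x) $ j * \<phi> x \<partial>disk R)" .
qed

lemma weak_diff_cong_AE:
  assumes "weak_diff (ball 0 R) u p" "AE x in disk R. u x = v x" "u \<in> borel_measurable (disk R)" "v \<in> borel_measurable (disk R)"
  shows "weak_diff (ball 0 R) v p"
  unfolding weak_diff_def
proof (intro allI impI)
  fix \<phi> j assume t: "C1_test (ball 0 R) \<phi>"
  then have [measurable]: "(\<lambda>x. partials \<phi> x $ j) \<in> borel_measurable (disk R)"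
    using C1_partials_L2 by (auto simp: C1_test_def L2_def)
  have [measurable]: "u \<in> borel_measurable (disk R)" "v \<in> borel_measurable (disk R)"
    by fact+
  have "(\<integral>x. v x * partials \<phi> x $ j \<partial>disk R) = (\<integral>x. u x * partials \<phi> x $ j \<partial>disk R)"
    by (intro integral_cong_AE) (use assms(2) in auto)
  then show "(\<integral>x. v x * partials \<phi> x $ j \<partial>disk R) = - (\<integral>x. p x $ j * \<phi> x \<partial>disk R)"
    using assms(1) t by (simp add: weak_diff_def)
qed

lemma V2_lincomb_integral:
  assumes "\<And>i. i < k \<Longrightarrow> V2 M (p i)"
  shows "(\<integral>x. (\<Sum>i<k. c i *\<^sub>R p i x) \<bullet> (\<Sum>i<(k::nat). c i *\<^sub>R p i x) \<partial>M)
    = (\<integral>x. (\<Sum>i<k. c i * p i x $ 1)\<^sup>2 \<partial>M) + (\<integral>x. (\<Sum>i<k. c i * p i x $ 2)\<^sup>2 \<partial>M)"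
  by (subst V2_integral[OF V2_lincomb[OF assms]]) simp_all

lemma C1_energy_lincomb:
  assumes "\<And>i. i < k \<Longrightarrow> C1 (\<phi> i)"
  shows "energy R a (\<lambda>x. \<Sum>i<(k::nat). c i * \<phi> i x)
    = (\<integral>x. (\<Sum>i<k. c i * partials (\<phi> i) x $ 1)\<^sup>2 \<partial>disk R) + (\<integral>x. (\<Sum>i<k. c i * partials (\<phi> i) x $ 2)\<^sup>2 \<partial>disk R)
      + a * (\<integral>t. (\<Sum>i<k. c i * \<phi> i (circle_curve R t))\<^sup>2 \<partial>angles)"
proof -
  have pe: "partials (\<lambda>x. \<Sum>i<k. c i * \<phi> i x) = (\<lambda>x. \<Sum>i<k. c i *\<^sub>R partials (\<phi> i) x)"
    by (rule C1_lincomb(2)) (rule assms)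
  show ?thesis
    unfolding energy_def pe by (subst V2_lincomb_integral) (auto intro: C1_partials_V2 assms)
qed

lemma dist_H1_lincomb:
  assumes u: "\<And>i. i < k \<Longrightarrow> L2 (disk R) (u i)" and p: "\<And>i. i < k \<Longrightarrow> V2 (disk R) (p i)" and \<phi>: "\<And>i. i < k \<Longrightarrow> C1 (\<phi> i)"
  shows "dist_H1 R (\<lambda>x. \<Sum>i<k. c i * u i x) (\<lambda>x. \<Sum>i<k. c i *\<^sub>R p i x) (\<lambda>x. \<Sum>i<(k::nat). c i * \<phi> i x)
     \<le> (\<Sum>i<k. (c i)\<^sup>2) * (\<Sum>i<k. dist_H1 R (u i) (p i) (\<phi> i))"
proof -
  have pe: "partials (\<lambda>x. \<Sum>i<k. c i * \<phi> i x) = (\<lambda>x. \<Sum>i<k. c i *\<^sub>R partials (\<phi> i) x)"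
    by (rule C1_lincomb(2)) (rule \<phi>)
  have d: "V2 (disk R) (\<lambda>x. partials (\<phi> i) x - p i x)" if "i < k" for i
    by (intro V2_diff C1_partials_V2 \<phi> p that)
  have "dist_H1 R (\<lambda>x. \<Sum>i<k. c i * u i x) (\<lambda>x. \<Sum>i<k. c i *\<^sub>R p i x) (\<lambda>x. \<Sum>i<k. c i * \<phi> i x)
     = (\<integral>x. (\<Sum>i<k. c i * (\<phi> i x - u i x))\<^sup>2 \<partial>disk R)
       + (\<integral>x. (\<Sum>i<k. c i *\<^sub>R (partials (\<phi> i) x - p i x)) \<bullet> (\<Sum>i<k. c i *\<^sub>R (partials (\<phi> i) x - p i x)) \<partial>disk R)"
    unfolding dist_H1_def pe
    by (simp add: right_diff_distrib scaleR_diff_right sum_subtractf)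
  also have "\<dots> = (\<integral>x. (\<Sum>i<k. c i * (\<phi> i x - u i x))\<^sup>2 \<partial>disk R)
      + ((\<integral>x. (\<Sum>i<k. c i * (partials (\<phi> i) x $ 1 - p i x $ 1))\<^sup>2 \<partial>disk R) + (\<integral>x. (\<Sum>i<k. c i * (partials (\<phi> i) x $ 2 - p i x $ 2))\<^sup>2 \<partial>disk R))"
    by (subst V2_lincomb_integral[OF d]) simp_all
  also have "\<dots> \<le> (\<Sum>i<k. (c i)\<^sup>2) * (\<Sum>i<k. \<integral>x. (\<phi> i x - u i x)\<^sup>2 \<partial>disk R)
      + ((\<Sum>i<k. (c i)\<^sup>2) * (\<Sum>i<k. \<integral>x. (partials (\<phi> i) x $ 1 - p i x $ 1)\<^sup>2 \<partial>disk R) + (\<Sum>i<k. (c i)\<^sup>2) * (\<Sum>i<k. \<integral>x. (partials (\<phi> i) x $ 2 - p i x $ 2)\<^sup>2 \<partial>disk R))"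
    by (intro add_mono L2_lincomb_bound L2_diff C1_L2 C1_partials_L2 V2_nth u p \<phi>)
  also have "\<dots> = (\<Sum>i<k. (c i)\<^sup>2) * (\<Sum>i<k. dist_H1 R (u i) (p i) (\<phi> i))"
  proof -
    have "dist_H1 R (u i) (p i) (\<phi> i) = (\<integral>x. (\<phi> i x - u i x)\<^sup>2 \<partial>disk R) + ((\<integral>x. (partials (\<phi> i) x $ 1 - p i x $ 1)\<^sup>2 \<partial>disk R) + (\<integral>x. (partials (\<phi> i) x $ 2 - p i x $ 2)\<^sup>2 \<partial>disk R))" if "i < k" for i
      unfolding dist_H1_def by (subst V2_integral[OF d[OF that]]) simp
    then show ?thesis
      by (simp add: sum.distrib distrib_left)
  qed
  finally show ?thesis .
qed

text \<open>A quantitative version of \<open>is_trace\<close>: the estimate against every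
  \<open>C1\<close> function is what \<open>trace_exists\<close> provides. It forces convergence of
  boundary values along every approximating sequence, not just along one.\<close>

definition has_trace :: "real \<Rightarrow> (real^2 \<Rightarrow> real) \<Rightarrow> (real^2 \<Rightarrow> real^2) \<Rightarrow> (real \<Rightarrow> real) \<Rightarrow> bool" where
  "has_trace R u p W \<longleftrightarrow> L2 angles W \<and>
     (\<forall>\<phi>. C1 \<phi> \<longrightarrow> (\<integral>t. (\<phi> (circle_curve R t) - W t)\<^sup>2 \<partial>angles) \<le> (4 / R\<^sup>2 + 1) * dist_H1 R u p \<phi>)"

lemma has_trace_tendsto:
  assumes W: "has_trace R u p W" and \<phi>: "\<And>m. C1 (\<phi> m)" and lim: "(\<lambda>m. dist_H1 R u p (\<phi> m)) \<longlonglongrightarrow> 0"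
  shows "(\<lambda>m. \<integral>t. (\<phi> m (circle_curve R t) - W t)\<^sup>2 \<partial>angles) \<longlonglongrightarrow> 0"
proof (rule tendsto_sandwich[OF _ _ tendsto_const])
  show "(\<lambda>m. (4 / R\<^sup>2 + 1) * dist_H1 R u p (\<phi> m)) \<longlonglongrightarrow> 0"
    using tendsto_mult_right_zero[OF lim] by simp
  show "\<forall>\<^sub>F m in sequentially. (\<integral>t. (\<phi> m (circle_curve R t) - W t)\<^sup>2 \<partial>angles) \<le> (4 / R\<^sup>2 + 1) * dist_H1 R u p (\<phi> m)"
    using W \<phi> by (intro always_eventually allI) (simp add: has_trace_def)
qed simp

lemma has_trace_unique:
  assumes W: "has_trace R u p W" and W': "L2 angles W'" and \<phi>: "\<And>m. C1 (\<phi> m)"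
    and lim: "(\<lambda>m. dist_H1 R u p (\<phi> m)) \<longlonglongrightarrow> 0" "(\<lambda>m. \<integral>t. (\<phi> m (circle_curve R t) - W' t)\<^sup>2 \<partial>angles) \<longlonglongrightarrow> 0"
  shows "AE t in angles. W t = W' t"
  by (rule L2_limit_unique[OF _ W' _ has_trace_tendsto[OF W \<phi> lim(1)] lim(2)])
    (use W in \<open>auto simp: has_trace_def intro!: continuous_circle_L2 C1_continuous \<phi>\<close>)

lemma dist_H1_cong_AE:
  assumes "AE x in disk R. u x = v x" "AE x in disk R. p x = q x" "C1 \<phi>"
    and u: "L2 (disk R) u" "L2 (disk R) v" and p: "V2 (disk R) p" "V2 (disk R) q"
  shows "dist_H1 R u p \<phi> = dist_H1 R v q \<phi>"
proof -
  have [measurable]: "u \<in> borel_measurable (disk R)" "v \<in> borel_measurable (disk R)" "\<phi> \<in> borel_measurable (disk R)"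
    using u C1_L2[OF assms(3)] by (auto simp: L2_def)
  have [measurable]: "(\<lambda>x. p x $ i) \<in> borel_measurable (disk R)" "(\<lambda>x. q x $ i) \<in> borel_measurable (disk R)" "(\<lambda>x. partials \<phi> x $ i) \<in> borel_measurable (disk R)" for i
    using p C1_partials_L2[OF assms(3)] by (auto simp: L2_def V2_def)
  have "(\<integral>x. (\<phi> x - u x)\<^sup>2 \<partial>disk R) = (\<integral>x. (\<phi> x - v x)\<^sup>2 \<partial>disk R)"
    by (intro integral_cong_AE) (use assms(1) in auto)
  moreover have "(\<integral>x. (partials \<phi> x - p x) \<bullet> (partials \<phi> x - p x) \<partial>disk R) = (\<integral>x. (partials \<phi> x - q x) \<bullet> (partials \<phi> x - q x) \<partial>disk R)"
    by (intro integral_cong_AE) (use assms(2) in \<open>auto simp: inner_real2\<close>)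
  ultimately show ?thesis
    by (simp add: dist_H1_def)
qed

text \<open>Combinations of the mollified \<open>u i\<close> approximate \<open>v\<close> in
  \<open>H1\<close>, and their boundary values approximate the combination of the
  \<open>W i\<close>. Uniqueness of the trace of \<open>v\<close> does the rest.\<close>

lemma has_trace_lincomb:
  assumes R: "R > 0" and u: "\<And>i. i < k \<Longrightarrow> L2 (disk R) (u i)" and p: "\<And>i. i < k \<Longrightarrow> V2 (disk R) (p i)"
    and wd: "\<And>i. i < k \<Longrightarrow> weak_diff (ball 0 R) (u i) (p i)" and W: "\<And>i. i < k \<Longrightarrow> has_trace R (u i) (p i) (W i)"
    and v: "L2 (disk R) v" "AE x in disk R. v x = (\<Sum>i<k. c i * u i x)" and q: "V2 (disk R) q" "AE x in disk R. q x = (\<Sum>i<(k::nat). c i *\<^sub>R p i x)"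
    and W': "has_trace R v q W'"
  shows "AE t in angles. W' t = (\<Sum>i<k. c i * W i t)"
proof (rule has_trace_unique[OF W'])
  define \<phi> where "\<phi> m x = (\<Sum>i<k. c i * mollify R m (u i) x)" for m x
  show "L2 angles (\<lambda>t. \<Sum>i<k. c i * W i t)"
    using W by (intro L2_sum L2_scale) (auto simp: has_trace_def)
  have C: "C1 (mollify R m (u i))" if "i < k" for i m
    by (intro C1_mollify u R that)
  show \<phi>: "C1 (\<phi> m)" for m
    unfolding \<phi>_def by (intro C1_lincomb C)
  have dl: "(\<lambda>m. (\<Sum>i<k. (c i)\<^sup>2) * (\<Sum>i<k. dist_H1 R (u i) (p i) (mollify R m (u i)))) \<longlonglongrightarrow> (\<Sum>i<k. (c i)\<^sup>2) * (\<Sum>i<k. 0)"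
    by (intro tendsto_intros tendsto_sum C1_dense_H1 u p wd R) auto
  show "(\<lambda>m. dist_H1 R v q (\<phi> m)) \<longlonglongrightarrow> 0"
  proof (rule tendsto_sandwich[OF _ _ tendsto_const])
    show "\<forall>\<^sub>F m in sequentially. 0 \<le> dist_H1 R v q (\<phi> m)"
      by (simp add: dist_H1_def)
    have "dist_H1 R v q (\<phi> m) = dist_H1 R (\<lambda>x. \<Sum>i<k. c i * u i x) (\<lambda>x. \<Sum>i<k. c i *\<^sub>R p i x) (\<phi> m)" for m
      by (intro dist_H1_cong_AE v q \<phi> L2_sum L2_scale V2_lincomb u p) auto
    then show "\<forall>\<^sub>F m in sequentially. dist_H1 R v q (\<phi> m) \<le> (\<Sum>i<k. (c i)\<^sup>2) * (\<Sum>i<k. dist_H1 R (u i) (p i) (mollify R m (u i)))"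
      unfolding \<phi>_def using dist_H1_lincomb[OF u p C] by (intro always_eventually allI) simp
    show "(\<lambda>m. (\<Sum>i<k. (c i)\<^sup>2) * (\<Sum>i<k. dist_H1 R (u i) (p i) (mollify R m (u i)))) \<longlonglongrightarrow> 0"
      using dl by simp
  qed
  have WL: "L2 angles (W i)" if "i < k" for i
    using W[OF that] by (simp add: has_trace_def)
  have "(\<lambda>m. (\<Sum>i<k. (c i)\<^sup>2) * (\<Sum>i<k. \<integral>t. (mollify R m (u i) (circle_curve R t) - W i t)\<^sup>2 \<partial>angles)) \<longlonglongrightarrow> (\<Sum>i<k. (c i)\<^sup>2) * (\<Sum>i<k. 0)"
    by (intro tendsto_intros tendsto_sum has_trace_tendsto[OF W] C C1_dense_H1 u p wd R) auto
  then have l: "(\<lambda>m. (\<Sum>i<k. (c i)\<^sup>2) * (\<Sum>i<k. \<integral>t. (mollify R m (u i) (circle_curve R t) - W i t)\<^sup>2 \<partial>angles)) \<longlonglongrightarrow> 0"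
    by simp
  show "(\<lambda>m. \<integral>t. (\<phi> m (circle_curve R t) - (\<Sum>i<k. c i * W i t))\<^sup>2 \<partial>angles) \<longlonglongrightarrow> 0"
  proof (rule tendsto_sandwich[OF _ _ tendsto_const l])
    show "\<forall>\<^sub>F m in sequentially. (\<integral>t. (\<phi> m (circle_curve R t) - (\<Sum>i<k. c i * W i t))\<^sup>2 \<partial>angles)
       \<le> (\<Sum>i<k. (c i)\<^sup>2) * (\<Sum>i<k. \<integral>t. (mollify R m (u i) (circle_curve R t) - W i t)\<^sup>2 \<partial>angles)"
    proof (intro always_eventually allI)
      fix m
      have "(\<integral>t. (\<phi> m (circle_curve R t) - (\<Sum>i<k. c i * W i t))\<^sup>2 \<partial>angles)
        = (\<integral>t. (\<Sum>i<k. c i * (mollify R m (u i) (circle_curve R t) - W i t))\<^sup>2 \<partial>angles)"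
        by (simp add: \<phi>_def right_diff_distrib sum_subtractf)
      also have "\<dots> \<le> (\<Sum>i<k. (c i)\<^sup>2) * (\<Sum>i<k. \<integral>t. (mollify R m (u i) (circle_curve R t) - W i t)\<^sup>2 \<partial>angles)"
        by (intro L2_lincomb_bound L2_diff continuous_circle_L2 C1_continuous C WL)
      finally show "(\<integral>t. (\<phi> m (circle_curve R t) - (\<Sum>i<k. c i * W i t))\<^sup>2 \<partial>angles)
       \<le> (\<Sum>i<k. (c i)\<^sup>2) * (\<Sum>i<k. \<integral>t. (mollify R m (u i) (circle_curve R t) - W i t)\<^sup>2 \<partial>angles)" .
    qed
  qed simp
qed

section \<open>Rayleigh quotients in a conformal metric\<close>

context conformal_disk
begin

abbreviation "D \<equiv> ball (0 :: real^2) R"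

lemma weighted_mass_bounds:
  obtains m M where "m > 0" "M > 0"
    "\<And>f. L2 (disk R) f \<Longrightarrow> m * (\<integral>x. (f x)\<^sup>2 \<partial>disk R) \<le> (\<integral>x. (w x)\<^sup>2 * (f x)\<^sup>2 \<partial>disk R)"
    "\<And>f. L2 (disk R) f \<Longrightarrow> (\<integral>x. (w x)\<^sup>2 * (f x)\<^sup>2 \<partial>disk R) \<le> M * (\<integral>x. (f x)\<^sup>2 \<partial>disk R)"
proof -
  obtain m M where m: "m > 0" "M > 0" and b: "\<And>x. x \<in> space (disk R) \<Longrightarrow> m \<le> (w x)\<^sup>2 \<and> (w x)\<^sup>2 \<le> M"
    using w_bounds by blast
  have i: "integrable (disk R) (\<lambda>x. (w x)\<^sup>2 * (f x)\<^sup>2)" "integrable (disk R) (\<lambda>x. (f x)\<^sup>2)" if "L2 (disk R) f" for f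
    using that integrable_weight_iff[of "\<lambda>x. (f x)\<^sup>2"] by (auto simp: L2_def)
  show ?thesis
  proof (rule that[OF m])
    fix f assume f: "L2 (disk R) f"
    have "m * (\<integral>x. (f x)\<^sup>2 \<partial>disk R) = (\<integral>x. m * (f x)\<^sup>2 \<partial>disk R)"
      by simp
    also have "\<dots> \<le> (\<integral>x. (w x)\<^sup>2 * (f x)\<^sup>2 \<partial>disk R)"
      using b i[OF f] by (intro integral_mono) (auto intro!: mult_right_mono)
    finally show "m * (\<integral>x. (f x)\<^sup>2 \<partial>disk R) \<le> (\<integral>x. (w x)\<^sup>2 * (f x)\<^sup>2 \<partial>disk R)" .
    have "(\<integral>x. (w x)\<^sup>2 * (f x)\<^sup>2 \<partial>disk R) \<le> (\<integral>x. M * (f x)\<^sup>2 \<partial>disk R)"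
      using b i[OF f] by (intro integral_mono) (auto intro!: mult_right_mono)
    then show "(\<integral>x. (w x)\<^sup>2 * (f x)\<^sup>2 \<partial>disk R) \<le> M * (\<integral>x. (f x)\<^sup>2 \<partial>disk R)"
      by simp
  qed
qed

lemma wdiff_H1:
  assumes "u \<in> H1 g D"
  shows "L2 (disk R) u" "V2 (disk R) (wdiff g D u)" "weak_diff D u (wdiff g D u)"
proof -
  obtain p where "H1_pair g D u p"
    using assms by (auto simp: H1_def)
  then have "H1_pair g D u (wdiff g D u)"
    unfolding wdiff_def by (rule someI[of "H1_pair g D u"])
  then show "L2 (disk R) u" "V2 (disk R) (wdiff g D u)" "weak_diff D u (wdiff g D u)"
    by (simp_all add: H1_pair_iff)
qed

lemma integral_mass_area:
  assumes "L2 (disk R) u"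
  shows "(\<integral>x. (u x)\<^sup>2 \<partial>area_measure g D) = (\<integral>x. (w x)\<^sup>2 * (u x)\<^sup>2 \<partial>disk R)"
  using assms by (intro integral_area) (auto simp: L2_def)

lemma trace_functional_eq:
  assumes u: "L2 (disk R) u" and p: "V2 (disk R) p" and \<phi>: "C1 \<phi>"
  shows "(\<integral>x. (\<phi> x - u x)\<^sup>2 + conorm2 g x (partials \<phi> x - p x) \<partial>area_measure g D)
     = (\<integral>x. (w x)\<^sup>2 * (\<phi> x - u x)\<^sup>2 \<partial>disk R) + (\<integral>x. (partials \<phi> x - p x) \<bullet> (partials \<phi> x - p x) \<partial>disk R)"
proof -
  have L: "L2 (disk R) (\<lambda>x. \<phi> x - u x)" and V: "V2 (disk R) (\<lambda>x. partials \<phi> x - p x)"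
    by (intro L2_diff V2_diff C1_L2 C1_partials_V2 u p \<phi>)+
  have m: "(\<lambda>x. (\<phi> x - u x)\<^sup>2) \<in> borel_measurable (disk R)"
    using L by (auto simp: L2_def)
  have m2: "(\<lambda>x. conorm2 g x (partials \<phi> x - p x)) \<in> borel_measurable (disk R)"
    using V by (intro conorm2_measurable) (auto simp: V2_def L2_def)
  have i1: "integrable (area_measure g D) (\<lambda>x. (\<phi> x - u x)\<^sup>2)"
    using L by (simp add: integral_area(2)[OF m] integrable_weight_iff[OF m] L2_integrable)
  have i2: "integrable (area_measure g D) (\<lambda>x. conorm2 g x (partials \<phi> x - p x))"
  proof -
    have "integrable (disk R) (\<lambda>x. (w x)\<^sup>2 * conorm2 g x (partials \<phi> x - p x)) \<longleftrightarrow> integrable (disk R) (\<lambda>x. (partials \<phi> x - p x) \<bullet> (partials \<phi> x - p x))"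
      by (intro Bochner_Integration.integrable_cong) (simp_all add: weight_conorm2 del: space_restrict_space)
    then show ?thesis
      using V2_integrable[OF V] by (simp add: integral_area(2)[OF m2])
  qed
  show ?thesis
    using i1 i2 by (simp add: integral_area(1)[OF m] integral_conorm2_area[OF V])
qed

text \<open>The bounds \<open>m\<close> and \<open>M\<close> on the area density make the Riemannian
  functional and the flat distance comparable up to the factors \<open>M + 1\<close> and
  \<open>1 / m + 1\<close>.\<close>

lemma is_trace_dist_iff:
  assumes u: "L2 (disk R) u" and p: "V2 (disk R) p" and \<phi>: "\<And>m. C1 (\<phi> m)"
  shows "(\<lambda>n. \<integral>x. (\<phi> n x - u x)\<^sup>2 + conorm2 g x (partials (\<phi> n) x - p x) \<partial>area_measure g D) \<longlonglongrightarrow> 0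
     \<longleftrightarrow> (\<lambda>n. dist_H1 R u p (\<phi> n)) \<longlonglongrightarrow> 0" (is "?T \<longlonglongrightarrow> 0 \<longleftrightarrow> _")
proof -
  obtain m M where m: "m > 0" "M > 0"
    and lo: "\<And>f. L2 (disk R) f \<Longrightarrow> m * (\<integral>x. (f x)\<^sup>2 \<partial>disk R) \<le> (\<integral>x. (w x)\<^sup>2 * (f x)\<^sup>2 \<partial>disk R)"
    and hi: "\<And>f. L2 (disk R) f \<Longrightarrow> (\<integral>x. (w x)\<^sup>2 * (f x)\<^sup>2 \<partial>disk R) \<le> M * (\<integral>x. (f x)\<^sup>2 \<partial>disk R)"
    using weighted_mass_bounds by blast
  have L: "L2 (disk R) (\<lambda>x. \<phi> n x - u x)" for n
    by (intro L2_diff C1_L2 u \<phi>)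
  have T: "?T n = (\<integral>x. (w x)\<^sup>2 * (\<phi> n x - u x)\<^sup>2 \<partial>disk R) + (\<integral>x. (partials (\<phi> n) x - p x) \<bullet> (partials (\<phi> n) x - p x) \<partial>disk R)" for n
    by (rule trace_functional_eq[OF u p \<phi>])
  have A0: "0 \<le> (\<integral>x. (\<phi> n x - u x)\<^sup>2 \<partial>disk R)" "0 \<le> (\<integral>x. (partials (\<phi> n) x - p x) \<bullet> (partials (\<phi> n) x - p x) \<partial>disk R)" for n
    by auto
  have up: "?T n \<le> (M + 1) * dist_H1 R u p (\<phi> n)" for n
    using hi[OF L, of n] A0[of n] mult_nonneg_nonneg[OF less_imp_le[OF m(2)] A0(2)[of n]]
    unfolding T dist_H1_def distrib_left distrib_right by linarith
  have dn: "dist_H1 R u p (\<phi> n) \<le> (1 / m + 1) * ?T n" for n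
  proof -
    have "(\<integral>x. (\<phi> n x - u x)\<^sup>2 \<partial>disk R) \<le> 1 / m * (\<integral>x. (w x)\<^sup>2 * (\<phi> n x - u x)\<^sup>2 \<partial>disk R)"
      using lo[OF L, of n] m by (simp add: field_simps)
    moreover have "0 \<le> (\<integral>x. (w x)\<^sup>2 * (\<phi> n x - u x)\<^sup>2 \<partial>disk R)"
      by simp
    moreover have "0 \<le> 1 / m * (\<integral>x. (partials (\<phi> n) x - p x) \<bullet> (partials (\<phi> n) x - p x) \<partial>disk R)"
      using m A0 by (intro mult_nonneg_nonneg) auto
    ultimately show ?thesis
      unfolding T dist_H1_def distrib_left distrib_right by linarith
  qed
  have T0: "0 \<le> ?T n" for n
    unfolding T using A0(2)[of n] by (intro add_nonneg_nonneg) auto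
  show ?thesis
  proof
    assume "?T \<longlonglongrightarrow> 0"
    then have l: "(\<lambda>n. (1 / m + 1) * ?T n) \<longlonglongrightarrow> 0"
      by (rule tendsto_mult_right_zero)
    show "(\<lambda>n. dist_H1 R u p (\<phi> n)) \<longlonglongrightarrow> 0"
      by (rule tendsto_sandwich[OF _ _ tendsto_const l]) (use dn in \<open>auto simp: dist_H1_def\<close>)
  next
    assume "(\<lambda>n. dist_H1 R u p (\<phi> n)) \<longlonglongrightarrow> 0"
    then have l: "(\<lambda>n. (M + 1) * dist_H1 R u p (\<phi> n)) \<longlonglongrightarrow> 0"
      by (rule tendsto_mult_right_zero)
    show "?T \<longlonglongrightarrow> 0"
      by (rule tendsto_sandwich[OF _ _ tendsto_const l]) (use up T0 in auto)
  qed
qed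

lemma is_trace_iff:
  assumes u: "u \<in> H1 g D"
  shows "is_trace g D (circle_curve R) u W \<longleftrightarrow> L2 angles W \<and>
    (\<exists>\<phi>. (\<forall>m. C1 (\<phi> m)) \<and> (\<lambda>m. dist_H1 R u (wdiff g D u) (\<phi> m)) \<longlonglongrightarrow> 0
      \<and> (\<lambda>m. \<integral>t. (\<phi> m (circle_curve R t) - W t)\<^sup>2 \<partial>angles) \<longlonglongrightarrow> 0)"
proof -
  have bR: "b * R \<noteq> 0"
    using b_pos R by simp
  have int: "(\<lambda>m. \<integral>t. (\<phi> m (circle_curve R t) - W t)\<^sup>2 \<partial>length_measure g (circle_curve R)) \<longlonglongrightarrow> 0
     \<longleftrightarrow> (\<lambda>m. \<integral>t. (\<phi> m (circle_curve R t) - W t)\<^sup>2 \<partial>angles) \<longlonglongrightarrow> 0"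
    if W: "W \<in> borel_measurable angles" and \<phi>: "\<And>m. C1 (\<phi> m)" for \<phi>
  proof -
    have "(\<lambda>t. (\<phi> m (circle_curve R t) - W t)\<^sup>2) \<in> borel_measurable angles" for m
      using W continuous_circle_L2[OF C1_continuous[OF \<phi>[of m]], of R] by (auto simp: L2_def)
    then have "(\<integral>t. (\<phi> m (circle_curve R t) - W t)\<^sup>2 \<partial>length_measure g (circle_curve R)) = (b * R) * (\<integral>t. (\<phi> m (circle_curve R t) - W t)\<^sup>2 \<partial>angles)" for m
      by (intro integral_length)
    then show ?thesis
      using bR by (simp add: tendsto_mult_left_iff[where c = "b * R" and l = 0, simplified])
  qed
  have "integrable (length_measure g (circle_curve R)) (\<lambda>t. (W t)\<^sup>2) \<longleftrightarrow> integrable angles (\<lambda>t. (W t)\<^sup>2)" if "W \<in> borel_measurable angles"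
    using that by (intro integral_length) auto
  then have L: "W \<in> borel_measurable (length_measure g (circle_curve R)) \<and> integrable (length_measure g (circle_curve R)) (\<lambda>t. (W t)\<^sup>2) \<longleftrightarrow> L2 angles W"
    unfolding L2_def borel_measurable_length by blast
  have "is_trace g D (circle_curve R) u W \<longleftrightarrow> L2 angles W \<and>
    (\<exists>\<phi>. (\<forall>m. C1 (\<phi> m)) \<and>
      (\<lambda>m. \<integral>x. (\<phi> m x - u x)\<^sup>2 + conorm2 g x (partials (\<phi> m) x - wdiff g D u x) \<partial>area_measure g D) \<longlonglongrightarrow> 0 \<and>
      (\<lambda>m. \<integral>t. (\<phi> m (circle_curve R t) - W t)\<^sup>2 \<partial>length_measure g (circle_curve R)) \<longlonglongrightarrow> 0)"
    unfolding is_trace_def L[symmetric] by (rule conj_assoc[symmetric])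
  also have "\<dots> \<longleftrightarrow> L2 angles W \<and>
    (\<exists>\<phi>. (\<forall>m. C1 (\<phi> m)) \<and> (\<lambda>m. dist_H1 R u (wdiff g D u) (\<phi> m)) \<longlonglongrightarrow> 0
      \<and> (\<lambda>m. \<integral>t. (\<phi> m (circle_curve R t) - W t)\<^sup>2 \<partial>angles) \<longlonglongrightarrow> 0)"
  proof (intro conj_cong refl ex_cong1)
    fix \<phi> :: "nat \<Rightarrow> real^2 \<Rightarrow> real"
    assume W: "L2 angles W" and \<phi>: "\<forall>m. C1 (\<phi> m)"
    show "(\<lambda>m. \<integral>x. (\<phi> m x - u x)\<^sup>2 + conorm2 g x (partials (\<phi> m) x - wdiff g D u x) \<partial>area_measure g D) \<longlonglongrightarrow> 0
        \<longleftrightarrow> (\<lambda>m. dist_H1 R u (wdiff g D u) (\<phi> m)) \<longlonglongrightarrow> 0"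
      using \<phi> by (intro is_trace_dist_iff wdiff_H1[OF u]) auto
    show "(\<lambda>m. \<integral>t. (\<phi> m (circle_curve R t) - W t)\<^sup>2 \<partial>length_measure g (circle_curve R)) \<longlonglongrightarrow> 0
        \<longleftrightarrow> (\<lambda>m. \<integral>t. (\<phi> m (circle_curve R t) - W t)\<^sup>2 \<partial>angles) \<longlonglongrightarrow> 0"
      using \<phi> W by (intro int) (auto simp: L2_def)
  qed
  finally show ?thesis .
qed

text \<open>The radial formula gives one trace, so the choice in \<open>trace_of\<close> is not
  void; whatever function it picks agrees almost everywhere with the radial one and inherits its
  estimate.\<close>

lemma has_trace_trace_of:
  assumes u: "u \<in> H1 g D"
  shows "has_trace R u (wdiff g D u) (trace_of g D (circle_curve R) u)"
proof -
  let ?p = "wdiff g D u"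
  note H = wdiff_H1[OF u]
  obtain W where "L2 angles W"
    "\<And>\<phi>. C1 \<phi> \<Longrightarrow> (\<integral>t. (\<phi> (circle_curve R t) - W t)\<^sup>2 \<partial>angles) \<le> (4 / R\<^sup>2 + 1) * dist_H1 R u ?p \<phi>"
    using trace_exists[OF R H(1,2)] by blast
  then have W: "has_trace R u ?p W"
    by (simp add: has_trace_def)
  have "is_trace g D (circle_curve R) u W"
    unfolding is_trace_iff[OF u]
  proof (intro conjI exI[of _ "\<lambda>m. mollify R m u"] allI)
    show "L2 angles W"
      using W by (simp add: has_trace_def)
    show "C1 (mollify R m u)" for m
      by (rule C1_mollify[OF H(1) R])
    show "(\<lambda>m. dist_H1 R u ?p (mollify R m u)) \<longlonglongrightarrow> 0"
      by (rule C1_dense_H1[OF H R])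
    then show "(\<lambda>m. \<integral>t. (mollify R m u (circle_curve R t) - W t)\<^sup>2 \<partial>angles) \<longlonglongrightarrow> 0"
      by (rule has_trace_tendsto[OF W C1_mollify[OF H(1) R]])
  qed
  then have "is_trace g D (circle_curve R) u (trace_of g D (circle_curve R) u)"
    unfolding trace_of_def by (rule someI[of "is_trace g D (circle_curve R) u"])
  then obtain \<phi> where L: "L2 angles (trace_of g D (circle_curve R) u)" and \<phi>: "\<And>m. C1 (\<phi> m)"
    and lim: "(\<lambda>m. dist_H1 R u ?p (\<phi> m)) \<longlonglongrightarrow> 0"
      "(\<lambda>m. \<integral>t. (\<phi> m (circle_curve R t) - trace_of g D (circle_curve R) u t)\<^sup>2 \<partial>angles) \<longlonglongrightarrow> 0"
    unfolding is_trace_iff[OF u] by blast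
  have eq: "AE t in angles. W t = trace_of g D (circle_curve R) u t"
    by (rule has_trace_unique[OF W L \<phi> lim])
  show ?thesis
    unfolding has_trace_def
  proof (intro conjI allI impI L)
    fix \<psi> assume \<psi>: "C1 \<psi>"
    have [measurable]: "W \<in> borel_measurable angles" "trace_of g D (circle_curve R) u \<in> borel_measurable angles" "(\<lambda>t. \<psi> (circle_curve R t)) \<in> borel_measurable angles"
      using W L continuous_circle_L2[OF C1_continuous[OF \<psi>], of R] by (auto simp: has_trace_def L2_def)
    have "(\<integral>t. (\<psi> (circle_curve R t) - trace_of g D (circle_curve R) u t)\<^sup>2 \<partial>angles) = (\<integral>t. (\<psi> (circle_curve R t) - W t)\<^sup>2 \<partial>angles)"
      by (intro integral_cong_AE) (use eq in auto)
    then show "(\<integral>t. (\<psi> (circle_curve R t) - trace_of g D (circle_curve R) u t)\<^sup>2 \<partial>angles) \<le> (4 / R\<^sup>2 + 1) * dist_H1 R u ?p \<psi>"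
      using W \<psi> by (simp add: has_trace_def)
  qed
qed

lemma rayleigh_eq:
  assumes v: "v \<in> H1 g D"
  shows "robin_rayleigh g D (circle_curve R) \<beta> v =
    ((\<integral>x. wdiff g D v x \<bullet> wdiff g D v x \<partial>disk R) + \<beta> * (b * R) * (\<integral>t. (trace_of g D (circle_curve R) v t)\<^sup>2 \<partial>angles))
    / (\<integral>x. (w x)\<^sup>2 * (v x)\<^sup>2 \<partial>disk R)"
proof -
  have "(\<lambda>t. (trace_of g D (circle_curve R) v t)\<^sup>2) \<in> borel_measurable angles"
    using has_trace_trace_of[OF v] by (auto simp: has_trace_def L2_def)
  then show ?thesis
    unfolding robin_rayleigh_def integral_conorm2_area[OF wdiff_H1(2)[OF v]] integral_mass_area[OF wdiff_H1(1)[OF v]]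
    by (simp add: integral_length(1) mult.assoc)
qed

text \<open>Members of a subspace are known only up to null sets, and their differentials and traces
  are independent choices. Uniqueness turns the quotient into a quotient of quadratic forms in
  \<open>c\<close>.\<close>

lemma rayleigh_lincomb:
  assumes u: "\<And>i. i < k \<Longrightarrow> u i \<in> H1 g D" and v: "v \<in> H1 g D" and eq: "AE x in disk R. v x = (\<Sum>i<(k::nat). c i * u i x)"
  shows "robin_rayleigh g D (circle_curve R) \<beta> v =
    ((\<integral>x. (\<Sum>i<k. c i * wdiff g D (u i) x $ 1)\<^sup>2 \<partial>disk R) + (\<integral>x. (\<Sum>i<k. c i * wdiff g D (u i) x $ 2)\<^sup>2 \<partial>disk R)
      + \<beta> * (b * R) * (\<integral>t. (\<Sum>i<k. c i * trace_of g D (circle_curve R) (u i) t)\<^sup>2 \<partial>angles))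
    / (\<integral>x. (w x)\<^sup>2 * (\<Sum>i<k. c i * u i x)\<^sup>2 \<partial>disk R)"
proof -
  let ?q = "wdiff g D v"
  note U = wdiff_H1[OF u] and V = wdiff_H1[OF v]
  define s where "s x = (\<Sum>i<k. c i * u i x)" for x
  define ps where "ps x = (\<Sum>i<k. c i *\<^sub>R wdiff g D (u i) x)" for x
  have sL: "L2 (disk R) s"
    unfolding s_def by (intro L2_sum L2_scale U) auto
  have psV: "V2 (disk R) ps"
    unfolding ps_def by (intro V2_lincomb U)
  have wds: "weak_diff D s ps"
    unfolding s_def ps_def by (intro weak_diff_lincomb U)
  have "AE x in disk R. s x = v x"
    using eq by eventually_elim (simp add: s_def)
  then have "weak_diff D v ps"
    using sL V(1) by (intro weak_diff_cong_AE[OF wds]) (auto simp: L2_def)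
  then have qeq: "AE x in disk R. ?q x = ps x"
    by (intro weak_diff_unique[OF V(1,2) psV V(3) _ R])
  have W: "AE t in angles. trace_of g D (circle_curve R) v t = (\<Sum>i<k. c i * trace_of g D (circle_curve R) (u i) t)"
    by (rule has_trace_lincomb[OF R U has_trace_trace_of[OF u] V(1) eq V(2) qeq[unfolded ps_def] has_trace_trace_of[OF v]])
  have [measurable]: "trace_of g D (circle_curve R) v \<in> borel_measurable angles"
    using has_trace_trace_of[OF v] by (auto simp: has_trace_def L2_def)
  have [measurable]: "(\<lambda>t. \<Sum>i<k. c i * trace_of g D (circle_curve R) (u i) t) \<in> borel_measurable angles"
    using has_trace_trace_of[OF u] by (intro borel_measurable_sum borel_measurable_times) (auto simp: has_trace_def L2_def)
  have [measurable]: "(\<lambda>x. ?q x $ i) \<in> borel_measurable (disk R)" "(\<lambda>x. ps x $ i) \<in> borel_measurable (disk R)" for i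
    using V(2) psV by (auto simp: V2_def L2_def)
  have [measurable]: "v \<in> borel_measurable (disk R)" "s \<in> borel_measurable (disk R)"
    using V(1) sL by (auto simp: L2_def)
  have [measurable]: "(\<lambda>x. \<Sum>i<k. c i * u i x) \<in> borel_measurable (disk R)"
    using sL by (simp add: s_def[abs_def] L2_def)
  have "(\<integral>x. ?q x \<bullet> ?q x \<partial>disk R) = (\<integral>x. ps x \<bullet> ps x \<partial>disk R)"
    by (intro integral_cong_AE) (use qeq in \<open>auto simp: inner_real2\<close>)
  also have "\<dots> = (\<integral>x. (\<Sum>i<k. c i * wdiff g D (u i) x $ 1)\<^sup>2 \<partial>disk R) + (\<integral>x. (\<Sum>i<k. c i * wdiff g D (u i) x $ 2)\<^sup>2 \<partial>disk R)"
    unfolding ps_def by (rule V2_lincomb_integral[OF U(2)])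
  finally have 1: "(\<integral>x. ?q x \<bullet> ?q x \<partial>disk R) = \<dots>" .
  have 2: "(\<integral>t. (trace_of g D (circle_curve R) v t)\<^sup>2 \<partial>angles) = (\<integral>t. (\<Sum>i<k. c i * trace_of g D (circle_curve R) (u i) t)\<^sup>2 \<partial>angles)"
    by (intro integral_cong_AE) (use W in auto)
  have 3: "(\<integral>x. (w x)\<^sup>2 * (v x)\<^sup>2 \<partial>disk R) = (\<integral>x. (w x)\<^sup>2 * (s x)\<^sup>2 \<partial>disk R)"
    by (intro integral_cong_AE) (use eq in \<open>auto simp: s_def\<close>)
  show ?thesis
    unfolding rayleigh_eq[OF v] 1 2 3 s_def ..
qed

end

section \<open>The min-max value over \<open>H1\<close> as an infimum over \<open>C1\<close>
  spaces\<close>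

context conformal_disk
begin

lemma C1_H1: "C1 \<phi> \<Longrightarrow> \<phi> \<in> H1 g D"
  unfolding H1_def using H1_pair_iff C1_L2 C1_partials_V2 C1_weak_diff by blast

lemma rayleigh_C1:
  assumes v: "v \<in> H1 g D" and \<psi>: "C1 \<psi>" and eq: "AE x in disk R. v x = \<psi> x"
  shows "robin_rayleigh g D (circle_curve R) \<beta> v = energy R (\<beta> * (b * R)) \<psi> / mass R (\<lambda>x. (w x)\<^sup>2) \<psi>"
proof -
  note H = wdiff_H1[OF C1_H1[OF \<psi>]]
  have t: "has_trace R \<psi> (wdiff g D \<psi>) (trace_of g D (circle_curve R) \<psi>)"
    by (rule has_trace_trace_of[OF C1_H1[OF \<psi>]])
  have "robin_rayleigh g D (circle_curve R) \<beta> v = robin_rayleigh g D (circle_curve R) \<beta> \<psi>"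
    \<comment> \<open>Applied to the one-element family of \<open>\<psi>\<close>, first for
      \<open>v\<close> and then for \<open>\<psi>\<close> itself, the formula shows that the
      quotient depends only on the class modulo null sets.\<close>
    using rayleigh_lincomb[of 1 "\<lambda>_. \<psi>" v "\<lambda>_. 1" \<beta>] rayleigh_lincomb[of 1 "\<lambda>_. \<psi>" \<psi> "\<lambda>_. 1" \<beta>] v eq C1_H1[OF \<psi>]
    by simp
  also have "\<dots> = energy R (\<beta> * (b * R)) \<psi> / mass R (\<lambda>x. (w x)\<^sup>2) \<psi>"
  proof -
    have weq: "AE x in disk R. wdiff g D \<psi> x = partials \<psi> x"
      by (rule weak_diff_unique[OF H(1,2) C1_partials_V2[OF \<psi>] H(3) C1_weak_diff[OF \<psi>] R])
    have "dist_H1 R \<psi> (wdiff g D \<psi>) \<psi> = dist_H1 R \<psi> (partials \<psi>) \<psi>"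
      using weq by (intro dist_H1_cong_AE \<psi> H C1_partials_V2) auto
    then have "dist_H1 R \<psi> (wdiff g D \<psi>) \<psi> = 0"
      by (simp add: dist_H1_def)
    then have t0: "AE t in angles. trace_of g D (circle_curve R) \<psi> t = \<psi> (circle_curve R t)"
      \<comment> \<open>The constant sequence has distance 0 to its limit, so the trace is the plain
        restriction to the circle.\<close>
      by (intro has_trace_unique[OF t, where \<phi> = "\<lambda>m. \<psi>"]) (auto intro!: continuous_circle_L2 C1_continuous \<psi>)
    have [measurable]: "trace_of g D (circle_curve R) \<psi> \<in> borel_measurable angles" "(\<lambda>t. \<psi> (circle_curve R t)) \<in> borel_measurable angles"
      using t continuous_circle_L2[OF C1_continuous[OF \<psi>], of R] by (auto simp: has_trace_def L2_def)
    have [measurable]: "(\<lambda>x. wdiff g D \<psi> x $ i) \<in> borel_measurable (disk R)" "(\<lambda>x. partials \<psi> x $ i) \<in> borel_measurable (disk R)" for i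
      using H(2) C1_partials_V2[OF \<psi>] by (auto simp: V2_def L2_def)
    have "(\<integral>x. wdiff g D \<psi> x \<bullet> wdiff g D \<psi> x \<partial>disk R) = (\<integral>x. partials \<psi> x \<bullet> partials \<psi> x \<partial>disk R)"
      by (intro integral_cong_AE) (use weq in \<open>auto simp: inner_real2\<close>)
    moreover have "(\<integral>t. (trace_of g D (circle_curve R) \<psi> t)\<^sup>2 \<partial>angles) = (\<integral>t. (\<psi> (circle_curve R t))\<^sup>2 \<partial>angles)"
      by (intro integral_cong_AE) (use t0 in auto)
    ultimately show ?thesis
      unfolding rayleigh_eq[OF C1_H1[OF \<psi>]] energy_def mass_def by simp
  qed
  finally show ?thesis .
qed

text \<open>The easy half of the min-max identity: the span of an admissible \<open>C1\<close>
  family, closed under change on null sets, is a subspace of \<open>H1\<close> whose quotients are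
  at most \<open>M\<close>.\<close>

lemma subspace_of_admissible:
  assumes adm: "admissible R (\<beta> * (b * R)) (\<lambda>x. (w x)\<^sup>2) k M" and k: "k \<ge> 1"
  obtains L where "H1_subspace g D k L"
    "(SUP u \<in> {u \<in> L. \<not> (AE x in area_measure g D. u x = 0)}. robin_rayleigh g D (circle_curve R) \<beta> u) \<le> M"
proof -
  obtain \<phi> where \<phi>: "\<And>i. i < k \<Longrightarrow> C1 (\<phi> i)"
    and *: "\<And>c :: nat \<Rightarrow> real. \<exists>i<k. c i \<noteq> 0 \<Longrightarrow> 0 < mass R (\<lambda>x. (w x)\<^sup>2) (\<lambda>x. \<Sum>i<k. c i * \<phi> i x) \<and>
        energy R (\<beta> * (b * R)) (\<lambda>x. \<Sum>i<k. c i * \<phi> i x) \<le> M * mass R (\<lambda>x. (w x)\<^sup>2) (\<lambda>x. \<Sum>i<k. c i * \<phi> i x)"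
    using adm unfolding admissible_def by blast
  define L where "L = {v \<in> H1 g D. \<exists>c :: nat \<Rightarrow> real. AE x in area_measure g D. v x = (\<Sum>i<k. c i * \<phi> i x)}"
  have C: "C1 (\<lambda>x. \<Sum>i<k. c i * \<phi> i x)" for c
    by (intro C1_lincomb \<phi>)
  have indep: "\<forall>i<k. c i = 0" if "AE x in area_measure g D. (\<Sum>i<k. c i * \<phi> i x) = 0" for c
  proof (rule ccontr)
    assume "\<not> ?thesis"
    then have "0 < mass R (\<lambda>x. (w x)\<^sup>2) (\<lambda>x. \<Sum>i<k. c i * \<phi> i x)"
      using *[of c] by blast
    moreover have "mass R (\<lambda>x. (w x)\<^sup>2) (\<lambda>x. \<Sum>i<k. c i * \<phi> i x) = 0"
    proof -
      have "(\<lambda>x. \<Sum>i<k. c i * \<phi> i x) \<in> borel_measurable (disk R)"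
        using C1_L2[OF C] by (simp add: L2_def)
      then have "(\<integral>x. (w x)\<^sup>2 * (\<Sum>i<k. c i * \<phi> i x)\<^sup>2 \<partial>disk R) = (\<integral>x. 0 \<partial>disk R)"
        using that by (intro integral_cong_AE) (auto simp: AE_area)
      then show ?thesis
        by (simp add: mass_def)
    qed
    ultimately show False by simp
  qed
  have sub: "H1_subspace g D k L"
    unfolding H1_subspace_def L_def using C1_H1[OF \<phi>] indep by blast
  \<comment> \<open>The supremum of an empty set would be unspecified; here \<open>k \<ge> 1\<close>
    supplies a nonzero element.\<close>
  have ne: "{u \<in> L. \<not> (AE x in area_measure g D. u x = 0)} \<noteq> {}"
  proof -
    have "(\<lambda>x. \<Sum>i<k. 1 * \<phi> i x) \<in> L"
      using C1_H1[OF C[of "\<lambda>_. 1"]] unfolding L_def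
      by (intro CollectI conjI exI[of _ "\<lambda>_. 1"] AE_I2 refl)
    moreover have "\<not> (AE x in area_measure g D. (\<Sum>i<k. 1 * \<phi> i x) = 0)"
    proof
      assume "AE x in area_measure g D. (\<Sum>i<k. 1 * \<phi> i x) = 0"
      from indep[OF this] k show False
        by auto
    qed
    ultimately show ?thesis
      by blast
  qed
  show ?thesis
  proof (rule that[OF sub], rule cSUP_least[OF ne])
    fix v assume "v \<in> {u \<in> L. \<not> (AE x in area_measure g D. u x = 0)}"
    then obtain c where v: "v \<in> H1 g D" and eq: "AE x in disk R. v x = (\<Sum>i<k. c i * \<phi> i x)"
      and nz: "\<not> (AE x in disk R. v x = 0)"
      unfolding L_def AE_area by blast
    have "\<exists>i<k. c i \<noteq> 0"
    proof (rule ccontr)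
      assume "\<not> ?thesis"
      then have "AE x in disk R. v x = 0"
        using eq by simp
      with nz show False ..
    qed
    then show "robin_rayleigh g D (circle_curve R) \<beta> v \<le> M"
      unfolding rayleigh_C1[OF v C eq] using *[of c] by (simp add: divide_le_eq)
  qed
qed

text \<open>The other half: a basis of \<open>L\<close> is replaced by its mollifications. All
  errors are small multiples of the coefficient norm, and independence bounds that norm by the mass,
  so the quotients change by a small relative amount uniformly in \<open>c\<close>. The gap below
  \<open>M'\<close> provides the room.\<close>

lemma admissible_of_subspace:
  assumes sub: "H1_subspace g D k L" and k: "k \<ge> 1" and \<beta>: "\<beta> \<ge> 0"
    and M': "(SUP u \<in> {u \<in> L. \<not> (AE x in area_measure g D. u x = 0)}. robin_rayleigh g D (circle_curve R) \<beta> u) < M'" (is "?S < M'")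
  shows "admissible R (\<beta> * (b * R)) (\<lambda>x. (w x)\<^sup>2) k M'"
proof -
  obtain u where u: "\<And>i. i < k \<Longrightarrow> u i \<in> H1 g D"
    and indep: "\<And>c. AE x in disk R. (\<Sum>i<k. c i * u i x) = 0 \<Longrightarrow> \<forall>i<k. c i = 0"
    and L: "L = {v \<in> H1 g D. \<exists>c :: nat \<Rightarrow> real. AE x in disk R. v x = (\<Sum>i<k. c i * u i x)}"
    using sub unfolding H1_subspace_def AE_area by blast
  note U = wdiff_H1[OF u]
  define a where "a = \<beta> * (b * R)"
  have a: "a \<ge> 0"
    using \<beta> b_pos R by (simp add: a_def)
  define p where "p i = wdiff g D (u i)" for i
  define W where "W i = trace_of g D (circle_curve R) (u i)" for i
  have uL: "L2 (disk R) (u i)" and pV: "V2 (disk R) (p i)" and wd: "weak_diff D (u i) (p i)" and tr: "has_trace R (u i) (p i) (W i)" if "i < k" for i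
    using U[OF that] has_trace_trace_of[OF u[OF that]] by (simp_all add: p_def W_def)
  have WL: "L2 angles (W i)" if "i < k" for i
    using tr[OF that] by (simp add: has_trace_def)
  define NN where "NN c = (\<integral>x. (\<Sum>i<k. c i * p i x $ 1)\<^sup>2 \<partial>disk R) + (\<integral>x. (\<Sum>i<k. c i * p i x $ 2)\<^sup>2 \<partial>disk R)
      + a * (\<integral>t. (\<Sum>i<k. c i * W i t)\<^sup>2 \<partial>angles)" for c
  define DD where "DD c = (\<integral>x. (w x)\<^sup>2 * (\<Sum>i<k. c i * u i x)\<^sup>2 \<partial>disk R)" for c
  define sq where "sq c = (\<Sum>i<k. (c i)\<^sup>2)" for c :: "nat \<Rightarrow> real"
  have sq0: "0 \<le> sq c" for c
    by (simp add: sq_def sum_nonneg)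
  have sq_pos: "0 < sq c" if "\<exists>i<k. c i \<noteq> 0" for c
    unfolding sq_def using that by (auto intro!: sum_pos2)
  obtain m M where m: "m > 0" "M > 0"
    and lo: "\<And>f. L2 (disk R) f \<Longrightarrow> m * (\<integral>x. (f x)\<^sup>2 \<partial>disk R) \<le> (\<integral>x. (w x)\<^sup>2 * (f x)\<^sup>2 \<partial>disk R)"
    and hi: "\<And>f. L2 (disk R) f \<Longrightarrow> (\<integral>x. (w x)\<^sup>2 * (f x)\<^sup>2 \<partial>disk R) \<le> M * (\<integral>x. (f x)\<^sup>2 \<partial>disk R)"
    using weighted_mass_bounds by blast
  obtain \<kappa>0 where \<kappa>0: "\<kappa>0 > 0" "\<And>c. \<kappa>0 * (\<Sum>i<k. (c i)\<^sup>2) \<le> (\<integral>x. (\<Sum>i<k. c i * u i x)\<^sup>2 \<partial>disk R)"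
  proof (rule L2_indep_lower[of k "disk R" u])
    show "\<And>i. i < k \<Longrightarrow> L2 (disk R) (u i)"
      by (rule uL)
    show "\<And>c. AE x in disk R. (\<Sum>i<k. c i * u i x) = 0 \<Longrightarrow> \<forall>i<k. c i = 0"
      by (rule indep)
  qed blast
  define \<kappa> where "\<kappa> = m * \<kappa>0"
  have \<kappa>: "\<kappa> > 0"
    using m \<kappa>0 by (simp add: \<kappa>_def)
  have lc: "L2 (disk R) (\<lambda>x. \<Sum>i<k. c i * u i x)" for c
    by (intro L2_sum L2_scale uL) auto
  have DD_lower: "\<kappa> * sq c \<le> DD c" for c
  proof -
    have "\<kappa> * sq c = m * (\<kappa>0 * sq c)"
      by (simp add: \<kappa>_def)
    also have "\<dots> \<le> m * (\<integral>x. (\<Sum>i<k. c i * u i x)\<^sup>2 \<partial>disk R)"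
      using m \<kappa>0(2)[of c] by (intro mult_left_mono) (auto simp: sq_def)
    also have "\<dots> \<le> DD c"
      unfolding DD_def by (rule lo[OF lc])
    finally show ?thesis .
  qed
  have NN0: "0 \<le> NN c" for c
    unfolding NN_def using a by (intro add_nonneg_nonneg mult_nonneg_nonneg) auto
  define KN where "KN = (\<Sum>i<k. \<integral>x. (p i x $ 1)\<^sup>2 \<partial>disk R) + (\<Sum>i<k. \<integral>x. (p i x $ 2)\<^sup>2 \<partial>disk R) + a * (\<Sum>i<k. \<integral>t. (W i t)\<^sup>2 \<partial>angles)"
  have NN_upper: "NN c \<le> sq c * KN" for c
  proof -
    have "NN c \<le> sq c * (\<Sum>i<k. \<integral>x. (p i x $ 1)\<^sup>2 \<partial>disk R) + sq c * (\<Sum>i<k. \<integral>x. (p i x $ 2)\<^sup>2 \<partial>disk R) + a * (sq c * (\<Sum>i<k. \<integral>t. (W i t)\<^sup>2 \<partial>angles))"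
      unfolding NN_def sq_def using a by (intro add_mono mult_left_mono L2_lincomb_bound V2_nth pV WL) auto
    then show ?thesis
      by (simp add: KN_def algebra_simps)
  qed
  have ray: "robin_rayleigh g D (circle_curve R) \<beta> v = NN c / DD c" if "v \<in> H1 g D" "AE x in disk R. v x = (\<Sum>i<k. c i * u i x)" for v c
    using rayleigh_lincomb[OF u that] by (simp add: NN_def DD_def a_def p_def W_def)
  \<comment> \<open>Without this the supremum could be an unspecified value that says nothing about
    single quotients. Numerator and denominator are compared through the coefficient norm.\<close>
  have bdd: "bdd_above (robin_rayleigh g D (circle_curve R) \<beta> ` {u \<in> L. \<not> (AE x in area_measure g D. u x = 0)})"
  proof (rule bdd_aboveI2)
    fix v assume "v \<in> {u \<in> L. \<not> (AE x in area_measure g D. u x = 0)}"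
    then obtain c where v: "v \<in> H1 g D" and eq: "AE x in disk R. v x = (\<Sum>i<k. c i * u i x)"
      and nz: "\<not> (AE x in disk R. v x = 0)"
      unfolding L AE_area by blast
    have "\<exists>i<k. c i \<noteq> 0"
    proof (rule ccontr)
      assume "\<not> ?thesis"
      then have "AE x in disk R. v x = 0"
        using eq by simp
      with nz show False ..
    qed
    then have s: "sq c > 0"
      by (rule sq_pos)
    have "NN c / DD c \<le> (sq c * KN) / (\<kappa> * sq c)"
      using NN_upper[of c] DD_lower[of c] NN0[of c] s \<kappa> by (intro frac_le) auto
    also have "\<dots> = KN / \<kappa>"
      using s by simp
    finally show "robin_rayleigh g D (circle_curve R) \<beta> v \<le> KN / \<kappa>"
      using ray[OF v eq] by simp
  qed
  have NN_le: "NN c \<le> ?S * DD c" if c: "\<exists>i<k. c i \<noteq> 0" for c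
  proof -
    define v where "v x = (\<Sum>i<k. c i * u i x)" for x
    have vH: "v \<in> H1 g D"
    proof -
      have "H1_pair g D v (\<lambda>x. \<Sum>i<k. c i *\<^sub>R p i x)"
        unfolding H1_pair_iff v_def by (intro conjI lc V2_lincomb weak_diff_lincomb pV uL wd)
      then show ?thesis
        by (auto simp: H1_def)
    qed
    have eq: "AE x in disk R. v x = (\<Sum>i<k. c i * u i x)"
      by (simp add: v_def)
    have "v \<in> {u \<in> L. \<not> (AE x in area_measure g D. u x = 0)}"
    proof -
      have "v \<in> L"
        unfolding L using vH eq by blast
      moreover have "\<not> (AE x in disk R. v x = 0)"
        unfolding v_def using indep[of c] c by blast
      ultimately show ?thesis
        unfolding AE_area by blast
    qed
    then have "robin_rayleigh g D (circle_curve R) \<beta> v \<le> ?S"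
      by (rule cSUP_upper[OF _ bdd])
    moreover have "DD c > 0"
      using DD_lower[of c] mult_pos_pos[OF \<kappa> sq_pos[OF c]] by linarith
    ultimately show ?thesis
      unfolding ray[OF vH eq] by (simp add: pos_divide_le_eq)
  qed
  have S0: "0 \<le> ?S"
  proof -
    have c: "\<exists>i<k. (\<lambda>_. 1 :: real) i \<noteq> 0"
      using k by (intro exI[of _ 0]) auto
    have "DD (\<lambda>_. 1) > 0"
      using DD_lower[of "\<lambda>_. 1"] mult_pos_pos[OF \<kappa> sq_pos[OF c]] by linarith
    moreover have "0 \<le> ?S * DD (\<lambda>_. 1)"
      using NN_le[OF c] NN0[of "\<lambda>_. 1"] by linarith
    ultimately show ?thesis
      by (simp add: zero_le_mult_iff)
  qed
  \<comment> \<open>After the perturbation the quotient is at most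
    \<open>(1 + e) * ((1 + e) * ?S + e) / (1 - e)\<close>, which tends to \<open>?S\<close> as
    \<open>e\<close> tends to 0.\<close>
  obtain e where e: "0 < e" "e < 1" "(1 + e) * ((1 + e) * ?S + e) \<le> (1 - e) * M'"
  proof -
    have "((\<lambda>e. (1 - e) * M' - (1 + e) * ((1 + e) * ?S + e)) \<longlongrightarrow> (1 - 0) * M' - (1 + 0) * ((1 + 0) * ?S + 0)) (at_right 0)"
      by (intro tendsto_intros)
    then have "\<forall>\<^sub>F e in at_right 0. 0 < (1 - e) * M' - (1 + e) * ((1 + e) * ?S + e)"
      using M' by (intro order_tendstoD(1)) auto
    moreover have "\<forall>\<^sub>F e in at_right (0::real). 0 < e \<and> e < 1"
      by (intro eventually_conj eventually_at_right_less) (auto simp: eventually_at_right_field intro: exI[of _ 1])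
    ultimately have "\<forall>\<^sub>F e in at_right 0. 0 < e \<and> e < 1 \<and> (1 + e) * ((1 + e) * ?S + e) \<le> (1 - e) * M'"
      by eventually_elim auto
    then show ?thesis
      using that eventually_happens[of _ "at_right (0::real)"] by force
  qed
  define \<delta> where "\<delta> n = (\<Sum>i<k. dist_H1 R (u i) (p i) (mollify R n (u i)))" for n
  define \<tau> where "\<tau> n = (\<Sum>i<k. \<integral>t. (mollify R n (u i) (circle_curve R t) - W i t)\<^sup>2 \<partial>angles)" for n
  have C: "C1 (mollify R n (u i))" if "i < k" for i n
    by (intro C1_mollify uL R that)
  have \<delta>lim: "\<delta> \<longlonglongrightarrow> (\<Sum>i<k. 0)"
    unfolding \<delta>_def by (intro tendsto_sum C1_dense_H1 uL pV wd R) auto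
  have \<tau>lim: "\<tau> \<longlonglongrightarrow> (\<Sum>i<k. 0)"
    unfolding \<tau>_def by (intro tendsto_sum has_trace_tendsto[OF tr] C C1_dense_H1 uL pV wd R) auto
  have l1: "(\<lambda>n. (1 + 1 / e) * (\<delta> n + a * \<tau> n)) \<longlonglongrightarrow> (1 + 1 / e) * ((\<Sum>i<k. 0) + a * (\<Sum>i<k. 0))"
    by (intro tendsto_intros \<delta>lim \<tau>lim)
  have l2: "(\<lambda>n. (1 + 1 / e) * (M * \<delta> n)) \<longlonglongrightarrow> (1 + 1 / e) * (M * (\<Sum>i<k. 0))"
    by (intro tendsto_intros \<delta>lim)
  \<comment> \<open>The thresholds are relative to \<open>\<kappa>\<close>: since
    \<open>\<kappa> * sq c \<le> DD c\<close>, the errors become at most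
    \<open>e * DD c\<close>.\<close>
  have "\<forall>\<^sub>F n in sequentially. (1 + 1 / e) * (\<delta> n + a * \<tau> n) < e * \<kappa>"
    "\<forall>\<^sub>F n in sequentially. (1 + 1 / e) * (M * \<delta> n) < e * \<kappa>"
    using order_tendstoD(2)[OF l1, of "e * \<kappa>"] order_tendstoD(2)[OF l2, of "e * \<kappa>"] e \<kappa> by auto
  then have "\<forall>\<^sub>F n in sequentially. (1 + 1 / e) * (\<delta> n + a * \<tau> n) < e * \<kappa> \<and> (1 + 1 / e) * (M * \<delta> n) < e * \<kappa>"
    by (rule eventually_conj)
  then obtain n where n: "(1 + 1 / e) * (\<delta> n + a * \<tau> n) < e * \<kappa>" "(1 + 1 / e) * (M * \<delta> n) < e * \<kappa>"
    by (auto simp: eventually_sequentially)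
  define \<phi> where "\<phi> i = mollify R n (u i)" for i
  have \<phi>: "C1 (\<phi> i)" if "i < k" for i
    using C[OF that] by (simp add: \<phi>_def)
  have e1: "0 < 1 + 1 / e"
    using e by (simp add: add_pos_pos)
  have \<delta>eq: "dist_H1 R (u i) (p i) (\<phi> i) = (\<integral>x. (\<phi> i x - u i x)\<^sup>2 \<partial>disk R) + ((\<integral>x. (partials (\<phi> i) x $ 1 - p i x $ 1)\<^sup>2 \<partial>disk R) + (\<integral>x. (partials (\<phi> i) x $ 2 - p i x $ 2)\<^sup>2 \<partial>disk R))" if "i < k" for i
    unfolding dist_H1_def using V2_integral[OF V2_diff[OF C1_partials_V2[OF \<phi>[OF that]] pV[OF that]]] by simp
  have \<delta>sum: "\<delta> n = (\<Sum>i<k. \<integral>x. (\<phi> i x - u i x)\<^sup>2 \<partial>disk R) + ((\<Sum>i<k. \<integral>x. (partials (\<phi> i) x $ 1 - p i x $ 1)\<^sup>2 \<partial>disk R) + (\<Sum>i<k. \<integral>x. (partials (\<phi> i) x $ 2 - p i x $ 2)\<^sup>2 \<partial>disk R))"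
    unfolding \<delta>_def using \<delta>eq by (simp add: sum.distrib flip: \<phi>_def)
  have nn: "0 \<le> (\<Sum>i<k. \<integral>x. (\<phi> i x - u i x)\<^sup>2 \<partial>disk R)" "0 \<le> (\<Sum>i<k. \<integral>x. (partials (\<phi> i) x $ 1 - p i x $ 1)\<^sup>2 \<partial>disk R)"
    "0 \<le> (\<Sum>i<k. \<integral>x. (partials (\<phi> i) x $ 2 - p i x $ 2)\<^sup>2 \<partial>disk R)"
    by (auto intro!: sum_nonneg)
  have goal: "0 < mass R (\<lambda>x. (w x)\<^sup>2) (\<lambda>x. \<Sum>i<k. c i * \<phi> i x) \<and>
      energy R a (\<lambda>x. \<Sum>i<k. c i * \<phi> i x) \<le> M' * mass R (\<lambda>x. (w x)\<^sup>2) (\<lambda>x. \<Sum>i<k. c i * \<phi> i x)"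
    if c: "\<exists>i<k. c i \<noteq> 0" for c
  proof -
    let ?N = "energy R a (\<lambda>x. \<Sum>i<k. c i * \<phi> i x)"
    let ?D = "mass R (\<lambda>x. (w x)\<^sup>2) (\<lambda>x. \<Sum>i<k. c i * \<phi> i x)"
    have Dpos: "DD c > 0"
      using DD_lower[of c] mult_pos_pos[OF \<kappa> sq_pos[OF c]] by linarith
    have en: "?N = (\<integral>x. (\<Sum>i<k. c i * partials (\<phi> i) x $ 1)\<^sup>2 \<partial>disk R) + (\<integral>x. (\<Sum>i<k. c i * partials (\<phi> i) x $ 2)\<^sup>2 \<partial>disk R)
      + a * (\<integral>t. (\<Sum>i<k. c i * \<phi> i (circle_curve R t))\<^sup>2 \<partial>angles)"
      by (rule C1_energy_lincomb) (rule \<phi>)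
    have y1: "(\<integral>x. (\<Sum>i<k. c i * partials (\<phi> i) x $ j)\<^sup>2 \<partial>disk R) \<le> (1 + e) * (\<integral>x. (\<Sum>i<k. c i * p i x $ j)\<^sup>2 \<partial>disk R)
        + (1 + 1 / e) * (sq c * (\<Sum>i<k. \<integral>x. (partials (\<phi> i) x $ j - p i x $ j)\<^sup>2 \<partial>disk R))" for j
      unfolding sq_def by (rule L2_lincomb_young[OF V2_nth[OF pV] C1_partials_L2[OF \<phi>] e(1)])
    have y2: "(\<integral>t. (\<Sum>i<k. c i * \<phi> i (circle_curve R t))\<^sup>2 \<partial>angles) \<le> (1 + e) * (\<integral>t. (\<Sum>i<k. c i * W i t)\<^sup>2 \<partial>angles) + (1 + 1 / e) * (sq c * \<tau> n)"
      unfolding sq_def \<tau>_def \<phi>_def[symmetric] by (rule L2_lincomb_young[OF WL continuous_circle_L2[OF C1_continuous[OF \<phi>]] e(1)])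
    have "?N \<le> ((1 + e) * (\<integral>x. (\<Sum>i<k. c i * p i x $ 1)\<^sup>2 \<partial>disk R) + (1 + 1 / e) * (sq c * (\<Sum>i<k. \<integral>x. (partials (\<phi> i) x $ 1 - p i x $ 1)\<^sup>2 \<partial>disk R)))
      + ((1 + e) * (\<integral>x. (\<Sum>i<k. c i * p i x $ 2)\<^sup>2 \<partial>disk R) + (1 + 1 / e) * (sq c * (\<Sum>i<k. \<integral>x. (partials (\<phi> i) x $ 2 - p i x $ 2)\<^sup>2 \<partial>disk R)))
      + a * ((1 + e) * (\<integral>t. (\<Sum>i<k. c i * W i t)\<^sup>2 \<partial>angles) + (1 + 1 / e) * (sq c * \<tau> n))"
      unfolding en by (intro add_mono mult_left_mono a y1 y2)
    also have "\<dots> = (1 + e) * NN c + (1 + 1 / e) * (sq c * (((\<Sum>i<k. \<integral>x. (partials (\<phi> i) x $ 1 - p i x $ 1)\<^sup>2 \<partial>disk R) + (\<Sum>i<k. \<integral>x. (partials (\<phi> i) x $ 2 - p i x $ 2)\<^sup>2 \<partial>disk R)) + a * \<tau> n))"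
      unfolding NN_def by (simp only: distrib_left mult.left_commute[of a] add_ac)
    also have "\<dots> \<le> (1 + e) * NN c + (1 + 1 / e) * (sq c * (\<delta> n + a * \<tau> n))"
      using nn e1 sq0[of c] by (intro add_left_mono mult_left_mono add_right_mono) (auto simp: \<delta>sum)
    also have "\<dots> = (1 + e) * NN c + sq c * ((1 + 1 / e) * (\<delta> n + a * \<tau> n))"
      by (simp only: mult_ac)
    also have "\<dots> \<le> (1 + e) * (?S * DD c) + sq c * (e * \<kappa>)"
      using NN_le[OF c] n e sq0[of c] by (intro add_mono mult_left_mono) auto
    also have "sq c * (e * \<kappa>) = e * (\<kappa> * sq c)"
      by simp
    also have "\<dots> \<le> e * DD c"
      using DD_lower[of c] e by (intro mult_left_mono) auto
    finally have N: "?N \<le> ((1 + e) * ?S + e) * DD c"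
      by (simp add: algebra_simps)
    have wL: "L2 (disk R) (\<lambda>x. w x * f x)" if "L2 (disk R) f" for f
    proof -
      have "integrable (disk R) (\<lambda>x. (w x)\<^sup>2 * (f x)\<^sup>2)"
        using that by (subst integrable_weight_iff) (auto simp: L2_def)
      then show ?thesis
        using that by (auto simp: L2_def power_mult_distrib)
    qed
    have pull: "(w x)\<^sup>2 * (\<Sum>i<k. c i * f i x)\<^sup>2 = (\<Sum>i<k. c i * (w x * f i x))\<^sup>2" for f x
      by (simp add: sum_distrib_left power_mult_distrib[symmetric] mult.left_commute)
    \<comment> \<open>Young is used with the roles exchanged, the old mass bounded by the new one,
      since a lower bound for the new mass is wanted.\<close>
    have "DD c \<le> (1 + e) * ?D + (1 + 1 / e) * (sq c * (\<Sum>i<k. \<integral>x. (w x * u i x - w x * \<phi> i x)\<^sup>2 \<partial>disk R))"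
      unfolding DD_def mass_def pull sq_def by (intro L2_lincomb_young wL uL C1_L2 \<phi> e)
    also have "(\<Sum>i<k. \<integral>x. (w x * u i x - w x * \<phi> i x)\<^sup>2 \<partial>disk R) \<le> (\<Sum>i<k. M * (\<integral>x. (\<phi> i x - u i x)\<^sup>2 \<partial>disk R))"
    proof (rule sum_mono)
      fix i assume "i \<in> {..<k}"
      then have i: "i < k" by simp
      have "(\<integral>x. (w x * u i x - w x * \<phi> i x)\<^sup>2 \<partial>disk R) = (\<integral>x. (w x)\<^sup>2 * (\<phi> i x - u i x)\<^sup>2 \<partial>disk R)"
        by (simp add: right_diff_distrib[symmetric] power_mult_distrib power2_commute)
      also have "\<dots> \<le> M * (\<integral>x. (\<phi> i x - u i x)\<^sup>2 \<partial>disk R)"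
        by (intro hi L2_diff C1_L2 \<phi> uL i)
      finally show "(\<integral>x. (w x * u i x - w x * \<phi> i x)\<^sup>2 \<partial>disk R) \<le> M * (\<integral>x. (\<phi> i x - u i x)\<^sup>2 \<partial>disk R)" .
    qed
    also have "\<dots> = M * (\<Sum>i<k. \<integral>x. (\<phi> i x - u i x)\<^sup>2 \<partial>disk R)"
      by (simp add: sum_distrib_left)
    also have "\<dots> \<le> M * \<delta> n"
      using nn m unfolding \<delta>sum by (intro mult_left_mono) auto
    finally have "DD c \<le> (1 + e) * ?D + (1 + 1 / e) * (sq c * (M * \<delta> n))"
      using e1 sq0[of c] by (simp add: mult_left_mono)
    also have "(1 + 1 / e) * (sq c * (M * \<delta> n)) = sq c * ((1 + 1 / e) * (M * \<delta> n))"
      by (simp only: mult_ac)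
    also have "\<dots> \<le> sq c * (e * \<kappa>)"
      using n sq0[of c] by (intro mult_left_mono) auto
    also have "sq c * (e * \<kappa>) = e * (\<kappa> * sq c)"
      by simp
    also have "\<dots> \<le> e * DD c"
      using DD_lower[of c] e by (intro mult_left_mono) auto
    finally have D: "(1 - e) * DD c \<le> (1 + e) * ?D"
      by (simp add: algebra_simps)
    have "0 < (1 - e) * DD c"
      using e Dpos by simp
    then have Dp: "0 < ?D"
      using D e by (smt (verit) mult_nonneg_nonpos)
    have "(1 - e) * ?N \<le> (1 - e) * (((1 + e) * ?S + e) * DD c)"
      using N e by (intro mult_left_mono) auto
    also have "\<dots> = ((1 + e) * ?S + e) * ((1 - e) * DD c)"
      by (simp only: mult_ac)
    also have "\<dots> \<le> ((1 + e) * ?S + e) * ((1 + e) * ?D)"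
      using D e S0 by (intro mult_left_mono add_nonneg_nonneg mult_nonneg_nonneg) auto
    also have "\<dots> = ((1 + e) * ((1 + e) * ?S + e)) * ?D"
      by (simp only: mult_ac)
    also have "\<dots> \<le> ((1 - e) * M') * ?D"
      using e Dp by (intro mult_right_mono) auto
    finally have "(1 - e) * ?N \<le> (1 - e) * (M' * ?D)"
      by (simp only: mult.assoc)
    then have "?N \<le> M' * ?D"
      using e by simp
    with Dp show ?thesis
      by simp
  qed
  show ?thesis
    unfolding admissible_def a_def[symmetric] using \<phi> goal by blast
qed

text \<open>Existence of one level makes both infima range over nonempty sets bounded below by 0, so
  both are genuine infima.\<close>

theorem robin_eigenvalue_eq_Inf:
  assumes k: "k \<ge> 1" and \<beta>: "\<beta> \<ge> 0" and ex: "\<exists>M. admissible R (\<beta> * (b * R)) (\<lambda>x. (w x)\<^sup>2) k M"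
  shows "robin_eigenvalue g D (circle_curve R) k \<beta> = Inf {M. admissible R (\<beta> * (b * R)) (\<lambda>x. (w x)\<^sup>2) k M}"
proof -
  define A where "A = {M. admissible R (\<beta> * (b * R)) (\<lambda>x. (w x)\<^sup>2) k M}"
  define F where "F L = (SUP u \<in> {u \<in> L. \<not> (AE x in area_measure g D. u x = 0)}. robin_rayleigh g D (circle_curve R) \<beta> u)" for L
  have a: "\<beta> * (b * R) \<ge> 0"
    using \<beta> b_pos R by simp
  have A0: "M \<ge> 0" if "M \<in> A" for M
    using admissible_nonneg[OF _ k a] that by (auto simp: A_def)
  have Ab: "bdd_below A"
    using A0 by (rule bdd_belowI)
  have Ane: "A \<noteq> {}"
    using ex by (auto simp: A_def)
  \<comment> \<open>The margin \<open>e\<close> is there because mollifying the basis costs an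
    arbitrarily small amount above the supremum.\<close>
  have lower: "Inf A \<le> F L" if "L \<in> {L. H1_subspace g D k L}" for L
  proof (rule field_le_epsilon)
    fix e :: real assume "e > 0"
    then have "F L + e \<in> A"
      using admissible_of_subspace[of k L \<beta> "F L + e"] that k \<beta> by (simp add: A_def F_def)
    then show "Inf A \<le> F L + e"
      by (rule cInf_lower[OF _ Ab])
  qed
  have upper: "\<exists>L\<in>{L. H1_subspace g D k L}. F L \<le> M" if "M \<in> A" for M
    using subspace_of_admissible[OF _ k] that unfolding A_def F_def by blast
  have ne: "{L. H1_subspace g D k L} \<noteq> {}"
    using upper Ane by blast
  have "Inf A \<le> (INF L \<in> {L. H1_subspace g D k L}. F L)"
    by (rule cINF_greatest[OF ne lower])
  moreover have "(INF L \<in> {L. H1_subspace g D k L}. F L) \<le> Inf A"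
  proof (rule cInf_greatest[OF Ane])
    fix M assume "M \<in> A"
    then obtain L where "L \<in> {L. H1_subspace g D k L}" "F L \<le> M"
      using upper by blast
    then show "(INF L \<in> {L. H1_subspace g D k L}. F L) \<le> M"
      using lower by (intro cINF_lower2[of _ _ L]) (auto intro!: bdd_belowI2[of _ "Inf A"])
  qed
  ultimately show ?thesis
    by (simp add: robin_eigenvalue_def F_def A_def)
qed

end

section \<open>Reduction to a weight on the unit disk\<close>

lemma integral_disk_lborel:
  fixes f :: "real^2 \<Rightarrow> real"
  assumes f [measurable]: "f \<in> borel_measurable borel"
  shows "(\<integral>x. f x \<partial>disk R) = (\<integral>x. indicator (ball 0 R) x * f x \<partial>lborel)"
proof -
  have m: "(\<lambda>x. indicator (ball 0 R) x * f x) \<in> borel_measurable borel"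
    by (intro borel_measurable_times borel_measurable_indicator f) auto
  have "(\<integral>x. f x \<partial>disk R) = (\<integral>x. indicator (ball 0 R) x *\<^sub>R f x \<partial>lebesgue)"
    by (rule integral_restrict_space) simp
  also have "\<dots> = (\<integral>x. indicator (ball 0 R) x * f x \<partial>lborel)"
    using m by (simp add: integral_completion)
  finally show ?thesis .
qed

lemma integral_disk_dilate:
  fixes f :: "real^2 \<Rightarrow> real"
  assumes f [measurable]: "f \<in> borel_measurable borel" and s: "s > 0"
  shows "(\<integral>x. s\<^sup>2 * f (s *\<^sub>R x) \<partial>disk (R / s)) = (\<integral>x. f x \<partial>disk R)"
proof -
  have m: "(\<lambda>x. indicator (ball 0 R) x * f x) \<in> borel_measurable borel"
    by (intro borel_measurable_times borel_measurable_indicator f) auto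
  have b: "indicator (ball 0 R) (s *\<^sub>R x) = (indicator (ball 0 (R / s)) x :: real)" for x :: "real^2"
    using s by (simp add: indicator_def field_simps)
  have "(\<integral>x. f x \<partial>disk R) = (\<integral>x. indicator (ball 0 R) x * f x \<partial>lborel)"
    by (rule integral_disk_lborel[OF f])
  also have "\<dots> = (\<integral>x. indicator (ball 0 R) x * f x \<partial>density (distr lborel borel (\<lambda>x. s *\<^sub>R x)) (\<lambda>_. ennreal (s\<^sup>2)))"
  proof -
    have "lborel = density (distr lborel borel (\<lambda>x :: real^2. s *\<^sub>R x)) (\<lambda>_. ennreal (s\<^sup>2))"
      using lborel_affine[of s "0 :: real^2"] s by simp
    then show ?thesis
      by (rule arg_cong)
  qed
  also have "\<dots> = (\<integral>x. s\<^sup>2 * (indicator (ball 0 R) x * f x) \<partial>distr lborel borel (\<lambda>x. s *\<^sub>R x))"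
    using m by (subst integral_density) auto
  also have "\<dots> = (\<integral>x. s\<^sup>2 * (indicator (ball 0 R) (s *\<^sub>R x) * f (s *\<^sub>R x)) \<partial>lborel)"
    using m by (subst integral_distr) auto
  also have "\<dots> = (\<integral>x. indicator (ball 0 (R / s)) x * (s\<^sup>2 * f (s *\<^sub>R x)) \<partial>lborel)"
    by (simp add: b mult_ac)
  also have "\<dots> = (\<integral>x. s\<^sup>2 * f (s *\<^sub>R x) \<partial>disk (R / s))"
    by (rule integral_disk_lborel[symmetric]) measurable
  finally show ?thesis ..
qed

lemma circle_curve_scale: "s *\<^sub>R circle_curve r t = circle_curve (s * r) t"
  by (simp add: circle_curve_def)

text \<open>In the plane the square of the chain rule factor cancels the Jacobian of the dilation,
  and the boundary term is integrated over the angle, which does not scale.\<close>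

lemma energy_dilate:
  assumes "C1 \<phi>" "s > 0"
  shows "energy (R / s) a (\<lambda>x. \<phi> (s *\<^sub>R x)) = energy R a \<phi>"
proof -
  have [measurable]: "(\<lambda>x. partials \<phi> x \<bullet> partials \<phi> x) \<in> borel_measurable borel"
    by (intro borel_measurable_continuous_onI continuous_intros C1_partials_continuous assms)
  have "(\<integral>x. s\<^sup>2 * (partials \<phi> (s *\<^sub>R x) \<bullet> partials \<phi> (s *\<^sub>R x)) \<partial>disk (R / s)) = (\<integral>x. partials \<phi> x \<bullet> partials \<phi> x \<partial>disk R)"
    by (rule integral_disk_dilate) (use assms in auto)
  then show ?thesis
    using assms(2) by (simp add: energy_def C1_dilate(2)[OF assms(1)] circle_curve_scale power2_eq_square mult.assoc)
qed

lemma mass_dilate: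
  assumes "C1 \<phi>" "s > 0" and [measurable]: "\<rho> \<in> borel_measurable borel"
  shows "mass (R / s) (\<lambda>x. s\<^sup>2 * \<rho> (s *\<^sub>R x)) (\<lambda>x. \<phi> (s *\<^sub>R x)) = mass R \<rho> \<phi>"
proof -
  have [measurable]: "\<phi> \<in> borel_measurable borel"
    by (intro borel_measurable_continuous_onI C1_continuous assms)
  have "(\<integral>x. s\<^sup>2 * (\<rho> (s *\<^sub>R x) * (\<phi> (s *\<^sub>R x))\<^sup>2) \<partial>disk (R / s)) = (\<integral>x. \<rho> x * (\<phi> x)\<^sup>2 \<partial>disk R)"
    by (rule integral_disk_dilate) (use assms in auto)
  then show ?thesis
    by (simp add: mass_def mult.assoc)
qed

lemma admissible_dilate:
  assumes "admissible R a \<rho> k M" "s > 0" "\<rho> \<in> borel_measurable borel"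
  shows "admissible (R / s) a (\<lambda>x. s\<^sup>2 * \<rho> (s *\<^sub>R x)) k M"
proof -
  obtain \<phi> where \<phi>: "\<And>i. i < k \<Longrightarrow> C1 (\<phi> i)"
    and *: "\<And>c :: nat \<Rightarrow> real. \<exists>i<k. c i \<noteq> 0 \<Longrightarrow> 0 < mass R \<rho> (\<lambda>x. \<Sum>i<k. c i * \<phi> i x) \<and>
        energy R a (\<lambda>x. \<Sum>i<k. c i * \<phi> i x) \<le> M * mass R \<rho> (\<lambda>x. \<Sum>i<k. c i * \<phi> i x)"
    using assms(1) unfolding admissible_def by blast
  have C: "C1 (\<lambda>x. \<Sum>i<k. c i * \<phi> i x)" for c
    by (intro C1_lincomb \<phi>)
  show ?thesis
    unfolding admissible_def
  proof (intro exI[of _ "\<lambda>i x. \<phi> i (s *\<^sub>R x)"] conjI allI impI)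
    show "C1 (\<lambda>x. \<phi> i (s *\<^sub>R x))" if "i < k" for i
      by (rule C1_dilate(1)[OF \<phi>[OF that]])
    fix c :: "nat \<Rightarrow> real" assume "\<exists>i<k. c i \<noteq> 0"
    then have h: "0 < mass R \<rho> (\<lambda>x. \<Sum>i<k. c i * \<phi> i x)"
        "energy R a (\<lambda>x. \<Sum>i<k. c i * \<phi> i x) \<le> M * mass R \<rho> (\<lambda>x. \<Sum>i<k. c i * \<phi> i x)"
      using * by blast+
    show "0 < mass (R / s) (\<lambda>x. s\<^sup>2 * \<rho> (s *\<^sub>R x)) (\<lambda>x. \<Sum>i<k. c i * \<phi> i (s *\<^sub>R x))"
      using mass_dilate[OF C[of c] assms(2,3), of R] h by simp
    show "energy (R / s) a (\<lambda>x. \<Sum>i<k. c i * \<phi> i (s *\<^sub>R x)) \<le> M * mass (R / s) (\<lambda>x. s\<^sup>2 * \<rho> (s *\<^sub>R x)) (\<lambda>x. \<Sum>i<k. c i * \<phi> i (s *\<^sub>R x))"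
      using mass_dilate[OF C[of c] assms(2,3), of R] energy_dilate[OF C[of c] assms(2), of R a] h by simp
  qed
qed

lemma admissible_dilate_iff:
  assumes "s > 0" "\<rho> \<in> borel_measurable borel"
  shows "admissible (R / s) a (\<lambda>x. s\<^sup>2 * \<rho> (s *\<^sub>R x)) k M \<longleftrightarrow> admissible R a \<rho> k M"
proof
  assume "admissible (R / s) a (\<lambda>x. s\<^sup>2 * \<rho> (s *\<^sub>R x)) k M"
  moreover have "(\<lambda>x. s\<^sup>2 * \<rho> (s *\<^sub>R x)) \<in> borel_measurable borel"
    using assms(2) by measurable
  moreover have "1 / s > 0"
    using assms(1) by simp
  ultimately have "admissible (R / s / (1 / s)) a (\<lambda>x. (1 / s)\<^sup>2 * (s\<^sup>2 * \<rho> (s *\<^sub>R ((1 / s) *\<^sub>R x)))) k M"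
    using admissible_dilate[of "R / s" a "\<lambda>x. s\<^sup>2 * \<rho> (s *\<^sub>R x)" k M "1 / s"] by blast
  moreover have "(\<lambda>x. (1 / s)\<^sup>2 * (s\<^sup>2 * \<rho> (s *\<^sub>R ((1 / s) *\<^sub>R x)))) = \<rho>"
    using assms(1) by (simp add: power_divide)
  moreover have "R / s / (1 / s) = R"
    using assms(1) by simp
  ultimately show "admissible R a \<rho> k M"
    by (simp only:)
qed (rule admissible_dilate[OF _ assms])

lemma mass_cong: "(\<And>x. norm x < R \<Longrightarrow> \<rho> x = \<sigma> x) \<Longrightarrow> mass R \<rho> \<phi> = mass R \<sigma> \<phi>"
  unfolding mass_def by (intro Bochner_Integration.integral_cong) auto

lemma admissible_cong: "(\<And>x. norm x < R \<Longrightarrow> \<rho> x = \<sigma> x) \<Longrightarrow> admissible R a \<rho> k M \<longleftrightarrow> admissible R a \<sigma> k M"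
  unfolding admissible_def using mass_cong[of R \<rho> \<sigma>] by simp

lemma mass_scale: "mass R (\<lambda>x. c * \<rho> x) \<phi> = c * mass R \<rho> \<phi>"
  by (simp add: mass_def mult.assoc)

lemma admissible_scale:
  assumes "c > 0"
  shows "admissible R a (\<lambda>x. c * \<rho> x) k M \<longleftrightarrow> admissible R a \<rho> k (c * M)"
  unfolding admissible_def mass_scale using assms by (simp add: zero_less_mult_iff mult_ac)

lemma Inf_scale:
  fixes c :: real
  assumes c: "c > 0" and ne: "\<exists>M. P M" and nn: "\<And>M. P M \<Longrightarrow> M \<ge> 0"
  shows "c * Inf {M. P (c * M)} = Inf {M. P M}"
proof -
  have b: "bdd_below {M. P M}"
    using nn by (intro bdd_belowI[of _ 0]) auto
  have b': "bdd_below {M. P (c * M)}"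
    using nn c by (intro bdd_belowI[of _ 0]) (force simp: zero_le_mult_iff)
  obtain M0 where M0: "P M0"
    using ne by blast
  have ne': "{M. P (c * M)} \<noteq> {}"
    using M0 c by (auto intro!: exI[of _ "M0 / c"])
  show ?thesis
  proof (rule antisym)
    show "c * Inf {M. P (c * M)} \<le> Inf {M. P M}"
    proof (rule cInf_greatest)
      fix M assume "M \<in> {M. P M}"
      then have "Inf {M. P (c * M)} \<le> M / c"
        using c by (intro cInf_lower b') simp
      then show "c * Inf {M. P (c * M)} \<le> M"
        using c by (simp add: field_simps)
    qed (use M0 in blast)
    have "Inf {M. P M} / c \<le> Inf {M. P (c * M)}"
    proof (rule cInf_greatest[OF ne'])
      fix M assume "M \<in> {M. P (c * M)}"
      then have "Inf {M. P M} \<le> c * M"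
        by (intro cInf_lower b) simp
      then show "Inf {M. P M} / c \<le> M"
        using c by (simp add: field_simps)
    qed
    then show "Inf {M. P M} \<le> c * Inf {M. P (c * M)}"
      using c by (simp add: field_simps)
  qed
qed

definition weight :: "real \<Rightarrow> real^2 \<Rightarrow> real" where
  "weight t x = 1 / (1 + t * (x \<bullet> x))\<^sup>2"

definition \<mu> :: "nat \<Rightarrow> real \<Rightarrow> (real^2 \<Rightarrow> real) \<Rightarrow> real" where
  "\<mu> k \<alpha> \<rho> = Inf {M. admissible 1 \<alpha> \<rho> k M}"

lemma weight_measurable [measurable]: "weight t \<in> borel_measurable borel"
  unfolding weight_def by measurable

text \<open>Joins the min-max identity, the dilation to the unit disk and the removal of the
  constant \<open>c\<close> from the weight. The equation
  \<open>\<beta> * (b * R) = \<alpha>\<close> is what the parameters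
  \<open>\<alpha> / sin \<Theta>\<close> and \<open>\<alpha> / sinh \<bar>\<Theta>\<bar>\<close> are
  designed for.\<close>

lemma (in conformal_disk) robin_eigenvalue_eq_\<mu>:
  assumes k: "k \<ge> 1" and \<alpha>: "\<alpha> > 0" "\<beta> * (b * R) = \<alpha>"
    and w: "w \<in> borel_measurable borel"
    and c: "c > 0" "\<And>x. norm x < 1 \<Longrightarrow> R\<^sup>2 * (w (R *\<^sub>R x))\<^sup>2 = c * weight t x"
    and ex: "\<exists>M. admissible 1 \<alpha> (weight t) k M"
  shows "c * robin_eigenvalue g (ball 0 R) (circle_curve R) k \<beta> = \<mu> k \<alpha> (weight t)"
proof -
  have \<beta>: "\<beta> \<ge> 0"
    using \<alpha> b_pos R by (metis less_imp_le mult_pos_pos zero_less_mult_pos2)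
  have eq: "admissible R (\<beta> * (b * R)) (\<lambda>x. (w x)\<^sup>2) k M \<longleftrightarrow> admissible 1 \<alpha> (weight t) k (c * M)" for M
  proof -
    have "admissible R (\<beta> * (b * R)) (\<lambda>x. (w x)\<^sup>2) k M \<longleftrightarrow> admissible (R / R) \<alpha> (\<lambda>x. R\<^sup>2 * (w (R *\<^sub>R x))\<^sup>2) k M"
      unfolding \<alpha>(2) by (intro admissible_dilate_iff[symmetric] R borel_measurable_power w)
    also have "\<dots> \<longleftrightarrow> admissible 1 \<alpha> (\<lambda>x. c * weight t x) k M"
    proof -
      have "R / R = 1"
        using R by simp
      then show ?thesis
        unfolding \<open>R / R = 1\<close> by (intro admissible_cong c(2))
    qed
    finally show ?thesis
      by (simp add: admissible_scale[OF c(1)])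
  qed
  obtain M where "admissible 1 \<alpha> (weight t) k M"
    using ex by blast
  then have "admissible 1 \<alpha> (weight t) k (c * (M / c))"
    using c by simp
  then have "\<exists>M. admissible R (\<beta> * (b * R)) (\<lambda>x. (w x)\<^sup>2) k M"
    unfolding eq by blast
  then have "robin_eigenvalue g (ball 0 R) (circle_curve R) k \<beta> = Inf {M. admissible 1 \<alpha> (weight t) k (c * M)}"
    by (simp add: robin_eigenvalue_eq_Inf[OF k \<beta>] eq)
  also have "c * \<dots> = \<mu> k \<alpha> (weight t)"
    unfolding \<mu>_def using ex admissible_nonneg[OF _ k] \<alpha>(1) by (intro Inf_scale c) auto
  finally show ?thesis .
qed

section \<open>The three geometries\<close>

lemma sphere_conformal_disk:
  assumes "R > 0"
  shows "conformal_disk sphere_metric R (\<lambda>z. 2 / (1 + z \<bullet> z)) (2 / (1 + R\<^sup>2))"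
proof
  have pos: "1 + z \<bullet> z > 0" for z :: "real^2"
    by (smt (verit) inner_ge_zero)
  show "R > 0" by fact
  show "sphere_metric z = mat ((2 / (1 + z \<bullet> z))\<^sup>2)" for z
    by (rule sphere_metric_conformal)
  show "continuous_on (cball 0 R) (\<lambda>z::real^2. 2 / (1 + z \<bullet> z))"
    using pos by (intro continuous_intros) (auto simp: less_imp_neq[OF pos, symmetric])
  show "0 < 2 / (1 + z \<bullet> z)" for z :: "real^2"
    using pos by simp
  show "2 / (1 + z \<bullet> z) = 2 / (1 + R\<^sup>2)" if "norm z = R" for z :: "real^2"
    using that by (simp add: dot_square_norm)
qed

lemma hyperbolic_conformal_disk:
  assumes "0 < R" "R < 1"
  shows "conformal_disk hyperbolic_metric R (\<lambda>z. 2 / (1 - z \<bullet> z)) (2 / (1 - R\<^sup>2))"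
proof
  have pos: "1 - z \<bullet> z > 0" if "norm z \<le> R" for z :: "real^2"
    using assms that by (simp add: dot_square_norm power_less_one_iff)
  show "R > 0" by fact
  show "hyperbolic_metric z = mat ((2 / (1 - z \<bullet> z))\<^sup>2)" if "norm z \<le> R" for z
    using that assms by (intro hyperbolic_metric_conformal) simp
  show "continuous_on (cball 0 R) (\<lambda>z::real^2. 2 / (1 - z \<bullet> z))"
    using pos by (intro continuous_intros) force
  show "0 < 2 / (1 - z \<bullet> z)" if "norm z \<le> R" for z :: "real^2"
    using pos[OF that] by simp
  show "2 / (1 - z \<bullet> z) = 2 / (1 - R\<^sup>2)" if "norm z = R" for z :: "real^2"
    using that by (simp add: dot_square_norm)
qed

lemma euclidean_conformal_disk: "conformal_disk (\<lambda>_. mat 1) 1 (\<lambda>_. 1) 1"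
  by unfold_locales auto

text \<open>The boundary circle has length \<open>sin \<Theta>\<close> per unit angle, which turns
  the Robin parameter into \<alpha>. The factor \<open>4 * (tan (\<Theta> / 2))\<^sup>2\<close> is
  the rescaled area density at the origin, where \<open>weight\<close> is 1.\<close>

lemma cap_eigenvalue_sphere:
  assumes \<Theta>: "0 < \<Theta>" "\<Theta> < pi" and k: "k \<ge> 1" and \<alpha>: "\<alpha> > 0"
    and ex: "\<exists>M. admissible 1 \<alpha> (weight ((tan (\<Theta> / 2))\<^sup>2)) k M"
  shows "cap_eigenvalue k \<Theta> (\<alpha> / sin \<Theta>) * (4 * (tan (\<Theta> / 2))\<^sup>2) = \<mu> k \<alpha> (weight ((tan (\<Theta> / 2))\<^sup>2))"
proof -
  define R where "R = tan (\<Theta> / 2)"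
  have R: "R > 0"
    using \<Theta> unfolding R_def by (intro tan_gt_zero) auto
  have sin: "sin \<Theta> = 2 * R / (1 + R\<^sup>2)"
    using \<Theta> sin_tan_half[of "\<Theta> / 2"] by (simp add: R_def)
  have p: "1 + R\<^sup>2 > 0"
    by (simp add: add_pos_nonneg)
  interpret conformal_disk sphere_metric R "\<lambda>z. 2 / (1 + z \<bullet> z)" "2 / (1 + R\<^sup>2)"
    by (rule sphere_conformal_disk[OF R])
  have "(4 * R\<^sup>2) * robin_eigenvalue sphere_metric (ball 0 R) (circle_curve R) k (\<alpha> / sin \<Theta>) = \<mu> k \<alpha> (weight (R\<^sup>2))"
  proof (rule robin_eigenvalue_eq_\<mu>[OF k \<alpha>])
    show "\<alpha> / sin \<Theta> * (2 / (1 + R\<^sup>2) * R) = \<alpha>"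
    proof -
      have "2 / (1 + R\<^sup>2) * R = sin \<Theta>"
        by (simp add: sin)
      then show ?thesis
        using sin_gt_zero[OF \<Theta>] by simp
    qed
    show "R\<^sup>2 * (2 / (1 + R *\<^sub>R x \<bullet> R *\<^sub>R x))\<^sup>2 = 4 * R\<^sup>2 * weight (R\<^sup>2) x" for x
      by (simp add: weight_def power_divide power2_eq_square mult_ac)
  qed (use R ex in \<open>auto simp: R_def\<close>)
  then show ?thesis
    using \<Theta> by (simp add: cap_eigenvalue_def sphere_cap_eq_ball R_def mult.commute)
qed

text \<open>The hyperbolic counterpart: the conformal factor has denominator
  \<open>1 - z \<bullet> z\<close>, whence the negative parameter of the weight, and the half-angle
  formula gives the boundary length \<open>sinh \<bar>\<Theta>\<bar>\<close> per unit angle.\<close>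

lemma cap_eigenvalue_hyperbolic:
  assumes \<Theta>: "\<Theta> < 0" and k: "k \<ge> 1" and \<alpha>: "\<alpha> > 0"
    and ex: "\<exists>M. admissible 1 \<alpha> (weight (- (tanh (\<Theta> / 2))\<^sup>2)) k M"
  shows "cap_eigenvalue k \<Theta> (\<alpha> / sinh \<bar>\<Theta>\<bar>) * (4 * (tanh (\<Theta> / 2))\<^sup>2) = \<mu> k \<alpha> (weight (- (tanh (\<Theta> / 2))\<^sup>2))"
proof -
  define R where "R = tanh (\<bar>\<Theta>\<bar> / 2)"
  have R: "R > 0" "R < 1"
    using \<Theta> tanh_real_lt_1 tanh_real_gt_neg1 by (auto simp: R_def)
  have R2: "R\<^sup>2 = (tanh (\<Theta> / 2))\<^sup>2"
    using \<Theta> by (simp add: R_def)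
  have p: "1 - R\<^sup>2 > 0"
    using R by (simp add: power_less_one_iff)
  have sinh: "sinh \<bar>\<Theta>\<bar> = 2 * R / (1 - R\<^sup>2)"
  proof -
    define y where "y = \<bar>\<Theta>\<bar> / 2"
    have c: "cosh y \<noteq> 0"
      by simp
    have "(cosh y)\<^sup>2 * (1 - R\<^sup>2) = 1"
    proof -
      have "(cosh y)\<^sup>2 * R\<^sup>2 = (sinh y)\<^sup>2"
        using c by (simp add: R_def y_def[symmetric] tanh_def power_divide)
      then show ?thesis
        using cosh_square_eq[of y] by (simp only: right_diff_distrib) simp
    qed
    then have c2: "(cosh y)\<^sup>2 = 1 / (1 - R\<^sup>2)"
      using p by (simp add: field_simps)
    have "sinh \<bar>\<Theta>\<bar> = sinh (2 * y)"
      by (simp add: y_def)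
    also have "\<dots> = 2 * R * (cosh y)\<^sup>2"
      unfolding sinh_double using c by (simp add: R_def y_def[symmetric] tanh_def power2_eq_square)
    finally show ?thesis
      by (simp add: c2)
  qed
  interpret conformal_disk hyperbolic_metric R "\<lambda>z. 2 / (1 - z \<bullet> z)" "2 / (1 - R\<^sup>2)"
    by (rule hyperbolic_conformal_disk[OF R])
  have "(4 * R\<^sup>2) * robin_eigenvalue hyperbolic_metric (ball 0 R) (circle_curve R) k (\<alpha> / sinh \<bar>\<Theta>\<bar>) = \<mu> k \<alpha> (weight (- R\<^sup>2))"
  proof (rule robin_eigenvalue_eq_\<mu>[OF k \<alpha>])
    show "\<alpha> / sinh \<bar>\<Theta>\<bar> * (2 / (1 - R\<^sup>2) * R) = \<alpha>"
    proof -
      define y where "y = sinh \<bar>\<Theta>\<bar>"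
      have "y \<noteq> 0"
        using \<Theta> by (simp add: y_def)
      moreover have "2 / (1 - R\<^sup>2) * R = y"
        unfolding y_def sinh by simp
      ultimately show ?thesis
        unfolding y_def[symmetric] by simp
    qed
    show "R\<^sup>2 * (2 / (1 - R *\<^sub>R x \<bullet> R *\<^sub>R x))\<^sup>2 = 4 * R\<^sup>2 * weight (- R\<^sup>2) x" for x
      by (simp add: weight_def power_divide power2_eq_square mult_ac)
  qed (use R ex R2 in auto)
  then show ?thesis
    using \<Theta> by (simp add: cap_eigenvalue_def hyperbolic_disk_eq_ball R_def mult.commute)
qed

lemma disk_eigenvalue_eq:
  assumes k: "k \<ge> 1" and \<alpha>: "\<alpha> > 0" and ex: "\<exists>M. admissible 1 \<alpha> (weight 0) k M"
  shows "disk_eigenvalue k \<alpha> = \<mu> k \<alpha> (weight 0)"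
proof -
  interpret conformal_disk "\<lambda>_. mat 1" 1 "\<lambda>_. 1" 1
    by (rule euclidean_conformal_disk)
  show ?thesis
    using robin_eigenvalue_eq_\<mu>[OF k \<alpha>, of \<alpha> 1 0] ex by (simp add: disk_eigenvalue_def weight_def)
qed

section \<open>Weighted estimates on the unit disk\<close>

text \<open>The value at radius \<open>s\<close> differs from the boundary value by the integral of
  the radial derivative over an interval of length at most 1, to which Cauchy-Schwarz applies. On
  that interval \<open>s \<le> r\<close>, so the factor \<open>s\<close> may move inside as
  \<open>r\<close>, the density of area.\<close>

lemma radial_square_bound:
  assumes \<phi>: "C1 \<phi>" and s: "0 < s" "s \<le> 1"
  shows "ennreal (s * (\<phi> (circle_curve s t))\<^sup>2) \<le> 2 * ennreal ((\<phi> (circle_curve 1 t))\<^sup>2)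
    + 2 * (\<integral>\<^sup>+r\<in>{0..1}. ennreal r * ennreal (partials \<phi> (circle_curve r t) \<bullet> partials \<phi> (circle_curve r t)) \<partial>lborel)"
    (is "_ \<le> _ + 2 * ?Q")
proof -
  define e where "e = (vector [cos t, sin t] :: real^2)"
  define \<psi> where "\<psi> r = partials \<phi> (circle_curve r t) \<bullet> e" for r
  have e1: "e \<bullet> e = 1"
    using sin_cos_squared_add[of t] by (simp add: e_def inner_real2 power2_eq_square)
  have \<psi>c: "continuous_on UNIV \<psi>"
    unfolding \<psi>_def
    by (intro continuous_intros continuous_on_compose2[OF C1_partials_continuous[OF \<phi>, of UNIV]]) auto
  have [measurable]: "\<psi> \<in> borel_measurable borel"
    using \<psi>c by (rule borel_measurable_continuous_onI)
  have \<psi>le: "(\<psi> r)\<^sup>2 \<le> partials \<phi> (circle_curve r t) \<bullet> partials \<phi> (circle_curve r t)" for r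
    unfolding \<psi>_def using Cauchy_Schwarz_ineq[of "partials \<phi> (circle_curve r t)" e] by (simp add: e1)
  define d where "d = \<phi> (circle_curve 1 t) - \<phi> (circle_curve s t)"
  have "has_bochner_integral lborel (\<lambda>r. \<psi> r * indicator {s..1} r) d"
    unfolding d_def
  proof (rule has_bochner_integral_FTC_Icc_real[OF s(2)])
    show "((\<lambda>s. \<phi> (circle_curve s t)) has_real_derivative \<psi> r) (at r)" for r
      unfolding \<psi>_def e_def by (rule C1_radial_derivative[OF \<phi>])
    show "isCont \<psi> r" for r
      using \<psi>c by (simp add: continuous_on_eq_continuous_at)
  qed
  then have di: "integrable lborel (\<lambda>r. \<psi> r * indicator {s..1} r)" and d: "d = (\<integral>r. \<psi> r * indicator {s..1} r \<partial>lborel)"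
    by (auto simp: has_bochner_integral_iff)
  have "ennreal \<bar>d\<bar> \<le> (\<integral>\<^sup>+r. ennreal \<bar>\<psi> r * indicator {s..1} r\<bar> \<partial>lborel)"
    unfolding d using integral_norm_bound_ennreal[OF di] by simp
  also have "\<dots> = (\<integral>\<^sup>+r. indicator {s..1} r * (ennreal \<bar>\<psi> r\<bar> * indicator {s..1} r) \<partial>lborel)"
    by (intro nn_integral_cong) (auto simp: indicator_def)
  finally have "(ennreal \<bar>d\<bar>)\<^sup>2 \<le> (\<integral>\<^sup>+r. indicator {s..1} r * (ennreal \<bar>\<psi> r\<bar> * indicator {s..1} r) \<partial>lborel)\<^sup>2"
    by (rule power_mono) simp
  also have "\<dots> \<le> (\<integral>\<^sup>+r. (indicator {s..1} r)\<^sup>2 \<partial>lborel) * (\<integral>\<^sup>+r. (ennreal \<bar>\<psi> r\<bar> * indicator {s..1} r)\<^sup>2 \<partial>lborel)"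
    by (rule Cauchy_Schwarz_nn_integral) measurable
  also have "(\<integral>\<^sup>+r. (indicator {s..1} r)\<^sup>2 \<partial>lborel) = (\<integral>\<^sup>+r. indicator {s..1} r \<partial>(lborel :: real measure))"
    by (intro nn_integral_cong) (auto simp: indicator_def)
  also have "\<dots> = ennreal (1 - s)"
    using s by simp
  also have "ennreal (1 - s) * (\<integral>\<^sup>+r. (ennreal \<bar>\<psi> r\<bar> * indicator {s..1} r)\<^sup>2 \<partial>lborel) \<le> 1 * (\<integral>\<^sup>+r. (ennreal \<bar>\<psi> r\<bar> * indicator {s..1} r)\<^sup>2 \<partial>lborel)"
    using s by (intro mult_right_mono) (auto simp: ennreal_le_1)
  finally have *: "ennreal (d\<^sup>2) \<le> (\<integral>\<^sup>+r. (ennreal \<bar>\<psi> r\<bar> * indicator {s..1} r)\<^sup>2 \<partial>lborel)"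
    by (simp add: ennreal_power)
  have "ennreal s * ennreal (d\<^sup>2) \<le> ennreal s * (\<integral>\<^sup>+r. (ennreal \<bar>\<psi> r\<bar> * indicator {s..1} r)\<^sup>2 \<partial>lborel)"
    by (rule mult_left_mono[OF *]) simp
  also have "\<dots> = (\<integral>\<^sup>+r. ennreal s * (ennreal \<bar>\<psi> r\<bar> * indicator {s..1} r)\<^sup>2 \<partial>lborel)"
    by (rule nn_integral_cmult[symmetric]) measurable
  also have "\<dots> \<le> ?Q"
  proof (intro nn_integral_mono)
    fix r :: real
    show "ennreal s * (ennreal \<bar>\<psi> r\<bar> * indicator {s..1} r)\<^sup>2
      \<le> ennreal r * ennreal (partials \<phi> (circle_curve r t) \<bullet> partials \<phi> (circle_curve r t)) * indicator {0..1} r"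
    proof (cases "r \<in> {s..1}")
      case True
      have "s * (\<psi> r)\<^sup>2 \<le> r * (partials \<phi> (circle_curve r t) \<bullet> partials \<phi> (circle_curve r t))"
        using True s \<psi>le[of r] by (intro mult_mono) auto
      then show ?thesis
        using True s by (simp add: ennreal_power ennreal_mult[symmetric] ennreal_leI)
    qed simp
  qed
  finally have Q: "ennreal (s * d\<^sup>2) \<le> ?Q"
    using s by (simp add: ennreal_mult)
  have "s * (\<phi> (circle_curve s t))\<^sup>2 \<le> s * (2 * (\<phi> (circle_curve 1 t))\<^sup>2 + 2 * d\<^sup>2)"
    using s square_sum_le_young[of 1 "\<phi> (circle_curve 1 t)" "- d"] by (intro mult_left_mono) (auto simp: d_def power2_commute)
  also have "\<dots> \<le> 2 * (\<phi> (circle_curve 1 t))\<^sup>2 + 2 * (s * d\<^sup>2)"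
    using mult_right_mono[OF s(2), of "(\<phi> (circle_curve 1 t))\<^sup>2"] by (simp add: distrib_left mult.left_commute)
  finally have "ennreal (s * (\<phi> (circle_curve s t))\<^sup>2) \<le> ennreal (2 * (\<phi> (circle_curve 1 t))\<^sup>2 + 2 * (s * d\<^sup>2))"
    by (rule ennreal_leI)
  also have "\<dots> = 2 * ennreal ((\<phi> (circle_curve 1 t))\<^sup>2) + 2 * ennreal (s * d\<^sup>2)"
    using s by (simp add: ennreal_plus ennreal_mult)
  also have "\<dots> \<le> 2 * ennreal ((\<phi> (circle_curve 1 t))\<^sup>2) + 2 * ?Q"
    by (intro add_left_mono mult_left_mono Q) simp
  finally show ?thesis .
qed

text \<open>The polar factor \<open>s\<close> is spent on the radial bound, whose right side does
  not depend on \<open>s\<close>. What remains is the integral of the majorant \<open>h\<close> with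
  respect to \<open>ds\<close>; a strip at the origin and one of equal width at the boundary are
  thus controlled alike.\<close>

lemma nn_mass_le_energy:
  assumes \<phi>: "C1 \<phi>" and [measurable]: "\<rho> \<in> borel_measurable borel" "h \<in> borel_measurable borel"
    and \<rho>: "\<And>x. norm x \<le> 1 \<Longrightarrow> 0 \<le> \<rho> x \<and> \<rho> x \<le> h (norm x)"
  shows "(\<integral>\<^sup>+x. ennreal (\<rho> x * (\<phi> x)\<^sup>2) \<partial>disk 1) \<le> (\<integral>\<^sup>+s\<in>{0..1}. ennreal (h s) \<partial>lborel) *
    ennreal (2 * (\<integral>t. (\<phi> (circle_curve 1 t))\<^sup>2 \<partial>angles) + 2 * (\<integral>x. partials \<phi> x \<bullet> partials \<phi> x \<partial>disk 1))"
proof -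
  have [measurable]: "\<phi> \<in> borel_measurable borel"
    by (intro borel_measurable_continuous_onI C1_continuous \<phi>)
  have [measurable]: "(\<lambda>x. partials \<phi> x \<bullet> partials \<phi> x) \<in> borel_measurable borel"
    by (intro borel_measurable_continuous_onI continuous_on_inner C1_partials_continuous \<phi>)
  define Q where "Q t = (\<integral>\<^sup>+r\<in>{0..1}. ennreal r * ennreal (partials \<phi> (circle_curve r t) \<bullet> partials \<phi> (circle_curve r t)) \<partial>lborel)" for t
  have [measurable]: "Q \<in> borel_measurable borel"
    unfolding Q_def by measurable
  define B where "B t = 2 * ennreal ((\<phi> (circle_curve 1 t))\<^sup>2) + 2 * Q t" for t
  have [measurable]: "B \<in> borel_measurable borel"
    unfolding B_def by measurable
  have "(\<integral>\<^sup>+x. ennreal (\<rho> x * (\<phi> x)\<^sup>2) \<partial>disk 1)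
     = (\<integral>\<^sup>+t\<in>{0..2*pi}. (\<integral>\<^sup>+s\<in>{0..1}. ennreal s * ennreal (\<rho> (circle_curve s t) * (\<phi> (circle_curve s t))\<^sup>2) \<partial>lborel) \<partial>lborel)"
    unfolding nn_integral_disk by (rule polar_nn_integral) measurable
  also have "\<dots> \<le> (\<integral>\<^sup>+t\<in>{0..2*pi}. (\<integral>\<^sup>+s\<in>{0..1}. ennreal (h s) \<partial>lborel) * B t \<partial>lborel)"
  proof (intro nn_integral_mono mult_right_mono)
    fix t :: real
    have "(\<integral>\<^sup>+s\<in>{0..1}. ennreal s * ennreal (\<rho> (circle_curve s t) * (\<phi> (circle_curve s t))\<^sup>2) \<partial>lborel)
       \<le> (\<integral>\<^sup>+s. (ennreal (h s) * indicator {0..1} s) * B t \<partial>lborel)"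
    proof (intro nn_integral_mono)
      fix s :: real
      show "ennreal s * ennreal (\<rho> (circle_curve s t) * (\<phi> (circle_curve s t))\<^sup>2) * indicator {0..1} s \<le> (ennreal (h s) * indicator {0..1} s) * B t"
      proof (cases "0 < s \<and> s \<le> 1")
        case True
        then have r: "0 \<le> \<rho> (circle_curve s t)" "\<rho> (circle_curve s t) \<le> h s"
          using \<rho>[of "circle_curve s t"] by (auto simp: norm_circle_curve)
        have "ennreal s * ennreal (\<rho> (circle_curve s t) * (\<phi> (circle_curve s t))\<^sup>2) = ennreal (\<rho> (circle_curve s t)) * ennreal (s * (\<phi> (circle_curve s t))\<^sup>2)"
          using True r by (simp add: ennreal_mult[symmetric] mult_ac)
        also have "\<dots> \<le> ennreal (h s) * B t"
          unfolding B_def Q_def using True r by (intro mult_mono radial_square_bound \<phi> ennreal_leI) auto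
        finally show ?thesis
          using True by simp
      qed (auto simp: indicator_def)
    qed
    also have "\<dots> = (\<integral>\<^sup>+s\<in>{0..1}. ennreal (h s) \<partial>lborel) * B t"
      by (rule nn_integral_multc) measurable
    finally show "(\<integral>\<^sup>+s\<in>{0..1}. ennreal s * ennreal (\<rho> (circle_curve s t) * (\<phi> (circle_curve s t))\<^sup>2) \<partial>lborel)
       \<le> (\<integral>\<^sup>+s\<in>{0..1}. ennreal (h s) \<partial>lborel) * B t" .
  qed simp
  also have "\<dots> = (\<integral>\<^sup>+s\<in>{0..1}. ennreal (h s) \<partial>lborel) * (\<integral>\<^sup>+t. B t \<partial>angles)"
    unfolding nn_integral_angles by (simp add: mult.assoc nn_integral_cmult)
  also have "(\<integral>\<^sup>+t. B t \<partial>angles) = 2 * (\<integral>\<^sup>+t. ennreal ((\<phi> (circle_curve 1 t))\<^sup>2) \<partial>angles) + 2 * (\<integral>\<^sup>+t. Q t \<partial>angles)"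
    unfolding B_def by (subst nn_integral_add) (auto intro!: borel_measurable_angles simp: nn_integral_cmult borel_measurable_angles)
  also have "(\<integral>\<^sup>+t. Q t \<partial>angles) = (\<integral>\<^sup>+x. ennreal (partials \<phi> x \<bullet> partials \<phi> x) \<partial>disk 1)"
    unfolding nn_integral_disk nn_integral_angles Q_def by (rule polar_nn_integral[symmetric]) measurable
  also have "\<dots> = ennreal (\<integral>x. partials \<phi> x \<bullet> partials \<phi> x \<partial>disk 1)"
    by (intro nn_integral_eq_integral V2_integrable C1_partials_V2 \<phi>) auto
  also have "(\<integral>\<^sup>+t. ennreal ((\<phi> (circle_curve 1 t))\<^sup>2) \<partial>angles) = ennreal (\<integral>t. (\<phi> (circle_curve 1 t))\<^sup>2 \<partial>angles)"
    by (intro nn_integral_eq_integral L2_integrable continuous_circle_L2 C1_continuous \<phi>) auto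
  also have "2 * ennreal (\<integral>t. (\<phi> (circle_curve 1 t))\<^sup>2 \<partial>angles) + 2 * ennreal (\<integral>x. partials \<phi> x \<bullet> partials \<phi> x \<partial>disk 1)
      = ennreal (2 * (\<integral>t. (\<phi> (circle_curve 1 t))\<^sup>2 \<partial>angles) + 2 * (\<integral>x. partials \<phi> x \<bullet> partials \<phi> x \<partial>disk 1))"
    by (simp add: ennreal_plus ennreal_mult)
  finally show ?thesis .
qed

text \<open>Chosen so that twice the boundary integral plus twice the Dirichlet integral is at most
  this constant times the energy: 2 serves the Dirichlet part and \<open>2 / \<alpha>\<close> the
  boundary part.\<close>

definition poincare_const :: "real \<Rightarrow> real" where
  "poincare_const \<alpha> = 2 * (1 + 1 / \<alpha>)"

text \<open>One estimate for two purposes. With \<open>\<kappa> = 0\<close> it bounds the mass in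
  the two strips; with small \<open>\<kappa>\<close> and \<open>\<eta>\<close> it shows that a
  weight concentrating at the centre or at the rim has small mass.\<close>

lemma mass_le_energy:
  assumes \<phi>: "C1 \<phi>" and \<alpha>: "\<alpha> > 0" and \<rho>m: "\<rho> \<in> borel_measurable borel"
    and A: "A \<ge> 0" and \<kappa>: "\<kappa> \<ge> 0" and \<eta>: "0 \<le> \<eta>" "\<eta> \<le> 1"
    and \<rho>: "\<And>x. norm x \<le> 1 \<Longrightarrow> 0 \<le> \<rho> x \<and> \<rho> x \<le> A"
    and mid: "\<And>x. \<eta> < norm x \<Longrightarrow> norm x < 1 - \<eta> \<Longrightarrow> \<rho> x \<le> \<kappa>"
  shows "mass 1 \<rho> \<phi> \<le> poincare_const \<alpha> * (2 * A * \<eta> + \<kappa>) * energy 1 \<alpha> \<phi>"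
proof -
  \<comment> \<open>The height \<open>A\<close> on two strips of width \<open>\<eta>\<close> plus
    \<open>\<kappa>\<close> everywhere. If the strips overlap, \<open>h\<close> only becomes larger,
    so no case distinction on \<open>\<eta>\<close> arises.\<close>
  define h where "h s = A * indicator {0..\<eta>} s + A * indicator {1 - \<eta>..1} s + \<kappa>" for s :: real
  define B where "B = (\<integral>t. (\<phi> (circle_curve 1 t))\<^sup>2 \<partial>angles)"
  define G where "G = (\<integral>x. partials \<phi> x \<bullet> partials \<phi> x \<partial>disk 1)"
  have B0: "B \<ge> 0" and G0: "G \<ge> 0"
    by (auto simp: B_def G_def)
  have hm: "h \<in> borel_measurable borel"
    unfolding h_def by measurable
  have h: "0 \<le> \<rho> x \<and> \<rho> x \<le> h (norm x)" if x: "norm x \<le> 1" for x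
  proof (cases "\<eta> < norm x \<and> norm x < 1 - \<eta>")
    case True
    then show ?thesis
      using \<rho>[OF x] mid[of x] A by (simp add: h_def)
  next
    case False
    then have "h (norm x) \<ge> A"
      using x A \<kappa> by (auto simp: h_def indicator_def not_less)
    then show ?thesis
      using \<rho>[OF x] by linarith
  qed
  have "(\<integral>\<^sup>+s\<in>{0..1}. ennreal (h s) \<partial>lborel) \<le> (\<integral>\<^sup>+s. ennreal A * indicator {0..\<eta>} s + ennreal A * indicator {1 - \<eta>..1} s + ennreal \<kappa> * indicator {0..1} s \<partial>lborel)"
    using A \<kappa> by (intro nn_integral_mono) (auto simp: h_def indicator_def simp flip: ennreal_plus)
  also have "\<dots> = ennreal A * ennreal \<eta> + ennreal A * ennreal \<eta> + ennreal \<kappa>"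
    using \<eta> by (simp add: nn_integral_add nn_integral_cmult)
  also have "\<dots> = ennreal (2 * A * \<eta> + \<kappa>)"
    using A \<kappa> \<eta> by (simp add: ennreal_mult[symmetric] ennreal_plus[symmetric] del: ennreal_plus)
  finally have H: "(\<integral>\<^sup>+s\<in>{0..1}. ennreal (h s) \<partial>lborel) \<le> ennreal (2 * A * \<eta> + \<kappa>)" .
  have "(\<integral>\<^sup>+x. ennreal (\<rho> x * (\<phi> x)\<^sup>2) \<partial>disk 1) \<le> (\<integral>\<^sup>+s\<in>{0..1}. ennreal (h s) \<partial>lborel) * ennreal (2 * B + 2 * G)"
    unfolding B_def G_def by (rule nn_mass_le_energy[OF \<phi> \<rho>m hm h])
  also have "\<dots> \<le> ennreal (2 * A * \<eta> + \<kappa>) * ennreal (2 * B + 2 * G)"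
    by (rule mult_right_mono[OF H]) simp
  also have "\<dots> = ennreal ((2 * A * \<eta> + \<kappa>) * (2 * B + 2 * G))"
    using B0 G0 A \<kappa> \<eta> by (simp add: ennreal_mult)
  finally have nn: "(\<integral>\<^sup>+x. ennreal (\<rho> x * (\<phi> x)\<^sup>2) \<partial>disk 1) \<le> ennreal ((2 * A * \<eta> + \<kappa>) * (2 * B + 2 * G))" .
  have H0: "0 \<le> 2 * A * \<eta> + \<kappa>"
    using A \<kappa> \<eta> by simp
  have "mass 1 \<rho> \<phi> \<le> (2 * A * \<eta> + \<kappa>) * (2 * B + 2 * G)"
  proof (cases "integrable (disk 1) (\<lambda>x. \<rho> x * (\<phi> x)\<^sup>2)")
    case True
    have "AE x in disk 1. 0 \<le> \<rho> x * (\<phi> x)\<^sup>2"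
      using \<rho> by (intro AE_I2) simp
    then have "ennreal (mass 1 \<rho> \<phi>) = (\<integral>\<^sup>+x. ennreal (\<rho> x * (\<phi> x)\<^sup>2) \<partial>disk 1)"
      unfolding mass_def by (rule nn_integral_eq_integral[OF True, symmetric])
    with nn have "ennreal (mass 1 \<rho> \<phi>) \<le> ennreal ((2 * A * \<eta> + \<kappa>) * (2 * B + 2 * G))"
      by simp
    then show ?thesis
      using H0 B0 G0 by (subst (asm) ennreal_le_iff) auto
  next
    case False
    then show ?thesis
      using H0 B0 G0 by (simp add: mass_def not_integrable_integral_eq)
  qed
  also have "\<dots> \<le> (2 * A * \<eta> + \<kappa>) * (poincare_const \<alpha> * energy 1 \<alpha> \<phi>)"
  proof (rule mult_left_mono[OF _ H0])
    have "poincare_const \<alpha> * energy 1 \<alpha> \<phi> = 2 * B + 2 * G + (2 * \<alpha> * B + 2 / \<alpha> * G)"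
      using \<alpha> unfolding poincare_const_def energy_def B_def[symmetric] G_def[symmetric] by (simp add: field_simps)
    moreover have "0 \<le> 2 * \<alpha> * B + 2 / \<alpha> * G"
      using \<alpha> B0 G0 by (intro add_nonneg_nonneg mult_nonneg_nonneg) auto
    ultimately show "2 * B + 2 * G \<le> poincare_const \<alpha> * energy 1 \<alpha> \<phi>"
      by linarith
  qed
  finally show ?thesis
    by (simp only: mult_ac)
qed

section \<open>Independent test functions and levels obtained from them\<close>

lemma continuous_AE_zero:
  fixes f :: "'a::euclidean_space \<Rightarrow> real"
  assumes c: "continuous_on UNIV f" and U: "open U" "U \<subseteq> S" "S \<in> sets lebesgue" and ae: "AE x in lebesgue_on S. f x = 0" and x: "x \<in> U"
  shows "f x = 0"
proof (rule ccontr)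
  assume "f x \<noteq> 0"
  define V where "V = {y \<in> U. f y \<noteq> 0}"
  have "open V"
  proof -
    have "V = U \<inter> f -` (- {0})"
      by (auto simp: V_def)
    then show ?thesis
      using c U(1) by (simp add: open_Int open_vimage open_Compl)
  qed
  moreover have "V \<noteq> {}"
    using x \<open>f x \<noteq> 0\<close> by (auto simp: V_def)
  moreover have "AE x in lebesgue. x \<in> S \<longrightarrow> f x = 0"
    using ae U(3) by (simp add: AE_restrict_space_iff)
  then have "AE x in lebesgue. x \<notin> V"
    by eventually_elim (use U(2) in \<open>auto simp: V_def\<close>)
  then have "V \<in> null_sets lebesgue"
    using \<open>open V\<close> by (subst (asm) AE_iff_null_sets[symmetric]) auto
  then have "negligible V"
    by (simp add: negligible_iff_null_sets)
  ultimately show False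
    using open_not_negligible by blast
qed

lemma polynomial_zero_on_interval:
  fixes c :: "nat \<Rightarrow> real"
  assumes "\<And>y. y \<in> {a<..<b} \<Longrightarrow> (\<Sum>i<k. c i * y ^ i) = 0" "a < b"
  shows "\<forall>i<k. c i = 0"
proof (cases k)
  case (Suc n)
  then have lt: "{..<k} = {..n}"
    by auto
  show ?thesis
  proof (rule ccontr)
    assume "\<not> ?thesis"
    then obtain i where i: "c i \<noteq> 0" "i \<le> n"
      using Suc by auto
    have "finite {z. (\<Sum>i\<le>n. c i * z ^ i) = 0}"
      using polyfun_rootbound[of n c] i by blast
    moreover have "{a<..<b} \<subseteq> {z. (\<Sum>i\<le>n. c i * z ^ i) = 0}"
      using assms(1) lt by auto
    ultimately show False
      using assms(2) finite_subset infinite_Ioo by blast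
  qed
qed simp

lemma mass_integrable:
  fixes \<rho> \<phi> :: "real^2 \<Rightarrow> real"
  assumes \<phi>: "continuous_on UNIV \<phi>" and \<rho>: "\<rho> \<in> borel_measurable borel" and b: "\<And>x. norm x < 1 \<Longrightarrow> \<bar>\<rho> x\<bar> \<le> A"
  shows "integrable (disk 1) (\<lambda>x. \<rho> x * (\<phi> x)\<^sup>2)"
proof (rule Bochner_Integration.integrable_bound)
  show "integrable (disk 1) (\<lambda>x. A * (\<phi> x)\<^sup>2)"
    by (intro integrable_mult_right L2_integrable continuous_L2_disk \<phi>)
  show "(\<lambda>x. \<rho> x * (\<phi> x)\<^sup>2) \<in> borel_measurable (disk 1)"
    by (intro borel_measurable_disk borel_measurable_times borel_measurable_power \<rho> borel_measurable_continuous_onI \<phi>)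
  show "AE x in disk 1. norm (\<rho> x * (\<phi> x)\<^sup>2) \<le> norm (A * (\<phi> x)\<^sup>2)"
  proof (intro AE_I2)
    fix x assume "x \<in> space (disk 1)"
    then have "\<bar>\<rho> x\<bar> \<le> \<bar>A\<bar>"
      using b[of x] by auto
    then show "norm (\<rho> x * (\<phi> x)\<^sup>2) \<le> norm (A * (\<phi> x)\<^sup>2)"
      by (simp add: abs_mult mult_right_mono)
  qed
qed

lemma mass_ge_L2:
  assumes \<phi>: "continuous_on UNIV \<phi>" and m: "\<And>x. norm x < 1 \<Longrightarrow> m * \<sigma> x \<le> \<rho> x" and \<rho>: "\<rho> \<in> borel_measurable borel"
    and \<sigma>: "\<sigma> \<in> borel_measurable borel"
    and bd: "\<And>x. norm x < 1 \<Longrightarrow> \<bar>\<rho> x\<bar> \<le> A" "\<And>x. norm x < 1 \<Longrightarrow> \<bar>\<sigma> x\<bar> \<le> A"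
  shows "m * mass 1 \<sigma> \<phi> \<le> mass 1 \<rho> \<phi>"
proof -
  have "m * mass 1 \<sigma> \<phi> = (\<integral>x. (m * \<sigma> x) * (\<phi> x)\<^sup>2 \<partial>disk 1)"
    by (simp add: mass_def mult.assoc)
  also have "\<dots> \<le> mass 1 \<rho> \<phi>"
    unfolding mass_def
  proof (rule integral_mono)
    show "integrable (disk 1) (\<lambda>x. (m * \<sigma> x) * (\<phi> x)\<^sup>2)"
      using integrable_mult_right[OF mass_integrable[OF \<phi> \<sigma> bd(2)], of m] by (simp add: mult.assoc)
    show "integrable (disk 1) (\<lambda>x. \<rho> x * (\<phi> x)\<^sup>2)"
      by (rule mass_integrable[OF \<phi> \<rho> bd(1)])
    show "m * \<sigma> x * (\<phi> x)\<^sup>2 \<le> \<rho> x * (\<phi> x)\<^sup>2" if "x \<in> space (disk 1)" for x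
      using m[of x] that by (intro mult_right_mono) auto
  qed
  finally show ?thesis .
qed

lemma energy_lincomb_bound:
  fixes \<phi> :: "nat \<Rightarrow> real^2 \<Rightarrow> real"
  assumes \<phi>: "\<And>i. i < k \<Longrightarrow> C1 (\<phi> i)" and \<alpha>: "\<alpha> \<ge> 0"
  obtains K where "K > 0" "\<And>c. energy R \<alpha> (\<lambda>x. \<Sum>i<k. c i * \<phi> i x) \<le> K * (\<Sum>i<k. (c i)\<^sup>2)"
proof -
  define K where "K = (\<Sum>i<k. \<integral>x. (partials (\<phi> i) x $ 1)\<^sup>2 \<partial>disk R) + (\<Sum>i<k. \<integral>x. (partials (\<phi> i) x $ 2)\<^sup>2 \<partial>disk R)
     + \<alpha> * (\<Sum>i<k. \<integral>t. (\<phi> i (circle_curve R t))\<^sup>2 \<partial>angles)"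
  have K0: "K \<ge> 0"
    unfolding K_def using \<alpha> by (intro add_nonneg_nonneg mult_nonneg_nonneg sum_nonneg) auto
  have "energy R \<alpha> (\<lambda>x. \<Sum>i<k. c i * \<phi> i x) \<le> K * (\<Sum>i<k. (c i)\<^sup>2)" for c
  proof -
    have en: "energy R \<alpha> (\<lambda>x. \<Sum>i<k. c i * \<phi> i x) = (\<integral>x. (\<Sum>i<k. c i * partials (\<phi> i) x $ 1)\<^sup>2 \<partial>disk R) + (\<integral>x. (\<Sum>i<k. c i * partials (\<phi> i) x $ 2)\<^sup>2 \<partial>disk R)
      + \<alpha> * (\<integral>t. (\<Sum>i<k. c i * \<phi> i (circle_curve R t))\<^sup>2 \<partial>angles)"
      by (rule C1_energy_lincomb) (rule \<phi>)
    have "\<dots> \<le> (\<Sum>i<k. (c i)\<^sup>2) * (\<Sum>i<k. \<integral>x. (partials (\<phi> i) x $ 1)\<^sup>2 \<partial>disk R) + (\<Sum>i<k. (c i)\<^sup>2) * (\<Sum>i<k. \<integral>x. (partials (\<phi> i) x $ 2)\<^sup>2 \<partial>disk R)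
      + \<alpha> * ((\<Sum>i<k. (c i)\<^sup>2) * (\<Sum>i<k. \<integral>t. (\<phi> i (circle_curve R t))\<^sup>2 \<partial>angles))"
      by (intro add_mono mult_left_mono L2_lincomb_bound C1_partials_L2 continuous_circle_L2 C1_continuous \<phi> \<alpha>)
    then show ?thesis
      unfolding en K_def by (simp add: algebra_simps)
  qed
  then have "energy R \<alpha> (\<lambda>x. \<Sum>i<k. c i * \<phi> i x) \<le> (K + 1) * (\<Sum>i<k. (c i)\<^sup>2)" for c
    by (rule order_trans) (intro mult_right_mono sum_nonneg, auto)
  then show ?thesis
    using K0 by (intro that[of "K + 1"]) auto
qed

lemma coefficient_square_sum_pos:
  fixes c :: "nat \<Rightarrow> real"
  assumes "\<exists>i<k. c i \<noteq> 0"
  shows "(\<Sum>i<k. (c i)\<^sup>2) > 0"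
  using assms by (auto intro!: sum_pos2)

lemma admissible_of_bounds:
  assumes \<phi>: "\<And>i. i < k \<Longrightarrow> C1 (\<phi> i)" and m: "m > 0" "\<And>c. m * (\<Sum>i<k. (c i)\<^sup>2) \<le> mass R \<rho> (\<lambda>x. \<Sum>i<k. c i * \<phi> i x)"
    and K: "\<And>c. energy R \<alpha> (\<lambda>x. \<Sum>i<k. c i * \<phi> i x) \<le> K * (\<Sum>i<k. (c i)\<^sup>2)" "K \<ge> 0"
  shows "admissible R \<alpha> \<rho> k (K / m)"
  unfolding admissible_def
proof (intro exI[of _ \<phi>] conjI allI impI \<phi>)
  fix c :: "nat \<Rightarrow> real" assume "\<exists>i<k. c i \<noteq> 0"
  then have "m * (\<Sum>i<k. (c i)\<^sup>2) > 0"
    using m(1) coefficient_square_sum_pos[of k c] by simp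
  then show "0 < mass R \<rho> (\<lambda>x. \<Sum>i<k. c i * \<phi> i x)"
    using m(2)[of c] by linarith
  have "K / m * (m * (\<Sum>i<k. (c i)\<^sup>2)) \<le> K / m * mass R \<rho> (\<lambda>x. \<Sum>i<k. c i * \<phi> i x)"
    using K(2) m by (intro mult_left_mono) auto
  then show "energy R \<alpha> (\<lambda>x. \<Sum>i<k. c i * \<phi> i x) \<le> K / m * mass R \<rho> (\<lambda>x. \<Sum>i<k. c i * \<phi> i x)"
    using K(1)[of c] m(1) by simp
qed

section \<open>Monotonicity and limits of the weighted eigenvalues\<close>

lemma inner_self_le_1: "norm (x :: real^2) \<le> 1 \<Longrightarrow> x \<bullet> x \<le> 1"
  by (simp add: dot_square_norm power_le_one)

text \<open>The denominator is affine in \<open>x \<bullet> x\<close>, which ranges over the unit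
  interval, so it lies between its end values 1 and \<open>1 + t\<close>.\<close>

lemma weight_denominator_bounds:
  fixes x :: "real^2"
  assumes "t > -1" "norm x \<le> 1"
  shows "min 1 (1 + t) \<le> 1 + t * (x \<bullet> x)" "1 + t * (x \<bullet> x) \<le> 1 + \<bar>t\<bar>" "0 < 1 + t * (x \<bullet> x)"
proof -
  have x: "0 \<le> x \<bullet> x" "x \<bullet> x \<le> 1"
    using inner_self_le_1[OF assms(2)] by auto
  have "t * (x \<bullet> x) \<ge> min 0 t"
  proof (cases "t \<ge> 0")
    case False
    then have "t * (x \<bullet> x) \<ge> t * 1"
      using x by (intro mult_left_mono_neg) auto
    then show ?thesis by simp
  qed simp
  then show 1: "min 1 (1 + t) \<le> 1 + t * (x \<bullet> x)"
    by linarith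
  with assms(1) show "0 < 1 + t * (x \<bullet> x)"
    by linarith
  have "t * (x \<bullet> x) \<le> \<bar>t\<bar> * 1"
    using x by (intro mult_mono) auto
  then show "1 + t * (x \<bullet> x) \<le> 1 + \<bar>t\<bar>"
    by simp
qed

lemma weight_bounds:
  assumes "t > -1" "norm x \<le> 1"
  shows "0 \<le> weight t x" "weight t x \<le> 1 / (min 1 (1 + t))\<^sup>2" "1 / (1 + \<bar>t\<bar>)\<^sup>2 \<le> weight t x"
proof -
  note b = weight_denominator_bounds[OF assms]
  show "0 \<le> weight t x"
    by (simp add: weight_def)
  have "(min 1 (1 + t))\<^sup>2 \<le> (1 + t * (x \<bullet> x))\<^sup>2"
    using b assms by (intro power_mono) auto
  then show "weight t x \<le> 1 / (min 1 (1 + t))\<^sup>2"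
    unfolding weight_def using assms(1) b(3) by (intro divide_left_mono mult_pos_pos zero_less_power) auto
  have "(1 + t * (x \<bullet> x))\<^sup>2 \<le> (1 + \<bar>t\<bar>)\<^sup>2"
    using b by (intro power_mono) auto
  then show "1 / (1 + \<bar>t\<bar>)\<^sup>2 \<le> weight t x"
    unfolding weight_def using b(3) by (intro divide_left_mono) auto
qed

text \<open>Half-angle formulas give \<open>G\<close> as \<open>F\<close> divided by
  \<open>(1 + t)\<^sup>2\<close>, and dividing an eigenvalue means multiplying the weight. The
  result is normalised to 1 on the unit circle, whereas \<open>weight\<close> is 1 at the
  origin.\<close>

definition gweight :: "real \<Rightarrow> real^2 \<Rightarrow> real" where
  "gweight t x = (1 + t)\<^sup>2 * weight t x"

lemma gweight_eq: "gweight t x = ((1 + t) / (1 + t * (x \<bullet> x)))\<^sup>2"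
  by (simp add: gweight_def weight_def power_divide)

lemma gweight_measurable: "gweight t \<in> borel_measurable borel"
  unfolding gweight_def by measurable

lemma gweight_bounds:
  fixes x :: "real^2"
  assumes t: "t > -1" and x: "norm x \<le> 1"
  shows "0 \<le> gweight t x" "gweight t x \<le> (1 + t)\<^sup>2 / (min 1 (1 + t))\<^sup>2"
proof -
  show "0 \<le> gweight t x"
    by (simp add: gweight_eq)
  show "gweight t x \<le> (1 + t)\<^sup>2 / (min 1 (1 + t))\<^sup>2"
    using mult_left_mono[OF weight_bounds(2)[OF t x], of "(1 + t)\<^sup>2"] by (simp add: gweight_def)
qed

text \<open>Restricting to a diameter leaves a polynomial in one variable that vanishes on an
  interval. Powers of the first coordinate thus form an explicit test space of every
  dimension.\<close>

lemma polynomials_indep_disk: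
  fixes c :: "nat \<Rightarrow> real"
  assumes "AE x in disk 1. (\<Sum>i<k. c i * (x $ 1) ^ i) = 0"
  shows "\<forall>i<k. c i = 0"
proof (rule polynomial_zero_on_interval[of "-1" 1])
  fix y :: real assume y: "y \<in> {-1<..<1}"
  have "(\<Sum>i<k. c i * ((vector [y, 0] :: real^2) $ 1) ^ i) = 0"
  proof (rule continuous_AE_zero[OF _ _ _ _ assms])
    show "continuous_on UNIV (\<lambda>x::real^2. \<Sum>i<k. c i * (x $ 1) ^ i)"
      by (intro continuous_intros)
    show "vector [y, 0] \<in> ball (0 :: real^2) 1"
      using y by (simp add: norm_real2 abs_less_iff)
  qed auto
  then show "(\<Sum>i<k. c i * y ^ i) = 0"
    by simp
qed simp

lemma mass_1: "mass R (\<lambda>_. 1) \<phi> = (\<integral>x. (\<phi> x)\<^sup>2 \<partial>disk R)"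
  by (simp add: mass_def)

text \<open>The test functions stay the same and only the weight changes. The comparison is asked
  only of functions whose quotient is at most \<open>M\<close>, which leaves room for arguments that
  need bounded energy.\<close>

lemma admissible_compare:
  assumes M: "admissible 1 \<alpha> \<rho> k M" "0 \<le> M" and K: "K > 0"
    and cmp: "\<And>\<phi>. C1 \<phi> \<Longrightarrow> 0 < mass 1 \<rho> \<phi> \<Longrightarrow> energy 1 \<alpha> \<phi> \<le> M * mass 1 \<rho> \<phi> \<Longrightarrow> mass 1 \<rho> \<phi> \<le> K * mass 1 \<sigma> \<phi>"
  shows "admissible 1 \<alpha> \<sigma> k (K * M)"
proof -
  obtain \<phi> where \<phi>: "\<And>i. i < k \<Longrightarrow> C1 (\<phi> i)"
    and *: "\<And>c :: nat \<Rightarrow> real. \<exists>i<k. c i \<noteq> 0 \<Longrightarrow> 0 < mass 1 \<rho> (\<lambda>x. \<Sum>i<k. c i * \<phi> i x) \<and>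
        energy 1 \<alpha> (\<lambda>x. \<Sum>i<k. c i * \<phi> i x) \<le> M * mass 1 \<rho> (\<lambda>x. \<Sum>i<k. c i * \<phi> i x)"
    using M(1) unfolding admissible_def by blast
  show ?thesis
    unfolding admissible_def
  proof (intro exI[of _ \<phi>] conjI allI impI \<phi>)
    fix c :: "nat \<Rightarrow> real" assume "\<exists>i<k. c i \<noteq> 0"
    then have h: "0 < mass 1 \<rho> (\<lambda>x. \<Sum>i<k. c i * \<phi> i x)"
        "energy 1 \<alpha> (\<lambda>x. \<Sum>i<k. c i * \<phi> i x) \<le> M * mass 1 \<rho> (\<lambda>x. \<Sum>i<k. c i * \<phi> i x)"
      using * by blast+
    have C: "C1 (\<lambda>x. \<Sum>i<k. c i * \<phi> i x)"
      by (intro C1_lincomb \<phi>)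
    have m: "mass 1 \<rho> (\<lambda>x. \<Sum>i<k. c i * \<phi> i x) \<le> K * mass 1 \<sigma> (\<lambda>x. \<Sum>i<k. c i * \<phi> i x)"
      by (rule cmp[OF C h])
    with h(1) have "0 < K * mass 1 \<sigma> (\<lambda>x. \<Sum>i<k. c i * \<phi> i x)"
      by linarith
    then show "0 < mass 1 \<sigma> (\<lambda>x. \<Sum>i<k. c i * \<phi> i x)"
      using K by (simp add: zero_less_mult_iff)
    have "M * mass 1 \<rho> (\<lambda>x. \<Sum>i<k. c i * \<phi> i x) \<le> M * (K * mass 1 \<sigma> (\<lambda>x. \<Sum>i<k. c i * \<phi> i x))"
      by (rule mult_left_mono[OF m M(2)])
    with h(2) show "energy 1 \<alpha> (\<lambda>x. \<Sum>i<k. c i * \<phi> i x) \<le> K * M * mass 1 \<sigma> (\<lambda>x. \<Sum>i<k. c i * \<phi> i x)"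
      by (simp add: mult_ac)
  qed
qed

section \<open>Comparison of eigenvalues for different weights\<close>

context
  fixes k :: nat and \<alpha> :: real
  assumes k: "k \<ge> 1" and \<alpha>: "\<alpha> > 0"
begin

lemma admissible_ge_0: "admissible 1 \<alpha> \<rho> k M \<Longrightarrow> 0 \<le> M"
  using admissible_nonneg[OF _ k] \<alpha> by simp

lemma bdd_below_admissible: "bdd_below {M. admissible 1 \<alpha> \<rho> k M}"
  using admissible_ge_0 by (intro bdd_belowI[of _ 0]) auto

lemma \<mu>_le: "admissible 1 \<alpha> \<rho> k M \<Longrightarrow> \<mu> k \<alpha> \<rho> \<le> M"
  unfolding \<mu>_def by (intro cInf_lower bdd_below_admissible) simp

text \<open>Only levels close to the infimum matter, so a fixed bound \<open>M1\<close> above it may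
  be imposed on the quotients, and the factor \<open>K\<close> does not depend on the level.\<close>

lemma \<mu>_compare:
  assumes ex: "\<exists>M. admissible 1 \<alpha> \<rho> k M" and K: "K > 0" and M1: "\<mu> k \<alpha> \<rho> < M1"
    and cmp: "\<And>\<phi>. C1 \<phi> \<Longrightarrow> 0 < mass 1 \<rho> \<phi> \<Longrightarrow> energy 1 \<alpha> \<phi> \<le> M1 * mass 1 \<rho> \<phi> \<Longrightarrow> mass 1 \<rho> \<phi> \<le> K * mass 1 \<sigma> \<phi>"
  shows "\<mu> k \<alpha> \<sigma> \<le> K * \<mu> k \<alpha> \<rho>"
proof (rule field_le_epsilon)
  fix e :: real assume e: "e > 0"
  have "\<mu> k \<alpha> \<rho> < min M1 (\<mu> k \<alpha> \<rho> + e / K)"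
    using M1 e K by simp
  then have "\<exists>M\<in>{M. admissible 1 \<alpha> \<rho> k M}. M < min M1 (\<mu> k \<alpha> \<rho> + e / K)"
    using ex by (subst (asm) (1) \<mu>_def) (intro cInf_lessD, auto)
  then obtain M where M: "admissible 1 \<alpha> \<rho> k M" "M < min M1 (\<mu> k \<alpha> \<rho> + e / K)"
    by blast
  have "admissible 1 \<alpha> \<sigma> k (K * M)"
  proof (rule admissible_compare[OF M(1) admissible_ge_0[OF M(1)] K])
    fix \<phi> assume h: "C1 \<phi>" "0 < mass 1 \<rho> \<phi>" "energy 1 \<alpha> \<phi> \<le> M * mass 1 \<rho> \<phi>"
    have "M * mass 1 \<rho> \<phi> \<le> M1 * mass 1 \<rho> \<phi>"
      using M(2) h(2) by (intro mult_right_mono) auto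
    then have "energy 1 \<alpha> \<phi> \<le> M1 * mass 1 \<rho> \<phi>"
      using h(3) by linarith
    then show "mass 1 \<rho> \<phi> \<le> K * mass 1 \<sigma> \<phi>"
      using h by (intro cmp)
  qed
  then have "\<mu> k \<alpha> \<sigma> \<le> K * M"
    by (rule \<mu>_le)
  also have "\<dots> \<le> K * (\<mu> k \<alpha> \<rho> + e / K)"
    using M(2) K by (intro mult_left_mono) auto
  also have "\<dots> = K * \<mu> k \<alpha> \<rho> + e"
    using K by (simp add: distrib_left)
  finally show "\<mu> k \<alpha> \<sigma> \<le> K * \<mu> k \<alpha> \<rho> + e" .
qed

text \<open>A single nonzero element of each test space suffices, since its quotient is at least
  \<open>1 / C\<close>; the combination with all coefficients 1 is taken, nonzero because
  \<open>k \<ge> 1\<close>.\<close>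

lemma \<mu>_lower_bound:
  assumes ex: "\<exists>M. admissible 1 \<alpha> \<rho> k M" and C: "C > 0" and b: "\<And>\<phi>. C1 \<phi> \<Longrightarrow> mass 1 \<rho> \<phi> \<le> C * energy 1 \<alpha> \<phi>"
  shows "1 / C \<le> \<mu> k \<alpha> \<rho>"
  unfolding \<mu>_def
proof (rule cInf_greatest)
  fix M assume "M \<in> {M. admissible 1 \<alpha> \<rho> k M}"
  then have M: "admissible 1 \<alpha> \<rho> k M"
    by simp
  then obtain \<phi> where \<phi>: "\<And>i. i < k \<Longrightarrow> C1 (\<phi> i)"
    and *: "\<And>c :: nat \<Rightarrow> real. \<exists>i<k. c i \<noteq> 0 \<Longrightarrow> 0 < mass 1 \<rho> (\<lambda>x. \<Sum>i<k. c i * \<phi> i x) \<and>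
        energy 1 \<alpha> (\<lambda>x. \<Sum>i<k. c i * \<phi> i x) \<le> M * mass 1 \<rho> (\<lambda>x. \<Sum>i<k. c i * \<phi> i x)"
    unfolding admissible_def by blast
  define f where "f x = (\<Sum>i<k. 1 * \<phi> i x)" for x
  have "\<exists>i<k. (1 :: real) \<noteq> 0"
    using k by (intro exI[of _ 0]) simp
  then have h: "0 < mass 1 \<rho> f" "energy 1 \<alpha> f \<le> M * mass 1 \<rho> f"
    using *[of "\<lambda>_. 1"] unfolding f_def by blast+
  have f: "C1 f"
    unfolding f_def by (intro C1_lincomb \<phi>)
  have e: "energy 1 \<alpha> f > 0"
    using b[OF f] h(1) C by (smt (verit) mult_nonneg_nonpos)
  have "energy 1 \<alpha> f \<le> M * (C * energy 1 \<alpha> f)"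
    using h(2) mult_left_mono[OF b[OF f] admissible_ge_0[OF M]] by linarith
  then have "1 * energy 1 \<alpha> f \<le> (M * C) * energy 1 \<alpha> f"
    by simp
  then have "1 \<le> M * C"
    using e by (rule mult_right_le_imp_le)
  then show "1 / C \<le> M"
    using C by (simp add: divide_le_eq)
qed (use ex in auto)

text \<open>
  Functions of bounded Rayleigh quotient carry little mass near the origin and near the boundary, so an
  increase of the weight in the middle region alone already lowers the eigenvalue by a definite factor.
\<close>

lemma \<mu>_strict_mono:
  assumes ex: "\<exists>M. admissible 1 \<alpha> \<rho> k M" and pos: "\<mu> k \<alpha> \<rho> > 0"
    and m: "\<rho> \<in> borel_measurable borel" "\<sigma> \<in> borel_measurable borel"
    and \<rho>: "\<And>x. norm x \<le> 1 \<Longrightarrow> 0 \<le> \<rho> x \<and> \<rho> x \<le> A"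
    and \<sigma>: "\<And>x. norm x \<le> 1 \<Longrightarrow> \<rho> x \<le> \<sigma> x \<and> \<sigma> x \<le> A'"
    and gain: "\<And>\<eta>. 0 < \<eta> \<Longrightarrow> \<eta> < 1 \<Longrightarrow> \<exists>\<kappa>>0. \<forall>x. \<eta> < norm x \<and> norm x < 1 - \<eta> \<longrightarrow> (1 + \<kappa>) * \<rho> x \<le> \<sigma> x"
  shows "\<mu> k \<alpha> \<sigma> < \<mu> k \<alpha> \<rho>"
proof -
  define M1 where "M1 = \<mu> k \<alpha> \<rho> + 1"
  have A0: "A \<ge> 0"
    using \<rho>[of 0] by simp
  define P where "P = poincare_const \<alpha>"
  have P: "P > 0"
    using \<alpha> by (simp add: P_def poincare_const_def add_pos_pos)
  \<comment> \<open>Solves \<open>P * (2 * A * \<eta>) * M1 \<le> 1 / 2\<close>, so that at most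
    half of the mass lies in the two strips. The terms \<open>A + 1\<close> and \<open>+ 2\<close>
    keep the denominator above 2, hence \<open>\<eta> < 1\<close>, also for
    \<open>A = 0\<close>.\<close>
  define \<eta> where "\<eta> = 1 / (4 * P * (A + 1) * M1 + 2)"
  have den: "4 * P * (A + 1) * M1 + 2 > 2"
    using P A0 pos by (simp add: M1_def)
  define N where "N = 4 * P * (A + 1) * M1 + 2"
  have \<eta>: "0 < \<eta>" "\<eta> < 1"
    using den unfolding \<eta>_def N_def[symmetric] by simp_all
  have small: "P * (2 * A * \<eta>) * M1 \<le> 1 / 2"
  proof -
    have "4 * P * A * M1 \<le> 4 * P * (A + 1) * M1 + 2"
      using P A0 pos by (simp add: M1_def algebra_simps)
    then have "4 * P * A * M1 * \<eta> \<le> 1"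
      using den unfolding \<eta>_def N_def[symmetric] by (simp add: divide_le_eq)
    then show ?thesis
      by (simp add: mult_ac)
  qed
  obtain \<kappa> where \<kappa>: "\<kappa> > 0" "\<And>x. \<eta> < norm x \<Longrightarrow> norm x < 1 - \<eta> \<Longrightarrow> (1 + \<kappa>) * \<rho> x \<le> \<sigma> x"
    using gain[OF \<eta>] by blast
  define mid where "mid = {x :: real^2. \<eta> < norm x \<and> norm x < 1 - \<eta>}"
  have mid: "mid \<in> sets borel"
    unfolding mid_def by (intro borel_open open_Collect_conj open_Collect_less continuous_intros)
  \<comment> \<open>The part of the weight outside the middle region; it vanishes on that region, so
    \<open>mass_le_energy\<close> applies with \<open>\<kappa> = 0\<close>.\<close>
  define \<rho>1 where "\<rho>1 x = indicator (- mid) x * \<rho> x" for x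
  have \<rho>1m: "\<rho>1 \<in> borel_measurable borel"
    unfolding \<rho>1_def using mid m by (intro borel_measurable_times borel_measurable_indicator) auto
  have cmp: "mass 1 \<rho> \<phi> \<le> (1 / (1 + \<kappa> / 2)) * mass 1 \<sigma> \<phi>"
    if \<phi>: "C1 \<phi>" and h: "0 < mass 1 \<rho> \<phi>" "energy 1 \<alpha> \<phi> \<le> M1 * mass 1 \<rho> \<phi>" for \<phi>
  proof -
    have "mass 1 \<rho>1 \<phi> \<le> P * (2 * A * \<eta> + 0) * energy 1 \<alpha> \<phi>"
      unfolding P_def
      by (rule mass_le_energy[OF \<phi> \<alpha> \<rho>1m A0]) (use \<rho> \<eta> A0 in \<open>auto simp: \<rho>1_def indicator_def mid_def\<close>)
    also have "\<dots> \<le> P * (2 * A * \<eta> + 0) * (M1 * mass 1 \<rho> \<phi>)"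
      using P A0 \<eta> by (intro mult_left_mono h) auto
    also have "\<dots> = (P * (2 * A * \<eta>) * M1) * mass 1 \<rho> \<phi>"
      by simp
    also have "\<dots> \<le> 1 / 2 * mass 1 \<rho> \<phi>"
      using small h(1) by (intro mult_right_mono) auto
    finally have edge: "mass 1 \<rho>1 \<phi> \<le> 1 / 2 * mass 1 \<rho> \<phi>" .
    have c: "continuous_on UNIV \<phi>"
      by (rule C1_continuous[OF \<phi>])
    have i1: "integrable (disk 1) (\<lambda>x. \<rho> x * (\<phi> x)\<^sup>2)"
      by (rule mass_integrable[OF c m(1), of A]) (use \<rho> in \<open>auto simp: abs_of_nonneg less_imp_le\<close>)
    have i2: "integrable (disk 1) (\<lambda>x. \<rho>1 x * (\<phi> x)\<^sup>2)"
      by (rule mass_integrable[OF c \<rho>1m, of A]) (use \<rho> A0 in \<open>auto simp: \<rho>1_def indicator_def less_imp_le\<close>)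
    have i3: "integrable (disk 1) (\<lambda>x. \<sigma> x * (\<phi> x)\<^sup>2)"
    proof (rule mass_integrable[OF c m(2), of A'])
      show "\<bar>\<sigma> x\<bar> \<le> A'" if "norm x < 1" for x
        using \<rho>[of x] \<sigma>[of x] that by auto
    qed
    \<comment> \<open>The weight \<open>\<sigma>\<close> dominates
      \<open>(1 + \<kappa>) * \<rho> - \<kappa> * \<rho>1\<close>: in the middle by the gain,
      elsewhere because the expression is just \<open>\<rho>\<close>. As \<open>\<rho>1\<close>
      carries at most half of the mass, the factor \<open>1 + \<kappa> / 2\<close> is left.\<close>
    have "(1 + \<kappa>) * mass 1 \<rho> \<phi> - \<kappa> * mass 1 \<rho>1 \<phi> = (\<integral>x. (1 + \<kappa>) * (\<rho> x * (\<phi> x)\<^sup>2) - \<kappa> * (\<rho>1 x * (\<phi> x)\<^sup>2) \<partial>disk 1)"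
      unfolding mass_def using i1 i2 by simp
    also have "\<dots> \<le> mass 1 \<sigma> \<phi>"
      unfolding mass_def
    proof (rule integral_mono)
      show "integrable (disk 1) (\<lambda>x. (1 + \<kappa>) * (\<rho> x * (\<phi> x)\<^sup>2) - \<kappa> * (\<rho>1 x * (\<phi> x)\<^sup>2))"
        using i1 i2 by simp
      show "(1 + \<kappa>) * (\<rho> x * (\<phi> x)\<^sup>2) - \<kappa> * (\<rho>1 x * (\<phi> x)\<^sup>2) \<le> \<sigma> x * (\<phi> x)\<^sup>2" if "x \<in> space (disk 1)" for x
      proof -
        have "(1 + \<kappa>) * \<rho> x - \<kappa> * \<rho>1 x \<le> \<sigma> x"
        proof (cases "x \<in> mid")
          case True
          then show ?thesis
            using \<kappa>(2)[of x] by (simp add: \<rho>1_def mid_def)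
        next
          case False
          then have "(1 + \<kappa>) * \<rho> x - \<kappa> * \<rho>1 x = \<rho> x"
            by (simp add: \<rho>1_def algebra_simps)
          then show ?thesis
            using \<sigma>[of x] that by simp
        qed
        then have "((1 + \<kappa>) * \<rho> x - \<kappa> * \<rho>1 x) * (\<phi> x)\<^sup>2 \<le> \<sigma> x * (\<phi> x)\<^sup>2"
          by (rule mult_right_mono) simp
        then show ?thesis
          by (simp add: algebra_simps)
      qed
    qed (rule i3)
    finally have "(1 + \<kappa>) * mass 1 \<rho> \<phi> - \<kappa> * mass 1 \<rho>1 \<phi> \<le> mass 1 \<sigma> \<phi>" .
    moreover have "\<kappa> * mass 1 \<rho>1 \<phi> \<le> \<kappa> * (1 / 2 * mass 1 \<rho> \<phi>)"
      using \<kappa>(1) edge by (intro mult_left_mono) auto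
    ultimately have "(1 + \<kappa> / 2) * mass 1 \<rho> \<phi> \<le> mass 1 \<sigma> \<phi>"
      by (simp add: distrib_right)
    then show ?thesis
      using \<kappa>(1) by (simp add: pos_le_divide_eq mult.commute add_pos_pos)
  qed
  have "\<mu> k \<alpha> \<sigma> \<le> (1 / (1 + \<kappa> / 2)) * \<mu> k \<alpha> \<rho>"
    using \<kappa>(1) by (intro \<mu>_compare[OF ex, where ?M1.0 = M1] cmp) (auto simp: M1_def add_pos_pos)
  also have "\<dots> < 1 * \<mu> k \<alpha> \<rho>"
    using \<kappa>(1) pos by (intro mult_strict_right_mono) (auto simp: add_pos_pos divide_less_eq)
  finally show ?thesis
    by simp
qed

lemma admissible_weight_exists:
  assumes t: "t > -1"
  shows "\<exists>M. admissible 1 \<alpha> (weight t) k M"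
proof -
  define \<phi> where "\<phi> i x = (x $ 1) ^ i" for i and x :: "real^2"
  have \<phi>: "C1 (\<phi> i)" for i
    unfolding \<phi>_def by (rule C1_power_nth1)
  obtain \<kappa> where \<kappa>: "\<kappa> > 0" "\<And>c. \<kappa> * (\<Sum>i<k. (c i)\<^sup>2) \<le> (\<integral>x. (\<Sum>i<k. c i * \<phi> i x)\<^sup>2 \<partial>disk 1)"
  proof (rule L2_indep_lower[of k "disk 1" \<phi>])
    show "\<And>c. AE x in disk 1. (\<Sum>i<k. c i * \<phi> i x) = 0 \<Longrightarrow> \<forall>i<k. c i = 0"
      unfolding \<phi>_def by (rule polynomials_indep_disk)
  qed (auto intro: C1_L2 \<phi>)
  obtain K where K: "K > 0" "\<And>c. energy 1 \<alpha> (\<lambda>x. \<Sum>i<k. c i * \<phi> i x) \<le> K * (\<Sum>i<k. (c i)\<^sup>2)"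
    using energy_lincomb_bound[of k \<phi> \<alpha> 1] \<phi> \<alpha> by auto
  define m where "m = 1 / (1 + \<bar>t\<bar>)\<^sup>2"
  have m: "m > 0"
    by (simp add: m_def zero_less_power add_pos_nonneg)
  have "m * \<kappa> * (\<Sum>i<k. (c i)\<^sup>2) \<le> mass 1 (weight t) (\<lambda>x. \<Sum>i<k. c i * \<phi> i x)" for c
  proof -
    have "m * \<kappa> * (\<Sum>i<k. (c i)\<^sup>2) \<le> m * mass 1 (\<lambda>_. 1) (\<lambda>x. \<Sum>i<k. c i * \<phi> i x)"
      using \<kappa>(2)[of c] m by (simp add: mass_1 mult.assoc)
    also have "\<dots> \<le> mass 1 (weight t) (\<lambda>x. \<Sum>i<k. c i * \<phi> i x)"
    proof (rule mass_ge_L2[where A = "max 1 (1 / (min 1 (1 + t))\<^sup>2)"])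
      show "continuous_on UNIV (\<lambda>x. \<Sum>i<k. c i * \<phi> i x)"
        by (intro continuous_intros C1_continuous \<phi>)
      show "m * 1 \<le> weight t x" if "norm x < 1" for x
        using weight_bounds(3)[OF t, of x] that by (simp add: m_def)
      show "\<bar>weight t x\<bar> \<le> max 1 (1 / (min 1 (1 + t))\<^sup>2)" if "norm x < 1" for x
        using weight_bounds(1,2)[OF t, of x] that by simp
    qed auto
    finally show ?thesis .
  qed
  then have "admissible 1 \<alpha> (weight t) k (K / (m * \<kappa>))"
    using K \<kappa>(1) m \<phi> by (intro admissible_of_bounds[of k \<phi>]) auto
  then show ?thesis
    by blast
qed

lemma \<mu>_weight_pos:
  assumes t: "t > -1"
  shows "\<mu> k \<alpha> (weight t) > 0"
proof -
  define A where "A = 1 / (min 1 (1 + t))\<^sup>2"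
  define P where "P = poincare_const \<alpha>"
  have P: "P > 0"
    using \<alpha> by (simp add: P_def poincare_const_def add_pos_pos)
  have A: "A > 0"
    using t by (simp add: A_def zero_less_power)
  have "mass 1 (weight t) \<phi> \<le> P * A * energy 1 \<alpha> \<phi>" if "C1 \<phi>" for \<phi>
    \<comment> \<open>With \<open>\<eta> = 0\<close> the strips have no width, and
      \<open>\<kappa> = A\<close> bounds the weight everywhere.\<close>
    using mass_le_energy[OF that \<alpha> weight_measurable[of t], of A A 0] A weight_bounds(1,2)[OF t]
    by (simp add: A_def P_def)
  then have "1 / (P * A) \<le> \<mu> k \<alpha> (weight t)"
    using P A by (intro \<mu>_lower_bound admissible_weight_exists t) auto
  moreover have "1 / (P * A) > 0"
    using P A by simp
  ultimately show ?thesis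
    by linarith
qed

lemma \<mu>_scale:
  assumes c: "c > 0" and ex: "\<exists>M. admissible 1 \<alpha> \<rho> k M"
  shows "\<mu> k \<alpha> (\<lambda>x. c * \<rho> x) = \<mu> k \<alpha> \<rho> / c" "\<exists>M. admissible 1 \<alpha> (\<lambda>x. c * \<rho> x) k M"
proof -
  have "c * \<mu> k \<alpha> (\<lambda>x. c * \<rho> x) = \<mu> k \<alpha> \<rho>"
    unfolding \<mu>_def admissible_scale[OF c] by (rule Inf_scale[OF c ex admissible_ge_0])
  then show "\<mu> k \<alpha> (\<lambda>x. c * \<rho> x) = \<mu> k \<alpha> \<rho> / c"
    using c by (simp add: field_simps)
  obtain M where "admissible 1 \<alpha> \<rho> k M"
    using ex by blast
  then have "admissible 1 \<alpha> \<rho> k (c * (M / c))"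
    using c by simp
  then show "\<exists>M. admissible 1 \<alpha> (\<lambda>x. c * \<rho> x) k M"
    unfolding admissible_scale[OF c] by blast
qed

text \<open>The denominators differ by at most \<open>\<bar>s - t\<bar>\<close>, which is compared
  with the lower bound \<open>min 1 (1 + t)\<close> of one of them. The factor tends to 1 as
  \<open>s\<close> tends to \<open>t\<close>, and this gives continuity.\<close>

lemma \<mu>_weight_compare:
  assumes t: "t > -1" and s: "s > -1"
  shows "\<mu> k \<alpha> (weight s) \<le> (1 + \<bar>s - t\<bar> / min 1 (1 + t))\<^sup>2 * \<mu> k \<alpha> (weight t)"
proof -
  define K where "K = (1 + \<bar>s - t\<bar> / min 1 (1 + t))\<^sup>2"
  have m: "min 1 (1 + t) > 0"
    using t by simp
  then have K1: "1 + \<bar>s - t\<bar> / min 1 (1 + t) > 0"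
    by (simp add: add_pos_nonneg)
  then have K: "K > 0"
    by (simp add: K_def)
  have w: "1 / K * weight t x \<le> weight s x" if x: "norm x < 1" for x
  proof -
    have b: "min 1 (1 + t) \<le> 1 + t * (x \<bullet> x)" "0 < 1 + t * (x \<bullet> x)" "0 < 1 + s * (x \<bullet> x)"
      using weight_denominator_bounds[OF t, of x] weight_denominator_bounds[OF s, of x] x by auto
    have "1 + s * (x \<bullet> x) = (1 + t * (x \<bullet> x)) + (s - t) * (x \<bullet> x)"
      by (simp add: algebra_simps)
    also have "(s - t) * (x \<bullet> x) \<le> \<bar>s - t\<bar> * 1"
      using inner_self_le_1[of x] x by (intro mult_mono) auto
    also have "\<bar>s - t\<bar> * 1 = \<bar>s - t\<bar> / min 1 (1 + t) * min 1 (1 + t)"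
      using m by simp
    also have "\<dots> \<le> \<bar>s - t\<bar> / min 1 (1 + t) * (1 + t * (x \<bullet> x))"
      using b m by (intro mult_left_mono) auto
    finally have "1 + s * (x \<bullet> x) \<le> (1 + \<bar>s - t\<bar> / min 1 (1 + t)) * (1 + t * (x \<bullet> x))"
      by (simp add: distrib_right)
    then have "(1 + s * (x \<bullet> x))\<^sup>2 \<le> K * (1 + t * (x \<bullet> x))\<^sup>2"
      unfolding K_def power_mult_distrib[symmetric] using b by (intro power_mono) auto
    then have "1 / (K * (1 + t * (x \<bullet> x))\<^sup>2) \<le> 1 / (1 + s * (x \<bullet> x))\<^sup>2"
      using b K by (intro divide_left_mono) auto
    then show ?thesis
      by (simp add: weight_def)
  qed
  have "mass 1 (weight t) \<phi> \<le> K * mass 1 (weight s) \<phi>" if \<phi>: "C1 \<phi>" for \<phi>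
  proof -
    have "1 / K * mass 1 (weight t) \<phi> \<le> mass 1 (weight s) \<phi>"
    proof (rule mass_ge_L2[where A = "max (1 / (min 1 (1 + s))\<^sup>2) (1 / (min 1 (1 + t))\<^sup>2)"])
      show "continuous_on UNIV \<phi>"
        by (rule C1_continuous[OF \<phi>])
      fix x :: "real^2" assume x: "norm x < 1"
      show "\<bar>weight s x\<bar> \<le> max (1 / (min 1 (1 + s))\<^sup>2) (1 / (min 1 (1 + t))\<^sup>2)"
        using weight_bounds(1,2)[OF s, of x] x by simp
      show "\<bar>weight t x\<bar> \<le> max (1 / (min 1 (1 + s))\<^sup>2) (1 / (min 1 (1 + t))\<^sup>2)"
        using weight_bounds(1,2)[OF t, of x] x by simp
    qed (use w in auto)
    then show ?thesis
      using K by (simp add: divide_le_eq mult.commute)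
  qed
  then have "\<mu> k \<alpha> (weight s) \<le> K * \<mu> k \<alpha> (weight t)"
    using K by (intro \<mu>_compare[where ?M1.0 = "\<mu> k \<alpha> (weight t) + 1"] admissible_weight_exists t) auto
  then show ?thesis
    by (simp add: K_def)
qed

text \<open>The comparison is used in both directions; with \<open>s\<close> and \<open>t\<close>
  exchanged it gives the lower half of the squeeze.\<close>

lemma continuous_on_\<mu>_weight: "continuous_on {-1<..} (\<lambda>t. \<mu> k \<alpha> (weight t))"
proof (rule continuous_at_imp_continuous_on, rule ballI)
  fix t :: real assume "t \<in> {-1<..}"
  then have t: "t > -1" by simp
  have ev: "\<forall>\<^sub>F s in at t. s > -1"
    using t order_tendstoD(1)[OF tendsto_ident_at, of "-1" t UNIV] by simp
  have up: "((\<lambda>s. (1 + \<bar>s - t\<bar> / min 1 (1 + t))\<^sup>2 * \<mu> k \<alpha> (weight t)) \<longlongrightarrow> (1 + \<bar>t - t\<bar> / min 1 (1 + t))\<^sup>2 * \<mu> k \<alpha> (weight t)) (at t)"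
    using t by (intro tendsto_intros) auto
  have lo: "((\<lambda>s. \<mu> k \<alpha> (weight t) / (1 + \<bar>t - s\<bar> / min 1 (1 + s))\<^sup>2) \<longlongrightarrow> \<mu> k \<alpha> (weight t) / (1 + \<bar>t - t\<bar> / min 1 (1 + t))\<^sup>2) (at t)"
    using t by (intro tendsto_intros) auto
  show "isCont (\<lambda>t. \<mu> k \<alpha> (weight t)) t"
    unfolding isCont_def
  proof (rule tendsto_sandwich)
    show "\<forall>\<^sub>F s in at t. \<mu> k \<alpha> (weight s) \<le> (1 + \<bar>s - t\<bar> / min 1 (1 + t))\<^sup>2 * \<mu> k \<alpha> (weight t)"
      using ev by eventually_elim (rule \<mu>_weight_compare[OF t])
    show "\<forall>\<^sub>F s in at t. \<mu> k \<alpha> (weight t) / (1 + \<bar>t - s\<bar> / min 1 (1 + s))\<^sup>2 \<le> \<mu> k \<alpha> (weight s)"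
      using ev
    proof eventually_elim
      case (elim s)
      then have "0 < 1 + \<bar>t - s\<bar> / min 1 (1 + s)"
        by (intro add_pos_nonneg divide_nonneg_pos) auto
      then show ?case
        using \<mu>_weight_compare[OF elim t] by (simp add: divide_le_eq mult.commute)
    qed
  qed (use up lo in simp_all)
qed

text \<open>The larger weight belongs to the smaller parameter. The relative gain is proportional to
  \<open>x \<bullet> x\<close>, so it degenerates only at the origin.\<close>

lemma \<mu>_weight_strict_mono:
  assumes s: "s > -1" and st: "s < t"
  shows "\<mu> k \<alpha> (weight s) < \<mu> k \<alpha> (weight t)"
proof -
  have t: "t > -1"
    using s st by simp
  show ?thesis
  proof (rule \<mu>_strict_mono[where A = "1 / (min 1 (1 + t))\<^sup>2" and A' = "1 / (min 1 (1 + s))\<^sup>2"])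
    show "\<exists>M. admissible 1 \<alpha> (weight t) k M"
      by (rule admissible_weight_exists[OF t])
    show "0 < \<mu> k \<alpha> (weight t)"
      by (rule \<mu>_weight_pos[OF t])
    show "0 \<le> weight t x \<and> weight t x \<le> 1 / (min 1 (1 + t))\<^sup>2" if "norm x \<le> 1" for x
      using weight_bounds[OF t that] by simp
    \<comment> \<open>With \<open>a\<close> and \<open>a + q\<close> the two denominators, the ratio
      of the weights is \<open>((a + q) / a)\<^sup>2\<close>, at least
      \<open>1 + q / a\<close>.\<close>
    have ratio: "(1 + (t - s) * (x \<bullet> x) / (1 + \<bar>s\<bar>)) * weight t x \<le> weight s x" if x: "norm x \<le> 1" for x
    proof -
      have b: "1 + s * (x \<bullet> x) \<le> 1 + \<bar>s\<bar>" "0 < 1 + t * (x \<bullet> x)" "0 < 1 + s * (x \<bullet> x)"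
        using weight_denominator_bounds[OF t x] weight_denominator_bounds[OF s x] by auto
      define q where "q = (t - s) * (x \<bullet> x)"
      have q: "0 \<le> q"
        using st by (simp add: q_def)
      define a where "a = 1 + s * (x \<bullet> x)"
      have ta: "1 + t * (x \<bullet> x) = a + q"
        by (simp add: a_def q_def algebra_simps)
      have a: "a > 0" "a \<le> 1 + \<bar>s\<bar>"
        using b by (simp_all add: a_def)
      have "q / (1 + \<bar>s\<bar>) \<le> q / a"
        using a q by (intro divide_left_mono) auto
      then have "1 + q / (1 + \<bar>s\<bar>) \<le> 1 + q / a"
        by simp
      also have "\<dots> = (a + q) / a"
        using a by (simp add: add_divide_distrib)
      also have "\<dots> \<le> ((a + q) / a)\<^sup>2"
        using a q by (intro self_le_power) auto
      finally have "(1 + q / (1 + \<bar>s\<bar>)) * (1 / (a + q)\<^sup>2) \<le> ((a + q) / a)\<^sup>2 * (1 / (a + q)\<^sup>2)"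
        by (rule mult_right_mono) simp
      also have "\<dots> = 1 / a\<^sup>2"
        using a q by (simp add: power_divide)
      finally show ?thesis
        unfolding weight_def ta q_def[symmetric] a_def[symmetric] .
    qed
    show "weight t x \<le> weight s x \<and> weight s x \<le> 1 / (min 1 (1 + s))\<^sup>2" if x: "norm x \<le> 1" for x
    proof
      show "weight s x \<le> 1 / (min 1 (1 + s))\<^sup>2"
        by (rule weight_bounds(2)[OF s x])
      have "1 * weight t x \<le> (1 + (t - s) * (x \<bullet> x) / (1 + \<bar>s\<bar>)) * weight t x"
        using st weight_bounds(1)[OF t x] by (intro mult_right_mono) auto
      then show "weight t x \<le> weight s x"
        using ratio[OF x] by simp
    qed
    fix \<eta> :: real assume \<eta>: "0 < \<eta>" "\<eta> < 1"
    show "\<exists>\<kappa>>0. \<forall>x. \<eta> < norm x \<and> norm x < 1 - \<eta> \<longrightarrow> (1 + \<kappa>) * weight t x \<le> weight s x"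
    proof (intro exI[of _ "(t - s) * \<eta>\<^sup>2 / (1 + \<bar>s\<bar>)"] conjI allI impI)
      show "0 < (t - s) * \<eta>\<^sup>2 / (1 + \<bar>s\<bar>)"
        using st \<eta> by (simp add: add_pos_nonneg)
      fix x :: "real^2" assume x: "\<eta> < norm x \<and> norm x < 1 - \<eta>"
      then have x1: "norm x \<le> 1"
        using \<eta> by linarith
      have "\<eta>\<^sup>2 \<le> x \<bullet> x"
        using x \<eta> by (simp add: dot_square_norm power_mono)
      then have "(1 + (t - s) * \<eta>\<^sup>2 / (1 + \<bar>s\<bar>)) * weight t x \<le> (1 + (t - s) * (x \<bullet> x) / (1 + \<bar>s\<bar>)) * weight t x"
        using st weight_bounds(1)[OF t x1] by (intro mult_right_mono add_left_mono divide_right_mono mult_left_mono) auto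
      then show "(1 + (t - s) * \<eta>\<^sup>2 / (1 + \<bar>s\<bar>)) * weight t x \<le> weight s x"
        using ratio[OF x1] by linarith
    qed
  qed measurable
qed

lemma \<mu>_gweight:
  assumes "t > -1"
  shows "\<mu> k \<alpha> (gweight t) = \<mu> k \<alpha> (weight t) / (1 + t)\<^sup>2" "\<exists>M. admissible 1 \<alpha> (gweight t) k M"
  using \<mu>_scale[of "(1 + t)\<^sup>2" "weight t"] admissible_weight_exists[OF assms] assms
  by (simp_all add: gweight_def[abs_def])

text \<open>The mirror image: now the weight grows with the parameter, and the relative gain is
  proportional to \<open>1 - x \<bullet> x\<close>, which degenerates only on the boundary.\<close>

lemma \<mu>_gweight_strict_antimono:
  assumes s: "s > -1" and st: "s < t"
  shows "\<mu> k \<alpha> (gweight t) < \<mu> k \<alpha> (gweight s)"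
proof -
  have t: "t > -1"
    using s st by simp
  show ?thesis
  proof (rule \<mu>_strict_mono[where A = "(1 + s)\<^sup>2 / (min 1 (1 + s))\<^sup>2" and A' = "(1 + t)\<^sup>2 / (min 1 (1 + t))\<^sup>2"])
    show "\<exists>M. admissible 1 \<alpha> (gweight s) k M"
      by (rule \<mu>_gweight(2)[OF s])
    show "0 < \<mu> k \<alpha> (gweight s)"
      using \<mu>_weight_pos[OF s] s by (simp add: \<mu>_gweight(1)[OF s])
    show "gweight s \<in> borel_measurable borel" "gweight t \<in> borel_measurable borel"
      by (rule gweight_measurable)+
    show "0 \<le> gweight s x \<and> gweight s x \<le> (1 + s)\<^sup>2 / (min 1 (1 + s))\<^sup>2" if "norm x \<le> 1" for x
      using gweight_bounds[OF s that] by simp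
    have ratio: "(1 + (t - s) * (1 - x \<bullet> x) / ((1 + s) * (1 + \<bar>t\<bar>))) * gweight s x \<le> gweight t x" if x: "norm x \<le> 1" for x
    proof -
      have b: "1 + t * (x \<bullet> x) \<le> 1 + \<bar>t\<bar>" "0 < 1 + t * (x \<bullet> x)" "0 < 1 + s * (x \<bullet> x)"
        using weight_denominator_bounds[OF t x] weight_denominator_bounds[OF s x] by auto
      define q where "q = (t - s) * (1 - x \<bullet> x)"
      have q: "0 \<le> q"
        using st inner_self_le_1[OF x] by (simp add: q_def)
      define a where "a = (1 + s) * (1 + t * (x \<bullet> x))"
      \<comment> \<open>The cross products of the two fractions under comparison differ exactly by
        \<open>(t - s) * (1 - x \<bullet> x)\<close>.\<close>
      have ta: "(1 + t) * (1 + s * (x \<bullet> x)) = a + q"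
        by (simp add: a_def q_def algebra_simps)
      have a: "a > 0" "a \<le> (1 + s) * (1 + \<bar>t\<bar>)"
        using b s by (auto simp: a_def)
      have "q / ((1 + s) * (1 + \<bar>t\<bar>)) \<le> q / a"
        using a q s by (intro divide_left_mono) auto
      then have "1 + q / ((1 + s) * (1 + \<bar>t\<bar>)) \<le> 1 + q / a"
        by simp
      also have "\<dots> = (a + q) / a"
        using a by (simp add: add_divide_distrib)
      also have "\<dots> \<le> ((a + q) / a)\<^sup>2"
        using a q by (intro self_le_power) auto
      finally have "(1 + q / ((1 + s) * (1 + \<bar>t\<bar>))) * gweight s x \<le> ((a + q) / a)\<^sup>2 * gweight s x"
        by (rule mult_right_mono) (simp add: gweight_eq)
      also have "\<dots> = gweight t x"
      proof -
        define d1 d2 where "d1 = 1 + t * (x \<bullet> x)" and "d2 = 1 + s * (x \<bullet> x)"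
        have "(a + q) / a * ((1 + s) / d2) = (1 + t) / d1"
          unfolding ta[symmetric] unfolding a_def d1_def[symmetric] d2_def[symmetric] using b s by (simp add: d1_def[symmetric] d2_def[symmetric])
        then show ?thesis
          unfolding gweight_eq power_mult_distrib[symmetric] by (simp add: d1_def d2_def)
      qed
      finally show ?thesis
        unfolding q_def .
    qed
    show "gweight s x \<le> gweight t x \<and> gweight t x \<le> (1 + t)\<^sup>2 / (min 1 (1 + t))\<^sup>2" if x: "norm x \<le> 1" for x
    proof
      show "gweight t x \<le> (1 + t)\<^sup>2 / (min 1 (1 + t))\<^sup>2"
        by (rule gweight_bounds(2)[OF t x])
      have "1 * gweight s x \<le> (1 + (t - s) * (1 - x \<bullet> x) / ((1 + s) * (1 + \<bar>t\<bar>))) * gweight s x"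
        using st s inner_self_le_1[OF x] gweight_bounds(1)[OF s x] by (intro mult_right_mono) auto
      then show "gweight s x \<le> gweight t x"
        using ratio[OF x] by simp
    qed
    fix \<eta> :: real assume \<eta>: "0 < \<eta>" "\<eta> < 1"
    show "\<exists>\<kappa>>0. \<forall>x. \<eta> < norm x \<and> norm x < 1 - \<eta> \<longrightarrow> (1 + \<kappa>) * gweight s x \<le> gweight t x"
    proof (intro exI[of _ "(t - s) * \<eta> / ((1 + s) * (1 + \<bar>t\<bar>))"] conjI allI impI)
      show "0 < (t - s) * \<eta> / ((1 + s) * (1 + \<bar>t\<bar>))"
        using st s \<eta> by (simp add: add_pos_nonneg)
      fix x :: "real^2" assume x: "\<eta> < norm x \<and> norm x < 1 - \<eta>"
      then have x1: "norm x \<le> 1"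
        using \<eta> by linarith
      \<comment> \<open>Away from the boundary strip this yields
        \<open>1 - x \<bullet> x \<ge> \<eta>\<close>, hence a gain linear in
        \<open>\<eta>\<close>.\<close>
      have "x \<bullet> x \<le> (1 - \<eta>) * 1"
        using x \<eta> unfolding dot_square_norm power2_eq_square by (intro mult_mono) auto
      then have "(1 + (t - s) * \<eta> / ((1 + s) * (1 + \<bar>t\<bar>))) * gweight s x \<le> (1 + (t - s) * (1 - x \<bullet> x) / ((1 + s) * (1 + \<bar>t\<bar>))) * gweight s x"
        using st s gweight_bounds(1)[OF s x1] by (intro mult_right_mono add_left_mono divide_right_mono mult_left_mono) auto
      then show "(1 + (t - s) * \<eta> / ((1 + s) * (1 + \<bar>t\<bar>))) * gweight s x \<le> gweight t x"
        using ratio[OF x1] by linarith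
    qed
  qed
qed

end

section \<open>Limits at the two ends of the parameter range\<close>

lemma C1_bump_mult:
  assumes p: "C1 p"
  shows "C1 (\<lambda>x. bump x * p x)" "\<And>x. norm x \<ge> 1 \<Longrightarrow> partials (\<lambda>x. bump x * p x) x = 0"
proof -
  show "C1 (\<lambda>x. bump x * p x)"
    by (rule C1_mult(1)[OF C1_bump(1) p])
  fix x :: "real^2" assume x: "norm x \<ge> 1"
  then have "dbump x = 0"
    by (simp add: dbump_def norm_eq_sqrt_inner)
  then show "partials (\<lambda>x. bump x * p x) x = 0"
    unfolding C1_mult(2)[OF C1_bump(1) p] C1_bump(2) by (simp add: bump_eq_0[OF x])
qed

lemma integral_disk_support:
  fixes f :: "real^2 \<Rightarrow> real"
  assumes f: "f \<in> borel_measurable borel" and 0: "\<And>x. norm x \<ge> 1 \<Longrightarrow> f x = 0" and R: "R \<ge> 1"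
  shows "(\<integral>x. f x \<partial>disk R) = (\<integral>x. f x \<partial>disk 1)"
proof -
  have eq: "(\<lambda>x. indicator (ball 0 R) x * f x) = (\<lambda>x. indicator (ball 0 1) x * f x)"
  proof
    show "indicator (ball 0 R) x * f x = indicator (ball 0 1) x * f x" for x
      using 0[of x] R by (cases "norm x \<ge> 1") (auto simp: indicator_def)
  qed
  show ?thesis
    unfolding integral_disk_lborel[OF f] eq ..
qed

text \<open>Function and derivative vanish outside the open unit disk, including the circle of
  radius \<open>R\<close>, so neither term of the energy sees \<open>R\<close>. After dilation this
  makes the energy independent of \<open>t\<close>.\<close>

lemma energy_bump_mult:
  assumes p: "C1 p" and R: "R \<ge> 1"
  shows "energy R \<alpha> (\<lambda>x. bump x * p x) = energy 1 \<alpha> (\<lambda>x. bump x * p x)"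
proof -
  let ?f = "\<lambda>x. bump x * p x"
  have "(\<integral>x. partials ?f x \<bullet> partials ?f x \<partial>disk R) = (\<integral>x. partials ?f x \<bullet> partials ?f x \<partial>disk 1)"
  proof (rule integral_disk_support[OF _ _ R])
    show "(\<lambda>x. partials ?f x \<bullet> partials ?f x) \<in> borel_measurable borel"
      by (intro borel_measurable_continuous_onI continuous_on_inner C1_partials_continuous C1_bump_mult p)
  qed (simp add: C1_bump_mult(2)[OF p])
  moreover have "bump (circle_curve r t) = 0" if "r \<ge> 1" for r t
    using that by (intro bump_eq_0) (simp add: norm_circle_curve)
  ultimately show ?thesis
    using R by (simp add: energy_def)
qed

text \<open>The polar formula with the radius outside, for estimates circle by circle.\<close>

lemma nn_integral_disk_annulus:
  assumes [measurable]: "f \<in> borel_measurable borel"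
  shows "(\<integral>\<^sup>+x. f x \<partial>disk R) = (\<integral>\<^sup>+s\<in>{0..R}. (\<integral>\<^sup>+t. ennreal s * f (circle_curve s t) \<partial>angles) \<partial>lborel)"
proof -
  define F where "F t s = ennreal s * f (circle_curve s t) * indicator {0..R} s * indicator {0..2*pi} t" for t s
  have Fm: "(\<lambda>(t, s). F t s) \<in> borel_measurable (lborel \<Otimes>\<^sub>M lborel)"
    unfolding F_def case_prod_beta by measurable
  have "(\<integral>\<^sup>+x. f x \<partial>disk R) = (\<integral>\<^sup>+t. (\<integral>\<^sup>+s. F t s \<partial>lborel) \<partial>lborel)"
    unfolding nn_integral_disk F_def by (subst polar_nn_integral) (auto simp: nn_integral_multc)
  also have "\<dots> = (\<integral>\<^sup>+s. (\<integral>\<^sup>+t. F t s \<partial>lborel) \<partial>lborel)"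
    by (rule lborel_pair.Fubini'[OF Fm, symmetric])
  also have "\<dots> = (\<integral>\<^sup>+s\<in>{0..R}. (\<integral>\<^sup>+t. ennreal s * f (circle_curve s t) \<partial>angles) \<partial>lborel)"
    unfolding nn_integral_angles F_def
    by (intro nn_integral_cong) (auto simp: indicator_def)
  finally show ?thesis .
qed

text \<open>These are the boundary values of the powers of the first coordinate; along
  \<open>arccos\<close> they become powers of \<open>y\<close> on an interval.\<close>

lemma cosine_powers_indep:
  fixes c :: "nat \<Rightarrow> real"
  assumes "AE t in angles. (\<Sum>i<k. c i * (cos t) ^ i) = 0"
  shows "\<forall>i<k. c i = 0"
proof (rule polynomial_zero_on_interval[of "-1" 1])
  fix y :: real assume y: "y \<in> {-1<..<1}"
  have "(\<Sum>i<k. c i * (cos (arccos y)) ^ i) = 0"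
  proof (rule continuous_AE_zero[OF _ _ _ _ assms])
    show "continuous_on UNIV (\<lambda>t::real. \<Sum>i<k. c i * (cos t) ^ i)"
      by (intro continuous_intros)
    show "arccos y \<in> {0<..<2*pi}"
      using y arccos_lt_bounded[of y] pi_gt_zero by auto
  qed auto
  then show "(\<Sum>i<k. c i * y ^ i) = 0"
    using y by simp
qed simp

context
  fixes k :: nat and \<alpha> :: real
  assumes k: "k \<ge> 1" and \<alpha>: "\<alpha> > 0"
begin

lemma poincare_const_pos: "poincare_const \<alpha> > 0"
  using \<alpha> by (simp add: poincare_const_def add_pos_pos)

text \<open>The strips contribute at most \<open>2 * \<eta> \<le> d / 2\<close> and the middle at
  most \<open>d / 2\<close>, so the mass is at most \<open>energy / Z\<close>. Both divergence
  statements reduce to this: \<open>weight\<close> tends to 0 off the origin, \<open>gweight\<close>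
  off the boundary.\<close>

lemma \<mu>_ge_of_small_weight:
  assumes ex: "\<exists>M. admissible 1 \<alpha> \<rho> k M" and m: "\<rho> \<in> borel_measurable borel" and Z: "Z > 0"
    and d: "d = 1 / (poincare_const \<alpha> * Z)" and \<eta>: "\<eta> = min 1 (d / 4)"
    and \<rho>: "\<And>x. norm x \<le> 1 \<Longrightarrow> 0 \<le> \<rho> x \<and> \<rho> x \<le> 1"
    and mid: "\<And>x. \<eta> < norm x \<Longrightarrow> norm x < 1 - \<eta> \<Longrightarrow> \<rho> x \<le> d / 2"
  shows "Z \<le> \<mu> k \<alpha> \<rho>"
proof -
  note P = poincare_const_pos
  have d0: "d > 0"
    using P Z by (simp add: d)
  have \<eta>0: "0 \<le> \<eta>" "\<eta> \<le> 1" "2 * \<eta> \<le> d / 2"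
    using d0 by (auto simp: \<eta>)
  have "mass 1 \<rho> \<phi> \<le> (poincare_const \<alpha> * d) * energy 1 \<alpha> \<phi>" if \<phi>: "C1 \<phi>" for \<phi>
  proof -
    have "mass 1 \<rho> \<phi> \<le> poincare_const \<alpha> * (2 * 1 * \<eta> + d / 2) * energy 1 \<alpha> \<phi>"
      by (rule mass_le_energy[OF \<phi> \<alpha> m]) (use \<eta>0 d0 \<rho> mid in auto)
    also have "\<dots> \<le> (poincare_const \<alpha> * d) * energy 1 \<alpha> \<phi>"
      using P \<eta>0 \<alpha> by (intro mult_right_mono mult_left_mono energy_nonneg) auto
    finally show ?thesis .
  qed
  then have "1 / (poincare_const \<alpha> * d) \<le> \<mu> k \<alpha> \<rho>"
    using P d0 by (intro \<mu>_lower_bound[OF k \<alpha> ex]) auto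
  then show ?thesis
    using P Z by (simp add: d)
qed

lemma \<mu>_weight_at_top: "filterlim (\<lambda>t. \<mu> k \<alpha> (weight t)) at_top at_top"
proof (subst filterlim_at_top_gt[where c = 0], intro allI impI)
  fix Z :: real assume Z: "Z > 0"
  define d where "d = 1 / (poincare_const \<alpha> * Z)"
  define \<eta> where "\<eta> = min 1 (d / 4)"
  have d0: "d > 0"
    using poincare_const_pos Z by (simp add: d_def)
  then have \<eta>0: "\<eta> > 0"
    by (simp add: \<eta>_def)
  show "\<forall>\<^sub>F t in at_top. Z \<le> \<mu> k \<alpha> (weight t)"
    \<comment> \<open>For such \<open>t\<close> and \<open>norm x > \<eta>\<close> the denominator
      \<open>1 + t * (x \<bullet> x)\<close> is at least \<open>2 / d\<close>, and its square is not
      smaller because it is at least 1.\<close>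
    using eventually_ge_at_top[of "2 / (d * \<eta>\<^sup>2)"] eventually_ge_at_top[of 0]
  proof eventually_elim
    case (elim t)
    then have t: "t > -1"
      by simp
    show ?case
    proof (rule \<mu>_ge_of_small_weight[OF admissible_weight_exists[OF k \<alpha> t] weight_measurable Z d_def \<eta>_def])
      show "0 \<le> weight t x \<and> weight t x \<le> 1" if "norm x \<le> 1" for x
        using weight_bounds[OF t that] elim by simp
      fix x :: "real^2" assume x: "\<eta> < norm x" "norm x < 1 - \<eta>"
      have "2 / d = 2 / (d * \<eta>\<^sup>2) * \<eta>\<^sup>2"
        using \<eta>0 by simp
      also have "\<dots> \<le> t * (x \<bullet> x)"
        using elim x \<eta>0 by (intro mult_mono) (auto simp: dot_square_norm power_mono)
      finally have a: "2 / d \<le> 1 + t * (x \<bullet> x)"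
        by simp
      have "1 + t * (x \<bullet> x) \<le> (1 + t * (x \<bullet> x))\<^sup>2"
        using elim by (intro self_le_power) auto
      with a have b: "2 / d \<le> (1 + t * (x \<bullet> x))\<^sup>2"
        by linarith
      have "weight t x \<le> 1 / (2 / d)"
        unfolding weight_def using d0 b by (intro divide_left_mono mult_pos_pos) (auto intro: less_le_trans[of 0 "2 / d"])
      then show "weight t x \<le> d / 2"
        by simp
    qed
  qed
qed

lemma \<mu>_gweight_at_minus_1: "filterlim (\<lambda>t. \<mu> k \<alpha> (gweight t)) at_top (at_right (-1))"
proof (subst filterlim_at_top_gt[where c = 0], intro allI impI)
  fix Z :: real assume Z: "Z > 0"
  define d where "d = 1 / (poincare_const \<alpha> * Z)"
  define \<eta> where "\<eta> = min 1 (d / 4)"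
  have d0: "d > 0"
    using poincare_const_pos Z by (simp add: d_def)
  then have \<eta>0: "\<eta> > 0" "\<eta> \<le> 1"
    by (simp_all add: \<eta>_def)
  \<comment> \<open>Off the boundary strip the denominator is at least \<open>\<eta>\<close>, so the
    weight is at most \<open>((1 + t) / \<eta>)\<^sup>2 \<le> (1 + t) / \<eta>\<^sup>2\<close>. The
    \<open>min\<close> with 1 ensures \<open>t < 0\<close>, which both bounds use.\<close>
  define e where "e = min 1 (d * \<eta>\<^sup>2 / 2)"
  have e: "e > 0"
    using d0 \<eta>0 by (simp add: e_def)
  have "\<forall>\<^sub>F t in at_right (-1). t \<in> {-1<..<-1 + e}"
    using e by (intro eventually_at_right_real) simp
  then show "\<forall>\<^sub>F t in at_right (-1). Z \<le> \<mu> k \<alpha> (gweight t)"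
  proof eventually_elim
    case (elim t)
    then have t: "t > -1" and te: "1 + t < e"
      by auto
    have t0: "t < 0"
      using te by (simp add: e_def)
    show ?case
    proof (rule \<mu>_ge_of_small_weight[OF \<mu>_gweight(2)[OF k \<alpha> t] gweight_measurable Z d_def \<eta>_def])
      show "0 \<le> gweight t x \<and> gweight t x \<le> 1" if "norm x \<le> 1" for x
        using gweight_bounds[OF t that] t t0 by simp
      fix x :: "real^2" assume x: "\<eta> < norm x" "norm x < 1 - \<eta>"
      have "x \<bullet> x \<le> (1 - \<eta>) * 1"
        using x \<eta>0 unfolding dot_square_norm power2_eq_square by (intro mult_mono) auto
      then have "(- t) * (x \<bullet> x) \<le> 1 * (1 - \<eta>)"
        using t t0 by (intro mult_mono) auto
      then have b: "\<eta> \<le> 1 + t * (x \<bullet> x)"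
        by simp
      have "gweight t x \<le> ((1 + t) / \<eta>)\<^sup>2"
        unfolding gweight_eq using b \<eta>0 t by (intro power_mono divide_left_mono mult_pos_pos divide_nonneg_pos) auto
      also have "\<dots> = (1 + t) * (1 + t) / \<eta>\<^sup>2"
        by (simp add: power_divide power2_eq_square)
      also have "\<dots> \<le> (1 + t) * 1 / \<eta>\<^sup>2"
        using t t0 by (intro divide_right_mono mult_left_mono) auto
      also have "\<dots> \<le> (d * \<eta>\<^sup>2 / 2) / \<eta>\<^sup>2"
        using te by (intro divide_right_mono) (auto simp: e_def)
      also have "\<dots> = d / 2"
        using \<eta>0 by simp
      finally show "gweight t x \<le> d / 2" .
    qed
  qed
qed

text \<open>
  Test functions concentrating at the origin: bumps times polynomials, shrunk by the factor
  \<open>sqrt t\<close>. Their energy does not depend on \<open>t\<close>.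
\<close>

lemma \<mu>_gweight_le:
  obtains C where "\<And>t. t \<ge> 1 \<Longrightarrow> \<mu> k \<alpha> (gweight t) \<le> C / t"
proof -
  define \<psi> where "\<psi> i x = bump x * (x $ 1) ^ i" for i and x :: "real^2"
  have \<psi>: "C1 (\<psi> i)" for i
    unfolding \<psi>_def by (intro C1_bump_mult C1_power_nth1)
  define p where "p c x = (\<Sum>i<k. c i * (x $ 1) ^ i)" for c and x :: "real^2"
  have p: "C1 (p c)" for c
    unfolding p_def by (intro C1_lincomb C1_power_nth1)
  have \<psi>p: "(\<lambda>x. \<Sum>i<k. c i * \<psi> i x) = (\<lambda>x. bump x * p c x)" for c
    by (simp add: \<psi>_def p_def sum_distrib_left mult.left_commute)
  obtain \<kappa> where \<kappa>: "\<kappa> > 0" "\<And>c. \<kappa> * (\<Sum>i<k. (c i)\<^sup>2) \<le> (\<integral>x. (\<Sum>i<k. c i * \<psi> i x)\<^sup>2 \<partial>disk 1)"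
  proof (rule L2_indep_lower[of k "disk 1" \<psi>])
    fix c assume ae: "AE x in disk 1. (\<Sum>i<k. c i * \<psi> i x) = 0"
    \<comment> \<open>The bump is positive on the open disk, so it can be divided out and
      independence reduces to that of polynomials.\<close>
    have "AE x in disk 1. (\<Sum>i<k. c i * (x $ 1) ^ i) = 0"
      using ae AE_space
    proof eventually_elim
      case (elim x)
      then have "bump x \<noteq> 0"
        by (auto simp: bump_def norm_eq_sqrt_inner)
      with elim fun_cong[OF \<psi>p[of c], of x] show ?case
        by (simp add: p_def)
    qed
    then show "\<forall>i<k. c i = 0"
      by (rule polynomials_indep_disk)
  qed (auto intro: C1_L2 \<psi>)
  obtain K where K: "K > 0" "\<And>c. energy 1 \<alpha> (\<lambda>x. \<Sum>i<k. c i * \<psi> i x) \<le> K * (\<Sum>i<k. (c i)\<^sup>2)"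
    using energy_lincomb_bound[of k \<psi> \<alpha> 1] \<psi> \<alpha> by auto
  \<comment> \<open>Dilating the disk of radius \<open>sqrt t\<close> to the unit disk turns this
    weight into \<open>t\<close> times the indicator of the disk of radius
    \<open>1 / sqrt t\<close>.\<close>
  define \<iota> where "\<iota> x = (indicator (ball 0 1) x :: real)" for x :: "real^2"
  have \<iota>m: "\<iota> \<in> borel_measurable borel"
    unfolding \<iota>_def by (intro borel_measurable_indicator) auto
  have adm: "admissible R \<alpha> \<iota> k (K / \<kappa>)" if R: "R \<ge> 1" for R
  proof (rule admissible_of_bounds[OF \<psi> \<kappa>(1)])
    fix c
    have "mass R \<iota> (\<lambda>x. \<Sum>i<k. c i * \<psi> i x) = (\<integral>x. \<iota> x * (bump x * p c x)\<^sup>2 \<partial>disk R)"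
      unfolding mass_def using \<psi>p[of c] by (simp add: fun_eq_iff)
    also have "\<dots> = (\<integral>x. \<iota> x * (bump x * p c x)\<^sup>2 \<partial>disk 1)"
    proof (rule integral_disk_support[OF _ _ R])
      show "(\<lambda>x. \<iota> x * (bump x * p c x)\<^sup>2) \<in> borel_measurable borel"
        by (intro borel_measurable_times borel_measurable_power \<iota>m borel_measurable_continuous_onI C1_continuous C1_bump_mult p)
    qed (simp add: \<iota>_def)
    also have "\<dots> = (\<integral>x. (\<Sum>i<k. c i * \<psi> i x)\<^sup>2 \<partial>disk 1)"
      using \<psi>p[of c] by (intro Bochner_Integration.integral_cong) (auto simp: \<iota>_def fun_eq_iff)
    finally show "\<kappa> * (\<Sum>i<k. (c i)\<^sup>2) \<le> mass R \<iota> (\<lambda>x. \<Sum>i<k. c i * \<psi> i x)"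
      using \<kappa>(2)[of c] by simp
    show "energy R \<alpha> (\<lambda>x. \<Sum>i<k. c i * \<psi> i x) \<le> K * (\<Sum>i<k. (c i)\<^sup>2)"
      using K(2)[of c] energy_bump_mult[OF p R, of \<alpha> c] by (simp only: \<psi>p)
  qed (use K in auto)
  have "\<mu> k \<alpha> (gweight t) \<le> (4 * (K / \<kappa>)) / t" if t: "t \<ge> 1" for t
  proof -
    define s where "s = sqrt t"
    have s: "s \<ge> 1" "s > 0" "s\<^sup>2 = t"
      using t by (simp_all add: s_def)
    have t1: "t > -1"
      using t by simp
    have "admissible (s / s) \<alpha> (\<lambda>x. s\<^sup>2 * \<iota> (s *\<^sub>R x)) k (K / \<kappa>)"
      by (rule admissible_dilate[OF adm[OF s(1)] s(2) \<iota>m])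
    then have a: "admissible 1 \<alpha> (\<lambda>x. t * \<iota> (s *\<^sub>R x)) k (K / \<kappa>)"
      using s by simp
    have "admissible 1 \<alpha> (gweight t) k (4 / t * (K / \<kappa>))"
    proof (rule admissible_compare[OF a])
      fix \<phi> assume \<phi>: "C1 \<phi>"
      \<comment> \<open>On the disk of radius \<open>1 / sqrt t\<close> the denominator of
        \<open>gweight\<close> is below 2, so \<open>gweight\<close> is at least
        \<open>((1 + t) / 2)\<^sup>2\<close>, which exceeds \<open>t / 4 * t\<close>.\<close>
      have "t / 4 * mass 1 (\<lambda>x. t * \<iota> (s *\<^sub>R x)) \<phi> \<le> mass 1 (gweight t) \<phi>"
      proof (rule mass_ge_L2[where A = "max t ((1 + t)\<^sup>2 / (min 1 (1 + t))\<^sup>2)"])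
        show "continuous_on UNIV \<phi>"
          by (rule C1_continuous[OF \<phi>])
        show "gweight t \<in> borel_measurable borel"
          by (rule gweight_measurable)
        show "(\<lambda>x. t * \<iota> (s *\<^sub>R x)) \<in> borel_measurable borel"
          using \<iota>m by measurable
        fix x :: "real^2" assume x: "norm x < 1"
        show "\<bar>gweight t x\<bar> \<le> max t ((1 + t)\<^sup>2 / (min 1 (1 + t))\<^sup>2)"
          using gweight_bounds[OF t1, of x] x by simp
        show "\<bar>t * \<iota> (s *\<^sub>R x)\<bar> \<le> max t ((1 + t)\<^sup>2 / (min 1 (1 + t))\<^sup>2)"
          using t by (auto simp: \<iota>_def indicator_def)
        show "t / 4 * (t * \<iota> (s *\<^sub>R x)) \<le> gweight t x"
        proof (cases "norm (s *\<^sub>R x) < 1")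
          case True
          then have "t * (x \<bullet> x) < 1"
          proof -
            have "(norm (s *\<^sub>R x))\<^sup>2 < 1"
              using True by (simp add: power_less_one_iff abs_square_less_1)
            then show ?thesis
              using s by (simp add: power_mult_distrib dot_square_norm)
          qed
          then have "(1 + t) / 2 \<le> (1 + t) / (1 + t * (x \<bullet> x))"
            using t by (intro divide_left_mono mult_pos_pos add_pos_nonneg) auto
          then have "((1 + t) / 2)\<^sup>2 \<le> gweight t x"
            unfolding gweight_eq using t by (intro power_mono) auto
          moreover have "t / 4 * t \<le> ((1 + t) / 2)\<^sup>2"
            using t by (simp add: power2_eq_square field_simps)
          moreover have "\<iota> (s *\<^sub>R x) = 1"
            using True by (simp add: \<iota>_def)
          ultimately show ?thesis
            by simp
        next
          case False
          then have "\<iota> (s *\<^sub>R x) = 0"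
            by (simp add: \<iota>_def)
          then show ?thesis
            using gweight_bounds(1)[OF t1, of x] x by simp
        qed
      qed
      then show "mass 1 (\<lambda>x. t * \<iota> (s *\<^sub>R x)) \<phi> \<le> 4 / t * mass 1 (gweight t) \<phi>"
        using t by (simp add: field_simps)
    qed (use K \<kappa> t in auto)
    then have "\<mu> k \<alpha> (gweight t) \<le> 4 / t * (K / \<kappa>)"
      by (rule \<mu>_le[OF k \<alpha>])
    then show ?thesis
      by (simp add: mult.commute)
  qed
  then show ?thesis
    by (rule that)
qed

lemma \<mu>_gweight_tendsto_0: "((\<lambda>t. \<mu> k \<alpha> (gweight t)) \<longlongrightarrow> 0) at_top"
proof -
  obtain C where C: "\<And>t. t \<ge> 1 \<Longrightarrow> \<mu> k \<alpha> (gweight t) \<le> C / t"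
    using \<mu>_gweight_le by blast
  have l: "((\<lambda>t. C / t) \<longlongrightarrow> 0) at_top"
    by (rule tendsto_divide_0[OF tendsto_const filterlim_at_top_imp_at_infinity[OF filterlim_ident]])
  show ?thesis
  proof (rule tendsto_sandwich[OF _ _ tendsto_const l])
    show "\<forall>\<^sub>F t in at_top. 0 \<le> \<mu> k \<alpha> (gweight t)"
      using eventually_ge_at_top[of 0]
    proof eventually_elim
      case (elim t)
      then have "t > -1"
        by simp
      then show ?case
        using \<mu>_weight_pos[OF k \<alpha>, of t] by (simp add: \<mu>_gweight(1)[OF k \<alpha>])
    qed
    show "\<forall>\<^sub>F t in at_top. \<mu> k \<alpha> (gweight t) \<le> C / t"
      using eventually_ge_at_top[of 1] by eventually_elim (rule C)
  qed
qed

text \<open>Polynomials have fixed energy and do not vanish near the circle. With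
  \<open>t = e - 1\<close> the weight is of order \<open>1 / e\<^sup>2\<close> on an annulus of
  width \<open>e\<close>, so the mass is at least of order \<open>1 / e\<close>.\<close>

lemma \<mu>_weight_le:
  obtains C where "\<And>e. 0 < e \<Longrightarrow> e \<le> 1 / 2 \<Longrightarrow> \<mu> k \<alpha> (weight (e - 1)) \<le> C * e"
proof -
  define \<phi> where "\<phi> i x = (x $ 1) ^ i" for i and x :: "real^2"
  have \<phi>: "C1 (\<phi> i)" for i
    unfolding \<phi>_def by (rule C1_power_nth1)
  obtain \<kappa> where \<kappa>: "\<kappa> > 0" "\<And>c. \<kappa> * (\<Sum>i<k. (c i)\<^sup>2) \<le> (\<integral>t. (\<Sum>i<k. c i * cos t ^ i)\<^sup>2 \<partial>angles)"
  proof (rule L2_indep_lower[of k angles "\<lambda>i t. cos t ^ i"])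
    show "L2 angles (\<lambda>t. cos t ^ i)" for i
      using continuous_circle_L2[OF C1_continuous[OF \<phi>[of i]], of 1] by (simp add: \<phi>_def)
    show "\<And>c. AE t in angles. (\<Sum>i<k. c i * cos t ^ i) = 0 \<Longrightarrow> \<forall>i<k. c i = 0"
      by (rule cosine_powers_indep)
  qed blast
  obtain K where K: "K > 0" "\<And>c. energy 1 \<alpha> (\<lambda>x. \<Sum>i<k. c i * \<phi> i x) \<le> K * (\<Sum>i<k. (c i)\<^sup>2)"
    using energy_lincomb_bound[of k \<phi> \<alpha> 1] \<phi> \<alpha> by auto
  \<comment> \<open>The 18 is the 9 of the weight bound times 2 from \<open>s \<ge> 1 / 2\<close> in
    the polar factor; \<open>(1 / 4) ^ k\<close> bounds the squares of the powers
    \<open>s ^ i\<close> from below.\<close>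
  define \<kappa>' where "\<kappa>' = \<kappa> * (1 / 4) ^ k / 18"
  have \<kappa>': "\<kappa>' > 0"
    using \<kappa> by (simp add: \<kappa>'_def)
  have "\<mu> k \<alpha> (weight (e - 1)) \<le> K / \<kappa>' * e" if e: "0 < e" "e \<le> 1 / 2" for e
  proof -
    have t: "e - 1 > -1"
      using e by simp
    have lower: "\<kappa>' / e * (\<Sum>i<k. (c i)\<^sup>2) \<le> mass 1 (weight (e - 1)) (\<lambda>x. \<Sum>i<k. c i * \<phi> i x)" for c
    proof -
      define S where "S = (\<Sum>i<k. (c i)\<^sup>2)"
      have S: "S \<ge> 0"
        by (simp add: S_def sum_nonneg)
      define f where "f x = weight (e - 1) x * (\<Sum>i<k. c i * \<phi> i x)\<^sup>2" for x
      have pc: "continuous_on UNIV (\<lambda>x. \<Sum>i<k. c i * \<phi> i x)"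
        by (intro continuous_intros C1_continuous \<phi>)
      have fm: "f \<in> borel_measurable borel"
        unfolding f_def by (intro borel_measurable_times borel_measurable_power weight_measurable borel_measurable_continuous_onI pc)
      have f0: "0 \<le> f x" for x
        by (simp add: f_def weight_def)
      have circ: "ennreal (\<kappa> * (1 / 4) ^ k * S / (18 * e\<^sup>2)) \<le> (\<integral>\<^sup>+t. ennreal s * ennreal (f (circle_curve s t)) \<partial>angles)"
        if s: "s \<in> {1 - e..1}" for s
      proof -
        have s12: "1 / 2 \<le> s" "s \<le> 1"
          using s e by auto
        have w: "1 / (9 * e\<^sup>2) \<le> weight (e - 1) (circle_curve s t)" for t
        proof -
          have xx: "circle_curve s t \<bullet> circle_curve s t = s\<^sup>2"
            by (simp add: dot_square_norm norm_circle_curve)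
          \<comment> \<open>The denominator is at most \<open>1 - (1 - e) ^ 3\<close>, and expanding
            the cube bounds this by \<open>3 * e\<close>.\<close>
          have "(1 - e) * (1 - e) \<le> s * s"
            using s e by (intro mult_mono) auto
          then have "(1 - e) * ((1 - e) * (1 - e)) \<le> (1 - e) * s\<^sup>2"
            using e unfolding power2_eq_square by (intro mult_left_mono) auto
          moreover have "(1 - e) * ((1 - e) * (1 - e)) = 1 - 3 * e + e * e * (3 - e)"
            by (simp add: algebra_simps)
          moreover have "0 \<le> e * e * (3 - e)"
            using e by (intro mult_nonneg_nonneg) auto
          ultimately have up: "1 + (e - 1) * s\<^sup>2 \<le> 3 * e"
            by (simp add: algebra_simps)
          have pos: "0 < 1 + (e - 1) * s\<^sup>2"
            using weight_denominator_bounds(3)[OF t, of "circle_curve s t"] s12 by (simp add: xx norm_circle_curve)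
          have "(1 + (e - 1) * s\<^sup>2)\<^sup>2 \<le> (3 * e)\<^sup>2"
            using up pos by (intro power_mono) auto
          then have "1 / (3 * e)\<^sup>2 \<le> 1 / (1 + (e - 1) * s\<^sup>2)\<^sup>2"
            using pos e by (intro divide_left_mono mult_pos_pos zero_less_power) auto
          then show ?thesis
            by (simp add: weight_def xx power_mult_distrib)
        qed
        have i: "integrable angles (\<lambda>t. (\<Sum>i<k. c i * \<phi> i (circle_curve s t))\<^sup>2)"
          by (intro L2_integrable continuous_circle_L2[OF pc])
        have "(1 / 4) ^ k * S = (\<Sum>i<k. (1 / 4) ^ k * (c i)\<^sup>2)"
          by (simp add: S_def sum_distrib_left)
        also have "\<dots> \<le> (\<Sum>i<k. (c i * s ^ i)\<^sup>2)"
        proof (rule sum_mono)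
          fix i assume "i \<in> {..<k}"
          then have "(1 / 4 :: real) ^ k \<le> (1 / 4) ^ i"
            by (intro power_decreasing) auto
          also have "\<dots> = ((1 / 2) ^ i)\<^sup>2"
            by (simp add: power2_eq_square flip: power_mult_distrib)
          also have "\<dots> \<le> (s ^ i)\<^sup>2"
            using s12 by (intro power_mono) auto
          finally show "(1 / 4) ^ k * (c i)\<^sup>2 \<le> (c i * s ^ i)\<^sup>2"
            unfolding power_mult_distrib by (subst mult.commute) (rule mult_left_mono, auto)
        qed
        finally have "\<kappa> * ((1 / 4) ^ k * S) \<le> \<kappa> * (\<Sum>i<k. (c i * s ^ i)\<^sup>2)"
          using \<kappa>(1) by (intro mult_left_mono) auto
        also have "\<dots> \<le> (\<integral>t. (\<Sum>i<k. (c i * s ^ i) * cos t ^ i)\<^sup>2 \<partial>angles)"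
          by (rule \<kappa>(2))
        also have "\<dots> = (\<integral>t. (\<Sum>i<k. c i * \<phi> i (circle_curve s t))\<^sup>2 \<partial>angles)"
          by (simp add: \<phi>_def power_mult_distrib mult.assoc)
        finally have I: "\<kappa> * ((1 / 4) ^ k * S) \<le> (\<integral>t. (\<Sum>i<k. c i * \<phi> i (circle_curve s t))\<^sup>2 \<partial>angles)" .
        have "\<kappa> * (1 / 4) ^ k * S / (18 * e\<^sup>2) = 1 / (18 * e\<^sup>2) * (\<kappa> * ((1 / 4) ^ k * S))"
          by simp
        also have "\<dots> \<le> 1 / (18 * e\<^sup>2) * (\<integral>t. (\<Sum>i<k. c i * \<phi> i (circle_curve s t))\<^sup>2 \<partial>angles)"
          by (rule mult_left_mono[OF I]) simp
        finally have "ennreal (\<kappa> * (1 / 4) ^ k * S / (18 * e\<^sup>2)) \<le> ennreal (\<integral>t. 1 / (18 * e\<^sup>2) * (\<Sum>i<k. c i * \<phi> i (circle_curve s t))\<^sup>2 \<partial>angles)"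
          by (intro ennreal_leI) simp
        also have "\<dots> = (\<integral>\<^sup>+t. ennreal (1 / (18 * e\<^sup>2) * (\<Sum>i<k. c i * \<phi> i (circle_curve s t))\<^sup>2) \<partial>angles)"
          by (intro nn_integral_eq_integral[symmetric] integrable_mult_right i AE_I2) simp
        also have "\<dots> \<le> (\<integral>\<^sup>+t. ennreal s * ennreal (f (circle_curve s t)) \<partial>angles)"
        proof (intro nn_integral_mono)
          fix t
          have "1 / (18 * e\<^sup>2) * (\<Sum>i<k. c i * \<phi> i (circle_curve s t))\<^sup>2 = 1 / 2 * (1 / (9 * e\<^sup>2) * (\<Sum>i<k. c i * \<phi> i (circle_curve s t))\<^sup>2)"
            by simp
          also have "\<dots> \<le> s * f (circle_curve s t)"
            unfolding f_def using s12 w[of t] by (intro mult_mono mult_right_mono) auto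
          finally show "ennreal (1 / (18 * e\<^sup>2) * (\<Sum>i<k. c i * \<phi> i (circle_curve s t))\<^sup>2) \<le> ennreal s * ennreal (f (circle_curve s t))"
            using s12 f0 by (simp add: ennreal_mult[symmetric] ennreal_leI)
        qed
        finally show ?thesis .
      qed
      \<comment> \<open>Integrating over the radii of an annulus of width \<open>e\<close> turns the
        bound \<open>1 / e\<^sup>2\<close> per circle into \<open>1 / e\<close>.\<close>
      have "ennreal (\<kappa>' / e * S) = ennreal (\<kappa> * (1 / 4) ^ k * S / (18 * e\<^sup>2)) * ennreal e"
        using e \<kappa> S by (subst ennreal_mult[symmetric]) (auto simp: \<kappa>'_def power2_eq_square)
      also have "\<dots> = (\<integral>\<^sup>+s. ennreal (\<kappa> * (1 / 4) ^ k * S / (18 * e\<^sup>2)) * indicator {1 - e..1} s \<partial>lborel)"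
        using e by (simp add: nn_integral_cmult)
      also have "\<dots> \<le> (\<integral>\<^sup>+s\<in>{0..1}. (\<integral>\<^sup>+t. ennreal s * ennreal (f (circle_curve s t)) \<partial>angles) \<partial>lborel)"
      proof (intro nn_integral_mono)
        fix s :: real
        show "ennreal (\<kappa> * (1 / 4) ^ k * S / (18 * e\<^sup>2)) * indicator {1 - e..1} s
          \<le> (\<integral>\<^sup>+t. ennreal s * ennreal (f (circle_curve s t)) \<partial>angles) * indicator {0..1} s"
          using circ[of s] e by (cases "s \<in> {1 - e..1}") auto
      qed
      also have "\<dots> = (\<integral>\<^sup>+x. ennreal (f x) \<partial>disk 1)"
        using fm by (intro nn_integral_disk_annulus[symmetric]) simp
      also have "\<dots> = ennreal (mass 1 (weight (e - 1)) (\<lambda>x. \<Sum>i<k. c i * \<phi> i x))"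
      proof -
        have "integrable (disk 1) f"
          unfolding f_def
        proof (rule mass_integrable[OF pc weight_measurable])
          show "\<bar>weight (e - 1) x\<bar> \<le> 1 / (min 1 (1 + (e - 1)))\<^sup>2" if "norm x < 1" for x
            using weight_bounds(1,2)[OF t, of x] that by simp
        qed
        then show ?thesis
          unfolding mass_def f_def[symmetric] using f0 by (intro nn_integral_eq_integral) auto
      qed
      finally have le: "ennreal (\<kappa>' / e * S) \<le> ennreal (mass 1 (weight (e - 1)) (\<lambda>x. \<Sum>i<k. c i * \<phi> i x))" .
      have "0 \<le> mass 1 (weight (e - 1)) (\<lambda>x. \<Sum>i<k. c i * \<phi> i x)"
        unfolding mass_def f_def[symmetric] using f0 by (intro Bochner_Integration.integral_nonneg) auto
      with le show ?thesis
        by (simp add: ennreal_le_iff S_def)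
    qed
    have "admissible 1 \<alpha> (weight (e - 1)) k (K / (\<kappa>' / e))"
      using K \<kappa>' e lower \<phi> by (intro admissible_of_bounds[of k \<phi>]) auto
    then have "\<mu> k \<alpha> (weight (e - 1)) \<le> K / (\<kappa>' / e)"
      by (rule \<mu>_le[OF k \<alpha>])
    then show ?thesis
      by simp
  qed
  then show ?thesis
    by (rule that)
qed

lemma \<mu>_weight_tendsto_0: "((\<lambda>t. \<mu> k \<alpha> (weight t)) \<longlongrightarrow> 0) (at_right (-1))"
proof -
  obtain C where C: "\<And>e. 0 < e \<Longrightarrow> e \<le> 1 / 2 \<Longrightarrow> \<mu> k \<alpha> (weight (e - 1)) \<le> C * e"
    using \<mu>_weight_le by blast
  have "((\<lambda>t. C * (1 + t)) \<longlongrightarrow> C * (1 + - 1)) (at_right (-1))"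
    by (intro tendsto_intros)
  then have l: "((\<lambda>t. C * (1 + t)) \<longlongrightarrow> 0) (at_right (-1))"
    by simp
  have ev: "\<forall>\<^sub>F t in at_right (-1 :: real). t \<in> {-1<..<-1/2}"
    by (intro eventually_at_right_real) simp
  show ?thesis
  proof (rule tendsto_sandwich[OF _ _ tendsto_const l])
    show "\<forall>\<^sub>F t in at_right (- 1). 0 \<le> \<mu> k \<alpha> (weight t)"
      using ev by eventually_elim (auto intro: less_imp_le[OF \<mu>_weight_pos[OF k \<alpha>]])
    show "\<forall>\<^sub>F t in at_right (- 1). \<mu> k \<alpha> (weight t) \<le> C * (1 + t)"
      using ev
    proof eventually_elim
      case (elim t)
      then show ?case
        using C[of "1 + t"] by simp
    qed
  qed
qed

end

section \<open>Proof of the theorem\<close>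

text \<open>
  The metric \<open>weight t \<bar>dx\<bar>\<^sup>2\<close> on the unit disk has curvature \<open>4 t\<close>; for \<open>t = curvature \<Theta>\<close> it is
  homothetic to \<open>C(\<Theta>)\<close>.
\<close>

definition curvature :: "real \<Rightarrow> real" where
  "curvature \<Theta> = (tan (max 0 \<Theta> / 2))\<^sup>2 - (tanh (min 0 \<Theta> / 2))\<^sup>2"

lemma curvature_nonneg: "\<Theta> \<ge> 0 \<Longrightarrow> curvature \<Theta> = (tan (\<Theta> / 2))\<^sup>2"
  by (simp add: curvature_def max_def min_def)

lemma curvature_nonpos: "\<Theta> \<le> 0 \<Longrightarrow> curvature \<Theta> = - (tanh (\<Theta> / 2))\<^sup>2"
  by (cases "\<Theta> = 0") (simp_all add: curvature_def max_def min_def)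

lemma tanh_square_less_1: "(tanh (x :: real))\<^sup>2 < 1"
  using tanh_real_lt_1[of x] tanh_real_gt_neg1[of x] by (simp add: abs_square_less_1 abs_less_iff)

lemma curvature_gt: "curvature \<Theta> > -1"
proof (cases "\<Theta> \<ge> 0")
  case True
  have "(0::real) \<le> (tan (\<Theta> / 2))\<^sup>2"
    by simp
  then show ?thesis
    unfolding curvature_nonneg[OF True] by linarith
next
  case False
  then show ?thesis
    using tanh_square_less_1[of "\<Theta> / 2"] by (simp add: curvature_nonpos)
qed

text \<open>Written with \<open>max\<close> and \<open>min\<close>, the function is a single
  expression without gluing at 0, and the argument of \<open>tan\<close> stays in the range where
  \<open>cos\<close> is positive.\<close>

lemma continuous_on_curvature: "continuous_on {..<pi} curvature"
  unfolding curvature_def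
proof (intro continuous_intros ballI)
  fix \<Theta> assume "\<Theta> \<in> {..<pi}"
  then have "cos (max 0 \<Theta> / 2) > 0"
    using pi_gt_zero by (intro cos_gt_zero_pi) (auto simp: max_def)
  then show "cos (max 0 \<Theta> / 2) \<noteq> 0"
    by simp
qed (auto intro: cosh_real_nonzero)

lemma curvature_strict_mono:
  assumes "\<Theta>1 < \<Theta>2" "\<Theta>2 < pi"
  shows "curvature \<Theta>1 < curvature \<Theta>2"
proof -
  have pos: "curvature a < curvature b" if "0 \<le> a" "a < b" "b < pi" for a b
  proof -
    have "tan (a / 2) < tan (b / 2)"
      using that by (intro tan_monotone) auto
    moreover have "0 \<le> tan (a / 2)"
      using that by (cases "a = 0") (auto intro!: less_imp_le tan_gt_zero)
    ultimately show ?thesis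
      using that by (simp add: curvature_nonneg power_strict_mono)
  qed
  have neg: "curvature a < curvature b" if "a < b" "b \<le> 0" for a b
  proof -
    have "- tanh (b / 2) < - tanh (a / 2)" "0 \<le> - tanh (b / 2)"
      using that by auto
    then have "(- tanh (b / 2))\<^sup>2 < (- tanh (a / 2))\<^sup>2"
      by (intro power_strict_mono) auto
    then show ?thesis
      using that by (simp add: curvature_nonpos)
  qed
  consider "0 \<le> \<Theta>1" | "\<Theta>2 \<le> 0" | "\<Theta>1 < 0" "0 < \<Theta>2"
    by linarith
  then show ?thesis
  proof cases
    case 3
    then show ?thesis
      using neg[of \<Theta>1 0] pos[of 0 \<Theta>2] assms by simp
  qed (use assms pos neg in auto)
qed

lemma filterlim_curvature_at_bot: "filterlim curvature (at_right (-1)) at_bot"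
proof (rule tendsto_imp_filterlim_at_right)
  have half: "filterlim (\<lambda>x::real. x / 2) at_bot at_bot"
    unfolding filterlim_at_bot
  proof (intro allI)
    fix Z :: real
    show "\<forall>\<^sub>F x in at_bot. x / 2 \<le> Z"
      using eventually_le_at_bot[of "2 * Z"] by eventually_elim simp
  qed
  have "((\<lambda>\<Theta>. - (tanh (\<Theta> / 2 :: real))\<^sup>2) \<longlongrightarrow> - (-1)\<^sup>2) at_bot"
    by (intro tendsto_intros filterlim_compose[OF tanh_real_at_bot half])
  moreover have "\<forall>\<^sub>F \<Theta> in at_bot. - (tanh (\<Theta> / 2))\<^sup>2 = curvature \<Theta>"
    using eventually_le_at_bot[of 0] by eventually_elim (simp add: curvature_nonpos)
  ultimately show "(curvature \<longlongrightarrow> -1) at_bot"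
    by (auto intro: Lim_transform_eventually)
  show "\<forall>\<^sub>F \<Theta> in at_bot. -1 < curvature \<Theta>"
    using curvature_gt by simp
qed

lemma filterlim_curvature_at_left_pi: "filterlim curvature at_top (at_left pi)"
proof -
  have half: "filterlim (\<lambda>x. x / 2) (at_left (pi / 2)) (at_left pi)"
  proof (rule tendsto_imp_filterlim_at_left)
    show "((\<lambda>x. x / 2) \<longlongrightarrow> pi / 2) (at_left pi)"
      by (intro tendsto_intros) auto
    show "\<forall>\<^sub>F x in at_left pi. x / 2 < pi / 2"
      by (auto simp: eventually_at_filter)
  qed
  have "filterlim (\<lambda>\<Theta>. (tan (\<Theta> / 2))\<^sup>2) at_top (at_left pi)"
    by (intro filterlim_pow_at_top filterlim_compose[OF filterlim_tan_at_left half]) auto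
  moreover have "\<forall>\<^sub>F \<Theta> in at_left pi. (tan (\<Theta> / 2))\<^sup>2 = curvature \<Theta>"
  proof -
    have "\<forall>\<^sub>F \<Theta> in at_left pi. \<Theta> \<in> {0<..<pi}"
      using pi_gt_zero by (rule eventually_at_left_real)
    then show ?thesis
      by eventually_elim (simp add: curvature_nonneg)
  qed
  ultimately show ?thesis
    by (simp add: filterlim_cong)
qed

section \<open>Translation of \<open>F\<close> and \<open>G\<close> into weighted
  eigenvalues\<close>

lemma F_fun_eq:
  assumes k: "k \<ge> 1" and \<alpha>: "\<alpha> > 0" and \<Theta>: "\<Theta> < pi"
  shows "F_fun k \<alpha> \<Theta> = \<mu> k \<alpha> (weight (curvature \<Theta>))"
proof -
  note ex = admissible_weight_exists[OF k \<alpha> curvature_gt[of \<Theta>]]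
  consider "\<Theta> < 0" | "\<Theta> = 0" | "\<Theta> > 0"
    by linarith
  then show ?thesis
  proof cases
    case 1
    then show ?thesis
      using cap_eigenvalue_hyperbolic[OF 1 k \<alpha>] ex by (simp add: F_fun_def curvature_nonpos)
  next
    case 2
    then show ?thesis
      using disk_eigenvalue_eq[OF k \<alpha>] ex by (simp add: F_fun_def curvature_nonneg)
  next
    case 3
    then show ?thesis
      using cap_eigenvalue_sphere[OF 3 \<Theta> k \<alpha>] ex by (simp add: F_fun_def curvature_nonneg)
  qed
qed

text \<open>Half-angle formulas: \<open>sin\<close> is twice the tangent of half the angle over
  \<open>1 + tan\<^sup>2\<close>, and \<open>sinh\<close> is twice \<open>tanh\<close> over
  \<open>1 - tanh\<^sup>2\<close>. In both cases the denominator is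
  \<open>1 + curvature \<Theta>\<close>.\<close>

lemma G_fun_eq_F_fun:
  assumes \<Theta>: "\<Theta> < pi"
  shows "G_fun k \<alpha> \<Theta> = F_fun k \<alpha> \<Theta> / (1 + curvature \<Theta>)\<^sup>2"
proof -
  consider "\<Theta> < 0" | "\<Theta> = 0" | "\<Theta> > 0"
    by linarith
  then show ?thesis
  proof cases
    case 1
    define y where "y = \<Theta> / 2"
    have c: "cosh y \<noteq> 0"
      by simp
    have "(cosh y)\<^sup>2 * (tanh y)\<^sup>2 = (sinh y)\<^sup>2"
      using c by (simp add: tanh_def power_divide)
    then have "(cosh y)\<^sup>2 * (1 - (tanh y)\<^sup>2) = 1"
      using cosh_square_eq[of y] by (simp only: right_diff_distrib) simp
    moreover have n: "1 - (tanh y)\<^sup>2 \<noteq> 0"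
      using tanh_square_less_1[of y] by simp
    ultimately have c2: "(cosh y)\<^sup>2 = 1 / (1 - (tanh y)\<^sup>2)"
      by (simp add: field_simps)
    have "sinh \<Theta> = sinh (2 * y)"
      by (simp add: y_def)
    also have "\<dots> = 2 * tanh y * (cosh y)\<^sup>2"
      unfolding sinh_double using c by (simp add: tanh_def power2_eq_square)
    finally have "(sinh \<Theta>)\<^sup>2 = 4 * (tanh y)\<^sup>2 / (1 - (tanh y)\<^sup>2)\<^sup>2"
      unfolding c2 by (simp add: power_mult_distrib power_divide)
    then show ?thesis
      using 1 by (simp add: G_fun_def F_fun_def curvature_nonpos y_def)
  next
    case 2
    then show ?thesis
      by (simp add: G_fun_def F_fun_def curvature_nonneg)
  next
    case 3
    have "sin \<Theta> = 2 * tan (\<Theta> / 2) / (1 + (tan (\<Theta> / 2))\<^sup>2)"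
      using sin_tan_half[of "\<Theta> / 2"] by simp
    then have "(sin \<Theta>)\<^sup>2 = 4 * (tan (\<Theta> / 2))\<^sup>2 / (1 + (tan (\<Theta> / 2))\<^sup>2)\<^sup>2"
      by (simp add: power_mult_distrib power_divide)
    then show ?thesis
      using 3 by (simp add: G_fun_def F_fun_def curvature_nonneg)
  qed
qed

lemma G_fun_eq:
  assumes "k \<ge> 1" "\<alpha> > 0" "\<Theta> < pi"
  shows "G_fun k \<alpha> \<Theta> = \<mu> k \<alpha> (gweight (curvature \<Theta>))"
  using \<mu>_gweight(1)[OF assms(1,2) curvature_gt] F_fun_eq[OF assms] G_fun_eq_F_fun[OF assms(3)] by simp

theorem theorem1p1:
  fixes k :: nat and \<alpha> :: real
  assumes "k \<ge> 1" and "\<alpha> > 0"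
  shows "(continuous_on {..<pi} (F_fun k \<alpha>)
          \<and> strict_mono_on {..<pi} (F_fun k \<alpha>)
          \<and> (F_fun k \<alpha> \<longlongrightarrow> 0) at_bot
          \<and> filterlim (F_fun k \<alpha>) at_top (at_left pi))
       \<and> (continuous_on {..<pi} (G_fun k \<alpha>)
          \<and> strict_antimono_on {..<pi} (G_fun k \<alpha>)
          \<and> filterlim (G_fun k \<alpha>) at_top at_bot
          \<and> (G_fun k \<alpha> \<longlongrightarrow> 0) (at_left pi))"
proof (intro conjI)
  note F = F_fun_eq[OF assms] and G = G_fun_eq[OF assms]
  have bot: "\<forall>\<^sub>F \<Theta> in at_bot. \<Theta> < pi"
    by (rule eventually_gt_at_bot)
  have left: "\<forall>\<^sub>F \<Theta> in at_left pi. \<Theta> < pi"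
    by (auto simp: eventually_at_filter)
  have "continuous_on {..<pi} (\<lambda>\<Theta>. \<mu> k \<alpha> (weight (curvature \<Theta>)))"
    by (rule continuous_on_compose2[OF continuous_on_\<mu>_weight[OF assms] continuous_on_curvature])
      (use curvature_gt in auto)
  then show cF: "continuous_on {..<pi} (F_fun k \<alpha>)"
    by (rule continuous_on_eq) (simp add: F)
  \<comment> \<open>Continuity of \<open>G\<close> is inherited from \<open>F\<close>. Its
    monotonicity cannot be: a quotient of two increasing functions may go either way, so it is read
    off from \<open>gweight\<close>.\<close>
  have "continuous_on {..<pi} (\<lambda>\<Theta>. F_fun k \<alpha> \<Theta> / (1 + curvature \<Theta>)\<^sup>2)"
  proof (intro continuous_intros cF continuous_on_curvature ballI)
    show "(1 + curvature \<Theta>)\<^sup>2 \<noteq> 0" for \<Theta>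
      using curvature_gt[of \<Theta>] by simp
  qed
  then show "continuous_on {..<pi} (G_fun k \<alpha>)"
    by (rule continuous_on_eq) (simp add: G_fun_eq_F_fun)
  show "strict_mono_on {..<pi} (F_fun k \<alpha>)"
    by (rule strict_mono_onI) (simp add: F \<mu>_weight_strict_mono[OF assms curvature_gt] curvature_strict_mono)
  show "strict_antimono_on {..<pi} (G_fun k \<alpha>)"
    by (rule monotone_onI) (simp add: G \<mu>_gweight_strict_antimono[OF assms curvature_gt] curvature_strict_mono)
  have "((\<lambda>\<Theta>. \<mu> k \<alpha> (weight (curvature \<Theta>))) \<longlongrightarrow> 0) at_bot"
    by (rule filterlim_compose[OF \<mu>_weight_tendsto_0[OF assms] filterlim_curvature_at_bot])
  moreover have "\<forall>\<^sub>F \<Theta> in at_bot. \<mu> k \<alpha> (weight (curvature \<Theta>)) = F_fun k \<alpha> \<Theta>"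
    using bot by eventually_elim (simp add: F)
  ultimately show "(F_fun k \<alpha> \<longlongrightarrow> 0) at_bot"
    by (rule Lim_transform_eventually)
  have "((\<lambda>\<Theta>. \<mu> k \<alpha> (gweight (curvature \<Theta>))) \<longlongrightarrow> 0) (at_left pi)"
    by (rule filterlim_compose[OF \<mu>_gweight_tendsto_0[OF assms] filterlim_curvature_at_left_pi])
  moreover have "\<forall>\<^sub>F \<Theta> in at_left pi. \<mu> k \<alpha> (gweight (curvature \<Theta>)) = G_fun k \<alpha> \<Theta>"
    using left by eventually_elim (simp add: G)
  ultimately show "(G_fun k \<alpha> \<longlongrightarrow> 0) (at_left pi)"
    by (rule Lim_transform_eventually)
  have "filterlim (\<lambda>\<Theta>. \<mu> k \<alpha> (weight (curvature \<Theta>))) at_top (at_left pi)"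
    by (rule filterlim_compose[OF \<mu>_weight_at_top[OF assms] filterlim_curvature_at_left_pi])
  moreover have "\<forall>\<^sub>F \<Theta> in at_left pi. F_fun k \<alpha> \<Theta> = \<mu> k \<alpha> (weight (curvature \<Theta>))"
    using left by eventually_elim (simp add: F)
  ultimately show "filterlim (F_fun k \<alpha>) at_top (at_left pi)"
    by (simp add: filterlim_cong)
  have "filterlim (\<lambda>\<Theta>. \<mu> k \<alpha> (gweight (curvature \<Theta>))) at_top at_bot"
    by (rule filterlim_compose[OF \<mu>_gweight_at_minus_1[OF assms] filterlim_curvature_at_bot])
  moreover have "\<forall>\<^sub>F \<Theta> in at_bot. G_fun k \<alpha> \<Theta> = \<mu> k \<alpha> (gweight (curvature \<Theta>))"
    using bot by eventually_elim (simp add: G)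
  ultimately show "filterlim (G_fun k \<alpha>) at_top at_bot"
    by (simp add: filterlim_cong)
qed

end
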